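(* Let $r_*\in\mathbb{R}$ and let $(\Phi_m)_{m\ge1}$ be real-valued potentials satisfying the following hypotheses. (Regularity) There is $\delta_*>0$ such that, for every $m\ge1$, the function $\eta\mapsto\Phi_m(r_*m+\eta)$ is $C^{3,1}$ on $|\eta|\le m\delta_*$. Put $\varsigma_m:=\Phi_m'(r_*m)$, $\alpha_m:=\Phi_m''(r_*m)$, $\beta_m:=\Phi_m'''(r_*m)/2$, and let $\gamma_m$ be $1/6$ times the Lipschitz constant of $\eta\mapsto\Phi_m'''(r_*m+\eta)$ on $|\eta|\le m\delta_*$. (Summability) $\sum_{m\ge1}|\beta_m|m^5<\infty$, $\sum_{m\ge1}\gamma_m m^4<\infty$, and $b:=\sum_{m\ge1}\beta_m m^3\neq0$. (Type I) The function $\lambda(k):=\sum_{m\ge1}\alpha_m m^2\operatorname{sinc}^2(mk/2)$ is Type I (definition in the context), with associated exponent $\sigma\in(0,2]$. Put $c_0^2:=\lambda(0)=\sum_{m\ge1}\alpha_m m^2$. Let $$W_0(x):=-\frac{3\lambda''(0)}{4b}\operatorname{sech}^2\left(\frac{x}{2}\right).$$ Then there exist $\varepsilon_I>0$ and $\kappa_I>0$ such that for every $\varepsilon\in(0,\varepsilon_I)$ there is a unique function $V_\varepsilon\in E^3$ with $\|V_\varepsilon\|_{H^1}\le\kappa_I$ such that $$c_\varepsilon^2=c_0^2-\tfrac12\lambda''(0)\varepsilon^2\quad\text{and}\quad W_\varepsilon(x)=W_0(x)+\varepsilon^\sigma V_\varepsilon(x)$$ solve $$\varepsilon^2c_\varepsilon^2W_\varepsilon=\sum_{m\ge1}m\,\mathcal{A}_{\varepsilon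 m}\left[\Phi_m'\left(r_*m+m\varepsilon^2\mathcal{A}_{\varepsilon m}W_\varepsilon\right)-\varsigma_m\right].$$
   Context: Notation. $H^s=H^s(\mathbb{R})$ is the usual $L^2$-based Sobolev space, and $E^s:=H^s\cap\{\text{even functions}\}$ with the $H^s$ norm. $\operatorname{sinc}(x)=\sin(x)/x$ with $\operatorname{sinc}(0)=1$. A function is $C^{3,1}$ on $I$ if its third derivative is Lipschitz on $I$. For $h>0$, $\mathcal{A}_hF(x):=\frac1h\int_{x-h/2}^{x+h/2}F(y)\,dy$. Each $\Phi_m$ is defined at least on $\{r_*m+\eta:|\eta|\le m\delta_*\}$. Standing convention. The series $\sum_{m\ge1}\alpha_m m^2$ is assumed to converge, so that $c_0^2$ and $\lambda$ are well defined. Definition (Type I). $\lambda(k)$ is Type I if: (i) $\lambda$ is bounded below on $\mathbb{R}$; (ii) $\lambda''(0)<0$; (iii) there exist $\mu_*>0$, $k_*>0$ and $\sigma\in(0,2]$ such that $|k|\le k_*$ implies $\lambda(k)-\lambda(0)\le-\mu_*k^2$ and $|\lambda(k)-\lambda(0)-\frac12\lambda''(0)k^2|\le\mu_*|k|^{2+\sigma}$; (iv) $\sup_{|k|\ge k_*}\lambda(k)<\lambda(0)$. Background. The equation for $(c_\varepsilon,W_\varepsilon)$ is the traveling wave equation for the lattice $\ddot u_j=\sum_{m\ge1}\Phi_m'(u_{j+m}-u_j)-\Phi_m'(u_j-u_{j-m})$, $j\in\mathbb{Z}$, obtained from the ansatz $u_j(t)=r_*j+\varepsilon U_\varepsilon(\varepsilon(j-c_\varepsilon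 t))$ with $W_\varepsilon=U_\varepsilon'$. *)

theory Defs
  imports "HOL-Probability.Sinc_Integral"
begin

section \<open>Derivatives on an interval and the class $C^{3,1}$\<close>

text \<open>Derivatives are taken within \<open>S\<close>, so that at an end point of a
  compact interval they are one-sided and the values of \<open>f\<close> outside \<open>S\<close> are irrelevant.\<close>

definition deriv_within :: "nat \<Rightarrow> real set \<Rightarrow> (real \<Rightarrow> real) \<Rightarrow> real \<Rightarrow> real" where
  "deriv_within n S f = ((\<lambda>g x. vector_derivative g (at x within S)) ^^ n) f"

definition C31_on :: "real set \<Rightarrow> (real \<Rightarrow> real) \<Rightarrow> bool" where
  "C31_on S f \<longleftrightarrow>
     (\<forall>i<3. deriv_within i S f differentiable_on S) \<and>
     (\<exists>L. L-lipschitz_on S (deriv_within 3 S f))"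

text \<open>The best constant; meaningful only for Lipschitz \<open>f\<close>.\<close>

definition lipschitz_constant :: "real set \<Rightarrow> (real \<Rightarrow> real) \<Rightarrow> real" where
  "lipschitz_constant S f = Inf {L. L-lipschitz_on S f}"

section \<open>Sobolev spaces of integer order on the real line\<close>

text \<open>Elements of \<open>H\<^sup>n\<close> are represented by Borel functions; two functions represent the
  same element iff they agree almost everywhere.\<close>

definition square_integrable :: "(real \<Rightarrow> real) \<Rightarrow> bool" where
  "square_integrable f \<longleftrightarrow> f \<in> borel_measurable lborel \<and> integrable lborel (\<lambda>x. (f x)\<^sup>2)"

definition test_function :: "(real \<Rightarrow> real) \<Rightarrow> bool" where
  "test_function \<phi> \<longleftrightarrow>
     (\<forall>n. (deriv ^^ n) \<phi> differentiable_on UNIV) \<and> compact (closure {x. \<phi> x \<noteq> 0})"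

definition has_weak_deriv :: "(real \<Rightarrow> real) \<Rightarrow> (real \<Rightarrow> real) \<Rightarrow> bool" where
  "has_weak_deriv f g \<longleftrightarrow>
     (\<forall>\<phi>. test_function \<phi> \<longrightarrow>
        (LINT x|lborel. f x * deriv \<phi> x) = - (LINT x|lborel. g x * \<phi> x))"

text \<open>\<open>weak_derivs n f g\<close>: the functions \<open>g 0 = f, g 1, \<dots>, g n\<close> are the successive weak
  derivatives of \<open>f\<close>, all in \<open>L\<^sup>2\<close>. They are unique up to null sets, hence the norm below
  does not depend on the choice.\<close>

definition weak_derivs :: "nat \<Rightarrow> (real \<Rightarrow> real) \<Rightarrow> (nat \<Rightarrow> real \<Rightarrow> real) \<Rightarrow> bool" where
  "weak_derivs n f g \<longleftrightarrow>
     g 0 = f \<and> (\<forall>i\<le>n. square_integrable (g i)) \<and> (\<forall>i<n. has_weak_deriv (g i) (g (Suc i)))"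

definition H_space :: "nat \<Rightarrow> (real \<Rightarrow> real) set" where
  "H_space n = {f. \<exists>g. weak_derivs n f g}"

definition H_norm :: "nat \<Rightarrow> (real \<Rightarrow> real) \<Rightarrow> real" where
  "H_norm n f =
     (let g = (SOME g. weak_derivs n f g) in sqrt (\<Sum>i\<le>n. LINT x|lborel. (g i x)\<^sup>2))"

definition E_space :: "nat \<Rightarrow> (real \<Rightarrow> real) set" where
  "E_space n = {f \<in> H_space n. AE x in lborel. f (- x) = f x}"

section \<open>Lattice potentials\<close>

text \<open>Throughout, \<open>\<Phi> m\<close> is relevant for \<open>m \<ge> 1\<close> only, and only on \<open>range_set r \<delta> m\<close>, the
  set of all \<open>r m + \<eta>\<close> with \<open>\<bar>\<eta>\<bar> \<le> m \<delta>\<close>.\<close>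

definition range_set :: "real \<Rightarrow> real \<Rightarrow> nat \<Rightarrow> real set" where
  "range_set r \<delta> m = cball (r * real m) (real m * \<delta>)"

definition dPot :: "nat \<Rightarrow> real \<Rightarrow> real \<Rightarrow> (nat \<Rightarrow> real \<Rightarrow> real) \<Rightarrow> nat \<Rightarrow> real \<Rightarrow> real" where
  "dPot i r \<delta> \<Phi> m = deriv_within i (range_set r \<delta> m) (\<Phi> m)"

definition varsigma_coeff :: "real \<Rightarrow> real \<Rightarrow> (nat \<Rightarrow> real \<Rightarrow> real) \<Rightarrow> nat \<Rightarrow> real" where
  "varsigma_coeff r \<delta> \<Phi> m = dPot 1 r \<delta> \<Phi> m (r * real m)"

definition alpha_coeff :: "real \<Rightarrow> real \<Rightarrow> (nat \<Rightarrow> real \<Rightarrow> real) \<Rightarrow> nat \<Rightarrow> real" where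
  "alpha_coeff r \<delta> \<Phi> m = dPot 2 r \<delta> \<Phi> m (r * real m)"

definition beta_coeff :: "real \<Rightarrow> real \<Rightarrow> (nat \<Rightarrow> real \<Rightarrow> real) \<Rightarrow> nat \<Rightarrow> real" where
  "beta_coeff r \<delta> \<Phi> m = dPot 3 r \<delta> \<Phi> m (r * real m) / 2"

definition gamma_coeff :: "real \<Rightarrow> real \<Rightarrow> (nat \<Rightarrow> real \<Rightarrow> real) \<Rightarrow> nat \<Rightarrow> real" where
  "gamma_coeff r \<delta> \<Phi> m = lipschitz_constant (range_set r \<delta> m) (dPot 3 r \<delta> \<Phi> m) / 6"

text \<open>Series over \<open>m \<ge> 1\<close> are written as series over \<open>n \<ge> 0\<close> with \<open>m = Suc n\<close>.
  They are ordered: no absolute convergence is presupposed.\<close>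

definition lam :: "(nat \<Rightarrow> real) \<Rightarrow> real \<Rightarrow> real" where
  "lam \<alpha> k =
     (\<Sum>n. \<alpha> (Suc n) * (real (Suc n))\<^sup>2 * (sinc (real (Suc n) * k / 2))\<^sup>2)"

text \<open>A symbol is Type I iff it is so with some exponent \<open>\<sigma>\<close>. Existence of the second
  derivative at \<open>0\<close> is made explicit because \<open>deriv\<close> is total.\<close>

definition type_I :: "(real \<Rightarrow> real) \<Rightarrow> real \<Rightarrow> bool" where
  "type_I l \<sigma> \<longleftrightarrow>
     bdd_below (range l) \<and>
     (\<forall>\<^sub>F k in nhds 0. l differentiable (at k)) \<and> deriv l differentiable (at 0) \<and>
     deriv (deriv l) 0 < 0 \<and>
     0 < \<sigma> \<and> \<sigma> \<le> 2 \<and>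
     (\<exists>\<mu>>0. \<exists>k\<^sub>s>0.
        (\<forall>k. \<bar>k\<bar> \<le> k\<^sub>s \<longrightarrow>
           l k - l 0 \<le> - \<mu> * k\<^sup>2 \<and>
           \<bar>l k - l 0 - deriv (deriv l) 0 * k\<^sup>2 / 2\<bar> \<le> \<mu> * \<bar>k\<bar> powr (2 + \<sigma>)) \<and>
        bdd_above (l ` {k. \<bar>k\<bar> \<ge> k\<^sub>s}) \<and> (SUP k\<in>{k. \<bar>k\<bar> \<ge> k\<^sub>s}. l k) < l 0)"

section \<open>The traveling wave equation\<close>

definition avg :: "real \<Rightarrow> (real \<Rightarrow> real) \<Rightarrow> real \<Rightarrow> real" where
  "avg h F x = 1 / h * (LINT y:{x - h / 2..x + h / 2}|lborel. F y)"

definition W0 :: "real \<Rightarrow> real \<Rightarrow> real \<Rightarrow> real" where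
  "W0 l2 b x = - (3 * l2 / (4 * b)) * (1 / cosh (x / 2))\<^sup>2"

text \<open>A solution must keep the arguments of each \<open>\<Phi> m\<close> in the set where \<open>\<Phi> m\<close> is
  given. As \<open>W\<close> is an equivalence class, the equation is required almost everywhere.\<close>

definition tw_solution ::
    "real \<Rightarrow> real \<Rightarrow> (nat \<Rightarrow> real \<Rightarrow> real) \<Rightarrow> real \<Rightarrow> real \<Rightarrow> (real \<Rightarrow> real) \<Rightarrow> bool" where
  "tw_solution r \<delta> \<Phi> \<epsilon> c W \<longleftrightarrow>
     (\<forall>m\<ge>1. \<forall>x. r * real m + real m * \<epsilon>\<^sup>2 * avg (\<epsilon> * real m) W x \<in> range_set r \<delta> m) \<and>
     (AE x in lborel.
        (\<lambda>n. let m = Suc n in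
           real m * avg (\<epsilon> * real m)
             (\<lambda>y. dPot 1 r \<delta> \<Phi> m (r * real m + real m * \<epsilon>\<^sup>2 * avg (\<epsilon> * real m) W y)
                    - varsigma_coeff r \<delta> \<Phi> m) x)
        sums (\<epsilon>\<^sup>2 * c\<^sup>2 * W x))"

end

theory Submission
  imports Defs
begin

text \<open>Write \<open>\<nu> = - \<lambda>''(0) / 2\<close>. On the transform side the equation reads \<open>a W = \<Sum>m. \<dots>\<close> with
  the symbol \<open>a(k) = (c\<^sub>\<epsilon>\<^sup>2 - \<lambda>(\<epsilon>k)) / \<epsilon>\<^sup>2\<close> on the left and the Taylor remainders of the forces,
  whose leading part is \<open>\<beta>\<^sub>m m\<^sup>3 (A W)\<^sup>2\<close>, on the right. The Type I conditions give \<open>a \<ge> \<nu>\<close> and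
  \<open>1 / a(k) = 1 / (\<nu> (1 + k\<^sup>2)) + O(\<epsilon>\<^sup>\<sigma>)\<close>. Hence \<open>W = T W\<close> with \<open>T W = (\<Sum>m. \<dots>) / a\<close> is a perturbation of
  order \<open>\<epsilon>\<^sup>\<sigma>\<close> of the KdV equation \<open>\<nu> (W - W'') = b W\<^sup>2\<close>, solved by \<open>W\<^sub>0\<close>. The linearization of the
  latter at \<open>W\<^sub>0\<close> is inverted on even functions explicitly, from the two solutions of
  \<open>v'' = (1 - 2 u) v\<close>, and a contraction argument in a ball of radius \<open>O(\<epsilon>\<^sup>\<sigma>)\<close> around \<open>W\<^sub>0\<close> yields
  existence and uniqueness. Since \<open>a\<close> is bounded, \<open>T\<close> does not smooth; the fixed point is in \<open>H\<^sup>3\<close>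
  because second differences of the averaged profiles \<open>A W\<close> are \<open>O(t\<^sup>2)\<close>.

  Functions in \<open>H\<^sup>1\<close> are encoded by \<open>p \<in> L\<^sup>2\<close>: \<open>emb p\<close> is the continuous function with Hartley
  transform \<open>p(k) / (1 + k\<^sup>2)\<^sup>1\<^sup>/\<^sup>2\<close>, so its \<open>H\<^sup>1\<close> norm is the \<open>L\<^sup>2\<close> norm of \<open>p\<close>. The Hartley transform
  (kernel \<open>cos + sin\<close>) is a real isometric involution and avoids complex scalars.\<close>

section \<open>The Hilbert space of square integrable functions\<close>

text \<open>From L2 to H1 the distance of \<open>sm / a\<close> from its limit is estimated with
  half the order, \<epsilon> powr (\<sigma> / 2): one derivative is to be gained while the Type I
  remainder grows like |k| powr (2 + \<sigma>), with \<sigma> up to 2. Hence two separate estimates.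
  The deviation of \<open>T\<close> from its linearization only has to be small, and there half the
  order suffices; the residual of W0 fixes the radius of the ball, and there the smoothness of the
  soliton gives the full order. Comparing an average over m sites with the identity costs a factor m
  or m^2 on top of the m^3 of the quadratic terms, which the summability with weight m^5 pays for.
  Invertibility of the linearization needs neither compactness nor spectral theory: solvability for
  all even right-hand sides and symmetry together give injectivity. The series for \<lambda> may
  converge only conditionally, so its properties come from summation by parts, including the decay
  at infinity that makes c0^2 nonnegative and the wave speed real.\<close>

lemma square_integrableD [measurable_dest]:
  "square_integrable f \<Longrightarrow> f \<in> borel_measurable borel"
  by (simp add: square_integrable_def)

lemma square_integrable_sq: "square_integrable f \<Longrightarrow> integrable lborel (\<lambda>x. (f x)\<^sup>2)"
  by (simp add: square_integrable_def)

lemma square_integrableI: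
  "f \<in> borel_measurable borel \<Longrightarrow> integrable lborel (\<lambda>x. (f x)\<^sup>2) \<Longrightarrow> square_integrable f"
  by (simp add: square_integrable_def)

lemma square_integrable_prod:
  assumes "square_integrable f" "square_integrable g"
  shows "integrable lborel (\<lambda>x. f x * g x)"
proof (rule Bochner_Integration.integrable_bound)
  note [measurable] = assms[THEN square_integrableD]
  show "integrable lborel (\<lambda>x. (f x)\<^sup>2 + (g x)\<^sup>2)"
    using assms by (simp add: square_integrable_sq)
  show "(\<lambda>x. f x * g x) \<in> borel_measurable lborel"
    by measurable
  have "\<bar>a * b\<bar> \<le> a\<^sup>2 + b\<^sup>2" for a b :: real
    using sum_squares_bound[of "\<bar>a\<bar>" "\<bar>b\<bar>"] zero_le_power2[of a] zero_le_power2[of b]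
      mult_nonneg_nonneg[OF abs_ge_zero[of a] abs_ge_zero[of b]]
    unfolding power2_abs abs_mult mult.assoc by linarith
  then show "AE x in lborel. norm (f x * g x) \<le> norm ((f x)\<^sup>2 + (g x)\<^sup>2)"
    by (simp add: order_trans[OF _ abs_ge_self])
qed

lemma square_integrable_zero [simp]: "square_integrable (\<lambda>_. 0)"
  by (simp add: square_integrable_def)

lemma square_integrable_cmult [simp]:
  assumes "square_integrable f"
  shows "square_integrable (\<lambda>x. c * f x)"
proof -
  note [measurable] = assms[THEN square_integrableD]
  show ?thesis
    by (rule square_integrableI) (measurable, simp add: power_mult_distrib square_integrable_sq[OF assms])
qed

lemma square_integrable_minus [simp]: "square_integrable f \<Longrightarrow> square_integrable (\<lambda>x. - f x)"
  using square_integrable_cmult[of f "-1"] by simp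

lemma square_integrable_add [simp]:
  assumes "square_integrable f" "square_integrable g"
  shows "square_integrable (\<lambda>x. f x + g x)"
proof -
  note [measurable] = assms[THEN square_integrableD]
  have "integrable lborel (\<lambda>x. (f x)\<^sup>2 + (g x)\<^sup>2 + 2 * (f x * g x))"
    using assms[THEN square_integrable_sq] square_integrable_prod[OF assms] by simp
  moreover have "(\<lambda>x. (f x)\<^sup>2 + (g x)\<^sup>2 + 2 * (f x * g x)) = (\<lambda>x. (f x + g x)\<^sup>2)"
    by (simp add: power2_sum ac_simps)
  ultimately have "integrable lborel (\<lambda>x. (f x + g x)\<^sup>2)" by simp
  then show ?thesis
    by (rule square_integrableI[rotated]) measurable
qed

lemma square_integrable_diff [simp]:
  assumes "square_integrable f" "square_integrable g"
  shows "square_integrable (\<lambda>x. f x - g x)"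
  using square_integrable_add[OF assms(1) square_integrable_minus[OF assms(2)]] by simp

lemma square_integrable_bound:
  assumes "square_integrable g" and [measurable]: "f \<in> borel_measurable borel"
    and "AE x in lborel. \<bar>f x\<bar> \<le> \<bar>g x\<bar>"
  shows "square_integrable f"
  unfolding square_integrable_def
proof (intro conjI)
  show "integrable lborel (\<lambda>x. (f x)\<^sup>2)"
    by (rule Bochner_Integration.integrable_bound[OF square_integrable_sq[OF assms(1)]])
       (use assms(3) in \<open>auto simp: abs_le_square_iff\<close>)
qed simp

lemma square_integrable_cong_AE:
  assumes "square_integrable g" and [measurable]: "f \<in> borel_measurable borel"
    and "AE x in lborel. f x = g x"
  shows "square_integrable f"
  by (rule square_integrable_bound[OF assms(1,2)]) (use assms(3) in auto)

text \<open>The relation is partial, with the square integrable functions as its domain, so the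
  quotient needs no intermediate subtype. \<open>fn\<close> picks some representative; every
  statement about \<open>fn\<close> of a sum or a multiple therefore holds only almost
  everywhere.\<close>

definition l2_rel :: "(real \<Rightarrow> real) \<Rightarrow> (real \<Rightarrow> real) \<Rightarrow> bool" where
  "l2_rel f g \<longleftrightarrow> square_integrable f \<and> square_integrable g \<and> (AE x in lborel. f x = g x)"

quotient_type l2 = "real \<Rightarrow> real" / partial: l2_rel
  morphisms fn cls
proof (rule part_equivpI)
  show "\<exists>x. l2_rel x x" by (rule exI[of _ "\<lambda>_. 0"]) (simp add: l2_rel_def)
  show "symp l2_rel" by (auto simp: symp_def l2_rel_def eq_commute)
  show "transp l2_rel" by (auto simp: transp_def l2_rel_def)
qed

lemma sqi_fn [simp]: "square_integrable (fn F)"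
  using Quotient3_rep_reflp[OF Quotient3_l2, of F] by (simp add: l2_rel_def)

lemma fn_measurable [measurable]: "fn F \<in> borel_measurable borel"
  using sqi_fn[of F] by (simp add: square_integrable_def)

lemma cls_fn [simp]: "cls (fn F) = F"
  by (rule Quotient3_abs_rep[OF Quotient3_l2])

lemma cls_eq_iff:
  "square_integrable f \<Longrightarrow> square_integrable g \<Longrightarrow> cls f = cls g \<longleftrightarrow> (AE x in lborel. f x = g x)"
  using Quotient3_rel[OF Quotient3_l2, of f g] by (auto simp: l2_rel_def)

lemma fn_cls: "square_integrable f \<Longrightarrow> AE x in lborel. fn (cls f) x = f x"
  using cls_eq_iff[of "fn (cls f)" f] by simp

lemma l2_eqI: "(AE x in lborel. fn F x = fn G x) \<Longrightarrow> F = G"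
  using cls_eq_iff[of "fn F" "fn G"] by simp

lemma cls_eqI: "square_integrable f \<Longrightarrow> (AE x in lborel. fn F x = f x) \<Longrightarrow> F = cls f"
  using cls_eq_iff[of "fn F" f] by simp

instantiation l2 :: real_inner
begin

lift_definition zero_l2 :: l2 is "\<lambda>_. 0" by (simp add: l2_rel_def)
lift_definition plus_l2 :: "l2 \<Rightarrow> l2 \<Rightarrow> l2" is "\<lambda>f g x. f x + g x" by (auto simp: l2_rel_def)
lift_definition minus_l2 :: "l2 \<Rightarrow> l2 \<Rightarrow> l2" is "\<lambda>f g x. f x - g x" by (auto simp: l2_rel_def)
lift_definition uminus_l2 :: "l2 \<Rightarrow> l2" is "\<lambda>f x. - f x" by (auto simp: l2_rel_def)
lift_definition scaleR_l2 :: "real \<Rightarrow> l2 \<Rightarrow> l2" is "\<lambda>c f x. c * f x" by (auto simp: l2_rel_def)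
definition inner_l2 :: "l2 \<Rightarrow> l2 \<Rightarrow> real" where "inner_l2 F G = (LINT x|lborel. fn F x * fn G x)"
definition norm_l2 :: "l2 \<Rightarrow> real" where "norm_l2 F = sqrt (inner F F)"
definition sgn_l2 :: "l2 \<Rightarrow> l2" where "sgn_l2 F = scaleR (inverse (norm F)) F"
definition dist_l2 :: "l2 \<Rightarrow> l2 \<Rightarrow> real" where "dist_l2 F G = norm (F - G)"
definition uniformity_l2 :: "(l2 \<times> l2) filter" where
  "uniformity_l2 = (INF e\<in>{0<..}. principal {(x, y). dist x y < e})"
definition open_l2 :: "l2 set \<Rightarrow> bool" where
  "open_l2 U \<longleftrightarrow> (\<forall>x\<in>U. eventually (\<lambda>(x', y). x' = x \<longrightarrow> y \<in> U) uniformity)"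

lemma zero_eq_cls: "0 = cls (\<lambda>_. 0)"
  by (simp add: zero_l2_def)

lemma fn_zero: "AE x in lborel. fn 0 x = 0"
  by (simp add: zero_eq_cls fn_cls)

lemma cls_add: "square_integrable f \<Longrightarrow> square_integrable g \<Longrightarrow> cls f + cls g = cls (\<lambda>x. f x + g x)"
  by (rule plus_l2.abs_eq) (simp_all add: l2_rel_def)

lemma cls_diff: "square_integrable f \<Longrightarrow> square_integrable g \<Longrightarrow> cls f - cls g = cls (\<lambda>x. f x - g x)"
  by (rule minus_l2.abs_eq) (simp_all add: l2_rel_def)

lemma cls_minus: "square_integrable f \<Longrightarrow> - cls f = cls (\<lambda>x. - f x)"
  by (rule uminus_l2.abs_eq) (simp_all add: l2_rel_def)

lemma cls_scaleR: "square_integrable f \<Longrightarrow> c *\<^sub>R cls f = cls (\<lambda>x. c * f x)"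
  by (rule scaleR_l2.abs_eq) (simp_all add: l2_rel_def)

lemma fn_add: "AE x in lborel. fn (F + G) x = fn F x + fn G x"
  using fn_cls[of "\<lambda>x. fn F x + fn G x"] cls_add[of "fn F" "fn G"] by simp

lemma fn_diff: "AE x in lborel. fn (F - G) x = fn F x - fn G x"
  using fn_cls[of "\<lambda>x. fn F x - fn G x"] cls_diff[of "fn F" "fn G"] by simp

lemma fn_minus: "AE x in lborel. fn (- F) x = - fn F x"
  using fn_cls[of "\<lambda>x. - fn F x"] cls_minus[of "fn F"] by simp

lemma fn_scaleR: "AE x in lborel. fn (c *\<^sub>R F) x = c * fn F x"
  using fn_cls[of "\<lambda>x. c * fn F x"] cls_scaleR[of "fn F" c] by simp

lemma inner_cls_gen:
  assumes "square_integrable f" "square_integrable g"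
    "AE x in lborel. fn F x = f x" "AE x in lborel. fn G x = g x"
  shows "inner F G = (LINT x|lborel. f x * g x)"
  unfolding inner_l2_def using assms
  by (intro integral_cong_AE) auto

instance proof
  fix F G K :: l2 and c d :: real and U :: "l2 set"
  show "dist F G = norm (F - G)" by (rule dist_l2_def)
  show "(uniformity :: (l2 \<times> l2) filter) = (INF e\<in>{0<..}. principal {(x, y). dist x y < e})"
    by (rule uniformity_l2_def)
  show "open U \<longleftrightarrow> (\<forall>x\<in>U. eventually (\<lambda>(x', y). x' = x \<longrightarrow> y \<in> U) uniformity)"
    by (rule open_l2_def)
  show "sgn F = scaleR (inverse (norm F)) F" by (rule sgn_l2_def)
  show "norm F = sqrt (inner F F)" by (rule norm_l2_def)
  show "F + G + K = F + (G + K)"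
    by (rule l2_eqI) (use fn_add[of "F + G" K] fn_add[of F G] fn_add[of F "G + K"] fn_add[of G K] in \<open>eventually_elim, simp\<close>)
  show "F + G = G + F"
    by (rule l2_eqI) (use fn_add[of F G] fn_add[of G F] in \<open>eventually_elim, simp\<close>)
  show "0 + F = F"
    by (rule l2_eqI) (use fn_add[of 0 F] fn_zero in \<open>eventually_elim, simp\<close>)
  show "- F + F = 0"
    by (rule l2_eqI) (use fn_add[of "- F" F] fn_minus[of F] fn_zero in \<open>eventually_elim, simp\<close>)
  show "F - G = F + - G"
    by (rule l2_eqI) (use fn_add[of F "- G"] fn_minus[of G] fn_diff[of F G] in \<open>eventually_elim, simp\<close>)
  show "c *\<^sub>R (F + G) = c *\<^sub>R F + c *\<^sub>R G"
    by (rule l2_eqI) (use fn_add[of F G] fn_add[of "c *\<^sub>R F" "c *\<^sub>R G"] fn_scaleR[of c F] fn_scaleR[of c G] fn_scaleR[of c "F + G"]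
      in \<open>eventually_elim, simp add: algebra_simps\<close>)
  show "(c + d) *\<^sub>R F = c *\<^sub>R F + d *\<^sub>R F"
    by (rule l2_eqI) (use fn_add[of "c *\<^sub>R F" "d *\<^sub>R F"] fn_scaleR[of c F] fn_scaleR[of d F] fn_scaleR[of "c + d" F]
      in \<open>eventually_elim, simp add: algebra_simps\<close>)
  show "c *\<^sub>R d *\<^sub>R F = (c * d) *\<^sub>R F"
    by (rule l2_eqI) (use fn_scaleR[of c "d *\<^sub>R F"] fn_scaleR[of d F] fn_scaleR[of "c * d" F]
      in \<open>eventually_elim, simp add: algebra_simps\<close>)
  show "1 *\<^sub>R F = F"
    by (rule l2_eqI) (use fn_scaleR[of 1 F] in \<open>eventually_elim, simp add: algebra_simps\<close>)
  show "inner F G = inner G F"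
    by (simp add: inner_l2_def mult.commute)
  have "inner (F + G) K = (LINT x|lborel. (fn F x + fn G x) * fn K x)"
    by (rule inner_cls_gen) (use fn_add[of F G] in auto)
  also have "\<dots> = inner F K + inner G K"
    unfolding inner_l2_def
    by (subst Bochner_Integration.integral_add[symmetric]) (auto simp: algebra_simps intro!: square_integrable_prod)
  finally show "inner (F + G) K = inner F K + inner G K" .
  have "inner (c *\<^sub>R F) G = (LINT x|lborel. (c * fn F x) * fn G x)"
    by (rule inner_cls_gen) (use fn_scaleR[of c F] in auto)
  also have "\<dots> = c * inner F G"
    unfolding inner_l2_def by (simp add: mult.assoc)
  finally show "inner (c *\<^sub>R F) G = c * inner F G" .
  show "0 \<le> inner F F" by (simp add: inner_l2_def)
  have "inner F F = 0 \<longleftrightarrow> (AE x in lborel. fn F x * fn F x = 0)"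
    unfolding inner_l2_def by (rule integral_nonneg_eq_0_iff_AE) (auto intro!: square_integrable_prod)
  also have "\<dots> \<longleftrightarrow> F = 0"
    using cls_eq_iff[of "fn F" "\<lambda>_. 0"] by (simp add: zero_eq_cls)
  finally show "inner F F = 0 \<longleftrightarrow> F = 0" .
qed

end

lemma inner_cls: "square_integrable f \<Longrightarrow> square_integrable g \<Longrightarrow> inner (cls f) (cls g) = (LINT x|lborel. f x * g x)"
  by (rule inner_cls_gen) (auto intro: fn_cls)

lemma inner_fn: "inner F G = (LINT x|lborel. fn F x * fn G x)"
  by (simp add: inner_l2_def)

lemma norm_fn: "(norm F)\<^sup>2 = (LINT x|lborel. (fn F x)\<^sup>2)"
  unfolding power2_norm_eq_inner inner_fn by (simp add: power2_eq_square)

lemma norm_cls: "square_integrable f \<Longrightarrow> (norm (cls f))\<^sup>2 = (LINT x|lborel. (f x)\<^sup>2)"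
  unfolding power2_norm_eq_inner by (simp add: inner_cls power2_eq_square)

section \<open>Limits in L2 and completeness\<close>

lemma nn_integral_sq: "square_integrable f \<Longrightarrow> (\<integral>\<^sup>+x. ennreal ((f x)\<^sup>2) \<partial>lborel) = ennreal ((norm (cls f))\<^sup>2)"
  by (simp add: norm_cls nn_integral_eq_integral square_integrable_sq)

lemma norm_cls_le:
  assumes "square_integrable f" "square_integrable g" "0 \<le> c" "AE x in lborel. \<bar>f x\<bar> \<le> c * \<bar>g x\<bar>"
  shows "norm (cls f) \<le> c * norm (cls g)"
proof -
  have "(norm (cls f))\<^sup>2 \<le> (LINT x|lborel. c\<^sup>2 * (g x)\<^sup>2)"
    unfolding norm_cls[OF assms(1)]
  proof (rule integral_mono_AE)
    show "AE x in lborel. (f x)\<^sup>2 \<le> c\<^sup>2 * (g x)\<^sup>2"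
      using assms(4) by eventually_elim (metis abs_ge_zero power2_abs power_mono power_mult_distrib)
  qed (use assms in \<open>auto intro: square_integrable_sq\<close>)
  also have "\<dots> = (c * norm (cls g))\<^sup>2"
    by (simp add: norm_cls[OF assms(2)] power_mult_distrib)
  finally show ?thesis
    using assms(3) by (meson mult_nonneg_nonneg norm_ge_zero power2_le_imp_le)
qed

text \<open>Fatou's lemma applied to the squares. It serves where the limit is not known beforehand
  to be square integrable: for completeness, and later to turn uniform bounds on difference
  quotients or truncated weights into regularity.\<close>

lemma fatou_l2:
  fixes f :: "nat \<Rightarrow> real \<Rightarrow> real"
  assumes "\<And>n. square_integrable (f n)" "\<And>n. norm (cls (f n)) \<le> B"
    and g [measurable]: "g \<in> borel_measurable borel"
    and lim: "AE x in lborel. (\<lambda>n. f n x) \<longlonglongrightarrow> g x"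
  shows "square_integrable g \<and> norm (cls g) \<le> B"
proof -
  have [measurable]: "f n \<in> borel_measurable borel" for n
    by (rule square_integrableD[OF assms(1)])
  have B: "B \<ge> 0" by (rule order_trans[OF norm_ge_zero assms(2)[of 0]])
  have "(\<integral>\<^sup>+x. ennreal ((g x)\<^sup>2) \<partial>lborel) = (\<integral>\<^sup>+x. liminf (\<lambda>n. ennreal ((f n x)\<^sup>2)) \<partial>lborel)"
  proof (rule nn_integral_cong_AE)
    show "AE x in lborel. ennreal ((g x)\<^sup>2) = liminf (\<lambda>n. ennreal ((f n x)\<^sup>2))"
      using lim
    proof eventually_elim
      fix x assume "(\<lambda>n. f n x) \<longlonglongrightarrow> g x"
      then have "(\<lambda>n. ennreal ((f n x)\<^sup>2)) \<longlonglongrightarrow> ennreal ((g x)\<^sup>2)"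
        by (intro tendsto_ennrealI tendsto_power)
      then show "ennreal ((g x)\<^sup>2) = liminf (\<lambda>n. ennreal ((f n x)\<^sup>2))"
        by (rule lim_imp_Liminf[symmetric, rotated]) simp
    qed
  qed
  also have "\<dots> \<le> liminf (\<lambda>n. \<integral>\<^sup>+x. ennreal ((f n x)\<^sup>2) \<partial>lborel)"
    by (rule nn_integral_liminf) measurable
  also have "\<dots> \<le> ennreal (B\<^sup>2)"
  proof (intro Liminf_le always_eventually allI)
    show "(\<integral>\<^sup>+x. ennreal ((f n x)\<^sup>2) \<partial>lborel) \<le> ennreal (B\<^sup>2)" for n
      unfolding nn_integral_sq[OF assms(1)] by (intro ennreal_leI power_mono assms(2) norm_ge_zero)
  qed simp
  finally have le: "(\<integral>\<^sup>+x. ennreal ((g x)\<^sup>2) \<partial>lborel) \<le> ennreal (B\<^sup>2)" .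
  have "integrable lborel (\<lambda>x. (g x)\<^sup>2)"
  proof (rule integrableI_nonneg)
    show "(\<integral>\<^sup>+x. ennreal ((g x)\<^sup>2) \<partial>lborel) < \<infinity>"
      by (rule le_less_trans[OF le]) simp
  qed auto
  then have sq: "square_integrable g" by (simp add: square_integrable_def)
  then have "ennreal ((norm (cls g))\<^sup>2) \<le> ennreal (B\<^sup>2)" using le nn_integral_sq by simp
  then have "(norm (cls g))\<^sup>2 \<le> B\<^sup>2" by (subst (asm) ennreal_le_iff) auto
  then have "norm (cls g) \<le> B" by (rule power2_le_imp_le[OF _ B])
  with sq show ?thesis by simp
qed

lemma fn_lim_AE:
  assumes lim: "F \<longlonglongrightarrow> G" and [measurable]: "g \<in> borel_measurable borel"
    and pt: "AE x in lborel. (\<lambda>n. fn (F n) x) \<longlonglongrightarrow> g x"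
  shows "square_integrable g" "G = cls g"
proof -
  have G: "norm (cls (\<lambda>x. g x - fn G x)) \<le> e \<and> square_integrable (\<lambda>x. g x - fn G x)" if "e > 0" for e
  proof -
    obtain N where N: "\<And>n. n \<ge> N \<Longrightarrow> norm (F n - G) < e"
      using lim \<open>e > 0\<close> by (auto simp: lim_sequentially dist_norm)
    have *: "norm (cls (\<lambda>x. fn (F (n + N)) x - fn G x)) \<le> e" for n
      using N[of "n + N"] by (simp add: cls_diff[symmetric] less_imp_le)
    have "square_integrable (\<lambda>x. g x - fn G x) \<and> norm (cls (\<lambda>x. g x - fn G x)) \<le> e"
    proof (rule fatou_l2[where f="\<lambda>n x. fn (F (n + N)) x - fn G x", OF _ *])
      show "AE x in lborel. (\<lambda>n. fn (F (n + N)) x - fn G x) \<longlonglongrightarrow> g x - fn G x"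
        using pt by eventually_elim (rule tendsto_diff[OF LIMSEQ_ignore_initial_segment tendsto_const])
    qed auto
    then show ?thesis by simp
  qed
  have "square_integrable (\<lambda>x. (g x - fn G x) + fn G x)"
    by (rule square_integrable_add[OF conjunct2[OF G[OF zero_less_one]] sqi_fn])
  then show sq: "square_integrable g" unfolding diff_add_cancel .
  have "norm (cls (\<lambda>x. g x - fn G x)) \<le> 0"
    by (rule field_le_epsilon) (use G in auto)
  then have "cls (\<lambda>x. g x - fn G x) = 0" by simp
  then have "cls g - G = 0"
    using cls_diff[OF sq sqi_fn, of G] by simp
  then show "G = cls g" by simp
qed

lemma integrable_inverse_square: "integrable lborel (\<lambda>x::real. 1 / (1 + x\<^sup>2))"
  using integrable_inverse_1_plus_square by (simp add: set_integrable_def einterval_def inverse_eq_divide)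

lemma square_integrable_inverse_square: "square_integrable (\<lambda>x::real. 1 / (1 + x\<^sup>2))"
proof -
  have "integrable lborel (\<lambda>x::real. (1 / (1 + x\<^sup>2))\<^sup>2)"
  proof (rule Bochner_Integration.integrable_bound[OF integrable_inverse_square])
    have "(1 / (1 + x\<^sup>2))\<^sup>2 \<le> 1 / (1 + x\<^sup>2)" for x :: real
      by (simp add: power2_eq_square divide_simps add_nonneg_eq_0_iff)
    then show "AE x in lborel. norm ((1 / (1 + x\<^sup>2))\<^sup>2) \<le> norm (1 / (1 + x\<^sup>2) :: real)"
      by auto
  qed simp
  then show ?thesis by (simp add: square_integrable_def)
qed

text \<open>Riesz--Fischer: along a rapidly converging subsequence the increments are
  integrable against \<open>1 / (1 + x\<^sup>2) \<in> L\<^sup>2\<close>, hence summable almost everywhere.\<close>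

lemma rapid_Cauchy_l2:
  fixes X :: "nat \<Rightarrow> l2"
  assumes X: "\<And>n. norm (X (Suc n) - X n) \<le> (1/2)^n"
  shows "\<exists>G. \<forall>n. norm (G - X n) \<le> 2 * (1/2)^n"
proof -
  define w :: "real \<Rightarrow> real" where "w = (\<lambda>x. 1 / (1 + x\<^sup>2))"
  have w: "square_integrable w" by (simp add: w_def square_integrable_inverse_square)
  have wpos: "w x > 0" for x by (simp add: w_def add_pos_nonneg)
  have [measurable]: "w \<in> borel_measurable borel" by (simp add: w_def)
  define g where "g n x = \<bar>fn (X (Suc n)) x - fn (X n) x\<bar>" for n x
  have sqg: "square_integrable (g n)" for n
    unfolding g_def by (rule square_integrable_bound[of "\<lambda>x. fn (X (Suc n)) x - fn (X n) x"]) auto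
  have [measurable]: "g n \<in> borel_measurable borel" for n by (rule square_integrableD[OF sqg])
  have ng: "norm (cls (g n)) \<le> (1/2)^n" for n
  proof -
    have "norm (cls (g n)) \<le> 1 * norm (cls (\<lambda>x. fn (X (Suc n)) x - fn (X n) x))"
      by (rule norm_cls_le[OF sqg]) (auto simp: g_def)
    then show ?thesis using X[of n] by (simp add: cls_diff[symmetric])
  qed
  have int: "integrable lborel (\<lambda>x. g n x * w x)" for n by (rule square_integrable_prod[OF sqg w])
  have "(\<integral>\<^sup>+x. ennreal (g n x * w x) \<partial>lborel) \<le> ennreal (norm (cls w) * (1/2)^n)" for n
  proof -
    have "(\<integral>\<^sup>+x. ennreal (g n x * w x) \<partial>lborel) = ennreal (inner (cls (g n)) (cls w))"
      unfolding inner_cls[OF sqg w] using int wpos by (intro nn_integral_eq_integral) (auto simp: g_def less_imp_le)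
    also have "inner (cls (g n)) (cls w) \<le> norm (cls (g n)) * norm (cls w)" by (rule norm_cauchy_schwarz)
    also have "\<dots> \<le> norm (cls w) * (1/2)^n" using ng[of n] by (simp add: mult.commute mult_left_mono)
    finally show ?thesis by (simp add: ennreal_leI)
  qed
  then have "(\<Sum>n. \<integral>\<^sup>+x. ennreal (g n x * w x) \<partial>lborel) \<le> (\<Sum>n. ennreal (norm (cls w) * (1/2)^n))"
    by (intro suminf_le) auto
  also have "\<dots> < \<infinity>"
    by (subst suminf_ennreal2) (auto intro!: summable_mult summable_geometric)
  finally have "(\<integral>\<^sup>+x. (\<Sum>n. ennreal (g n x * w x)) \<partial>lborel) < \<infinity>"
    by (subst nn_integral_suminf) auto
  then have "AE x in lborel. (\<Sum>n. ennreal (g n x * w x)) \<noteq> \<infinity>"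
    by (intro nn_integral_noteq_infinite) auto
  then have conv: "AE x in lborel. convergent (\<lambda>n. fn (X n) x)"
  proof eventually_elim
    fix x assume "(\<Sum>n. ennreal (g n x * w x)) \<noteq> \<infinity>"
    then have "summable (\<lambda>n. g n x * w x)"
      using wpos[of x] by (intro summable_suminf_not_top) (auto simp: g_def less_imp_le)
    from summable_mult2[OF this, of "1 / w x"] have "summable (\<lambda>n. g n x)"
      using wpos[of x] by (simp add: less_imp_neq[THEN not_sym])
    then have "summable (\<lambda>n. fn (X (Suc n)) x - fn (X n) x)"
      unfolding g_def by (rule summable_rabs_cancel)
    then have "convergent (\<lambda>n. \<Sum>i<n. fn (X (Suc i)) x - fn (X i) x)"
      by (simp add: summable_iff_convergent)
    then have "convergent (\<lambda>n. fn (X n) x - fn (X 0) x)"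
      unfolding sum_lessThan_telescope[of "\<lambda>i. fn (X i) x"] .
    from convergent_add[OF this convergent_const[of "fn (X 0) x"]]
    show "convergent (\<lambda>n. fn (X n) x)" by simp
  qed
  define f where "f x = lim (\<lambda>n. fn (X n) x)" for x
  have [measurable]: "f \<in> borel_measurable borel" unfolding f_def by measurable
  have fl: "AE x in lborel. (\<lambda>n. fn (X n) x) \<longlonglongrightarrow> f x"
    using conv by eventually_elim (simp add: f_def convergent_LIMSEQ_iff)
  have tele: "norm (X (k + n) - X n) \<le> 2 * (1/2)^n" for n k
  proof -
    \<comment> \<open>The exact geometric sum is carried through the induction; the cruder bound
      \<open>2 * (1/2)^n\<close> would not reproduce itself.\<close>
    have "norm (X (k + n) - X n) \<le> (2 - 2 * (1/2)^k) * (1/2)^n"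
    proof (induction k)
      case (Suc k)
      have "norm (X (Suc k + n) - X n) \<le> norm (X (Suc (k + n)) - X (k + n)) + norm (X (k + n) - X n)"
        using norm_triangle_ineq[of "X (Suc (k + n)) - X (k + n)" "X (k + n) - X n"] by simp
      also have "\<dots> \<le> (1/2)^(k+n) + (2 - 2 * (1/2)^k) * (1/2)^n"
        using X[of "k + n"] Suc.IH by linarith
      also have "\<dots> = (2 - 2 * (1/2)^Suc k) * (1/2)^n" by (simp add: power_add algebra_simps)
      finally show ?case .
    qed simp
    also have "\<dots> \<le> 2 * (1/2)^n" by (intro mult_right_mono) auto
    finally show ?thesis .
  qed
  have main: "square_integrable (\<lambda>x. f x - fn (X n) x) \<and> norm (cls (\<lambda>x. f x - fn (X n) x)) \<le> 2 * (1/2)^n" for n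
  proof (rule fatou_l2[where f="\<lambda>k x. fn (X (k + n)) x - fn (X n) x"])
    show "AE x in lborel. (\<lambda>k. fn (X (k + n)) x - fn (X n) x) \<longlonglongrightarrow> f x - fn (X n) x"
      using fl by eventually_elim (rule tendsto_diff[OF LIMSEQ_ignore_initial_segment tendsto_const])
  qed (use tele in \<open>auto simp: cls_diff[symmetric]\<close>)
  have "square_integrable (\<lambda>x. (f x - fn (X 0) x) + fn (X 0) x)"
    by (rule square_integrable_add[OF conjunct1[OF main] sqi_fn])
  then have "square_integrable f" unfolding diff_add_cancel .
  then have "norm (cls f - X n) \<le> 2 * (1/2)^n" for n
    using main[of n] cls_diff[of f "fn (X n)"] by simp
  then show ?thesis by blast
qed

instance l2 :: banach
proof
  fix X :: "nat \<Rightarrow> l2" assume X: "Cauchy X"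
  have "\<forall>n. \<exists>N. \<forall>i\<ge>N. \<forall>j\<ge>N. norm (X i - X j) < (1/2)^n"
    using X unfolding Cauchy_iff by (metis zero_less_power half_gt_zero zero_less_one)
  then obtain N where N: "\<And>n i j. i \<ge> N n \<Longrightarrow> j \<ge> N n \<Longrightarrow> norm (X i - X j) < (1/2)^n"
    by metis
  \<comment> \<open>A nondecreasing index that dominates \<open>N n\<close>, so that consecutive
    members of the subsequence are \<open>(1/2)^n\<close> close.\<close>
  define r where "r n = n + (\<Sum>i\<le>n. N i)" for n
  have rN: "r n \<ge> N n" for n
    unfolding r_def by (metis atMost_iff finite_atMost member_le_sum order_refl trans_le_add2 zero_le)
  have rS: "r (Suc n) \<ge> r n" for n unfolding r_def by simp
  have "norm (X (r (Suc n)) - X (r n)) \<le> (1/2)^n" for n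
    using N[of n "r (Suc n)" "r n"] rN[of n] rS[of n] by linarith
  from rapid_Cauchy_l2[of "\<lambda>n. X (r n)", OF this]
  obtain G where G: "\<And>n. norm (G - X (r n)) \<le> 2 * (1/2)^n" by blast
  have "X \<longlonglongrightarrow> G"
  proof (rule LIMSEQ_I)
    fix e :: real assume "e > 0"
    obtain n where n: "(1/2::real)^n < e / 3"
      using real_arch_pow_inv[of "e/3" "1/2"] \<open>e > 0\<close> by auto
    have "norm (X i - G) < e" if "i \<ge> N n" for i
    proof -
      have "norm (X i - G) \<le> norm (X i - X (r n)) + norm (X (r n) - G)"
        using norm_triangle_ineq[of "X i - X (r n)" "X (r n) - G"] by simp
      then show ?thesis
        using N[OF that rN[of n]] G[of n] n by (simp add: norm_minus_commute)
    qed
    then show "\<exists>no. \<forall>n\<ge>no. norm (X n - G) < e" by blast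
  qed
  then show "convergent X" by (auto simp: convergent_def)
qed

lemma square_integrable_mult_bounded:
  assumes f: "square_integrable f" and [measurable]: "a \<in> borel_measurable borel"
    and a: "\<And>x. \<bar>a x\<bar> \<le> C"
  shows "square_integrable (\<lambda>x. a x * f x)" "norm (cls (\<lambda>x. a x * f x)) \<le> C * norm (cls f)"
proof -
  note [measurable] = square_integrableD[OF f]
  have C: "C \<ge> 0" by (rule order_trans[OF abs_ge_zero a[of 0]])
  have le: "AE x in lborel. \<bar>a x * f x\<bar> \<le> C * \<bar>f x\<bar>"
    by (intro AE_I2) (simp add: abs_mult mult_right_mono[OF a])
  show sq: "square_integrable (\<lambda>x. a x * f x)"
  proof (rule square_integrable_bound)
    show "square_integrable (\<lambda>x. C * f x)" using f by simp
    show "AE x in lborel. \<bar>a x * f x\<bar> \<le> \<bar>C * f x\<bar>" using le C by (simp add: abs_mult)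
  qed measurable
  show "norm (cls (\<lambda>x. a x * f x)) \<le> C * norm (cls f)"
    by (rule norm_cls_le[OF sq f C le])
qed

lemma l2_dominated_convergence:
  assumes f: "\<And>n. square_integrable (f n)" and h: "square_integrable h"
    and g [measurable]: "g \<in> borel_measurable borel"
    and lim: "AE x in lborel. (\<lambda>n. f n x) \<longlonglongrightarrow> g x"
    and bound: "\<And>n. AE x in lborel. \<bar>f n x\<bar> \<le> h x" and gb: "AE x in lborel. \<bar>g x\<bar> \<le> h x"
  shows "square_integrable g" "(\<lambda>n. cls (f n)) \<longlonglongrightarrow> cls g"
proof -
  note [measurable] = square_integrableD[OF f] square_integrableD[OF h]
  show sg: "square_integrable g"
    by (rule square_integrable_bound[OF h g]) (use gb in \<open>eventually_elim, simp\<close>)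
  have "(\<lambda>n. LINT x|lborel. (f n x - g x)\<^sup>2) \<longlonglongrightarrow> (LINT x::real|lborel. 0)"
  proof (rule integral_dominated_convergence[where w="\<lambda>x. 4 * (h x)\<^sup>2"])
    show "integrable lborel (\<lambda>x. 4 * (h x)\<^sup>2)" using square_integrable_sq[OF h] by simp
    show "AE x in lborel. (\<lambda>n. (f n x - g x)\<^sup>2) \<longlonglongrightarrow> 0"
      using lim
    proof eventually_elim
      fix x assume "(\<lambda>n. f n x) \<longlonglongrightarrow> g x"
      from tendsto_power[OF tendsto_diff[OF this tendsto_const[of "g x"]], of 2]
      show "(\<lambda>n. (f n x - g x)\<^sup>2) \<longlonglongrightarrow> 0" by simp
    qed
    show "AE x in lborel. norm ((f n x - g x)\<^sup>2) \<le> 4 * (h x)\<^sup>2" for n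
      using bound[of n] gb
    proof eventually_elim
      fix x assume "\<bar>f n x\<bar> \<le> h x" "\<bar>g x\<bar> \<le> h x"
      then have "\<bar>f n x - g x\<bar> \<le> 2 * h x" by linarith
      then have "\<bar>f n x - g x\<bar>\<^sup>2 \<le> (2 * h x)\<^sup>2" by (rule power_mono) simp
      then show "norm ((f n x - g x)\<^sup>2) \<le> 4 * (h x)\<^sup>2" by (simp add: power_mult_distrib)
    qed
  qed measurable
  then have "(\<lambda>n. (norm (cls (f n) - cls g))\<^sup>2) \<longlonglongrightarrow> 0"
    using f sg by (simp add: cls_diff norm_cls)
  then have "(\<lambda>n. sqrt ((norm (cls (f n) - cls g))\<^sup>2)) \<longlonglongrightarrow> sqrt 0"
    by (rule tendsto_real_sqrt)
  then have "(\<lambda>n. norm (cls (f n) - cls g)) \<longlonglongrightarrow> 0" by simp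
  then show "(\<lambda>n. cls (f n)) \<longlonglongrightarrow> cls g"
    by (simp add: tendsto_norm_zero_iff LIM_zero_iff)
qed

section \<open>Density of step functions\<close>

text \<open>The signed indicator of the interval between 0 and \<open>b\<close>, for either sign of
  \<open>b\<close>. This one-parameter family suffices: its differences give all bounded half-open
  intervals, and both its inner products and its Hartley transforms have closed formulas.\<close>

definition chi :: "real \<Rightarrow> real \<Rightarrow> real" where
  "chi b x = indicator {..b} x - indicator {..0} x"

lemma chi_measurable [measurable]: "chi b \<in> borel_measurable borel"
  unfolding chi_def by measurable

lemma square_integrable_indicator:
  assumes [measurable]: "A \<in> sets borel" and "A \<subseteq> {-N..N::real}"
  shows "square_integrable (indicator A)"
proof -
  have "emeasure lborel A < \<infinity>"
    by (rule emeasure_bounded_finite, rule bounded_subset[OF bounded_closed_interval assms(2)])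
  then have "integrable lborel (indicator A :: real \<Rightarrow> real)" by (simp add: integrable_indicator_iff)
  moreover have "(\<lambda>x. (indicator A x :: real)\<^sup>2) = indicator A" by (auto split: split_indicator)
  ultimately show ?thesis by (simp add: square_integrable_def)
qed

lemma chi_eq: "chi b x = (if b \<ge> 0 then indicator {0<..b} x else - indicator {b<..0} x)"
  by (auto simp: chi_def split: split_indicator)

lemma square_integrable_chi [simp]: "square_integrable (chi b)"
proof -
  have eq: "chi b = (if b \<ge> 0 then indicator {0<..b} else (\<lambda>x. - indicator {b<..0} x))"
    by (auto simp: chi_eq fun_eq_iff)
  have "square_integrable (indicator {0<..b})" "square_integrable (indicator {b<..0})"
    by (rule square_integrable_indicator[of _ "\<bar>b\<bar>"]; force)+
  then show ?thesis unfolding eq by (simp add: square_integrable_minus)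
qed

lemma integrable_chi: "integrable lborel (chi b)"
proof -
  have "integrable lborel (indicator {0<..b} :: real \<Rightarrow> real)" "integrable lborel (indicator {b<..0} :: real \<Rightarrow> real)"
    by (cases "0 \<le> b"; simp add: integrable_indicator_iff)+
  then show ?thesis
    by (cases "b \<ge> 0") (auto simp: chi_eq[abs_def])
qed

abbreviation "step_span \<equiv> closure (span (range (\<lambda>b. cls (chi b))))"

lemma step_span_add: "F \<in> step_span \<Longrightarrow> G \<in> step_span \<Longrightarrow> F + G \<in> step_span"
proof -
  assume "F \<in> step_span" "G \<in> step_span"
  then obtain f g where "\<And>n::nat. f n \<in> span (range (\<lambda>b. cls (chi b)))" "f \<longlonglongrightarrow> F"
     "\<And>n::nat. g n \<in> span (range (\<lambda>b. cls (chi b)))" "g \<longlonglongrightarrow> G"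
    unfolding closure_sequential by blast
  then have "\<And>n. f n + g n \<in> span (range (\<lambda>b. cls (chi b)))" "(\<lambda>n. f n + g n) \<longlonglongrightarrow> F + G"
    by (auto intro: span_add tendsto_add)
  then show ?thesis unfolding closure_sequential by (intro exI[of _ "\<lambda>n. f n + g n"]) auto
qed

lemma step_span_scale: "F \<in> step_span \<Longrightarrow> c *\<^sub>R F \<in> step_span"
proof -
  assume "F \<in> step_span"
  then obtain f where "\<And>n::nat. f n \<in> span (range (\<lambda>b. cls (chi b)))" "f \<longlonglongrightarrow> F"
    unfolding closure_sequential by blast
  then have "\<And>n. c *\<^sub>R f n \<in> span (range (\<lambda>b. cls (chi b)))" "(\<lambda>n. c *\<^sub>R f n) \<longlonglongrightarrow> c *\<^sub>R F"
    by (auto intro: span_scale tendsto_scaleR)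
  then show ?thesis unfolding closure_sequential by (intro exI[of _ "\<lambda>n. c *\<^sub>R f n"]) auto
qed

lemma step_span_diff: "F \<in> step_span \<Longrightarrow> G \<in> step_span \<Longrightarrow> F - G \<in> step_span"
  using step_span_add[of F "(-1) *\<^sub>R G"] step_span_scale[of G "-1"] by simp

lemma step_span_chi: "cls (chi b) \<in> step_span"
  by (rule subsetD[OF closure_subset], rule span_base) simp

lemma step_span_zero: "0 \<in> step_span"
  by (rule subsetD[OF closure_subset], rule span_zero)

lemma step_span_sum: "(\<And>i. i \<in> I \<Longrightarrow> F i \<in> step_span) \<Longrightarrow> sum F I \<in> step_span"
  by (induction I rule: infinite_finite_induct) (auto intro: step_span_zero step_span_add)

lemma cls_sum:
  assumes "\<And>i. i \<in> I \<Longrightarrow> square_integrable (f i)"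
  shows "square_integrable (\<lambda>x. \<Sum>i\<in>I. f i x) \<and> cls (\<lambda>x. \<Sum>i\<in>I. f i x) = (\<Sum>i\<in>I. cls (f i))"
  using assms
proof (induction I rule: infinite_finite_induct)
  case (insert i I)
  then show ?case using cls_add[of "f i" "\<lambda>x. \<Sum>i\<in>I. f i x"] by simp
qed (auto simp: zero_eq_cls)

text \<open>Induction over the Borel sets through complements and disjoint unions, starting from the
  half lines, an intersection-stable generator. The fixed window keeps all indicators in L2 and
  supplies the dominating function for countable unions.\<close>

lemma step_span_indicator:
  assumes A: "A \<in> sets borel" and N: "N > 0"
  shows "cls (indicator (A \<inter> {-N<..N})) \<in> step_span"
proof -
  have sq: "square_integrable (indicator (A \<inter> {-N<..N}) :: real \<Rightarrow> real)" if "A \<in> sets borel" for A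
    by (rule square_integrable_indicator[of _ N]) (use that in auto)
  have sqN: "square_integrable (indicator {-N<..N} :: real \<Rightarrow> real)" using sq[of UNIV] by simp
  have full: "cls (indicator {-N<..N}) \<in> step_span"
  proof -
    have "indicator {-N<..N} = (\<lambda>x. chi N x - chi (-N) x)"
      using N by (auto simp: chi_def fun_eq_iff split: split_indicator)
    then show ?thesis by (simp add: cls_diff[symmetric] step_span_diff step_span_chi)
  qed
  have gen: "sets borel = sigma_sets UNIV (range (\<lambda>a::real. {..a}))"
    by (subst borel_eq_atMost) (simp add: sets_measure_of)
  have "Int_stable (range (\<lambda>a::real. {..a}))"
    by (auto simp: Int_stable_def)
  moreover have "range (\<lambda>a::real. {..a}) \<subseteq> Pow UNIV" by auto
  moreover have "A \<in> sigma_sets UNIV (range (\<lambda>a::real. {..a}))" using A gen by simp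
  ultimately show ?thesis
  proof (induction A rule: sigma_sets_induct_disjoint)
    case (basic A)
    then obtain a where a: "A = {..a}" by auto
    \<comment> \<open>Clamping \<open>a\<close> to the window turns the truncated half line into a
      difference of two functions \<open>chi\<close>.\<close>
    define a' where "a' = max (-N) (min a N)"
    have "indicator (A \<inter> {-N<..N}) = (\<lambda>x. chi a' x - chi (-N) x)"
      using N by (auto simp: a a'_def chi_def fun_eq_iff split: split_indicator)
    then show ?case by (simp add: cls_diff[symmetric] step_span_diff step_span_chi)
  next
    case empty
    have "(indicator ({} \<inter> {-N<..N}) :: real \<Rightarrow> real) = (\<lambda>_. 0)" by (auto simp: fun_eq_iff)
    then show ?case by (simp add: zero_eq_cls[symmetric] step_span_zero)
  next
    case (compl A)
    have eq: "(indicator ((UNIV - A) \<inter> {-N<..N}) :: real \<Rightarrow> real) = (\<lambda>x. indicator {-N<..N} x - indicator (A \<inter> {-N<..N}) x)"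
      by (auto simp: fun_eq_iff split: split_indicator)
    have "square_integrable (indicator (A \<inter> {-N<..N}) :: real \<Rightarrow> real)" using compl(1) gen by (intro sq) simp
    then show ?case unfolding eq
      using compl(2) sqN by (simp add: cls_diff[symmetric] step_span_diff full)
  next
    case (union A)
    have meas: "A i \<in> sets borel" for i using union(2) gen by auto
    define f where "f n = (\<lambda>x. \<Sum>i<n. indicator (A i \<inter> {-N<..N}) x :: real)" for n
    have f: "square_integrable (f n)" "cls (f n) \<in> step_span" for n
      using cls_sum[of "{..<n}" "\<lambda>i. indicator (A i \<inter> {-N<..N})"] sq[OF meas] union(3)
      by (auto simp: f_def intro: step_span_sum)
    have f_eq: "f n x = indicator ((\<Union>i<n. A i) \<inter> {-N<..N}) x" for n x
    proof -
      have "disjoint_family_on (\<lambda>i. A i \<inter> {-N<..N}) {..<n}"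
        using union(1) by (auto simp: disjoint_family_on_def)
      from indicator_UN_disjoint[OF _ this, of x]
      have h1: "indicator (\<Union>i<n. A i \<inter> {-N<..N}) x = f n x" unfolding f_def by simp
      have h2: "(\<Union>i<n. A i) \<inter> {-N<..N} = (\<Union>i<n. A i \<inter> {-N<..N})" by blast
      show ?thesis unfolding h2 by (rule h1[symmetric])
    qed
    have "(\<lambda>n. cls (f n)) \<longlonglongrightarrow> cls (indicator ((\<Union>i. A i) \<inter> {-N<..N}))"
    proof (rule l2_dominated_convergence(2)[OF f(1)])
      show "square_integrable (indicator {-N<..N} :: real \<Rightarrow> real)" using sq[of UNIV] by simp
      show "AE x in lborel. (\<lambda>n. f n x) \<longlonglongrightarrow> indicator ((\<Union>i. A i) \<inter> {-N<..N}) x"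
      proof (rule AE_I2)
        fix x
        show "(\<lambda>n. f n x) \<longlonglongrightarrow> indicator ((\<Union>i. A i) \<inter> {-N<..N}) x"
        proof (cases "x \<in> (\<Union>i. A i)")
          case True
          then obtain k where "x \<in> A k" by auto
          then have "eventually (\<lambda>n. f n x = indicator ((\<Union>i. A i) \<inter> {-N<..N}) x) sequentially"
            by (intro eventually_sequentiallyI[of "Suc k"]) (auto simp: f_eq Suc_le_eq split: split_indicator)
          then show ?thesis by (rule tendsto_eventually)
        next
          case False
          then show ?thesis by (auto simp: f_eq)
        qed
      qed
    qed (use meas in \<open>auto simp: f_eq split: split_indicator\<close>)
    then show ?case by (rule closed_sequentially[OF closed_closure, rotated]) (rule f(2))
  qed
qed

text \<open>Simple functions converging pointwise to \<open>fn F\<close>, with majorant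
  \<open>2 * \<bar>fn F x\<bar>\<close>, are cut off to growing windows. Each becomes a finite
  combination of the indicators already treated, and dominated convergence in L2 finishes.\<close>

lemma step_span_UNIV: "F \<in> step_span"
proof -
  have "fn F \<in> borel_measurable borel" by measurable
  from borel_measurable_implies_sequence_metric[OF this, of 0]
  obtain s where s: "\<And>i. simple_function borel (s i)" "\<And>x. (\<lambda>i. s i x) \<longlonglongrightarrow> fn F x"
     "\<And>i x. \<bar>s i x\<bar> \<le> 2 * \<bar>fn F x\<bar>" by (auto simp: dist_real_def)
  define t where "t i x = s i x * indicator {- real (Suc i)<..real (Suc i)} x" for i x
  have [measurable]: "s i \<in> borel_measurable borel" for i
    using s(1) by (rule borel_measurable_simple_function)
  have tF: "\<bar>t i x\<bar> \<le> 2 * \<bar>fn F x\<bar>" for i x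
    using s(3)[of i x] by (auto simp: t_def split: split_indicator)
  have sqh: "square_integrable (\<lambda>x. 2 * \<bar>fn F x\<bar>)"
    by (rule square_integrable_bound[of "\<lambda>x. 2 * fn F x"]) (auto simp: abs_mult)
  have tsq: "square_integrable (t i)" for i
    by (rule square_integrable_bound[OF sqh]) (use tF in \<open>auto simp: t_def[abs_def]\<close>)
  have t: "cls (t i) \<in> step_span" for i
  proof -
    let ?f = "\<lambda>y x. y * indicator (s i -` {y} \<inter> {- real (Suc i)<..real (Suc i)}) x"
    have ms: "s i -` {y} \<in> sets borel" for y
      using measurable_sets[of "s i" borel borel "{y}"] by simp
    have eq: "t i = (\<lambda>x. \<Sum>y\<in>s i ` UNIV. ?f y x)"
    proof
      fix x
      have "s i x = (\<Sum>y\<in>s i ` UNIV. indicator (s i -` {y}) x * y)"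
        using simple_function_indicator_representation_banach[OF s(1)[of i], of x]
        unfolding space_borel Int_UNIV_right real_scaleR_def by blast
      then have "t i x = (\<Sum>y\<in>s i ` UNIV. indicator (s i -` {y}) x * y) * indicator {- real (Suc i)<..real (Suc i)} x"
        unfolding t_def by metis
      also have "\<dots> = (\<Sum>y\<in>s i ` UNIV. ?f y x)"
        unfolding sum_distrib_right by (intro sum.cong refl) (simp add: indicator_inter_arith)
      finally show "t i x = (\<Sum>y\<in>s i ` UNIV. ?f y x)" .
    qed
    have sqf: "square_integrable (?f y)" for y
      by (intro square_integrable_cmult square_integrable_indicator[of _ "real (Suc i)"]) (use ms in auto)
    have "cls (?f y) \<in> step_span" for y
    proof -
      have "square_integrable (indicator (s i -` {y} \<inter> {- real (Suc i)<..real (Suc i)}))"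
        by (rule square_integrable_indicator[of _ "real (Suc i)"]) (use ms in auto)
      from cls_scaleR[OF this, of y] step_span_scale[OF step_span_indicator[OF ms[of y], of "real (Suc i)"], of y]
      show ?thesis by simp
    qed
    then show ?thesis
      unfolding eq using cls_sum[of "s i ` UNIV" ?f] sqf by (simp add: step_span_sum)
  qed
  have "(\<lambda>i. cls (t i)) \<longlonglongrightarrow> cls (fn F)"
  proof (rule l2_dominated_convergence(2)[OF tsq sqh])
    show "AE x in lborel. (\<lambda>n. t n x) \<longlonglongrightarrow> fn F x"
    proof (rule AE_I2)
      fix x
      obtain k where k: "\<bar>x\<bar> < real k" using reals_Archimedean2 by blast
      have "eventually (\<lambda>n. s n x = t n x) sequentially"
        by (rule eventually_sequentiallyI[of k]) (use k in \<open>auto simp: t_def split: split_indicator\<close>)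
      with s(2)[of x] show "(\<lambda>n. t n x) \<longlonglongrightarrow> fn F x"
        by (rule Lim_transform_eventually)
    qed
  qed (use tF in auto)
  then have "cls (fn F) \<in> step_span" by (rule closed_sequentially[OF closed_closure, rotated]) (rule t)
  then show ?thesis by simp
qed

text \<open>\<open>F - G\<close> is a limit of combinations to which it is orthogonal, hence
  orthogonal to itself. This is the test by which the Hartley transform is pinned down.\<close>

lemma l2_eqI_chi:
  assumes "\<And>b. inner F (cls (chi b)) = inner G (cls (chi b))"
  shows "F = G"
proof -
  have "F - G \<in> closure (span (range (\<lambda>b. cls (chi b))))" by (rule step_span_UNIV)
  then obtain X where X: "\<And>n::nat. X n \<in> span (range (\<lambda>b. cls (chi b)))" "X \<longlonglongrightarrow> F - G"
    unfolding closure_sequential by blast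
  have "inner (F - G) x = 0" if "x \<in> span (range (\<lambda>b. cls (chi b)))" for x
    using that by (induction rule: span_induct_alt) (auto simp: inner_simps assms)
  then have "(\<lambda>n. inner (F - G) (X n)) = (\<lambda>_. 0)" using X(1) by auto
  moreover have "(\<lambda>n. inner (F - G) (X n)) \<longlonglongrightarrow> inner (F - G) (F - G)"
    by (intro tendsto_inner tendsto_const X(2))
  ultimately have "inner (F - G) (F - G) = 0"
    using LIMSEQ_unique[OF tendsto_const] by metis
  then show ?thesis by simp
qed

section \<open>The Hartley transform\<close>

definition cas :: "real \<Rightarrow> real" where "cas x = cos x + sin x"

lemma cas_measurable [measurable]: "cas \<in> borel_measurable borel"
  unfolding cas_def by measurable

lemma isCont_cas [continuous_intros]: "isCont cas x"
  unfolding cas_def[abs_def] by (intro continuous_intros)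

lemma cas_le: "\<bar>cas x\<bar> \<le> 2"
  using abs_cos_le_one[of x] abs_sin_le_one[of x] unfolding cas_def by linarith

lemma abs_mult_cas_le: "\<bar>g * cas y\<bar> \<le> 2 * \<bar>g\<bar>"
  using mult_left_mono[OF cas_le[of y] abs_ge_zero[of g]] by (simp add: abs_mult)

lemma cas_add: "cas (a + b) = cos a * cas b + sin a * cas (- b)"
  by (simp add: cas_def cos_add sin_add algebra_simps)

definition hart :: "(real \<Rightarrow> real) \<Rightarrow> real \<Rightarrow> real" where
  "hart g x = (LINT k|lborel. g k * cas (k * x)) / sqrt (2 * pi)"

lemma sqrt_2pi_ge: "sqrt (2 * pi) \<ge> 2"
  using pi_gt3 by (intro real_le_rsqrt) auto

lemma integrable_cas:
  assumes "integrable lborel g" and [measurable]: "h \<in> borel_measurable borel"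
  shows "integrable lborel (\<lambda>k. g k * cas (h k))"
proof (rule Bochner_Integration.integrable_bound)
  show "integrable lborel (\<lambda>k. 2 * \<bar>g k\<bar>)" using assms(1) by simp
  have [measurable]: "g \<in> borel_measurable borel" using borel_measurable_integrable[OF assms(1)] by simp
  show "(\<lambda>k. g k * cas (h k)) \<in> borel_measurable lborel" by measurable
  show "AE k in lborel. norm (g k * cas (h k)) \<le> norm (2 * \<bar>g k\<bar>)"
    using abs_mult_cas_le by simp
qed

text \<open>The bound 2 on the kernel is absorbed by the normalization, since
  \<open>sqrt (2 * pi) \<ge> 2\<close>; therefore no constant appears.\<close>

lemma hart_bound:
  assumes "integrable lborel g"
  shows "\<bar>hart g x\<bar> \<le> (LINT k|lborel. \<bar>g k\<bar>)"
proof -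
  have "\<bar>LINT k|lborel. g k * cas (k * x)\<bar> \<le> (LINT k|lborel. \<bar>g k * cas (k * x)\<bar>)"
    by (rule integral_abs_bound)
  also have "\<dots> \<le> (LINT k|lborel. 2 * \<bar>g k\<bar>)"
    by (rule integral_mono) (use integrable_abs[OF integrable_cas[OF assms, of "\<lambda>k. k * x"]] assms abs_mult_cas_le in auto)
  finally have "\<bar>LINT k|lborel. g k * cas (k * x)\<bar> \<le> 2 * (LINT k|lborel. \<bar>g k\<bar>)" by simp
  moreover have "2 * (LINT k|lborel. \<bar>g k\<bar>) \<le> sqrt (2 * pi) * (LINT k|lborel. \<bar>g k\<bar>)"
    using sqrt_2pi_ge by (intro mult_right_mono) auto
  ultimately show ?thesis by (simp add: hart_def field_simps)
qed

lemma isCont_hart: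
  assumes "integrable lborel g"
  shows "isCont (hart g) x"
proof (rule continuous_at_sequentiallyI)
  fix u :: "nat \<Rightarrow> real" assume u: "u \<longlonglongrightarrow> x"
  have [measurable]: "g \<in> borel_measurable borel" using borel_measurable_integrable[OF assms] by simp
  have "(\<lambda>n. LINT k|lborel. g k * cas (k * u n)) \<longlonglongrightarrow> (LINT k|lborel. g k * cas (k * x))"
  proof (rule integral_dominated_convergence[where w="\<lambda>k. 2 * \<bar>g k\<bar>"])
    show "AE k in lborel. (\<lambda>n. g k * cas (k * u n)) \<longlonglongrightarrow> g k * cas (k * x)"
      by (intro AE_I2 tendsto_mult tendsto_const isCont_tendsto_compose[OF isCont_cas] u)
    show "AE k in lborel. norm (g k * cas (k * u n)) \<le> 2 * \<bar>g k\<bar>" for n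
      using abs_mult_cas_le by simp
  qed (use assms in auto)
  then show "(\<lambda>n. hart g (u n)) \<longlonglongrightarrow> hart g x"
    unfolding hart_def by (rule tendsto_divide) auto
qed

lemma hart_measurable: "integrable lborel g \<Longrightarrow> hart g \<in> borel_measurable borel"
  by (intro borel_measurable_continuous_onI continuous_at_imp_continuous_on ballI isCont_hart)

lemma integrable_pair_mult:
  fixes f g :: "real \<Rightarrow> real"
  assumes f: "integrable lborel f" and g: "integrable lborel g"
  shows "integrable (lborel \<Otimes>\<^sub>M lborel) (\<lambda>(x, y). f x * g y)"
proof (rule lborel_pair.Fubini_integrable)
  have [measurable]: "f \<in> borel_measurable borel" "g \<in> borel_measurable borel"
    using borel_measurable_integrable[OF f] borel_measurable_integrable[OF g] by simp_all
  show "(\<lambda>(x, y). f x * g y) \<in> borel_measurable (lborel \<Otimes>\<^sub>M lborel)" by measurable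
  show "integrable lborel (\<lambda>x. LINT y|lborel. norm (case (x, y) of (x, y) \<Rightarrow> f x * g y))"
    using f by (simp add: abs_mult)
  show "AE x in lborel. integrable lborel (\<lambda>y. case (x, y) of (x, y) \<Rightarrow> f x * g y)"
    using g by simp
qed

lemma Fubini_bounded_kernel:
  fixes f g :: "real \<Rightarrow> real" and K :: "real \<Rightarrow> real \<Rightarrow> real"
  assumes f: "integrable lborel f" and g: "integrable lborel g"
    and K [measurable]: "(\<lambda>(x, y). K x y) \<in> borel_measurable (borel \<Otimes>\<^sub>M borel)" and Kb: "\<And>x y. \<bar>K x y\<bar> \<le> C"
  shows "(LINT x|lborel. f x * (LINT y|lborel. g y * K x y)) = (LINT y|lborel. g y * (LINT x|lborel. f x * K x y))"
proof -
  have [measurable]: "f \<in> borel_measurable borel" "g \<in> borel_measurable borel"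
    using borel_measurable_integrable[OF f] borel_measurable_integrable[OF g] by simp_all
  have "integrable (lborel \<Otimes>\<^sub>M lborel) (\<lambda>(x, y). f x * g y * K x y)"
  proof (rule Bochner_Integration.integrable_bound)
    show "integrable (lborel \<Otimes>\<^sub>M lborel) (\<lambda>z. C * (case z of (x, y) \<Rightarrow> f x * g y))"
      by (intro integrable_mult_right integrable_pair_mult f g)
    show "(\<lambda>(x, y). f x * g y * K x y) \<in> borel_measurable (lborel \<Otimes>\<^sub>M lborel)" by measurable
    have "\<bar>f x * g y * K x y\<bar> \<le> \<bar>C * (f x * g y)\<bar>" for x y
      using mult_left_mono[OF order_trans[OF Kb abs_ge_self], of "\<bar>f x * g y\<bar>" x y] by (simp add: abs_mult mult_ac)
    then show "AE z in lborel \<Otimes>\<^sub>M lborel. norm (case z of (x, y) \<Rightarrow> f x * g y * K x y) \<le> norm (C * (case z of (x, y) \<Rightarrow> f x * g y))"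
      by auto
  qed
  from lborel_pair.Fubini_integral[OF this]
  show ?thesis by (simp add: mult_ac flip: integral_mult_right_zero)
qed

lemma hart_symmetric:
  assumes "integrable lborel f" "integrable lborel g"
  shows "(LINT x|lborel. hart f x * g x) = (LINT x|lborel. f x * hart g x)"
proof -
  have "(LINT x|lborel. f x * (LINT y|lborel. g y * cas (y * x))) = (LINT y|lborel. g y * (LINT x|lborel. f x * cas (y * x)))"
    by (rule Fubini_bounded_kernel[OF assms, where C=2]) (auto simp: cas_le)
  then have "(LINT y|lborel. g y * (LINT x|lborel. f x * cas (x * y))) / sqrt (2 * pi) =
      (LINT x|lborel. f x * (LINT y|lborel. g y * cas (y * x))) / sqrt (2 * pi)"
    by (simp add: mult.commute)
  moreover have "(\<lambda>x. hart f x * g x) = (\<lambda>y. g y * (LINT x|lborel. f x * cas (x * y)) / sqrt (2 * pi))"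
    by (auto simp: hart_def)
  moreover have "(\<lambda>x. f x * hart g x) = (\<lambda>x. f x * (LINT y|lborel. g y * cas (y * x)) / sqrt (2 * pi))"
    by (auto simp: hart_def)
  ultimately show ?thesis by simp
qed

section \<open>Transforms of step functions in closed form\<close>

lemma integrable_reflect: "integrable lborel f \<Longrightarrow> integrable lborel (\<lambda>x::real. f (- x) :: real)"
  using lborel_integrable_real_affine[of f "-1" 0] by simp

lemma integral_reflect: "(LINT x|lborel. f (- x :: real)) = (LINT x|lborel. f x :: real)"
  using lborel_integral_real_affine[of "-1" f 0] by simp

lemma AE_reflect:
  assumes "AE x in lborel. P (x::real)"
  shows "AE x in lborel. P (- x)"
proof -
  obtain N where N: "{x. \<not> P x} \<subseteq> N" "emeasure lborel N = 0" "N \<in> sets lborel"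
    using assms by (auto elim!: AE_E)
  have eq: "lborel = distr lborel borel (\<lambda>x::real. - x)"
    using lborel_distr_uminus by (simp add: lborel_def)
  have "emeasure lborel (uminus -` N) = emeasure (distr lborel borel (\<lambda>x::real. - x)) N"
    by (subst emeasure_distr) (use N in auto)
  then have "emeasure lborel (uminus -` N) = 0" using N(2) eq by simp
  moreover have "uminus -` N \<in> sets lborel" using N(3) measurable_sets[of "uminus :: real \<Rightarrow> real" borel borel N] by simp
  ultimately show ?thesis
    by (intro AE_I[of _ _ "uminus -` N"]) (use N in auto)
qed

text \<open>Since \<open>Si x - (1 - cos x) / x\<close> is an antiderivative of \<open>(1 - cos x) / x\<^sup>2\<close>,
  the Dirichlet integral evaluates the following one.\<close>

lemma integral_one_minus_cos:
  "integrable lborel (\<lambda>x::real. (1 - cos x) / x\<^sup>2)" "(LINT x|lborel. (1 - cos x) / x\<^sup>2) = pi"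
proof -
  let ?f = "\<lambda>x::real. (1 - cos x) / x\<^sup>2" and ?F = "\<lambda>x. Si x - (1 - cos x) / x"
  have D: "DERIV ?F x :> ?f x" if "0 < ereal x" for x
  proof -
    have x: "x \<noteq> 0" using that by auto
    show ?thesis
      by (rule DERIV_cong[OF DERIV_diff[OF DERIV_Si DERIV_divide[OF DERIV_diff[OF DERIV_const DERIV_cos] DERIV_ident x]]])
         (use x in \<open>simp add: field_simps power2_eq_square\<close>)
  qed
  have cos0: "((\<lambda>x::real. (1 - cos x) / x) \<longlongrightarrow> 0) (at 0)"
    using DERIV_cos[of 0, unfolded DERIV_def] tendsto_minus[of "\<lambda>h. (cos (0 + h) - cos 0) / h" 0 "at (0::real)"]
    by (simp add: minus_divide_left)
  have A: "((?F \<circ> real_of_ereal) \<longlongrightarrow> 0) (at_right (0::ereal))"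
  proof -
    have "(Si \<longlongrightarrow> Si 0) (at_right 0)"
      using isCont_Si[of 0] unfolding isCont_def by (rule tendsto_within_subset) simp
    moreover have "Si 0 = 0" by (simp add: Si_def zero_ereal_def)
    ultimately have "(?F \<longlongrightarrow> 0 - 0) (at_right 0)"
      using tendsto_diff[OF _ tendsto_within_subset[OF cos0, of "{0<..}"], of Si "Si 0"] by simp
    then show ?thesis by (simp add: ereal_tendsto_simps zero_ereal_def)
  qed
  have B: "((?F \<circ> real_of_ereal) \<longlongrightarrow> pi / 2) (at_left (\<infinity>::ereal))"
  proof -
    have "((\<lambda>x::real. (1 - cos x) / x) \<longlongrightarrow> 0) at_top"
    proof (rule Lim_null_comparison)
      show "\<forall>\<^sub>F x in at_top. norm ((1 - cos x) / x) \<le> 2 / x"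
        using eventually_gt_at_top[of "0::real"]
      proof eventually_elim
        fix x :: real assume "0 < x"
        then have "0 \<le> (1 - cos x) / x" "(1 - cos x) / x \<le> 2 / x"
          using cos_ge_minus_one[of x] cos_le_one[of x] by (auto intro!: divide_right_mono)
        then show "norm ((1 - cos x) / x) \<le> 2 / x" by simp
      qed
      show "((\<lambda>x::real. 2 / x) \<longlongrightarrow> 0) at_top"
        by (rule tendsto_divide_0[OF tendsto_const]) (rule filterlim_at_top_imp_at_infinity, rule filterlim_ident)
    qed
    from tendsto_diff[OF Si_at_top this] show ?thesis by (simp add: ereal_tendsto_simps)
  qed
  have nonneg: "0 \<le> ?f x" for x using cos_le_one[of x] by simp
  have cont: "isCont ?f x" if "0 < ereal x" for x
    using that by (intro continuous_intros) auto
  note FTC = interval_integral_FTC_nonneg[of 0 "\<infinity>" ?F ?f 0 "pi / 2", OF _ D cont _ A B]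
  have s: "set_integrable lborel {0<..} ?f" and v: "(LINT x:{0<..}|lborel. ?f x) = pi / 2"
  proof -
    have e: "einterval 0 \<infinity> = {0<..}" by (auto simp: einterval_def zero_ereal_def)
    show "set_integrable lborel {0<..} ?f" using FTC(1) nonneg unfolding e by auto
    show "(LINT x:{0<..}|lborel. ?f x) = pi / 2"
      using FTC(2) nonneg unfolding interval_lebesgue_integral_0_infty by auto
  qed
  let ?g = "\<lambda>x. indicator {0<..} x *\<^sub>R ?f x"
  have g: "integrable lborel ?g" "(LINT x|lborel. ?g x) = pi / 2"
    using s v by (auto simp: set_integrable_def set_lebesgue_integral_def)
  have ae: "AE x in lborel. ?g x + ?g (- x) = ?f x"
    using AE_lborel_singleton[of 0] by eventually_elim (auto split: split_indicator)
  have i: "integrable lborel (\<lambda>x. ?g x + ?g (- x))"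
    by (rule Bochner_Integration.integrable_add[OF g(1) integrable_reflect[OF g(1)]])
  show "integrable lborel ?f"
    by (rule integrable_cong_AE_imp[OF i]) (use ae in \<open>auto simp: eq_commute\<close>)
  have "(LINT x|lborel. ?f x) = (LINT x|lborel. ?g x + ?g (- x))"
    by (rule integral_cong_AE) (use ae in \<open>auto simp: eq_commute\<close>)
  also have "\<dots> = pi"
    using g Bochner_Integration.integral_add[OF g(1) integrable_reflect[OF g(1)]] integral_reflect[of ?g] by simp
  finally show "(LINT x|lborel. ?f x) = pi" .
qed

lemma integral_one_minus_cos_scaled:
  fixes t :: real
  shows "integrable lborel (\<lambda>x. (1 - cos (t * x)) / x\<^sup>2)" "(LINT x|lborel. (1 - cos (t * x)) / x\<^sup>2) = pi * \<bar>t\<bar>"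
proof -
  have "integrable lborel (\<lambda>x. (1 - cos (t * x)) / x\<^sup>2) \<and> (LINT x|lborel. (1 - cos (t * x)) / x\<^sup>2) = pi * \<bar>t\<bar>"
  proof (cases "t = 0")
    case False
    let ?f = "\<lambda>x::real. (1 - cos x) / x\<^sup>2"
    have eq: "(\<lambda>x. (1 - cos (t * x)) / x\<^sup>2) = (\<lambda>x. t\<^sup>2 * ?f (0 + t * x))"
      using False by (auto simp: fun_eq_iff power_mult_distrib)
    have "integrable lborel (\<lambda>x. ?f (0 + t * x))"
      by (rule lborel_integrable_real_affine[OF integral_one_minus_cos(1) False])
    moreover have "\<bar>t\<bar> * (LINT x|lborel. ?f (0 + t * x)) = pi"
      using lborel_integral_real_affine[OF False, of ?f 0] integral_one_minus_cos(2) by simp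
    then have "t\<^sup>2 * (LINT x|lborel. ?f (0 + t * x)) = pi * \<bar>t\<bar>"
      by (metis (no_types, lifting) mult.assoc mult.commute power2_abs power2_eq_square)
    ultimately show ?thesis unfolding eq
      by (simp only: integrable_mult_right integral_mult_right_zero simp_thms)
  qed simp
  then show "integrable lborel (\<lambda>x. (1 - cos (t * x)) / x\<^sup>2)" "(LINT x|lborel. (1 - cos (t * x)) / x\<^sup>2) = pi * \<bar>t\<bar>"
    by auto
qed

text \<open>The Hartley transform of \<open>chi b\<close>, except at \<open>k = 0\<close>: there
  division by zero makes it 0, whereas the integral gives \<open>b / sqrt (2 * pi)\<close>. Hence
  the identification holds only off the origin.\<close>

definition hchi :: "real \<Rightarrow> real \<Rightarrow> real" where
  "hchi b k = (sin (b * k) + 1 - cos (b * k)) / (sqrt (2 * pi) * k)"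

lemma hchi_measurable [measurable]: "hchi b \<in> borel_measurable borel"
  unfolding hchi_def by measurable

text \<open>The product splits into a part even in \<open>k\<close>, made of the functions
  \<open>(1 - cos (t * k)) / k\<^sup>2\<close> whose integrals are known, and an odd part that
  integrates to zero.\<close>

lemma hchi_mult:
  "hchi a k * hchi b k = ((1 - cos (a * k)) / k\<^sup>2 + (1 - cos (b * k)) / k\<^sup>2 - (1 - cos ((a - b) * k)) / k\<^sup>2) / (2 * pi)
     + (sin (a * k) * (1 - cos (b * k)) + sin (b * k) * (1 - cos (a * k))) / k\<^sup>2 / (2 * pi)"
proof (cases "k = 0")
  case False
  have "sqrt (2 * pi) * sqrt (2 * pi) = 2 * pi" by simp
  then have "hchi a k * hchi b k = (sin (a * k) + 1 - cos (a * k)) * (sin (b * k) + 1 - cos (b * k)) / (2 * pi * k\<^sup>2)"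
    by (simp add: hchi_def power2_eq_square mult_ac)
  moreover have "(s + 1 - c) * (s' + 1 - c') / (2 * pi * q) =
      ((1 - c) / q + (1 - c') / q - (1 - (c * c' + s * s')) / q) / (2 * pi) + (s * (1 - c') + s' * (1 - c)) / q / (2 * pi)"
    for s c s' c' q :: real
  proof -
    have "(s + 1 - c) * (s' + 1 - c') = (1 - c) + (1 - c') - (1 - (c * c' + s * s')) + (s * (1 - c') + s' * (1 - c))"
      by (simp add: algebra_simps)
    then show ?thesis
      by (simp only: add_divide_distrib diff_divide_distrib divide_divide_eq_left mult.commute[of q])
  qed
  ultimately show ?thesis by (simp only: left_diff_distrib cos_diff)
qed (simp add: hchi_def)

lemma square_integrable_hchi [simp]: "square_integrable (hchi b)"
proof (rule square_integrableI)
  have eq: "(hchi b k)\<^sup>2 = (1 - cos (b * k)) / k\<^sup>2 / pi + sin (b * k) * (1 - cos (b * k)) / k\<^sup>2 / pi" for k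
  proof -
    have *: "(A + A - 0) / (2 * p) + (S + S) / q / (2 * p) = A / p + S / q / p" for A S p q :: real
      by (simp flip: mult_2)
    have z: "(1 - cos ((b - b) * k)) / k\<^sup>2 = 0" by simp
    show ?thesis unfolding power2_eq_square[of "hchi b k"] hchi_mult z by (rule *)
  qed
  have "integrable lborel (\<lambda>k. sin (b * k) * (1 - cos (b * k)) / k\<^sup>2)"
  proof (rule Bochner_Integration.integrable_bound[OF integral_one_minus_cos_scaled(1)[of b]])
    have "\<bar>sin (b * k)\<bar> * \<bar>1 - cos (b * k)\<bar> \<le> 1 * \<bar>1 - cos (b * k)\<bar>" for k
      by (intro mult_right_mono) auto
    then show "AE k in lborel. norm (sin (b * k) * (1 - cos (b * k)) / k\<^sup>2) \<le> norm ((1 - cos (b * k)) / k\<^sup>2)"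
      by (intro AE_I2) (simp add: abs_mult divide_right_mono)
  qed measurable
  then show "integrable lborel (\<lambda>k. (hchi b k)\<^sup>2)"
    unfolding eq using integral_one_minus_cos_scaled(1)[of b]
    by (intro Bochner_Integration.integrable_add integrable_divide_zero) auto
qed measurable

lemma inner_hchi: "inner (cls (hchi a)) (cls (hchi b)) = (\<bar>a\<bar> + \<bar>b\<bar> - \<bar>a - b\<bar>) / 2"
proof -
  define E where "E k = ((1 - cos (a * k)) / k\<^sup>2 + (1 - cos (b * k)) / k\<^sup>2 - (1 - cos ((a - b) * k)) / k\<^sup>2) / (2 * pi)" for k
  define O' where "O' k = (sin (a * k) * (1 - cos (b * k)) + sin (b * k) * (1 - cos (a * k))) / k\<^sup>2 / (2 * pi)" for k
  have iE: "integrable lborel E" "(LINT k|lborel. E k) = (pi * \<bar>a\<bar> + pi * \<bar>b\<bar> - pi * \<bar>a - b\<bar>) / (2 * pi)"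
    unfolding E_def using integral_one_minus_cos_scaled by simp_all
  have split: "hchi a k * hchi b k = E k + O' k" for k unfolding E_def O'_def by (rule hchi_mult)
  have "integrable lborel (\<lambda>k. hchi a k * hchi b k - E k)"
    by (intro Bochner_Integration.integrable_diff square_integrable_prod iE(1)) simp_all
  then have iO: "integrable lborel O'" by (simp add: split)
  have "O' (- k) = - O' k" for k by (simp add: O'_def minus_divide_left)
  then have "(LINT k|lborel. O' k) = 0" using integral_reflect[of O'] by simp
  then have "(LINT k|lborel. hchi a k * hchi b k) = (pi * \<bar>a\<bar> + pi * \<bar>b\<bar> - pi * \<bar>a - b\<bar>) / (2 * pi)"
    using iE iO by (simp add: split)
  also have "\<dots> = (\<bar>a\<bar> + \<bar>b\<bar> - \<bar>a - b\<bar>) / 2"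
    by (simp add: field_simps)
  finally show ?thesis by (simp add: inner_cls)
qed

text \<open>The overlap of two signed intervals. It coincides with the value in
  \<open>inner_hchi\<close>, which is all that is needed for the map from \<open>chi b\<close> to
  \<open>hchi b\<close> to be isometric on finite combinations.\<close>

lemma inner_chi: "inner (cls (chi a)) (cls (chi b)) = (\<bar>a\<bar> + \<bar>b\<bar> - \<bar>a - b\<bar>) / 2"
proof -
  have "chi a x * chi b x = (if 0 \<le> a \<and> 0 \<le> b then indicator {0<..min a b} x
      else if a < 0 \<and> b < 0 then indicator {max a b<..0} x else 0)" for x
    by (auto simp: chi_eq split: split_indicator)
  then have "(LINT x|lborel. chi a x * chi b x) = (if 0 \<le> a \<and> 0 \<le> b then min a b
      else if a < 0 \<and> b < 0 then - max a b else 0)"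
    by (cases "0 \<le> a \<and> 0 \<le> b"; cases "a < 0 \<and> b < 0") auto
  then show ?thesis by (auto simp: inner_cls)
qed

lemma hart_chi: "k \<noteq> 0 \<Longrightarrow> hart (chi b) k = hchi b k"
proof -
  assume k: "k \<noteq> 0"
  let ?F = "\<lambda>x. (sin (x * k) - cos (x * k)) / k"
  have D: "(?F has_vector_derivative cas (x * k)) (at x within S)" for x S
    unfolding has_real_derivative_iff_has_vector_derivative[symmetric]
    by (rule derivative_eq_intros refl | use k in \<open>simp add: cas_def field_simps\<close>)+
  have c: "continuous_on S (\<lambda>x. cas (x * k))" for S
    unfolding cas_def by (intro continuous_intros)
  have 1: "(LINT x|lborel. indicator {u..v} x *\<^sub>R cas (x * k)) = ?F v - ?F u" if "u \<le> v" for u v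
    by (rule integral_FTC_Icc[OF that D c])
  have 2: "(LINT x|lborel. indicator {u<..v} x *\<^sub>R cas (x * k)) = (LINT x|lborel. indicator {u..v} x *\<^sub>R cas (x * k))" for u v
    by (rule integral_cong_AE) (use AE_lborel_singleton[of u] in \<open>auto elim!: eventually_mono split: split_indicator\<close>)
  have "(LINT x|lborel. chi b x * cas (x * k)) = ?F b - ?F 0"
  proof (cases "b \<ge> 0")
    case True
    then show ?thesis using 1[of 0 b] 2[of 0 b] by (simp add: chi_eq)
  next
    case False
    then show ?thesis using 1[of b 0] 2[of b 0] by (simp add: chi_eq)
  qed
  also have "?F b - ?F 0 = (sin (b * k) + 1 - cos (b * k)) / k" using k by (simp add: field_simps)
  finally show ?thesis by (simp add: hart_def hchi_def mult.commute)
qed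

lemma AE_hart_chi: "AE k in lborel. hart (chi b) k = hchi b k"
  using AE_lborel_singleton[of 0] by eventually_elim (simp add: hart_chi)

text \<open>Symmetry on the generators, from Fubini for integrable functions. It provides the image
  of a finite combination in the weak sense, and afterwards the symmetry of the extended
  transform.\<close>

lemma inner_hchi_chi: "inner (cls (hchi a)) (cls (chi b)) = inner (cls (chi a)) (cls (hchi b))"
proof -
  note [measurable] = hart_measurable[OF integrable_chi]
  have "(LINT k|lborel. hchi a k * chi b k) = (LINT k|lborel. hart (chi a) k * chi b k)"
    by (rule integral_cong_AE) (use AE_hart_chi[of a] in \<open>auto elim!: eventually_mono\<close>)
  also have "\<dots> = (LINT k|lborel. chi a k * hart (chi b) k)"
    by (rule hart_symmetric[OF integrable_chi integrable_chi])
  also have "\<dots> = (LINT k|lborel. chi a k * hchi b k)"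
    by (rule integral_cong_AE) (use AE_hart_chi[of b] in \<open>auto elim!: eventually_mono\<close>)
  finally show ?thesis by (simp add: inner_cls)
qed

text \<open>The isometry \<open>chi b \<mapsto> hchi b\<close> extends to all of \<open>L\<^sup>2\<close>; it is symmetric, hence an involution.\<close>

lemma ex_Hartley: "\<exists>y. (\<forall>b. inner y (cls (chi b)) = inner x (cls (hchi b))) \<and> norm y = norm x"
proof -
  let ?e = "\<lambda>b. cls (chi b)" and ?h = "\<lambda>b. cls (hchi b)"
  let ?W = "\<lambda>x y. \<forall>b. inner y (?e b) = inner x (?h b)"
  have fin: "\<exists>y. ?W x y \<and> norm y = norm x" if "x \<in> span (range ?e)" for x
  proof -
    from that obtain T r where T: "finite T" "T \<subseteq> range ?e" and x: "x = (\<Sum>a\<in>T. r a *\<^sub>R a)"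
      unfolding span_explicit by blast
    \<comment> \<open>A parameter is chosen for each vector of \<open>T\<close>, which avoids
      proving that \<open>b\<close> is determined by \<open>cls (chi b)\<close>.\<close>
    define g where "g a = (SOME b. ?e b = a)" for a
    have g: "?e (g a) = a" if "a \<in> T" for a
      unfolding g_def by (rule someI_ex) (use T that in auto)
    define y where "y = (\<Sum>a\<in>T. r a *\<^sub>R ?h (g a))"
    have x': "x = (\<Sum>a\<in>T. r a *\<^sub>R ?e (g a))" unfolding x by (intro sum.cong) (auto simp: g)
    have "?W x y"
      by (simp add: x' y_def inner_sum_left inner_hchi_chi)
    moreover have "inner y y = inner x x"
      by (simp add: x' y_def inner_sum_left inner_sum_right inner_hchi inner_chi)
    ultimately show ?thesis by (auto simp: norm_eq_sqrt_inner)
  qed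
  have uniq: "y = y'" if "?W x y" "?W x y'" for x y y'
    by (rule l2_eqI_chi) (use that in simp)
  obtain X where X: "\<And>n::nat. X n \<in> span (range ?e)" "X \<longlonglongrightarrow> x"
    using step_span_UNIV[of x] unfolding closure_sequential by blast
  obtain Y where Y: "\<And>n. ?W (X n) (Y n)" "\<And>n. norm (Y n) = norm (X n)"
    using fin[OF X(1)] by metis
  \<comment> \<open>By uniqueness the image of a difference is the difference of the images, so the
    isometry on the span makes \<open>Y\<close> a Cauchy sequence.\<close>
  have dist: "norm (Y n - Y m) = norm (X n - X m)" for n m
  proof -
    obtain z where z: "?W (X n - X m) z" "norm z = norm (X n - X m)"
      using fin[OF span_diff[OF X(1) X(1)]] by blast
    have "z = Y n - Y m" by (rule uniq[OF z(1)]) (use Y(1) in \<open>simp add: inner_diff_left\<close>)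
    with z(2) show ?thesis by simp
  qed
  have "Cauchy X" using X(2) by (rule LIMSEQ_imp_Cauchy)
  then have "Cauchy Y" by (simp add: Cauchy_iff dist)
  then obtain y where y: "Y \<longlonglongrightarrow> y" using Cauchy_convergent convergent_def by blast
  have "inner y (?e b) = inner x (?h b)" for b
  proof -
    have "(\<lambda>n. inner (Y n) (?e b)) \<longlonglongrightarrow> inner y (?e b)" by (intro tendsto_inner y tendsto_const)
    moreover have "(\<lambda>n. inner (X n) (?h b)) \<longlonglongrightarrow> inner x (?h b)" by (intro tendsto_inner X tendsto_const)
    ultimately show ?thesis using Y(1) LIMSEQ_unique by auto
  qed
  moreover have "norm y = norm x"
    using tendsto_norm[OF y] tendsto_norm[OF X(2)] Y(2) LIMSEQ_unique by auto
  ultimately show ?thesis by blast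
qed

text \<open>The first condition alone determines the image; carrying the norm along makes the
  isometry part of the definition.\<close>

definition Hartley :: "l2 \<Rightarrow> l2" where
  "Hartley x = (SOME y. (\<forall>b. inner y (cls (chi b)) = inner x (cls (hchi b))) \<and> norm y = norm x)"

lemma inner_Hartley_chi: "inner (Hartley x) (cls (chi b)) = inner x (cls (hchi b))"
  and norm_Hartley [simp]: "norm (Hartley x) = norm x"
  using someI_ex[OF ex_Hartley[of x]] by (auto simp: Hartley_def)

lemma Hartley_eqI: "(\<And>b. inner y (cls (chi b)) = inner x (cls (hchi b))) \<Longrightarrow> y = Hartley x"
  by (rule l2_eqI_chi) (simp add: inner_Hartley_chi)

lemma Hartley_add: "Hartley (x + y) = Hartley x + Hartley y"
  by (rule Hartley_eqI[symmetric]) (simp add: inner_add_left inner_Hartley_chi)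

lemma Hartley_scaleR: "Hartley (c *\<^sub>R x) = c *\<^sub>R Hartley x"
  by (rule Hartley_eqI[symmetric]) (simp add: inner_Hartley_chi)

lemma bounded_linear_Hartley: "bounded_linear Hartley"
  by (rule bounded_linear_intro[where K=1]) (simp_all add: Hartley_add Hartley_scaleR)

lemma Hartley_diff: "Hartley (x - y) = Hartley x - Hartley y"
  by (rule linear_diff[OF bounded_linear.linear[OF bounded_linear_Hartley]])

lemma Hartley_zero: "Hartley 0 = 0"
  by (metis norm_Hartley norm_eq_zero norm_zero)

lemma Hartley_chi: "Hartley (cls (chi b)) = cls (hchi b)"
  by (rule Hartley_eqI[symmetric]) (rule inner_hchi_chi)

lemma Hartley_symmetric: "inner (Hartley x) y = inner x (Hartley y)"
proof -
  have "y \<in> closure (span (range (\<lambda>b. cls (chi b))))" by (rule step_span_UNIV)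
  then obtain Y where Y: "\<And>n::nat. Y n \<in> span (range (\<lambda>b. cls (chi b)))" "Y \<longlonglongrightarrow> y"
    unfolding closure_sequential by blast
  have eq: "inner (Hartley x) z = inner x (Hartley z)" if "z \<in> span (range (\<lambda>b. cls (chi b)))" for z
    using that
  proof (induction rule: span_induct_alt)
    case (step c z w)
    then obtain b where "z = cls (chi b)" by auto
    with step show ?case
      by (simp add: Hartley_add Hartley_scaleR inner_simps inner_Hartley_chi Hartley_chi)
  qed (simp add: Hartley_zero)
  have "(\<lambda>n. inner (Hartley x) (Y n)) \<longlonglongrightarrow> inner (Hartley x) y"
    by (intro tendsto_inner Y tendsto_const)
  moreover have "(\<lambda>n. inner x (Hartley (Y n))) \<longlonglongrightarrow> inner x (Hartley y)"
    by (intro tendsto_inner tendsto_const bounded_linear.tendsto[OF bounded_linear_Hartley] Y)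
  ultimately show ?thesis using eq[OF Y(1)] LIMSEQ_unique by auto
qed

lemma Hartley_isometry: "inner (Hartley x) (Hartley y) = inner x y"
  by (simp add: dot_norm flip: Hartley_add)

lemma Hartley_Hartley [simp]: "Hartley (Hartley x) = x"
proof -
  have "inner (Hartley (Hartley x)) z = inner x z" for z
    using Hartley_symmetric[of "Hartley x" z] Hartley_isometry[of x z] by simp
  then have "inner (Hartley (Hartley x) - x) (Hartley (Hartley x) - x) = 0"
    by (simp only: inner_diff_left)
  then show ?thesis by simp
qed

text \<open>Clamping \<open>b\<close> to a window turns orthogonality of \<open>g\<close> into
  orthogonality of its truncation, so square integrability on bounded windows is enough. This
  matters for transforms that are at first known only to be bounded.\<close>

lemma AE_zero_if_orthogonal_chi:
  assumes g [measurable]: "g \<in> borel_measurable borel"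
    and loc: "\<And>N. square_integrable (\<lambda>x. indicator {-N<..N} x * g x)"
    and orth: "\<And>b. (LINT x|lborel. g x * chi b x) = 0"
  shows "AE x in lborel. g x = 0"
proof -
  have z: "AE x in lborel. indicator {- real n<..real n} x * g x = 0" for n
  proof -
    define N where "N = real n"
    let ?g = "\<lambda>x. indicator {-N<..N} x * g x"
    have "inner (cls ?g) (cls (chi b)) = inner 0 (cls (chi b))" for b
    proof -
      define b' where "b' = max (-N) (min N b)"
      have "?g x * chi b x = g x * chi b' x" for x
        by (auto simp: b'_def chi_def N_def split: split_indicator)
      then have "(LINT x|lborel. ?g x * chi b x) = 0" by (simp only: orth)
      then show ?thesis by (simp only: inner_cls[OF loc square_integrable_chi] inner_zero_left)
    qed
    then have "cls ?g = 0" by (rule l2_eqI_chi)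
    then show ?thesis using cls_eq_iff[OF loc[of N] square_integrable_zero] by (simp add: zero_eq_cls N_def)
  qed
  have "AE x in lborel. \<forall>n. indicator {- real n<..real n} x * g x = 0"
    unfolding AE_all_countable using z by blast
  then show ?thesis
  proof eventually_elim
    fix x assume *: "\<forall>n. indicator {- real n<..real n} x * g x = 0"
    obtain n where "\<bar>x\<bar> < real n" using reals_Archimedean2 by blast
    then show "g x = 0" using *[rule_format, of n] by (auto split: split_indicator_asm)
  qed
qed

text \<open>Both transforms have the same pairing with each \<open>chi b\<close>, by symmetry of the
  kernel. Since \<open>hart f\<close> is at first only bounded, the comparison is local, and its
  square integrability comes out as a consequence.\<close>

lemma Hartley_cls:
  assumes f: "square_integrable f" and fi: "integrable lborel f"
  shows "square_integrable (hart f)" "Hartley (cls f) = cls (hart f)"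
proof -
  note [measurable] = hart_measurable[OF fi] hart_measurable[OF integrable_chi] square_integrableD[OF f]
  let ?G = "fn (Hartley (cls f))"
  let ?B = "LINT k|lborel. \<bar>f k\<bar>"
  have "AE x in lborel. ?G x - hart f x = 0"
  proof (rule AE_zero_if_orthogonal_chi)
    show "square_integrable (\<lambda>x. indicator {-N<..N} x * (?G x - hart f x))" for N
    proof -
      have ind: "square_integrable (indicator {-N<..N})" by (rule square_integrable_indicator[of _ N]) auto
      have "square_integrable (\<lambda>x. indicator {-N<..N} x * ?G x)"
        by (rule square_integrable_bound[OF sqi_fn]) (auto split: split_indicator)
      moreover have "square_integrable (\<lambda>x. indicator {-N<..N} x * hart f x)"
        by (rule square_integrable_bound[OF square_integrable_cmult[OF ind, of ?B]])
           (use hart_bound[OF fi] in \<open>auto split: split_indicator\<close>)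
      ultimately show ?thesis unfolding right_diff_distrib by (rule square_integrable_diff)
    qed
    fix b
    have i1: "integrable lborel (\<lambda>x. ?G x * chi b x)" by (intro square_integrable_prod) auto
    have i2: "integrable lborel (\<lambda>x. hart f x * chi b x)"
    proof (rule Bochner_Integration.integrable_bound)
      show "integrable lborel (\<lambda>x. ?B * chi b x)" using integrable_chi by simp
      show "AE x in lborel. norm (hart f x * chi b x) \<le> norm (?B * chi b x)"
      proof (rule AE_I2)
        show "norm (hart f x * chi b x) \<le> norm (?B * chi b x)" for x
          using mult_right_mono[OF order_trans[OF hart_bound[OF fi, of x] abs_ge_self], of "\<bar>chi b x\<bar>"] 
          by (simp add: abs_mult)
      qed
    qed measurable
    have "(LINT x|lborel. ?G x * chi b x) = inner (Hartley (cls f)) (cls (chi b))"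
      by (rule inner_cls_gen[symmetric]) (auto intro: fn_cls)
    also have "\<dots> = (LINT x|lborel. f x * hchi b x)"
      by (simp add: inner_Hartley_chi inner_cls f)
    also have "\<dots> = (LINT x|lborel. f x * hart (chi b) x)"
      by (rule integral_cong_AE) (use AE_hart_chi[of b] in \<open>auto elim!: eventually_mono\<close>)
    also have "\<dots> = (LINT x|lborel. hart f x * chi b x)"
      by (rule hart_symmetric[OF fi integrable_chi, symmetric])
    finally show "(LINT x|lborel. (?G x - hart f x) * chi b x) = 0"
      using i1 i2 by (simp add: left_diff_distrib)
  qed measurable
  then have ae: "AE x in lborel. ?G x = hart f x" by eventually_elim simp
  show sq: "square_integrable (hart f)"
    by (rule square_integrable_cong_AE[OF sqi_fn]) (use ae in \<open>auto simp: eq_commute\<close>)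
  show "Hartley (cls f) = cls (hart f)" by (rule cls_eqI[OF sq ae])
qed

text \<open>Evenness of a profile is carried through the proof as \<open>refl p = p\<close>, an
  equation in L2 that defines a closed subspace.\<close>

definition refl :: "l2 \<Rightarrow> l2" where "refl F = cls (\<lambda>x. fn F (- x))"

lemma square_integrable_reflect:
  assumes "square_integrable f"
  shows "square_integrable (\<lambda>x. f (- x))"
proof (rule square_integrableI)
  note [measurable] = square_integrableD[OF assms]
  show "(\<lambda>x. f (- x)) \<in> borel_measurable borel" by measurable
  show "integrable lborel (\<lambda>x. (f (- x))\<^sup>2)" by (rule integrable_reflect[OF square_integrable_sq[OF assms]])
qed

lemma fn_refl: "AE x in lborel. fn (refl F) x = fn F (- x)"
  unfolding refl_def by (rule fn_cls) (rule square_integrable_reflect, simp)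

lemma refl_cls: "square_integrable f \<Longrightarrow> refl (cls f) = cls (\<lambda>x. f (- x))"
  unfolding refl_def
  by (subst cls_eq_iff) (auto intro: square_integrable_reflect AE_reflect fn_cls)

lemma inner_refl: "inner (refl F) G = inner F (refl G)"
proof -
  have "inner (refl F) G = (LINT x|lborel. fn F (- x) * fn G x)"
    by (rule inner_cls_gen) (auto intro: fn_refl square_integrable_reflect)
  also have "\<dots> = (LINT x|lborel. fn F x * fn G (- x))"
    using integral_reflect[of "\<lambda>x. fn F x * fn G (- x)"] by simp
  also have "\<dots> = inner F (refl G)"
    by (rule inner_cls_gen[symmetric]) (auto intro: fn_refl square_integrable_reflect)
  finally show ?thesis .
qed

lemma Hartley_refl: "Hartley (refl F) = refl (Hartley F)"
proof (rule Hartley_eqI[symmetric])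
  fix b
  have *: "refl (cls (chi b)) = - cls (chi (- b))"
  proof -
    have "AE x in lborel. chi b (- x) = - chi (- b) x"
      using AE_lborel_singleton[of 0] AE_lborel_singleton[of "-b"]
      by eventually_elim (auto simp: chi_def split: split_indicator)
    then show ?thesis
      by (simp add: refl_cls cls_minus cls_eq_iff square_integrable_reflect)
  qed
  have **: "refl (cls (hchi b)) = - cls (hchi (- b))"
  proof -
    have "hchi b (- x) = - hchi (- b) x" for x by (simp add: hchi_def minus_divide_left)
    then show ?thesis by (simp add: refl_cls cls_minus)
  qed
  show "inner (refl (Hartley F)) (cls (chi b)) = inner (refl F) (cls (hchi b))"
    by (simp add: inner_refl * ** inner_Hartley_chi)
qed

section \<open>Integration by parts and smooth bump functions\<close>

lemma integral_derivative_zero: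
  fixes F f :: "real \<Rightarrow> real"
  assumes D: "\<And>x. DERIV F x :> f x" and c: "\<And>x. isCont f x" and i: "integrable lborel f"
    and t: "(F \<longlongrightarrow> 0) at_top" and b: "(F \<longlongrightarrow> 0) at_bot"
  shows "(LINT x|lborel. f x) = 0"
proof -
  have "(LBINT x=-\<infinity>..\<infinity>. f x) = 0 - 0"
  proof (rule interval_integral_FTC_integrable)
    show "(F has_vector_derivative f x) (at x)" for x
      using D by (simp add: has_real_derivative_iff_has_vector_derivative)
    show "set_integrable lborel (einterval (-\<infinity>) \<infinity>) f" using i by (simp add: set_integrable_def einterval_def)
    show "((F \<circ> real_of_ereal) \<longlongrightarrow> 0) (at_right (-\<infinity>))" using b by (simp add: ereal_tendsto_simps)
    show "((F \<circ> real_of_ereal) \<longlongrightarrow> 0) (at_left \<infinity>)" using t by (simp add: ereal_tendsto_simps)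
  qed (use c in auto)
  then show ?thesis by (simp add: interval_lebesgue_integral_def set_lebesgue_integral_def einterval_def)
qed

lemma cas_affine_DERIV: "DERIV (\<lambda>x. cas (x * k)) x :> k * cas (- (x * k))"
  unfolding cas_def by (rule derivative_eq_intros refl | simp add: algebra_simps)+

text \<open>Integration by parts. The derivative of \<open>cas (x * k)\<close> in \<open>x\<close>
  is \<open>k * cas (- (x * k))\<close>, so differentiation becomes multiplication by
  \<open>- k\<close> together with a reflection, the price of a real kernel.\<close>

lemma hart_derivative:
  fixes f f' :: "real \<Rightarrow> real"
  assumes D: "\<And>x. DERIV f x :> f' x" and c: "\<And>x. isCont f' x"
    and i: "integrable lborel f" "integrable lborel f'"
    and t: "(f \<longlongrightarrow> 0) at_top" and b: "(f \<longlongrightarrow> 0) at_bot"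
  shows "hart f' k = - k * hart f (- k)"
proof -
  have i1: "integrable lborel (\<lambda>x. f' x * cas (x * k))" by (rule integrable_cas[OF i(2)]) simp
  have i2: "integrable lborel (\<lambda>x. f x * cas (- (x * k)))" by (rule integrable_cas[OF i(1)]) simp
  have ct: "isCont (\<lambda>x. cas (h x)) x" if "isCont h x" for h :: "real \<Rightarrow> real" and x
    using that by (rule isCont_o2) (rule isCont_cas)
  have lim: "((\<lambda>x. f x * cas (x * k)) \<longlongrightarrow> 0) F" if "(f \<longlongrightarrow> 0) F" for F
    using that by (rule tendsto_0_le[where K=2]) (use abs_mult_cas_le in \<open>simp add: mult.commute\<close>)
  have "(LINT x|lborel. f' x * cas (x * k) + k * (f x * cas (- (x * k)))) = 0"
  proof (rule integral_derivative_zero)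
    show "DERIV (\<lambda>x. f x * cas (x * k)) x :> f' x * cas (x * k) + k * (f x * cas (- (x * k)))" for x
      by (rule DERIV_cong[OF DERIV_mult[OF D cas_affine_DERIV]]) (simp add: algebra_simps)
    show "isCont (\<lambda>x. f' x * cas (x * k) + k * (f x * cas (- (x * k)))) x" for x
      by (intro continuous_intros c ct DERIV_isCont[OF D])
  qed (use i1 i2 lim t b in auto)
  then have "(LINT x|lborel. f' x * cas (x * k)) = - k * (LINT x|lborel. f x * cas (- (x * k)))"
    using i1 i2 by simp
  then show ?thesis by (simp add: hart_def)
qed

text \<open>Recursive form of n-fold differentiability, chosen because closure under sums, products
  and affine substitutions is then a direct induction; \<open>times_diff_deriv\<close> translates it
  to iterated \<open>deriv\<close> as required for test functions.\<close>

fun times_diff :: "nat \<Rightarrow> (real \<Rightarrow> real) \<Rightarrow> bool" where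
  "times_diff 0 f \<longleftrightarrow> True"
| "times_diff (Suc n) f \<longleftrightarrow> (\<exists>f'. (\<forall>x. DERIV f x :> f' x) \<and> times_diff n f')"

lemma times_diff_Suc_D: "times_diff (Suc n) f \<Longrightarrow> times_diff n f"
  by (induction n arbitrary: f) auto

lemma times_diff_add: "times_diff n f \<Longrightarrow> times_diff n g \<Longrightarrow> times_diff n (\<lambda>x. f x + g x)"
proof (induction n arbitrary: f g)
  case (Suc n)
  from Suc.prems obtain f' g' where "\<forall>x. DERIV f x :> f' x" "times_diff n f'" "\<forall>x. DERIV g x :> g' x" "times_diff n g'"
    by auto
  with Suc.IH[of f' g'] show ?case
    by (auto intro!: exI[of _ "\<lambda>x. f' x + g' x"] DERIV_add)
qed simp

lemma times_diff_cmult: "times_diff n f \<Longrightarrow> times_diff n (\<lambda>x. c * f x)"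
proof (induction n arbitrary: f)
  case (Suc n)
  from Suc.prems obtain f' where "\<forall>x. DERIV f x :> f' x" "times_diff n f'" by auto
  with Suc.IH[of f'] show ?case by (auto intro!: exI[of _ "\<lambda>x. c * f' x"] DERIV_cmult)
qed simp

lemma times_diff_mult: "times_diff n f \<Longrightarrow> times_diff n g \<Longrightarrow> times_diff n (\<lambda>x. f x * g x)"
proof (induction n arbitrary: f g)
  case (Suc n)
  from Suc.prems obtain f' g' where fg: "\<forall>x. DERIV f x :> f' x" "times_diff n f'" "\<forall>x. DERIV g x :> g' x" "times_diff n g'"
    by auto
  have "times_diff n (\<lambda>x. f' x * g x + g' x * f x)"
    using fg Suc.prems[THEN times_diff_Suc_D] by (intro times_diff_add Suc.IH) auto
  with fg show ?case by (auto intro!: exI[of _ "\<lambda>x. f' x * g x + g' x * f x"] DERIV_mult)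
qed simp

lemma times_diff_affine: "times_diff n f \<Longrightarrow> times_diff n (\<lambda>x. f (a * x + b))"
proof (induction n arbitrary: f)
  case (Suc n)
  from Suc.prems obtain f' where f': "\<And>x. DERIV f x :> f' x" "times_diff n f'" by auto
  have "DERIV (\<lambda>x. f (a * x + b)) x :> a * f' (a * x + b)" for x
  proof -
    have "DERIV (\<lambda>x. a * x + b) x :> a" by (auto intro!: derivative_eq_intros)
    from DERIV_chain2[OF f'(1) this] show ?thesis by (simp only: mult.commute)
  qed
  then show ?case using times_diff_cmult[OF Suc.IH[OF f'(2)], of a]
    by (auto intro!: exI[of _ "\<lambda>x. a * f' (a * x + b)"])
qed simp

lemma times_diff_deriv:
  assumes "\<And>n. times_diff n f"
  shows "(deriv ^^ n) f differentiable_on UNIV"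
proof -
  have "times_diff (Suc n) f \<Longrightarrow> (deriv ^^ n) f differentiable_on UNIV" for f
  proof (induction n arbitrary: f)
    case 0
    then show ?case by (auto simp: differentiable_on_def real_differentiable_def)
  next
    case (Suc n)
    then obtain f' where f': "\<forall>x. DERIV f x :> f' x" "times_diff (Suc n) f'" by auto
    then have "deriv f = f'" by (auto intro!: DERIV_imp_deriv)
    with Suc.IH[OF f'(2)] show ?case by (simp add: funpow_swap1)
  qed
  with assms show ?thesis by blast
qed

text \<open>The powers of \<open>inverse t\<close> are included so that the family is closed under
  differentiation. Smoothness of the standard function exp(-1/t), the case \<open>k = 0\<close>,
  then needs no formula for its higher derivatives.\<close>

definition flat :: "nat \<Rightarrow> real \<Rightarrow> real" where
  "flat k t = (if t > 0 then inverse t ^ k * exp (- inverse t) else 0)"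

lemma flat_tendsto_0: "(flat k \<longlongrightarrow> 0) (at 0)"
proof (rule filterlim_split_at)
  show "(flat k \<longlongrightarrow> 0) (at_left 0)"
    by (rule tendsto_eventually) (auto simp: flat_def eventually_at_filter)
  have "((\<lambda>t. inverse t ^ k / exp (inverse t)) \<longlongrightarrow> (0::real)) (at_right 0)"
    by (rule filterlim_compose[OF tendsto_power_div_exp_0 filterlim_inverse_at_top_right])
  moreover have "\<forall>\<^sub>F t in at_right (0::real). inverse t ^ k / exp (inverse t) = flat k t"
    by (auto simp: flat_def eventually_at_filter exp_minus field_simps)
  ultimately show "(flat k \<longlongrightarrow> 0) (at_right 0)" by (rule Lim_transform_eventually)
qed

lemma flat_DERIV: "DERIV (flat k) t :> flat (k + 2) t - real k * flat (k + 1) t"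
proof -
  consider "t > 0" | "t = 0" | "t < 0" by linarith
  then show ?thesis
  proof cases
    case 1
    have "DERIV (\<lambda>t. inverse t ^ k * exp (- inverse t)) t :> flat (k + 2) t - real k * flat (k + 1) t"
    proof (cases k)
      case 0
      then show ?thesis using 1
        by (auto intro!: derivative_eq_intros simp: flat_def power2_eq_square)
    next
      case (Suc j)
      show ?thesis unfolding Suc
        by (rule derivative_eq_intros refl | use 1 in \<open>simp add: flat_def power2_eq_square algebra_simps\<close>)+
    qed
    then show ?thesis
      by (rule has_field_derivative_transform_within_open[where S="{0<..}"]) (use 1 in \<open>auto simp: flat_def\<close>)
  next
    case 2
    \<comment> \<open>Dividing by \<open>h\<close> raises the index by one, so the difference
      quotient at 0 is again a flat function and tends to 0.\<close>
    have "((\<lambda>h. flat (k + 1) h) \<longlongrightarrow> 0) (at 0)" by (rule flat_tendsto_0)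
    moreover have "\<forall>\<^sub>F h in at 0. flat (k + 1) h = (flat k (0 + h) - flat k 0) / h"
      by (auto simp: flat_def eventually_at_filter field_simps)
    ultimately have "((\<lambda>h. (flat k (0 + h) - flat k 0) / h) \<longlongrightarrow> 0) (at 0)"
      by (rule Lim_transform_eventually)
    then show ?thesis using 2 by (simp add: DERIV_def flat_def)
  next
    case 3
    have "DERIV (\<lambda>t. 0) t :> flat (k + 2) t - real k * flat (k + 1) t"
      using 3 by (simp add: flat_def)
    then show ?thesis
      by (rule has_field_derivative_transform_within_open[where S="{..<0}"]) (use 3 in \<open>auto simp: flat_def\<close>)
  qed
qed

lemma times_diff_flat: "times_diff n (flat k)"
proof (induction n arbitrary: k)
  case (Suc n)
  have "times_diff n (\<lambda>t. flat (k + 2) t + (- real k) * flat (k + 1) t)"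
    by (intro times_diff_add times_diff_cmult Suc.IH)
  with flat_DERIV[of k] show ?case by (auto intro!: exI[of _ "\<lambda>t. flat (k + 2) t + (- real k) * flat (k + 1) t"])
qed simp

definition bump :: "real \<Rightarrow> real" where "bump x = flat 0 (1 + x) * flat 0 (1 - x)"

lemma times_diff_bump: "times_diff n (\<lambda>y. bump (a * y + b))"
proof -
  have "times_diff n (\<lambda>y. flat 0 (1 * y + 1) * flat 0 ((-1) * y + 1))"
    by (intro times_diff_mult times_diff_affine times_diff_flat)
  from times_diff_affine[OF this, of a b] show ?thesis by (simp add: bump_def algebra_simps)
qed

lemma bump_even: "bump (- x) = bump x"
  by (simp add: bump_def mult.commute)

lemma bump_eq_0: "\<bar>x\<bar> \<ge> 1 \<Longrightarrow> bump x = 0"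
  by (auto simp: bump_def flat_def abs_if split: if_splits)

lemma bump_nonneg: "0 \<le> bump x" by (simp add: bump_def flat_def)

lemma bump_pos: "\<bar>x\<bar> < 1 \<Longrightarrow> 0 < bump x" by (auto simp: bump_def flat_def)

lemma test_function_bump:
  assumes a: "a > 0"
  shows "test_function (\<lambda>y. bump (a * y + b))"
  unfolding test_function_def
proof (intro conjI allI)
  show "(deriv ^^ n) (\<lambda>y. bump (a * y + b)) differentiable_on UNIV" for n
    by (rule times_diff_deriv) (rule times_diff_bump)
  have "{y. bump (a * y + b) \<noteq> 0} \<subseteq> {(- 1 - b) / a..(1 - b) / a}"
  proof safe
    fix y assume "bump (a * y + b) \<noteq> 0"
    then have "\<bar>a * y + b\<bar> < 1" using bump_eq_0[of "a * y + b"] by linarith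
    then show "y \<in> {(- 1 - b) / a..(1 - b) / a}" using a by (auto simp: field_simps abs_less_iff)
  qed
  then show "compact (closure {y. bump (a * y + b) \<noteq> 0})"
    unfolding compact_closure using bounded_closed_interval bounded_subset by blast
qed

lemma test_functionD:
  assumes "test_function \<phi>"
  shows "DERIV \<phi> x :> deriv \<phi> x" "isCont (deriv \<phi>) x" "\<exists>R>0. \<forall>x. \<bar>x\<bar> \<ge> R \<longrightarrow> \<phi> x = 0 \<and> deriv \<phi> x = 0"
proof -
  have d: "(deriv ^^ n) \<phi> differentiable_on UNIV" for n
    using assms by (auto simp: test_function_def)
  have cpt: "compact (closure {x. \<phi> x \<noteq> 0})"
    using assms by (auto simp: test_function_def)
  have D: "DERIV ((deriv ^^ n) \<phi>) x :> deriv ((deriv ^^ n) \<phi>) x" for n x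
    using d[of n] DERIV_deriv_iff_real_differentiable[of "(deriv ^^ n) \<phi>" x] by (simp add: differentiable_on_def)
  show DD: "DERIV \<phi> x :> deriv \<phi> x" for x using D[of 0] by simp
  show "isCont (deriv \<phi>) x" using D[of 1] DERIV_isCont by auto
  obtain R where R: "\<And>x. \<phi> x \<noteq> 0 \<Longrightarrow> \<bar>x\<bar> \<le> R"
  proof -
    obtain R where "\<forall>x\<in>closure {x. \<phi> x \<noteq> 0}. norm x \<le> R"
      using compact_imp_bounded[OF cpt] unfolding bounded_iff by blast
    then have "\<phi> x \<noteq> 0 \<Longrightarrow> \<bar>x\<bar> \<le> R" for x
      using subsetD[OF closure_subset, of x "{x. \<phi> x \<noteq> 0}"] by simp
    then show ?thesis by (rule that)
  qed
  have z: "\<phi> x = 0" if "\<bar>x\<bar> > R" for x using R[of x] that by linarith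
  have "deriv \<phi> x = 0" if "\<bar>x\<bar> > R" for x
  proof -
    have "DERIV \<phi> x :> 0"
      by (rule has_field_derivative_transform_within_open[where f="\<lambda>_. 0" and S="{x. \<bar>x\<bar> > R}"])
         (use that z in \<open>auto intro!: open_Collect_less continuous_intros\<close>)
    then show ?thesis by (rule DERIV_imp_deriv)
  qed
  with z show "\<exists>R>0. \<forall>x. \<bar>x\<bar> \<ge> R \<longrightarrow> \<phi> x = 0 \<and> deriv \<phi> x = 0"
    by (intro exI[of _ "\<bar>R\<bar> + 1"]) auto
qed

lemma compact_support_integrable:
  fixes f :: "real \<Rightarrow> real"
  assumes c: "\<And>x. isCont f x" and z: "\<And>x. \<bar>x\<bar> \<ge> R \<Longrightarrow> f x = 0"
  shows "integrable lborel f" "square_integrable f" "(f \<longlongrightarrow> 0) at_top" "(f \<longlongrightarrow> 0) at_bot"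
proof -
  have m [measurable]: "f \<in> borel_measurable borel"
    by (intro borel_measurable_continuous_onI continuous_at_imp_continuous_on ballI c)
  have int: "integrable lborel g" if "\<And>x. isCont g x" "\<And>x. \<bar>x\<bar> \<ge> R \<Longrightarrow> g x = 0" for g :: "real \<Rightarrow> real"
  proof -
    have "integrable lborel (\<lambda>x. indicator {-R..R} x *\<^sub>R g x)"
      by (rule borel_integrable_compact) (auto intro!: continuous_at_imp_continuous_on that)
    moreover have "(\<lambda>x. indicator {-R..R} x *\<^sub>R g x) = g"
    proof
      fix x show "indicator {-R..R} x *\<^sub>R g x = g x"
        using that(2)[of x] by (cases "\<bar>x\<bar> \<ge> R") (auto split: split_indicator)
    qed
    ultimately show ?thesis by simp
  qed
  show "integrable lborel f" by (rule int[OF c z])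
  have "integrable lborel (\<lambda>x. (f x)\<^sup>2)" by (rule int) (auto intro!: continuous_intros c simp: z)
  then show "square_integrable f" by (rule square_integrableI[OF m])
  show "(f \<longlongrightarrow> 0) at_top"
    by (rule tendsto_eventually) (use z in \<open>auto intro!: eventually_mono[OF eventually_ge_at_top[of R]]\<close>)
  show "(f \<longlongrightarrow> 0) at_bot"
    by (rule tendsto_eventually) (use z in \<open>auto intro!: eventually_mono[OF eventually_le_at_bot[of "-R"]]\<close>)
qed

lemma test_function_integrable:
  assumes "test_function \<phi>"
  shows "integrable lborel \<phi>" "square_integrable \<phi>" "integrable lborel (deriv \<phi>)" "square_integrable (deriv \<phi>)"
    "hart (deriv \<phi>) k = - k * hart \<phi> (- k)"
proof -
  note D = test_functionD(1,2)[OF assms]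
  obtain R where R: "\<And>x. \<bar>x\<bar> \<ge> R \<Longrightarrow> \<phi> x = 0" "\<And>x. \<bar>x\<bar> \<ge> R \<Longrightarrow> deriv \<phi> x = 0"
    using test_functionD(3)[OF assms] by blast
  note 1 = compact_support_integrable[OF DERIV_isCont[OF D(1)] R(1)] and 2 = compact_support_integrable[OF D(2) R(2)]
  show "integrable lborel \<phi>" "square_integrable \<phi>" "integrable lborel (deriv \<phi>)" "square_integrable (deriv \<phi>)"
    using 1 2 by auto
  show "hart (deriv \<phi>) k = - k * hart \<phi> (- k)" by (rule hart_derivative) (use D 1 2 in auto)
qed

section \<open>Weak derivatives under the Hartley transform\<close>

text \<open>Parseval on both sides. The derivative of the test function contributes
  \<open>- k\<close> and a reflection, which the substitution of \<open>- k\<close> for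
  \<open>k\<close> moves onto the transform of \<open>f\<close>.\<close>

lemma weak_deriv_Hartley_converse:
  assumes f: "square_integrable f" and g: "square_integrable g"
    and eq: "AE k in lborel. fn (Hartley (cls g)) k = - k * fn (Hartley (cls f)) (- k)"
  shows "has_weak_deriv f g"
  unfolding has_weak_deriv_def
proof (intro allI impI)
  fix \<phi> assume "test_function \<phi>"
  note \<phi> = test_function_integrable[OF this]
  note H = Hartley_cls[OF \<phi>(2,1)] Hartley_cls[OF \<phi>(4,3)]
  let ?F = "fn (Hartley (cls f))" and ?G = "fn (Hartley (cls g))"
  note [measurable] = hart_measurable[OF \<phi>(1)]
  have "(LINT x|lborel. f x * deriv \<phi> x) = inner (Hartley (cls f)) (Hartley (cls (deriv \<phi>)))"
    using f \<phi> by (simp add: Hartley_isometry inner_cls)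
  also have "\<dots> = (LINT k|lborel. ?F k * hart (deriv \<phi>) k)"
    unfolding H by (rule inner_cls_gen) (use H in \<open>auto intro: fn_cls\<close>)
  also have "\<dots> = (LINT k|lborel. ?F k * (- k * hart \<phi> (- k)))" by (simp add: \<phi>)
  also have "\<dots> = (LINT k|lborel. ?F (- k) * (k * hart \<phi> k))"
    using integral_reflect[of "\<lambda>k. ?F (- k) * (k * hart \<phi> k)"] by simp
  also have "\<dots> = (LINT k|lborel. - (?G k * hart \<phi> k))"
    by (rule integral_cong_AE) (use eq in \<open>auto elim!: eventually_mono simp: mult_ac\<close>)
  also have "\<dots> = - (LINT k|lborel. ?G k * hart \<phi> k)" by simp
  also have "(LINT k|lborel. ?G k * hart \<phi> k) = inner (Hartley (cls g)) (Hartley (cls \<phi>))"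
    unfolding H by (rule inner_cls_gen[symmetric]) (use H in \<open>auto intro: fn_cls\<close>)
  also have "\<dots> = (LINT x|lborel. g x * \<phi> x)"
    using g \<phi> by (simp add: Hartley_isometry inner_cls)
  finally show "(LINT x|lborel. f x * deriv \<phi> x) = - (LINT x|lborel. g x * \<phi> x)" .
qed

text \<open>For even \<open>\<rho>\<close> the sine part of the addition formula integrates to zero,
  so a translation by \<open>x\<close> only multiplies by the kernel \<open>cas (x * k)\<close>.
  Pairings with translates are thus again values of a Hartley transform.\<close>

lemma hart_even_translate:
  assumes i: "integrable lborel \<rho>" and ev: "\<And>y. \<rho> (- y) = \<rho> y"
  shows "hart (\<lambda>y. \<rho> (y - x)) k = cas (x * k) * hart \<rho> k"
proof -
  have m [measurable]: "\<rho> \<in> borel_measurable borel" using borel_measurable_integrable[OF i] by simp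
  have trig: "integrable lborel (\<lambda>y. \<rho> y * h (y * k))" if "h \<in> {sin, cos}" for h :: "real \<Rightarrow> real"
  proof (rule Bochner_Integration.integrable_bound[OF i])
    have "\<bar>h t\<bar> \<le> 1" for t using that by auto
    then show "AE y in lborel. norm (\<rho> y * h (y * k)) \<le> norm (\<rho> y)"
      by (intro AE_I2) (simp add: abs_mult mult_left_le)
  qed (use that in auto)
  have s: "(LINT y|lborel. \<rho> y * sin (y * k)) = 0"
    using integral_reflect[of "\<lambda>y. \<rho> y * sin (y * k)"] by (simp add: ev)
  let ?C = "LINT y|lborel. \<rho> y * cos (y * k)"
  have cas0: "(LINT y|lborel. \<rho> y * cas (y * k)) = ?C"
    using trig s by (simp add: cas_def distrib_left)
  have "(LINT y|lborel. \<rho> (y - x) * cas (y * k)) = (LINT y|lborel. \<rho> y * cas (y * k + x * k))"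
    using lborel_integral_real_affine[of 1 "\<lambda>y. \<rho> (y - x) * cas (y * k)" x] by (simp add: distrib_right add_ac)
  also have "\<dots> = (LINT y|lborel. cas (x * k) * (\<rho> y * cos (y * k)) + cas (- (x * k)) * (\<rho> y * sin (y * k)))"
    by (simp add: cas_add algebra_simps)
  also have "\<dots> = cas (x * k) * ?C"
    using trig s by simp
  finally show ?thesis by (simp add: hart_def cas0)
qed

text \<open>Testing with the translates of a scaled bump \<open>\<rho>\<close> gives the Hartley transform of
  \<open>hart \<rho> k * (fn (Hartley (cls g)) k + k * fn (Hartley (cls f)) (- k))\<close>, which therefore vanishes.\<close>

lemma weak_deriv_Hartley:
  assumes f: "square_integrable f" and g: "square_integrable g" and wd: "has_weak_deriv f g"
  shows "AE k in lborel. fn (Hartley (cls g)) k = - k * fn (Hartley (cls f)) (- k)"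
proof -
  let ?F = "fn (Hartley (cls f))" and ?G = "fn (Hartley (cls g))"
  \<comment> \<open>A sequence of scalings is used because the transform of a single bump may vanish
    at some \<open>k\<close>. For the scaled bump it is a positive multiple of
    \<open>hart (\<rho> 0) (k / real (Suc n))\<close>, which for large \<open>n\<close> is close to
    the positive value at 0.\<close>
  define \<rho> where "\<rho> n y = bump (real (Suc n) * y)" for n y
  have test: "test_function (\<lambda>y. \<rho> n (y - x))" for n x
    using test_function_bump[of "real (Suc n)" "- real (Suc n) * x"] by (simp add: \<rho>_def algebra_simps)
  have test0: "test_function (\<rho> n)" for n using test[of n 0] by simp
  note r = test_function_integrable[OF test0]
  have ev: "\<rho> n (- y) = \<rho> n y" for n y by (simp add: \<rho>_def bump_even)
  have z: "AE k in lborel. hart (\<rho> n) k * (?G k + k * ?F (- k)) = 0" for n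
  proof -
    define u where "u k = hart (\<rho> n) k * ?G k + (k * hart (\<rho> n) k) * ?F (- k)" for k
    note [measurable] = hart_measurable[OF r(1)] hart_measurable[OF r(3)]
    have hev: "hart (\<rho> n) (- k) = hart (\<rho> n) k" for k
    proof -
      have "hart (\<rho> n) (- k) = (LINT y|lborel. \<rho> n (- y) * cas (y * k)) / sqrt (2 * pi)"
        using integral_reflect[of "\<lambda>y. \<rho> n y * cas (y * - k)"] by (simp add: hart_def)
      then show ?thesis by (simp add: ev hart_def)
    qed
    \<comment> \<open>By evenness the unbounded factor \<open>k\<close> is traded for the derivative
      of the bump, so this multiplier is bounded and square integrable.\<close>
    have kr: "k * hart (\<rho> n) k = - hart (deriv (\<rho> n)) k" for k by (simp add: r hev)
    have sq1: "square_integrable (hart (\<rho> n))" by (rule Hartley_cls[OF r(2,1)])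
    have sq2: "square_integrable (\<lambda>k. k * hart (\<rho> n) k)"
      unfolding kr by (intro square_integrable_minus Hartley_cls r)
    have FR: "square_integrable (\<lambda>k. ?F (- k))" by (rule square_integrable_reflect) simp
    have iu1: "integrable lborel (\<lambda>k. hart (\<rho> n) k * ?G k)"
      and iu2: "integrable lborel (\<lambda>k. (k * hart (\<rho> n) k) * ?F (- k))"
      by (rule square_integrable_prod[OF sq1 sqi_fn] square_integrable_prod[OF sq2 FR])+
    have iu: "integrable lborel u" unfolding u_def using iu1 iu2 by simp
    have "square_integrable (\<lambda>k. hart (\<rho> n) k * ?G k)"
      by (rule square_integrable_mult_bounded(1)[OF sqi_fn _ hart_bound[OF r(1)]]) measurable
    moreover have "square_integrable (\<lambda>k. (k * hart (\<rho> n) k) * ?F (- k))"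
      by (rule square_integrable_mult_bounded(1)[OF FR, where C="LINT k|lborel. \<bar>deriv (\<rho> n) k\<bar>"])
         (use hart_bound[OF r(3)] in \<open>auto simp: kr\<close>)
    ultimately have squ: "square_integrable u" unfolding u_def by (rule square_integrable_add)
    have "hart u x = 0" for x
    proof -
      let ?\<phi> = "\<lambda>y. \<rho> n (y - x)"
      note \<phi> = test_function_integrable[OF test[of n x]]
      note H = Hartley_cls[OF \<phi>(2,1)] Hartley_cls[OF \<phi>(4,3)]
      note tr = hart_even_translate[OF r(1) ev]
      have i1: "integrable lborel (\<lambda>k. (hart (\<rho> n) k * ?G k) * cas (k * x))"
        and i2: "integrable lborel (\<lambda>k. ((k * hart (\<rho> n) k) * ?F (- k)) * cas (k * x))"
        by (rule integrable_cas[OF iu1] integrable_cas[OF iu2]; measurable)+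
      have "(LINT y|lborel. f y * deriv ?\<phi> y) = inner (Hartley (cls f)) (Hartley (cls (deriv ?\<phi>)))"
        using f \<phi> by (simp add: Hartley_isometry inner_cls)
      also have "\<dots> = (LINT k|lborel. ?F k * hart (deriv ?\<phi>) k)"
        unfolding H by (rule inner_cls_gen) (use H in \<open>auto intro: fn_cls\<close>)
      also have "\<dots> = (LINT k|lborel. ?F k * (- k * hart ?\<phi> (- k)))" by (simp add: \<phi>)
      also have "\<dots> = (LINT k|lborel. ?F (- k) * (k * hart ?\<phi> k))"
        using integral_reflect[of "\<lambda>k. ?F (- k) * (k * hart ?\<phi> k)"] by simp
      also have "\<dots> = (LINT k|lborel. ((k * hart (\<rho> n) k) * ?F (- k)) * cas (k * x))"
        by (simp add: tr mult_ac)
      finally have a: "(LINT y|lborel. f y * deriv ?\<phi> y) = (LINT k|lborel. ((k * hart (\<rho> n) k) * ?F (- k)) * cas (k * x))" .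
      have "(LINT y|lborel. g y * ?\<phi> y) = inner (Hartley (cls g)) (Hartley (cls ?\<phi>))"
        using g \<phi> by (simp add: Hartley_isometry inner_cls)
      also have "\<dots> = (LINT k|lborel. ?G k * hart ?\<phi> k)"
        unfolding H by (rule inner_cls_gen) (use H in \<open>auto intro: fn_cls\<close>)
      also have "\<dots> = (LINT k|lborel. (hart (\<rho> n) k * ?G k) * cas (k * x))"
        by (simp add: tr mult_ac)
      finally have b: "(LINT y|lborel. g y * ?\<phi> y) = (LINT k|lborel. (hart (\<rho> n) k * ?G k) * cas (k * x))" .
      have "(LINT y|lborel. f y * deriv ?\<phi> y) = - (LINT y|lborel. g y * ?\<phi> y)"
        using wd test[of n x] unfolding has_weak_deriv_def by blast
      then have "(LINT k|lborel. (hart (\<rho> n) k * ?G k) * cas (k * x) + ((k * hart (\<rho> n) k) * ?F (- k)) * cas (k * x)) = 0"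
        using i1 i2 by (simp add: a b)
      then show ?thesis by (simp add: hart_def u_def distrib_right)
    qed
    then have "hart u = (\<lambda>_. 0)" by auto
    then have "norm (cls u) = 0"
      using Hartley_cls(2)[OF squ iu] norm_Hartley[of "cls u"] by (simp add: zero_eq_cls[symmetric])
    then have "AE k in lborel. u k = 0"
      using cls_eq_iff[OF squ square_integrable_zero] by (simp add: zero_eq_cls[symmetric])
    then show ?thesis by eventually_elim (simp add: u_def algebra_simps)
  qed
  have "AE k in lborel. \<forall>n. hart (\<rho> n) k * (?G k + k * ?F (- k)) = 0"
    unfolding AE_all_countable using z by blast
  then show ?thesis
  proof eventually_elim
    fix k assume *: "\<forall>n. hart (\<rho> n) k * (?G k + k * ?F (- k)) = 0"
    have sc: "hart (\<rho> n) k = hart (\<rho> 0) (k / real (Suc n)) / real (Suc n)" for n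
    proof -
      have "(LINT y|lborel. \<rho> 0 y * cas (y * (k / real (Suc n)))) =
          real (Suc n) * (LINT y|lborel. \<rho> 0 (real (Suc n) * y) * cas (real (Suc n) * y * (k / real (Suc n))))"
        using lborel_integral_real_affine[of "real (Suc n)" "\<lambda>y. \<rho> 0 y * cas (y * (k / real (Suc n)))" 0] by simp
      also have "\<dots> = real (Suc n) * (LINT y|lborel. \<rho> n y * cas (y * k))"
      proof -
        have "\<rho> 0 (real (Suc n) * y) * cas (real (Suc n) * y * (k / real (Suc n))) = \<rho> n y * cas (y * k)" for y
        proof -
          have "real (Suc n) * y * (k / real (Suc n)) = y * k" by (simp del: of_nat_Suc)
          then show ?thesis by (simp only: \<rho>_def) simp
        qed
        then show ?thesis by (simp only:)
      qed
      finally show ?thesis by (simp add: hart_def del: of_nat_Suc)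
    qed
    have pos: "hart (\<rho> 0) 0 > 0"
    proof -
      have "(LINT y|lborel. \<rho> 0 y) \<noteq> 0"
      proof
        assume "(LINT y|lborel. \<rho> 0 y) = 0"
        moreover have "(LINT y|lborel. \<rho> 0 y) = 0 \<longleftrightarrow> (AE y in lborel. \<rho> 0 y = 0)"
          by (rule integral_nonneg_eq_0_iff_AE[OF r(1)[of 0]]) (simp add: \<rho>_def bump_nonneg)
        ultimately have ae: "AE y in lborel. \<rho> 0 y = 0" by blast
        have p: "\<rho> 0 y \<noteq> 0" if "y \<in> {-1/2..1/2}" for y
          using that bump_pos[of y] by (simp add: \<rho>_def abs_less_iff)
        have "AE y in lborel. y \<notin> {-1/2..1/2::real}"
          using ae by eventually_elim (use p in blast)
        then have "emeasure lborel {-1/2..1/2::real} = 0"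
          by (subst (asm) AE_iff_measurable[of "{-1/2..1/2::real}"]) auto
        then show False by simp
      qed
      moreover have "(LINT y|lborel. \<rho> 0 y) \<ge> 0" by (intro integral_nonneg_AE AE_I2) (simp add: \<rho>_def bump_nonneg)
      ultimately show ?thesis by (simp add: hart_def cas_def)
    qed
    have "(\<lambda>n. hart (\<rho> 0) (k / real (Suc n))) \<longlonglongrightarrow> hart (\<rho> 0) 0"
      by (rule isCont_tendsto_compose[OF isCont_hart[OF r(1)]])
         (rule LIMSEQ_Suc[OF tendsto_divide_0[OF tendsto_const filterlim_real_at_infinity_sequentially]])
    from order_tendstoD(1)[OF this pos] obtain N where "\<forall>n\<ge>N. hart (\<rho> 0) (k / real (Suc n)) > 0"
      unfolding eventually_sequentially by blast
    then obtain n where "hart (\<rho> 0) (k / real (Suc n)) > 0" by blast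
    then have "hart (\<rho> n) k \<noteq> 0" using sc[of n] by simp
    with *[rule_format, of n] have "?G k + k * ?F (- k) = 0" by simp
    then show "?G k = - k * ?F (- k)" by simp
  qed
qed

lemma weak_deriv_exists:
  assumes f: "square_integrable f" and kf: "square_integrable (\<lambda>k. k * fn (Hartley (cls f)) k)"
  shows "\<exists>g. square_integrable g \<and> has_weak_deriv f g \<and> (AE k in lborel. fn (Hartley (cls g)) k = - k * fn (Hartley (cls f)) (- k))"
proof -
  have sq: "square_integrable (\<lambda>k. - k * fn (Hartley (cls f)) (- k))"
    using square_integrable_reflect[OF kf] by simp
  define g where "g = fn (Hartley (cls (\<lambda>k. - k * fn (Hartley (cls f)) (- k))))"
  have g: "square_integrable g" by (simp add: g_def)
  have "AE k in lborel. fn (Hartley (cls g)) k = - k * fn (Hartley (cls f)) (- k)"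
    using fn_cls[OF sq] by (simp add: g_def)
  with weak_deriv_Hartley_converse[OF f g] g show ?thesis by blast
qed

section \<open>Sobolev norms on the transform side\<close>

definition om :: "real \<Rightarrow> real" where "om k = sqrt (1 + k\<^sup>2)"

lemma om_measurable [measurable]: "om \<in> borel_measurable borel"
  unfolding om_def by measurable

lemma om_sq: "(om k)\<^sup>2 = 1 + k\<^sup>2" by (simp add: om_def add_nonneg_nonneg)
lemma om_ge_1: "1 \<le> om k" by (simp add: om_def)
lemma om_pos: "0 < om k" using om_ge_1[of k] by linarith
lemma abs_le_om: "\<bar>k\<bar> \<le> om k" by (simp add: om_def real_le_rsqrt)
lemma om_even [simp]: "om (- k) = om k" by (simp add: om_def)
lemma om_neq_0 [simp]: "om k \<noteq> 0" using om_pos[of k] by simp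

text \<open>Only the top power has to be assumed, as the lower ones are dominated by
  \<open>1 + \<bar>k\<bar> ^ 3\<close>. The weak derivatives are then built one at a time, each
  contributing a factor \<open>- k\<close> and a reflection.\<close>

lemma H_space_3I:
  assumes f: "square_integrable f" and kf: "square_integrable (\<lambda>k. k ^ 3 * fn (Hartley (cls f)) k)"
  shows "f \<in> H_space 3"
proof -
  let ?F = "fn (Hartley (cls f))"
  have sq: "square_integrable (\<lambda>k. k ^ j * ?F k)" if "j \<le> 3" for j
  proof (rule square_integrable_bound)
    show "square_integrable (\<lambda>k. \<bar>?F k\<bar> + \<bar>k ^ 3 * ?F k\<bar>)"
      by (rule square_integrable_add[OF square_integrable_bound[OF sqi_fn[of "Hartley (cls f)"]] square_integrable_bound[OF kf]]) auto
    have "\<bar>k\<bar> ^ j \<le> 1 + \<bar>k\<bar> ^ 3" for k :: real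
    proof (cases "\<bar>k\<bar> \<le> 1")
      case True then show ?thesis using power_le_one[of "\<bar>k\<bar>" j] by (simp add: add_increasing2)
    next
      case False then show ?thesis using power_increasing[OF that, of "\<bar>k\<bar>"] by linarith
    qed
    then have "\<bar>k\<bar> ^ j * \<bar>?F k\<bar> \<le> (1 + \<bar>k\<bar> ^ 3) * \<bar>?F k\<bar>" for k by (intro mult_right_mono) auto
    then show "AE k in lborel. \<bar>k ^ j * ?F k\<bar> \<le> \<bar>\<bar>?F k\<bar> + \<bar>k ^ 3 * ?F k\<bar>\<bar>"
      by (intro AE_I2) (simp add: abs_mult power_abs distrib_right)
  qed measurable
  obtain g1 where g1: "square_integrable g1" "has_weak_deriv f g1" "AE k in lborel. fn (Hartley (cls g1)) k = - k * ?F (- k)"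
    using weak_deriv_exists[OF f] sq[of 1] by auto
  have "square_integrable (\<lambda>k. k * fn (Hartley (cls g1)) k)"
    by (rule square_integrable_cong_AE[OF square_integrable_reflect[OF square_integrable_minus[OF sq[of 2]]]])
       (use g1(3) in \<open>auto elim!: eventually_mono simp: power2_eq_square\<close>)
  then obtain g2 where g2: "square_integrable g2" "has_weak_deriv g1 g2" "AE k in lborel. fn (Hartley (cls g2)) k = - k * fn (Hartley (cls g1)) (- k)"
    using weak_deriv_exists[OF g1(1)] by auto
  have "AE k in lborel. k * fn (Hartley (cls g2)) k = - (k ^ 3 * ?F k)"
    using g2(3) AE_reflect[OF g1(3)] by eventually_elim (simp add: power3_eq_cube)
  then have "square_integrable (\<lambda>k. k * fn (Hartley (cls g2)) k)"
    by (intro square_integrable_cong_AE[OF square_integrable_minus[OF kf]]) auto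
  then obtain g3 where g3: "square_integrable g3" "has_weak_deriv g2 g3"
    using weak_deriv_exists[OF g2(1)] by auto
  define g where "g i = (if i = 0 then f else if i = 1 then g1 else if i = 2 then g2 else g3)" for i :: nat
  have "weak_derivs 3 f g"
    unfolding weak_derivs_def using f g1 g2 g3 by (auto simp: g_def less_Suc_eq numeral_3_eq_3 le_Suc_eq)
  then show ?thesis by (auto simp: H_space_def)
qed

lemma H_space_mono_1: "f \<in> H_space 3 \<Longrightarrow> f \<in> H_space 1"
  by (auto simp: H_space_def weak_derivs_def)

text \<open>\<open>H_norm\<close> refers to an arbitrary choice of weak derivatives. Their Hartley
  transforms are forced almost everywhere by that of \<open>f\<close>, so the choice does not matter
  and the norm becomes a weighted L2 norm, because \<open>om\<close> squared is
  \<open>1 + k\<^sup>2\<close>.\<close>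

lemma H_norm_1:
  assumes "f \<in> H_space 1"
  shows "square_integrable f" "square_integrable (\<lambda>k. om k * fn (Hartley (cls f)) k)"
    "H_norm 1 f = norm (cls (\<lambda>k. om k * fn (Hartley (cls f)) k))"
proof -
  let ?F = "fn (Hartley (cls f))"
  define g where "g = (SOME g. weak_derivs 1 f g)"
  have "weak_derivs 1 f g" unfolding g_def by (rule someI_ex[of "weak_derivs 1 f"]) (use assms in \<open>simp add: H_space_def\<close>)
  then have g: "g 0 = f" "square_integrable (g 0)" "square_integrable (g 1)" "has_weak_deriv (g 0) (g 1)"
    by (auto simp: weak_derivs_def)
  then show f: "square_integrable f" by simp
  have ae: "AE k in lborel. fn (Hartley (cls (g 1))) k = - k * ?F (- k)"
    using weak_deriv_Hartley[OF g(2-4)] g(1) by simp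
  have sqk: "square_integrable (\<lambda>k. k * ?F k)"
  proof -
    have "AE k in lborel. - k * ?F (- k) = fn (Hartley (cls (g 1))) k" using ae by eventually_elim simp
    then have "square_integrable (\<lambda>k. - k * ?F (- k))"
      by (intro square_integrable_cong_AE[OF sqi_fn[of "Hartley (cls (g 1))"]]) auto
    from square_integrable_reflect[OF this] show ?thesis by simp
  qed
  show sqo: "square_integrable (\<lambda>k. om k * ?F k)"
  proof (rule square_integrableI)
    have "integrable lborel (\<lambda>k. (?F k)\<^sup>2 + (k * ?F k)\<^sup>2)"
      using square_integrable_sq[OF sqk] square_integrable_sq[OF sqi_fn] by simp
    then show "integrable lborel (\<lambda>k. (om k * ?F k)\<^sup>2)"
      by (simp add: power_mult_distrib om_sq algebra_simps)
  qed measurable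
  have "(LINT x|lborel. (g 1 x)\<^sup>2) = (norm (Hartley (cls (g 1))))\<^sup>2"
    using norm_cls[OF g(3)] by simp
  also have "\<dots> = (LINT k|lborel. (- k * ?F (- k))\<^sup>2)"
    unfolding norm_fn by (rule integral_cong_AE) (use ae in \<open>auto elim!: eventually_mono\<close>)
  also have "\<dots> = (LINT k|lborel. (k * ?F k)\<^sup>2)"
    using integral_reflect[of "\<lambda>k. (k * ?F k)\<^sup>2"] by simp
  finally have 1: "(LINT x|lborel. (g 1 x)\<^sup>2) = (LINT k|lborel. (k * ?F k)\<^sup>2)" .
  have 0: "(LINT x|lborel. (f x)\<^sup>2) = (LINT k|lborel. (?F k)\<^sup>2)"
    using norm_cls[OF f] norm_fn[of "Hartley (cls f)"] by simp
  have "integrable lborel (\<lambda>k. k\<^sup>2 * (?F k)\<^sup>2)"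
    using square_integrable_sq[OF sqk] by (simp add: power_mult_distrib)
  then have "(LINT x|lborel. (g 0 x)\<^sup>2) + (LINT x|lborel. (g 1 x)\<^sup>2) = (LINT k|lborel. (om k * ?F k)\<^sup>2)"
    unfolding 1 g(1) 0
    by (subst Bochner_Integration.integral_add[symmetric])
       (auto simp: square_integrable_sq power_mult_distrib om_sq algebra_simps)
  also have "\<dots> = (norm (cls (\<lambda>k. om k * ?F k)))\<^sup>2" by (simp add: norm_cls[OF sqo])
  finally show "H_norm 1 f = norm (cls (\<lambda>k. om k * ?F k))"
    unfolding H_norm_def g_def[symmetric] by (simp add: Let_def)
qed

section \<open>Fourier multipliers and the Sobolev space of order one\<close>

definition mul :: "(real \<Rightarrow> real) \<Rightarrow> l2 \<Rightarrow> l2" where "mul a F = cls (\<lambda>k. a k * fn F k)"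

definition bounded_by :: "real \<Rightarrow> (real \<Rightarrow> real) \<Rightarrow> bool" where
  "bounded_by C a \<longleftrightarrow> a \<in> borel_measurable borel \<and> (\<forall>x. \<bar>a x\<bar> \<le> C)"

lemma bounded_byI: "a \<in> borel_measurable borel \<Longrightarrow> (\<And>x. \<bar>a x\<bar> \<le> C) \<Longrightarrow> bounded_by C a"
  by (simp add: bounded_by_def)

lemma bounded_by_nonneg: "bounded_by C a \<Longrightarrow> 0 \<le> C"
  unfolding bounded_by_def by (meson abs_ge_zero order_trans)

lemma bounded_by_mult: "bounded_by C a \<Longrightarrow> bounded_by D b \<Longrightarrow> bounded_by (C * D) (\<lambda>x. a x * b x)"
  using bounded_by_nonneg[of C a] by (auto simp: bounded_by_def abs_mult intro!: mult_mono)

lemma sqi_mul: "bounded_by C a \<Longrightarrow> square_integrable f \<Longrightarrow> square_integrable (\<lambda>k. a k * f k)"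
  unfolding bounded_by_def using square_integrable_mult_bounded(1) by blast

lemma fn_mul: "bounded_by C a \<Longrightarrow> AE k in lborel. fn (mul a F) k = a k * fn F k"
  unfolding mul_def by (rule fn_cls) (rule sqi_mul, auto)

lemma norm_mul: "bounded_by C a \<Longrightarrow> norm (mul a F) \<le> C * norm F"
  unfolding mul_def bounded_by_def using square_integrable_mult_bounded(2)[OF sqi_fn, of a C F] by simp

lemma mul_cls:
  assumes "bounded_by C a" "square_integrable f"
  shows "mul a (cls f) = cls (\<lambda>k. a k * f k)"
proof -
  have "AE k in lborel. a k * fn (cls f) k = a k * f k"
    using fn_cls[OF assms(2)] by eventually_elim simp
  then show ?thesis unfolding mul_def
    by (subst cls_eq_iff) (auto intro: sqi_mul[OF assms(1)] assms(2))
qed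

lemma mul_add: "bounded_by C a \<Longrightarrow> mul a (F + G) = mul a F + mul a G"
  using mul_cls[of C a "\<lambda>x. fn F x + fn G x"] cls_add[of "fn F" "fn G"]
    cls_add[of "\<lambda>k. a k * fn F k" "\<lambda>k. a k * fn G k"] sqi_mul[of C a "fn F"] sqi_mul[of C a "fn G"]
  by (simp add: distrib_left mul_def)

lemma mul_diff: "bounded_by C a \<Longrightarrow> mul a (F - G) = mul a F - mul a G"
  using mul_cls[of C a "\<lambda>x. fn F x - fn G x"] cls_diff[of "fn F" "fn G"]
    cls_diff[of "\<lambda>k. a k * fn F k" "\<lambda>k. a k * fn G k"] sqi_mul[of C a "fn F"] sqi_mul[of C a "fn G"]
  by (simp add: right_diff_distrib mul_def)

lemma mul_scaleR: "bounded_by C a \<Longrightarrow> mul a (c *\<^sub>R F) = c *\<^sub>R mul a F"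
  using mul_cls[of C a "\<lambda>x. c * fn F x"] cls_scaleR[of "fn F" c]
    cls_scaleR[of "\<lambda>k. a k * fn F k" c] sqi_mul[of C a "fn F"]
  by (simp add: mult.left_commute mul_def)

lemma bounded_linear_mul: "bounded_by C a \<Longrightarrow> bounded_linear (mul a)"
  by (rule bounded_linear_intro[where K=C]) (auto simp: mul_add mul_scaleR norm_mul mult.commute)

lemma mul_mul:
  assumes "bounded_by C a" "bounded_by D b"
  shows "mul a (mul b F) = mul (\<lambda>k. a k * b k) F"
  using mul_cls[OF assms(1) sqi_mul[OF assms(2) sqi_fn], of F] by (simp add: mul_def mult.assoc)

lemma inner_mul:
  assumes "bounded_by C a"
  shows "inner (mul a F) G = inner F (mul a G)"
proof -
  have "inner (mul a F) G = (LINT k|lborel. (a k * fn F k) * fn G k)"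
    by (rule inner_cls_gen) (auto intro: fn_mul[OF assms] sqi_mul[OF assms])
  also have "\<dots> = (LINT k|lborel. fn F k * (a k * fn G k))" by (simp add: mult_ac)
  also have "\<dots> = inner F (mul a G)"
    by (rule inner_cls_gen[symmetric]) (auto intro: fn_mul[OF assms] sqi_mul[OF assms])
  finally show ?thesis .
qed

lemma norm_mul_le:
  assumes "bounded_by C a" "square_integrable g" "0 \<le> D" "AE k in lborel. \<bar>a k * fn F k\<bar> \<le> D * \<bar>g k\<bar>"
  shows "norm (mul a F) \<le> D * norm (cls g)"
  unfolding mul_def by (rule norm_cls_le) (use assms in \<open>auto intro: sqi_mul\<close>)

lemma refl_mul:
  assumes "bounded_by C a" "\<And>k. a (- k) = a k"
  shows "refl (mul a F) = mul a (refl F)"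
proof -
  have "mul a (refl F) = cls (\<lambda>k. a k * fn F (- k))"
    unfolding refl_def by (rule mul_cls[OF assms(1)]) (rule square_integrable_reflect, simp)
  also have "\<dots> = refl (mul a F)"
    unfolding mul_def using refl_cls[OF sqi_mul[OF assms(1) sqi_fn, of F]] by (simp add: assms(2))
  finally show ?thesis by simp
qed

lemma bounded_linear_refl: "bounded_linear refl"
proof (rule bounded_linear_intro[where K=1])
  fix F G :: l2 and c :: real
  have sq: "square_integrable (\<lambda>x. fn H (- x))" for H by (rule square_integrable_reflect) simp
  show "refl (F + G) = refl F + refl G"
    using refl_cls[of "\<lambda>x. fn F x + fn G x"] cls_add[of "fn F" "fn G"] cls_add[OF sq sq]
    by (simp add: refl_def)
  show "refl (c *\<^sub>R F) = c *\<^sub>R refl F"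
    using refl_cls[of "\<lambda>x. c * fn F x"] cls_scaleR[of "fn F" c] cls_scaleR[OF sq]
    by (simp add: refl_def)
  have "(norm (refl F))\<^sup>2 = (LINT x|lborel. (fn F (- x))\<^sup>2)"
    unfolding refl_def by (rule norm_cls[OF sq])
  then have "(norm (refl F))\<^sup>2 = (norm F)\<^sup>2"
    unfolding norm_fn[of F] integral_reflect[of "\<lambda>x. (fn F x)\<^sup>2"] .
  then show "norm (refl F) \<le> norm F * 1" by simp
qed

lemma refl_diff: "refl (F - G) = refl F - refl G"
  by (rule linear_diff[OF bounded_linear.linear[OF bounded_linear_refl]])

lemma refl_scaleR: "refl (c *\<^sub>R F) = c *\<^sub>R refl F"
  by (rule linear_scale[OF bounded_linear.linear[OF bounded_linear_refl]])

lemma refl_add: "refl (F + G) = refl F + refl G"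
  by (rule linear_add[OF bounded_linear.linear[OF bounded_linear_refl]])

section \<open>The encoding of H1 functions by L2 functions\<close>

lemma bounded_by_inverse_om: "bounded_by 1 (\<lambda>k. 1 / om k)"
  by (rule bounded_byI) (use om_ge_1 om_pos in \<open>auto simp: less_imp_le abs_of_pos\<close>)

lemma square_integrable_inverse_om: "square_integrable (\<lambda>k. 1 / om k)"
proof (rule square_integrableI)
  have "(\<lambda>k. (1 / om k)\<^sup>2) = (\<lambda>k. 1 / (1 + k\<^sup>2))" by (simp add: power_divide om_sq)
  then show "integrable lborel (\<lambda>k. (1 / om k)\<^sup>2)" by (simp only: integrable_inverse_square)
qed measurable

text \<open>The constant of the embedding of H1 into the bounded functions, obtained by
  Cauchy-Schwarz against \<open>1 / om\<close>.\<close>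

definition Cinf :: real where "Cinf = norm (cls (\<lambda>k. 1 / om k))"

lemma Cinf_nonneg: "0 \<le> Cinf" by (simp add: Cinf_def)

lemma integrable_emb: "integrable lborel (\<lambda>k. fn p k / om k)"
  using square_integrable_prod[OF sqi_fn square_integrable_inverse_om, of p] by simp

text \<open>Defined by the convergent integral and not as a class: \<open>fn p k / om k\<close> is
  integrable, so the function has point values everywhere, which averages and nonlinear terms can
  refer to.\<close>

definition emb :: "l2 \<Rightarrow> real \<Rightarrow> real" where "emb p = hart (\<lambda>k. fn p k / om k)"

lemma integral_abs_emb: "(LINT k|lborel. \<bar>fn p k / om k\<bar>) \<le> Cinf * norm p"
proof -
  have sqa: "square_integrable (\<lambda>k. \<bar>fn p k\<bar>)" by (rule square_integrable_bound[OF sqi_fn[of p]]) auto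
  have "(LINT k|lborel. \<bar>fn p k / om k\<bar>) = inner (cls (\<lambda>k. \<bar>fn p k\<bar>)) (cls (\<lambda>k. 1 / om k))"
    by (subst inner_cls[OF sqa square_integrable_inverse_om])
       (use om_pos in \<open>simp add: abs_of_pos\<close>)
  also have "\<dots> \<le> norm (cls (\<lambda>k. \<bar>fn p k\<bar>)) * Cinf" unfolding Cinf_def by (rule norm_cauchy_schwarz)
  also have "norm (cls (\<lambda>k. \<bar>fn p k\<bar>)) \<le> 1 * norm (cls (fn p))" by (rule norm_cls_le[OF sqa]) auto
  finally show ?thesis by (simp add: mult.commute mult_right_mono Cinf_nonneg)
qed

lemma emb_bound: "\<bar>emb p x\<bar> \<le> Cinf * norm p"
  unfolding emb_def by (rule order_trans[OF hart_bound[OF integrable_emb] integral_abs_emb])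

lemma hart_cong_AE:
  assumes [measurable]: "f \<in> borel_measurable borel" "g \<in> borel_measurable borel" and "AE k in lborel. f k = g k"
  shows "hart f x = hart g x"
proof -
  have "(LINT k|lborel. f k * cas (k * x)) = (LINT k|lborel. g k * cas (k * x))"
    by (rule integral_cong_AE) (use assms(3) in \<open>auto elim!: eventually_mono\<close>)
  then show ?thesis by (simp add: hart_def)
qed

lemma hart_add: "integrable lborel f \<Longrightarrow> integrable lborel g \<Longrightarrow> hart (\<lambda>k. f k + g k) x = hart f x + hart g x"
  using integrable_cas[of f "\<lambda>k. k * x"] integrable_cas[of g "\<lambda>k. k * x"]
  by (simp add: hart_def distrib_right add_divide_distrib)

lemma hart_diff: "integrable lborel f \<Longrightarrow> integrable lborel g \<Longrightarrow> hart (\<lambda>k. f k - g k) x = hart f x - hart g x"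
  using integrable_cas[of f "\<lambda>k. k * x"] integrable_cas[of g "\<lambda>k. k * x"]
  by (simp add: hart_def left_diff_distrib diff_divide_distrib)

lemma hart_cmult: "hart (\<lambda>k. c * f k) x = c * hart f x"
  by (simp add: hart_def mult.assoc)

lemma emb_add: "emb (p + q) x = emb p x + emb q x"
proof -
  have "emb (p + q) x = hart (\<lambda>k. fn p k / om k + fn q k / om k) x"
    unfolding emb_def by (rule hart_cong_AE) (use fn_add[of p q] in \<open>auto elim!: eventually_mono simp: add_divide_distrib\<close>)
  then show ?thesis by (simp add: emb_def hart_add integrable_emb)
qed

lemma emb_diff: "emb (p - q) x = emb p x - emb q x"
proof -
  have "emb (p - q) x = hart (\<lambda>k. fn p k / om k - fn q k / om k) x"
    unfolding emb_def by (rule hart_cong_AE) (use fn_diff[of p q] in \<open>auto elim!: eventually_mono simp: diff_divide_distrib\<close>)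
  then show ?thesis by (simp add: emb_def hart_diff integrable_emb)
qed

lemma emb_scaleR: "emb (c *\<^sub>R p) x = c * emb p x"
proof -
  have "emb (c *\<^sub>R p) x = hart (\<lambda>k. c * (fn p k / om k)) x"
    unfolding emb_def by (rule hart_cong_AE) (use fn_scaleR[of c p] in \<open>auto elim!: eventually_mono\<close>)
  then show ?thesis by (simp only: emb_def hart_cmult)
qed

lemma isCont_emb: "isCont (emb p) x"
  unfolding emb_def by (rule isCont_hart[OF integrable_emb])

lemma emb_measurable [measurable]: "emb p \<in> borel_measurable borel"
  unfolding emb_def by (rule hart_measurable[OF integrable_emb])

lemma sqi_inverse_om: "square_integrable f \<Longrightarrow> square_integrable (\<lambda>k. f k / om k)"
  using sqi_mul[OF bounded_by_inverse_om] by simp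

lemma emb_cls:
  shows sqi_emb [simp]: "square_integrable (emb p)" and cls_emb: "cls (emb p) = Hartley (mul (\<lambda>k. 1 / om k) p)"
  using Hartley_cls[OF sqi_inverse_om[OF sqi_fn] integrable_emb, of p] by (auto simp: emb_def mul_def)

lemma norm_emb: "norm (cls (emb p)) \<le> norm p"
  using norm_mul[OF bounded_by_inverse_om, of p] by (simp add: cls_emb)

lemma Hartley_emb: "Hartley (cls (emb p)) = mul (\<lambda>k. 1 / om k) p"
  by (simp add: cls_emb)

lemma sqi_om_Hartley_emb: "square_integrable (\<lambda>k. om k * fn (Hartley (cls (emb p))) k)"
  and om_Hartley_emb: "cls (\<lambda>k. om k * fn (Hartley (cls (emb p))) k) = p"
proof -
  have ae: "AE k in lborel. om k * fn (Hartley (cls (emb p))) k = fn p k"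
    unfolding Hartley_emb using fn_mul[OF bounded_by_inverse_om, of p] by eventually_elim simp
  show sq: "square_integrable (\<lambda>k. om k * fn (Hartley (cls (emb p))) k)"
    by (rule square_integrable_cong_AE[OF sqi_fn _ ae]) measurable
  show "cls (\<lambda>k. om k * fn (Hartley (cls (emb p))) k) = p"
    using cls_eq_iff[OF sq sqi_fn, of p] ae by simp
qed

lemma emb_inject: "cls (emb p) = cls (emb q) \<Longrightarrow> p = q"
  using trans[OF om_Hartley_emb[of p, symmetric]] om_Hartley_emb[of q] by (simp only:)

text \<open>Surjectivity of \<open>emb\<close> onto H1 up to null sets. Together with
  \<open>emb_inject\<close> it allows \<open>p\<close> to be the unknown of the equation.\<close>

lemma emb_repr:
  assumes f: "square_integrable f" and o: "square_integrable (\<lambda>k. om k * fn (Hartley (cls f)) k)"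
  shows "AE x in lborel. emb (cls (\<lambda>k. om k * fn (Hartley (cls f)) k)) x = f x"
proof -
  let ?p = "cls (\<lambda>k. om k * fn (Hartley (cls f)) k)"
  have "mul (\<lambda>k. 1 / om k) ?p = cls (fn (Hartley (cls f)))"
    by (subst mul_cls[OF bounded_by_inverse_om o]) simp
  then have "cls (emb ?p) = cls f" by (simp add: cls_emb)
  then show ?thesis using cls_eq_iff[OF sqi_emb f] by simp
qed

lemma emb_refl: "emb (refl p) x = emb p (- x)"
proof -
  have "emb (refl p) x = hart (\<lambda>k. fn p (- k) / om (- k)) x"
    unfolding emb_def by (rule hart_cong_AE) (use fn_refl[of p] in \<open>auto elim!: eventually_mono\<close>)
  also have "\<dots> = hart (\<lambda>k. fn p k / om k) (- x)"
    using integral_reflect[of "\<lambda>k. fn p k / om k * cas (k * - x)"] by (simp add: hart_def)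
  finally show ?thesis by (simp add: emb_def)
qed

lemma refl_eqI_emb: "(\<And>x. emb p (- x) = emb p x) \<Longrightarrow> refl p = p"
  by (rule emb_inject) (simp add: emb_refl[abs_def] fun_eq_iff cls_eq_iff)

lemma emb_mul: "bounded_by C a \<Longrightarrow> emb (mul a p) x = hart (\<lambda>k. a k * (fn p k / om k)) x"
  unfolding emb_def
  by (rule hart_cong_AE) (use fn_mul[of C a p] in \<open>auto elim!: eventually_mono simp: bounded_by_def\<close>)

section \<open>Averages\<close>

text \<open>A separate name that stays folded, so that the case distinction at 0 behind
  \<open>sinc\<close> does not enter simplification.\<close>

definition snc :: "real \<Rightarrow> real" where "snc x = sinc x"

lemma snc_measurable [measurable]: "snc \<in> borel_measurable borel"
  unfolding snc_def[abs_def] by measurable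

lemma isCont_snc: "isCont snc x"
  unfolding snc_def[abs_def] by (rule isCont_sinc)

lemma snc_even [simp]: "snc (- x) = snc x" by (simp add: snc_def)

lemma snc_mult: "x * snc x = sin x" by (simp add: snc_def)

text \<open>The mean value theorem for \<open>sin\<close>. The bound by 1 and the quadratic
  closeness to 1 at the origin are then both read off from \<open>cos\<close>.\<close>

lemma snc_cos: "\<exists>\<xi>. \<bar>\<xi>\<bar> \<le> \<bar>x\<bar> \<and> snc x = cos \<xi>"
proof -
  consider "x = 0" | "x > 0" | "x < 0" by linarith
  then show ?thesis
  proof cases
    case 1 then show ?thesis by (intro exI[of _ 0]) (simp add: snc_def)
  next
    case 2
    from MVT2[OF this, of sin cos] obtain z where "0 < z" "z < x" "sin x - sin 0 = (x - 0) * cos z"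
      by (auto intro: DERIV_sin)
    then show ?thesis using 2 by (intro exI[of _ z]) (auto simp: snc_def)
  next
    case 3
    from MVT2[OF this, of sin cos] obtain z where "x < z" "z < 0" "sin 0 - sin x = (0 - x) * cos z"
      by (auto intro: DERIV_sin)
    then show ?thesis using 3 by (intro exI[of _ z]) (auto simp: snc_def)
  qed
qed

lemma abs_snc_le: "\<bar>snc x\<bar> \<le> 1"
  using snc_cos[of x] abs_cos_le_one by metis

lemma snc_minus_1_le_sq: "\<bar>snc x - 1\<bar> \<le> x\<^sup>2"
proof -
  obtain z where z: "\<bar>z\<bar> \<le> \<bar>x\<bar>" "snc x = cos z" using snc_cos[of x] by blast
  have "1 - cos z = 2 * (sin (z / 2))\<^sup>2" using cos_double_sin[of "z / 2"] by simp
  moreover have "(sin (z / 2))\<^sup>2 \<le> (z / 2)\<^sup>2" using abs_sin_x_le_abs_x[of "z / 2"] unfolding abs_le_square_iff .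
  moreover have "(z / 2)\<^sup>2 = z\<^sup>2 / 4" by (simp add: power_divide)
  moreover have "0 \<le> z\<^sup>2" by simp
  ultimately have "1 - cos z \<le> z\<^sup>2" by linarith
  also have "z\<^sup>2 \<le> x\<^sup>2" using z(1) by (simp add: abs_le_square_iff)
  finally show ?thesis using z(2) cos_le_one[of z] by simp
qed

lemma snc_minus_1_le: "\<bar>snc x - 1\<bar> \<le> 2 * \<bar>x\<bar>"
proof (cases "\<bar>x\<bar> \<le> 1")
  case True
  then have "x\<^sup>2 \<le> \<bar>x\<bar>" using mult_left_mono[of "\<bar>x\<bar>" 1 "\<bar>x\<bar>"] by (simp add: power2_eq_square)
  then show ?thesis using snc_minus_1_le_sq[of x] by linarith
next
  case False
  then show ?thesis using abs_snc_le[of x] by linarith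
qed

lemma abs_mult_snc_le: "\<bar>x * snc x\<bar> \<le> 1" by (simp add: snc_mult)

lemma integrable_indicator_Icc: "integrable lborel (indicator {a..b::real} :: real \<Rightarrow> real)"
  by (cases "a \<le> b") (simp_all add: integrable_indicator_iff)

lemma integral_cas_interval:
  assumes h: "h > 0"
  shows "(LINT y|lborel. indicator {x - h / 2..x + h / 2} y * cas (k * y)) = h * snc (h * k / 2) * cas (k * x)"
proof (cases "k = 0")
  case True
  then show ?thesis using h by (simp add: snc_def cas_def)
next
  case False
  let ?F = "\<lambda>y. (sin (k * y) - cos (k * y)) / k"
  have D: "(?F has_vector_derivative cas (k * y)) (at y within S)" for y S
    unfolding has_real_derivative_iff_has_vector_derivative[symmetric]
    by (rule derivative_eq_intros refl | use False in \<open>simp add: cas_def field_simps\<close>)+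
  have "(LINT y|lborel. indicator {x - h / 2..x + h / 2} y *\<^sub>R cas (k * y)) = ?F (x + h / 2) - ?F (x - h / 2)"
    by (rule integral_FTC_Icc[OF _ D]) (use h in \<open>auto simp: cas_def intro!: continuous_intros\<close>)
  also have "\<dots> = 2 * sin (k * h / 2) * cas (k * x) / k"
  proof -
    have "(sin (k * (x + h / 2)) - cos (k * (x + h / 2))) - (sin (k * (x - h / 2)) - cos (k * (x - h / 2)))
        = 2 * sin (k * h / 2) * cas (k * x)"
      by (simp add: distrib_left right_diff_distrib sin_add sin_diff cos_add cos_diff cas_def)
    then show ?thesis by (simp only: diff_divide_distrib[symmetric])
  qed
  also have "2 * sin (k * h / 2) = h * k * snc (h * k / 2)"
    using snc_mult[of "h * k / 2"] by (simp add: mult.commute)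
  finally show ?thesis using False by simp
qed

lemma avg_eq: "avg h F x = (LINT y|lborel. indicator {x - h / 2..x + h / 2} y * F y) / h"
  by (simp add: avg_def set_lebesgue_integral_def)

text \<open>Averaging is convolution with an even box, so it acts as a multiplier without any
  reflection; the multiplier is the transform of the box.\<close>

lemma avg_hart:
  assumes g: "integrable lborel g" and h: "h > 0"
  shows "avg h (hart g) x = hart (\<lambda>k. snc (h * k / 2) * g k) x"
proof -
  let ?I = "indicator {x - h / 2..x + h / 2} :: real \<Rightarrow> real"
  have I: "integrable lborel ?I" by (rule integrable_indicator_Icc)
  have "(LINT y|lborel. ?I y * (LINT k|lborel. g k * cas (k * y))) = (LINT k|lborel. g k * (LINT y|lborel. ?I y * cas (k * y)))"
    by (rule Fubini_bounded_kernel[OF I g, where C=2]) (auto simp: cas_le)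
  also have "\<dots> = (LINT k|lborel. h * (snc (h * k / 2) * g k * cas (k * x)))"
    unfolding integral_cas_interval[OF h] by (simp add: mult_ac)
  also have "\<dots> = h * (LINT k|lborel. snc (h * k / 2) * g k * cas (k * x))" by simp
  finally have e: "(LINT y|lborel. ?I y * (LINT k|lborel. g k * cas (k * y))) = h * (LINT k|lborel. snc (h * k / 2) * g k * cas (k * x))" .
  have "avg h (hart g) x = (LINT y|lborel. ?I y * (LINT k|lborel. g k * cas (k * y))) / sqrt (2 * pi) / h"
    unfolding avg_eq hart_def by simp
  then show ?thesis unfolding e using h by (simp add: hart_def)
qed

lemma avg_cong_AE:
  assumes [measurable]: "f \<in> borel_measurable borel" "g \<in> borel_measurable borel" and "AE x in lborel. f x = g x"
  shows "avg h f x = avg h g x"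
proof -
  have "(LINT y|lborel. indicator {x - h / 2..x + h / 2} y * f y) = (LINT y|lborel. indicator {x - h / 2..x + h / 2} y * g y)"
    by (rule integral_cong_AE) (use assms(3) in \<open>auto elim!: eventually_mono\<close>)
  then show ?thesis by (simp add: avg_eq)
qed

text \<open>The Fourier symbol of \<open>avg h\<close>.\<close>

definition sm :: "real \<Rightarrow> real \<Rightarrow> real" where "sm h k = snc (h * k / 2)"

lemma sm_measurable [measurable]: "sm h \<in> borel_measurable borel" unfolding sm_def by measurable
lemma bounded_by_sm: "bounded_by 1 (sm h)"
  by (rule bounded_byI) (auto simp: sm_def abs_snc_le)
lemma sm_even [simp]: "sm h (- k) = sm h k" by (simp add: sm_def)

lemma avg_emb: "h > 0 \<Longrightarrow> avg h (emb p) x = emb (mul (sm h) p) x"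
  using avg_hart[OF integrable_emb, of h p x] emb_mul[OF bounded_by_sm, of h p x] by (simp add: emb_def sm_def)

lemma integrable_bounded_imp_sqi:
  assumes "integrable lborel f" "\<And>x. \<bar>f x\<bar> \<le> B"
  shows "square_integrable f"
proof (rule square_integrableI)
  show m [measurable]: "f \<in> borel_measurable borel" using borel_measurable_integrable[OF assms(1)] by simp
  show "integrable lborel (\<lambda>x. (f x)\<^sup>2)"
  proof (rule Bochner_Integration.integrable_bound)
    show "integrable lborel (\<lambda>x. B * \<bar>f x\<bar>)" using assms(1) by simp
    have "\<bar>f x\<bar> * \<bar>f x\<bar> \<le> B * \<bar>f x\<bar>" for x by (rule mult_right_mono[OF assms(2)]) simp
    then show "AE x in lborel. norm ((f x)\<^sup>2) \<le> norm (B * \<bar>f x\<bar>)"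
      by (intro AE_I2) (metis abs_ge_self abs_mult_self_eq order_trans power2_eq_square real_norm_def abs_power2)
  qed measurable
qed

lemma avg_bounded:
  assumes f [measurable]: "f \<in> borel_measurable borel" and B: "\<And>x. \<bar>f x\<bar> \<le> B" and h: "h > 0"
  shows "\<bar>avg h f x\<bar> \<le> B"
proof -
  let ?I = "indicator {x - h / 2..x + h / 2} :: real \<Rightarrow> real"
  have I: "integrable lborel ?I" by (rule integrable_indicator_Icc)
  have "\<bar>LINT y|lborel. ?I y * f y\<bar> \<le> (LINT y|lborel. \<bar>?I y * f y\<bar>)" by (rule integral_abs_bound)
  also have "\<dots> \<le> (LINT y|lborel. B * ?I y)"
  proof (rule integral_mono')
    show "integrable lborel (\<lambda>y. B * ?I y)" using I by simp
    show "\<bar>?I y * f y\<bar> \<le> B * ?I y" for y using B[of y] by (auto split: split_indicator)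
  qed (use order_trans[OF abs_ge_zero B] in auto)
  also have "\<dots> = B * h" using h by simp
  finally show ?thesis using h by (simp add: avg_eq field_simps)
qed

text \<open>The same multiplier rule for functions given on the physical side. The nonlinear terms
  are integrable and bounded, but are not given in the form \<open>hart g\<close>.\<close>

lemma Hartley_avg:
  assumes f: "integrable lborel f" and B: "\<And>x. \<bar>f x\<bar> \<le> B" and h: "h > 0"
  shows "square_integrable (avg h f)" "Hartley (cls (avg h f)) = mul (sm h) (Hartley (cls f))"
proof -
  have fm [measurable]: "f \<in> borel_measurable borel" using borel_measurable_integrable[OF f] by simp
  let ?I = "indicator {- (h / 2)..h / 2} :: real \<Rightarrow> real"
  have I: "integrable lborel ?I" by (rule integrable_indicator_Icc)
  have fa: "integrable lborel (\<lambda>x. f (x + t))" "(LINT x|lborel. \<bar>f (x + t)\<bar>) = (LINT x|lborel. \<bar>f x\<bar>)" for t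
    using lborel_integrable_real_affine[OF f, of 1 t] lborel_integral_real_affine[of 1 "\<lambda>x. \<bar>f x\<bar>" t] by (simp_all add: add.commute)
  have av: "avg h f x = (LINT t|lborel. ?I t * f (x + t)) / h" for x
    using lborel_integral_real_affine[of 1 "\<lambda>y. indicator {x - h / 2..x + h / 2} y * f y" x]
    by (simp add: avg_eq indicator_def if_distrib cong: if_cong)
  have prod: "integrable (lborel \<Otimes>\<^sub>M lborel) (\<lambda>(t, x). ?I t * f (x + t))"
  proof (rule lborel_pair.Fubini_integrable)
    show "integrable lborel (\<lambda>t. LINT x|lborel. norm (case (t, x) of (t, x) \<Rightarrow> ?I t * f (x + t)))"
      using I by (simp add: abs_mult fa)
    show "AE t in lborel. integrable lborel (\<lambda>x. case (t, x) of (t, x) \<Rightarrow> ?I t * f (x + t))"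
      using fa by simp
  qed measurable
  have iav: "integrable lborel (avg h f)"
    unfolding av[abs_def] using lborel_pair.integrable_snd[OF prod] by simp
  have bav: "\<bar>avg h f x\<bar> \<le> B" for x by (rule avg_bounded[OF fm B h])
  show sq: "square_integrable (avg h f)" by (rule integrable_bounded_imp_sqi[OF iav bav])
  have sqf: "square_integrable f" by (rule integrable_bounded_imp_sqi[OF f B])
  have "hart (avg h f) k = sm h k * hart f k" for k
  proof -
    have prodk: "integrable (lborel \<Otimes>\<^sub>M lborel) (\<lambda>(t, x). ?I t * f (x + t) * cas (x * k))"
    proof (rule Bochner_Integration.integrable_bound)
      show "integrable (lborel \<Otimes>\<^sub>M lborel) (\<lambda>z. 2 * \<bar>case z of (t, x) \<Rightarrow> ?I t * f (x + t)\<bar>)"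
        using prod by simp
      show "AE z in lborel \<Otimes>\<^sub>M lborel. norm (case z of (t, x) \<Rightarrow> ?I t * f (x + t) * cas (x * k))
          \<le> norm (2 * \<bar>case z of (t, x) \<Rightarrow> ?I t * f (x + t)\<bar>)"
        using abs_mult_cas_le by (intro AE_I2) (simp add: case_prod_beta)
    qed measurable
    have "(LINT x|lborel. avg h f x * cas (x * k)) * h = (LINT x|lborel. (LINT t|lborel. ?I t * f (x + t) * cas (x * k)))"
    proof -
      have "avg h f x * cas (x * k) * h = (LINT t|lborel. ?I t * f (x + t) * cas (x * k))" for x
        using h by (simp add: av)
      then show ?thesis by (simp only: integral_mult_left_zero[symmetric])
    qed
    also have "\<dots> = (LINT t|lborel. (LINT x|lborel. ?I t * f (x + t) * cas (x * k)))"
      by (rule lborel_pair.Fubini_integral[OF prodk])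
    also have "\<dots> = (LINT t|lborel. ?I t * (LINT x|lborel. f x * cas ((x - t) * k)))"
    proof (rule Bochner_Integration.integral_cong[OF HOL.refl])
      fix t
      show "(LINT x|lborel. ?I t * f (x + t) * cas (x * k)) = ?I t * (LINT x|lborel. f x * cas ((x - t) * k))"
        using lborel_integral_real_affine[of 1 "\<lambda>x. f x * cas ((x - t) * k)" t]
        by (simp add: mult.assoc add.commute)
    qed
    also have "\<dots> = (LINT x|lborel. f x * (LINT t|lborel. ?I t * cas ((x - t) * k)))"
      by (rule Fubini_bounded_kernel[OF I f, where C=2]) (auto simp: cas_le)
    also have "(\<lambda>x. LINT t|lborel. ?I t * cas ((x - t) * k)) = (\<lambda>x. h * sm h k * cas (x * k))"
    proof
      fix x
      have "(LINT t|lborel. ?I t * cas ((x - t) * k)) = (LINT t|lborel. indicator {x - h / 2..x + h / 2} t * cas (k * t))"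
        using lborel_integral_real_affine[of "-1" "\<lambda>t. indicator {x - h / 2..x + h / 2} t * cas (k * t)" x]
        by (simp add: indicator_def mult.commute) (rule Bochner_Integration.integral_cong, auto)
      then show "(LINT t|lborel. ?I t * cas ((x - t) * k)) = h * sm h k * cas (x * k)"
        using integral_cas_interval[OF h, of x k] by (simp add: sm_def mult.commute)
    qed
    also have "(LINT x|lborel. f x * (h * sm h k * cas (x * k))) = h * sm h k * (LINT x|lborel. f x * cas (x * k))"
      by (subst integral_mult_right_zero[symmetric]) (simp only: mult_ac)
    finally show ?thesis using h by (simp add: hart_def)
  qed
  then have e: "hart (avg h f) = (\<lambda>k. sm h k * hart f k)" by (rule ext)
  show "Hartley (cls (avg h f)) = mul (sm h) (Hartley (cls f))"
    unfolding Hartley_cls(2)[OF sq iav] Hartley_cls(2)[OF sqf f] mul_cls[OF bounded_by_sm Hartley_cls(1)[OF sqf f]] e ..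
qed

section \<open>Conditionally convergent symbols\<close>

text \<open>Summation by parts against the tails \<open>R\<close>, which tend to 0 also when the
  series converges only conditionally.\<close>

lemma abel_summation:
  fixes a v :: "nat \<Rightarrow> real"
  defines "R \<equiv> \<lambda>n. suminf a - sum a {..<n}"
  shows "(\<Sum>n<N. a n * v n) = R 0 * v 0 - R N * v N + (\<Sum>n<N. R (Suc n) * (v (Suc n) - v n))"
proof (induction N)
  case (Suc N)
  have "a N = R N - R (Suc N)" by (simp add: R_def)
  show ?case unfolding sum.lessThan_Suc Suc.IH by (simp add: \<open>a N = _\<close> algebra_simps)
qed simp

text \<open>The derivative of the squared sinc is bounded near 0 and decays like 1/x^2, each of the
  two factors contributing 1/x. Its majorant is a multiple of the derivative of
  \<open>arctan\<close>.\<close>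

lemma snc_derivative_bound:
  assumes "x > 0"
  shows "\<exists>D. DERIV (\<lambda>x. (snc x)\<^sup>2) x :> D \<and> \<bar>D\<bar> \<le> 6 / (1 + x\<^sup>2)"
proof -
  let ?d = "(x * cos x - sin x) / x\<^sup>2"
  have D: "DERIV snc x :> ?d"
  proof (rule has_field_derivative_transform_within_open[where S="{0<..}"])
    show "DERIV (\<lambda>x. sin x / x) x :> ?d"
      by (rule derivative_eq_intros refl | use assms in \<open>simp add: power2_eq_square mult.commute\<close>)+
  qed (use assms in \<open>auto simp: snc_def\<close>)
  have d1: "\<bar>?d\<bar> \<le> 1"
  proof -
    obtain z where z: "0 < z" "z < x" "(x * cos x - sin x) - (0 * cos 0 - sin 0) = (x - 0) * (- z * sin z)"
      using MVT2[OF assms, of "\<lambda>x. x * cos x - sin x" "\<lambda>z. - z * sin z"]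
      by (force intro!: derivative_eq_intros)
    have "\<bar>x * cos x - sin x\<bar> = x * (z * \<bar>sin z\<bar>)" using z assms by (simp add: abs_mult)
    also have "\<dots> \<le> x * (x * 1)" using z assms by (intro mult_mono) auto
    finally show ?thesis using assms by (simp add: power2_eq_square abs_mult)
  qed
  have d2: "\<bar>?d\<bar> * x \<le> 2" if "x \<ge> 1"
  proof -
    have "\<bar>x * cos x - sin x\<bar> \<le> \<bar>x\<bar> * \<bar>cos x\<bar> + \<bar>sin x\<bar>"
      using abs_triangle_ineq4[of "x * cos x" "sin x"] by (simp add: abs_mult)
    also have "\<dots> \<le> x * 1 + 1" using assms by (intro add_mono mult_mono) auto
    also have "\<dots> \<le> 2 * x" using that by simp
    finally show ?thesis using assms by (simp add: power2_eq_square abs_mult field_simps)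
  qed
  have s2: "\<bar>snc x\<bar> * x \<le> 1" using abs_mult_snc_le[of x] assms by (simp add: abs_mult mult.commute)
  have "DERIV (\<lambda>x. (snc x)\<^sup>2) x :> 2 * snc x * ?d"
    by (rule DERIV_cong[OF DERIV_power[OF D]]) simp
  moreover have "\<bar>2 * snc x * ?d\<bar> * (1 + x\<^sup>2) \<le> 6"
  proof -
    have a: "\<bar>snc x\<bar> * \<bar>?d\<bar> \<le> 1 * 1" by (intro mult_mono abs_snc_le d1) auto
    have "(\<bar>snc x\<bar> * x) * (\<bar>?d\<bar> * x) \<le> 2"
    proof (cases "x \<ge> 1")
      case True
      have "(\<bar>snc x\<bar> * x) * (\<bar>?d\<bar> * x) \<le> 1 * 2"
        by (rule mult_mono[OF s2 d2[OF True]]) (use assms in auto)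
      then show ?thesis by simp
    next
      case False
      then have "\<bar>?d\<bar> * x \<le> 1 * 1" by (intro mult_mono[OF d1]) (use assms in auto)
      then have "(\<bar>snc x\<bar> * x) * (\<bar>?d\<bar> * x) \<le> 1 * (1 * 1)" by (rule mult_mono[OF s2]) (use assms in auto)
      then show ?thesis by simp
    qed
    then have b: "\<bar>snc x\<bar> * \<bar>?d\<bar> * x\<^sup>2 \<le> 2" by (simp only: power2_eq_square mult_ac)
    have "\<bar>2 * snc x * ?d\<bar> * (1 + x\<^sup>2) = 2 * (\<bar>snc x\<bar> * \<bar>?d\<bar>) + 2 * (\<bar>snc x\<bar> * \<bar>?d\<bar> * x\<^sup>2)"
    proof -
      have "\<bar>2 * s * d\<bar> * (1 + y) = 2 * (\<bar>s\<bar> * \<bar>d\<bar>) + 2 * (\<bar>s\<bar> * \<bar>d\<bar> * y)" for s d y :: real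
        by (simp add: abs_mult algebra_simps)
      then show ?thesis .
    qed
    then show ?thesis using a b by linarith
  qed
  then have "\<bar>2 * snc x * ?d\<bar> \<le> 6 / (1 + x\<^sup>2)"
    by (subst pos_le_divide_eq) (auto intro: add_pos_nonneg)
  ultimately show ?thesis by blast
qed

lemma snc_sq_variation:
  assumes "0 < x" "x \<le> y"
  shows "\<bar>(snc y)\<^sup>2 - (snc x)\<^sup>2\<bar> \<le> 6 * (arctan y - arctan x)"
proof (cases "x = y")
  case False
  then have xy: "x < y" using assms by simp
  obtain D where D: "\<And>z. z > 0 \<Longrightarrow> DERIV (\<lambda>x. (snc x)\<^sup>2) z :> D z" "\<And>z. z > 0 \<Longrightarrow> \<bar>D z\<bar> \<le> 6 / (1 + z\<^sup>2)"
    using snc_derivative_bound by metis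
  have A: "DERIV (\<lambda>z. 6 * arctan z) z :> 6 / (1 + z\<^sup>2)" for z
    by (rule derivative_eq_intros refl | simp add: inverse_eq_divide)+
  have "6 * arctan x - (snc x)\<^sup>2 \<le> 6 * arctan y - (snc y)\<^sup>2"
  proof (rule DERIV_nonneg_imp_nondecreasing[OF assms(2)])
    fix z assume "x \<le> z"
    then have z: "z > 0" using assms(1) by simp
    show "\<exists>y. DERIV (\<lambda>z. 6 * arctan z - (snc z)\<^sup>2) z :> y \<and> 0 \<le> y"
      by (rule exI[of _ "6 / (1 + z\<^sup>2) - D z"]) (use DERIV_diff[OF A D(1)[OF z]] D(2)[OF z] in \<open>auto simp: abs_le_iff\<close>)
  qed
  moreover have "6 * arctan x + (snc x)\<^sup>2 \<le> 6 * arctan y + (snc y)\<^sup>2"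
  proof (rule DERIV_nonneg_imp_nondecreasing[OF assms(2)])
    fix z assume "x \<le> z"
    then have z: "z > 0" using assms(1) by simp
    show "\<exists>y. DERIV (\<lambda>z. 6 * arctan z + (snc z)\<^sup>2) z :> y \<and> 0 \<le> y"
      by (rule exI[of _ "6 / (1 + z\<^sup>2) + D z"]) (use DERIV_add[OF A D(1)[OF z]] D(2)[OF z] in \<open>auto simp: abs_le_iff\<close>)
  qed
  ultimately show ?thesis by (simp add: abs_le_iff algebra_simps)
qed simp

text \<open>The \<open>arctan\<close> majorants telescope to at most 6 * pi / 2, which is below 12.
  The point is uniformity in \<open>k\<close> and \<open>N\<close>: sampling along any grid sees no
  more than the total variation on the half line.\<close>

lemma snc_sq_total_variation:
  "(\<Sum>n<N. \<bar>(snc (real (Suc (Suc n)) * k / 2))\<^sup>2 - (snc (real (Suc n) * k / 2))\<^sup>2\<bar>) \<le> 12"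
proof -
  define t where "t = \<bar>k\<bar> / 2"
  have s: "snc (real n * k / 2) = snc (real n * t)" for n
    unfolding t_def by (cases "k \<ge> 0") (auto simp: abs_if)
  show ?thesis
  proof (cases "t = 0")
    case False
    then have t: "t > 0" by (simp add: t_def)
    have "(\<Sum>n<N. \<bar>(snc (real (Suc (Suc n)) * k / 2))\<^sup>2 - (snc (real (Suc n) * k / 2))\<^sup>2\<bar>)
        \<le> (\<Sum>n<N. 6 * (arctan (real (Suc (Suc n)) * t) - arctan (real (Suc n) * t)))"
      unfolding s by (intro sum_mono snc_sq_variation) (use t in \<open>auto simp: mult_right_mono\<close>)
    also have "\<dots> = 6 * (arctan (real (Suc N) * t) - arctan (real (Suc 0) * t))"
      unfolding sum_distrib_left[symmetric] sum_lessThan_telescope[of "\<lambda>n. arctan (real (Suc n) * t)" N] ..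
    also have "\<dots> \<le> 6 * (pi / 2 - 0)"
      using arctan_ubound[of "real (Suc N) * t"] t by (intro mult_left_mono diff_mono) (auto simp: zero_le_arctan_iff)
    also have "\<dots> \<le> 12" using pi_less_4 by simp
    finally show ?thesis .
  qed (simp add: t_def s)
qed

lemma lam_alt: "lam \<alpha> k = (\<Sum>n. \<alpha> (Suc n) * (real (Suc n))\<^sup>2 * (snc (real (Suc n) * k / 2))\<^sup>2)"
  by (simp add: lam_def snc_def del: of_nat_Suc)

text \<open>Abel summation with tails \<open>R\<close> that tend to 0 and weights whose variation is
  bounded uniformly in \<open>k\<close>. Decay at infinity follows by separating the first
  \<open>N\<close> terms, where all weights are small for large \<open>k\<close>, from the rest,
  where the tails are small.\<close>

lemma lam_abel:
  assumes a: "summable (\<lambda>n. \<alpha> (Suc n) * real (Suc n) ^ 2)"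
  shows lam_sums: "(\<lambda>n. \<alpha> (Suc n) * (real (Suc n))\<^sup>2 * (snc (real (Suc n) * k / 2))\<^sup>2) sums lam \<alpha> k" (is "?f k sums _")
    and lam_partial_bound: "\<exists>C. \<forall>N k. \<bar>\<Sum>n<N. \<alpha> (Suc n) * (real (Suc n))\<^sup>2 * (snc (real (Suc n) * k / 2))\<^sup>2\<bar> \<le> C"
    and lam_limit: "e > 0 \<Longrightarrow> \<exists>K. \<forall>k\<ge>K. \<bar>lam \<alpha> k\<bar> \<le> e"
proof -
  define A where "A n = \<alpha> (Suc n) * (real (Suc n))\<^sup>2" for n
  define R where "R n = suminf A - sum A {..<n}" for n
  define v where "v k n = (snc (real (Suc n) * k / 2))\<^sup>2" for k n
  have sA: "summable A" using a by (simp add: A_def[abs_def])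
  have R0: "R \<longlonglongrightarrow> 0"
    unfolding R_def using tendsto_diff[OF tendsto_const summable_LIMSEQ[OF sA], of "suminf A"] by simp
  then have "Bseq R" by (rule convergent_imp_Bseq[OF convergentI])
  then obtain M where M: "M > 0" "\<And>n. \<bar>R n\<bar> \<le> M" unfolding Bseq_def by auto
  have v1: "\<bar>v k n\<bar> \<le> 1" for k n using abs_snc_le by (simp add: v_def abs_square_le_1)
  have tv: "(\<Sum>n<N. \<bar>v k (Suc n) - v k n\<bar>) \<le> 12" for N k
    unfolding v_def by (rule snc_sq_total_variation)
  have ab: "(\<Sum>n<N. A n * v k n) = R 0 * v k 0 - R N * v k N + (\<Sum>n<N. R (Suc n) * (v k (Suc n) - v k n))" for N k
    unfolding R_def by (rule abel_summation)
  have tvs: "summable (\<lambda>n. \<bar>v k (Suc n) - v k n\<bar>)" for k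
    by (rule summableI_nonneg_bounded[OF _ tv]) simp
  have Rs: "summable (\<lambda>n. R (Suc n) * (v k (Suc n) - v k n))" for k
  proof (rule summable_comparison_test'[OF summable_mult[OF tvs, of M]])
    show "norm (R (Suc n) * (v k (Suc n) - v k n)) \<le> M * \<bar>v k (Suc n) - v k n\<bar>" for n
      using M(2)[of "Suc n"] by (simp add: abs_mult mult_right_mono)
  qed
  have Rv: "(\<lambda>N. R N * v k N) \<longlonglongrightarrow> 0" for k
    by (rule tendsto_0_le[OF R0, where K=1]) (intro always_eventually allI, simp add: abs_mult mult_left_le v1)
  have lim: "(\<lambda>N. \<Sum>n<N. A n * v k n) \<longlonglongrightarrow> R 0 * v k 0 - 0 + (\<Sum>n. R (Suc n) * (v k (Suc n) - v k n))" for k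
    unfolding ab by (intro tendsto_add tendsto_diff tendsto_const Rv summable_LIMSEQ[OF Rs])
  then have sums: "(\<lambda>n. A n * v k n) sums (R 0 * v k 0 - 0 + (\<Sum>n. R (Suc n) * (v k (Suc n) - v k n)))" for k
    by (simp add: sums_def)
  have lam: "lam \<alpha> k = R 0 * v k 0 + (\<Sum>n. R (Suc n) * (v k (Suc n) - v k n))" for k
    unfolding lam_alt using sums_unique[OF sums[of k]] by (simp add: A_def v_def)
  show "?f k sums lam \<alpha> k" using sums[of k] unfolding lam by (simp add: A_def v_def)
  have bd: "\<bar>\<Sum>n<N. A n * v k n\<bar> \<le> M + M + M * 12" for N k
  proof -
    have "\<bar>R n * v k n'\<bar> \<le> M" for n n'
      using mult_mono[OF M(2)[of n] v1[of k n']] M(1) by (simp add: abs_mult)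
    moreover have "\<bar>\<Sum>n<N. R (Suc n) * (v k (Suc n) - v k n)\<bar> \<le> M * 12"
    proof -
      have "\<bar>\<Sum>n<N. R (Suc n) * (v k (Suc n) - v k n)\<bar> \<le> (\<Sum>n<N. \<bar>R (Suc n) * (v k (Suc n) - v k n)\<bar>)"
        by (rule sum_abs)
      also have "\<dots> \<le> (\<Sum>n<N. M * \<bar>v k (Suc n) - v k n\<bar>)"
        by (intro sum_mono) (simp add: abs_mult mult_right_mono M(2))
      also have "\<dots> \<le> M * 12" using tv[of k N] M(1) by (simp flip: sum_distrib_left)
      finally show ?thesis .
    qed
    ultimately have "\<bar>R 0 * v k 0\<bar> \<le> M" "\<bar>R N * v k N\<bar> \<le> M" "\<bar>\<Sum>n<N. R (Suc n) * (v k (Suc n) - v k n)\<bar> \<le> M * 12"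
      by blast+
    then show ?thesis unfolding ab by linarith
  qed
  then show "\<exists>C. \<forall>N k. \<bar>\<Sum>n<N. \<alpha> (Suc n) * (real (Suc n))\<^sup>2 * (snc (real (Suc n) * k / 2))\<^sup>2\<bar> \<le> C"
    by (auto simp: A_def v_def)
  show "\<exists>K. \<forall>k\<ge>K. \<bar>lam \<alpha> k\<bar> \<le> e" if e: "e > 0"
  proof -
    \<comment> \<open>The total variation contributes a factor 12, so the late terms use up half of
      \<open>e\<close>; the other half is left for the early ones.\<close>
    define e' where "e' = e / 24"
    have "e' > 0" using e by (simp add: e'_def)
    with R0 obtain N where N: "\<And>n. n \<ge> N \<Longrightarrow> \<bar>R n\<bar> \<le> e'"
      by (metis LIMSEQ_D diff_zero less_imp_le real_norm_def)
    define L where "L = M + 2 * real N * M"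
    have L: "L > 0" using M(1) by (simp add: L_def add_pos_nonneg)
    have main: "\<bar>lam \<alpha> k\<bar> \<le> e" if k: "k \<ge> max 1 (8 * L / e)" for k
    proof -
      have k1: "k \<ge> 1" "8 * L / e \<le> k" using k by auto
      have vk: "\<bar>v k n\<bar> \<le> 4 / k" for n
      proof -
        have "\<bar>snc (real (Suc n) * k / 2)\<bar> * (real (Suc n) * k / 2) \<le> 1"
          using abs_mult_snc_le[of "real (Suc n) * k / 2"] k1 by (simp add: abs_mult mult.commute)
        moreover have "\<bar>snc (real (Suc n) * k / 2)\<bar> * (k / 2) \<le> \<bar>snc (real (Suc n) * k / 2)\<bar> * (real (Suc n) * k / 2)"
          using k1 by (intro mult_left_mono) auto
        ultimately have "\<bar>snc (real (Suc n) * k / 2)\<bar> * (k / 2) \<le> 1" by linarith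
        then have "\<bar>snc (real (Suc n) * k / 2)\<bar> \<le> 2 / k"
          using k1 by (simp add: field_simps)
        then have "\<bar>snc (real (Suc n) * k / 2)\<bar> * \<bar>snc (real (Suc n) * k / 2)\<bar> \<le> (2 / k) * 1"
          using k1 by (intro mult_mono abs_snc_le) auto
        also have "\<dots> \<le> 4 / k" using k1 by (simp add: divide_right_mono)
        finally show ?thesis by (simp add: v_def power2_eq_square abs_mult)
      qed
      have sabs: "summable (\<lambda>n. \<bar>R (Suc n) * (v k (Suc n) - v k n)\<bar>)"
      proof (rule summable_comparison_test'[OF summable_mult[OF tvs, of M]])
        show "norm \<bar>R (Suc n) * (v k (Suc n) - v k n)\<bar> \<le> M * \<bar>v k (Suc n) - v k n\<bar>" for n
          using M(2)[of "Suc n"] by (simp add: abs_mult mult_right_mono)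
      qed
      have "\<bar>\<Sum>n. R (Suc n) * (v k (Suc n) - v k n)\<bar> \<le> (\<Sum>n. \<bar>R (Suc n) * (v k (Suc n) - v k n)\<bar>)"
        by (rule summable_rabs[OF sabs])
      also have "\<dots> \<le> 2 * real N * M * (4 / k) + e' * 12"
      proof (rule suminf_le_const[OF sabs])
        fix n
        \<comment> \<open>Early terms use the decay of the weights in \<open>k\<close>, late terms
          the smallness of the tails; adding both bounds avoids splitting the sum.\<close>
        have each: "\<bar>R (Suc i) * (v k (Suc i) - v k i)\<bar> \<le> (if i < N then M * (8 / k) else 0) + e' * \<bar>v k (Suc i) - v k i\<bar>" for i
        proof (cases "i < N")
          case True
          have "\<bar>v k (Suc i) - v k i\<bar> \<le> 8 / k" using vk[of "Suc i"] vk[of i] by linarith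
          then have "\<bar>R (Suc i) * (v k (Suc i) - v k i)\<bar> \<le> M * (8 / k)"
            unfolding abs_mult using M by (intro mult_mono) auto
          moreover have "0 \<le> e' * \<bar>v k (Suc i) - v k i\<bar>" using \<open>e' > 0\<close> by simp
          ultimately show ?thesis using True by simp
        next
          case False
          then show ?thesis using N[of "Suc i"] by (simp add: abs_mult mult_right_mono)
        qed
        have "(\<Sum>i<n. \<bar>R (Suc i) * (v k (Suc i) - v k i)\<bar>)
            \<le> (\<Sum>i<n. (if i < N then M * (8 / k) else 0) + e' * \<bar>v k (Suc i) - v k i\<bar>)"
          by (intro sum_mono each)
        also have "\<dots> = (\<Sum>i<n. if i < N then M * (8 / k) else 0) + e' * (\<Sum>i<n. \<bar>v k (Suc i) - v k i\<bar>)"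
          by (simp add: sum.distrib sum_distrib_left)
        also have "(\<Sum>i<n. if i < N then M * (8 / k) else 0) \<le> real N * (M * (8 / k))"
        proof -
          have "(\<Sum>i<n. if i < N then M * (8 / k) else 0) = real (card ({..<n} \<inter> {i. i < N})) * (M * (8 / k))"
            by (simp add: sum.If_cases)
          also have "\<dots> \<le> real N * (M * (8 / k))"
          proof (rule mult_right_mono)
            have "card ({..<n} \<inter> {i. i < N}) \<le> card {..<N}" by (rule card_mono) auto
            then show "real (card ({..<n} \<inter> {i. i < N})) \<le> real N" by simp
          qed (use M k1 in auto)
          finally show ?thesis .
        qed
        also have "e' * (\<Sum>i<n. \<bar>v k (Suc i) - v k i\<bar>) \<le> e' * 12"
          using tv[of k n] \<open>e' > 0\<close> by (intro mult_left_mono) auto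
        finally show "(\<Sum>i<n. \<bar>R (Suc i) * (v k (Suc i) - v k i)\<bar>) \<le> 2 * real N * M * (4 / k) + e' * 12"
          by (simp add: mult_ac)
      qed
      finally have 1: "\<bar>\<Sum>n. R (Suc n) * (v k (Suc n) - v k n)\<bar> \<le> 2 * real N * M * (4 / k) + e' * 12" .
      have 2: "\<bar>R 0 * v k 0\<bar> \<le> M * (4 / k)"
        unfolding abs_mult using M vk[of 0] by (intro mult_mono) auto
      have 3: "M * (4 / k) + 2 * real N * M * (4 / k) = L * (4 / k)" by (simp add: L_def algebra_simps)
      have 4: "L * (4 / k) \<le> e / 2" using k1 e by (simp add: field_simps)
      have 5: "e' * 12 = e / 2" by (simp add: e'_def)
      show ?thesis unfolding lam using abs_triangle_ineq[of "R 0 * v k 0" "\<Sum>n. R (Suc n) * (v k (Suc n) - v k n)"] 1 2 3 4 5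
        by linarith
    qed
    then show ?thesis by blast
  qed
qed

section \<open>The linearized KdV travelling wave operator\<close>

text \<open>Quadratic decay gives membership in L1 and L2 and vanishing at both ends at once, and is
  easier to propagate than the exponential decay that the concrete functions have.\<close>

definition decays :: "real \<Rightarrow> (real \<Rightarrow> real) \<Rightarrow> bool" where
  "decays C f \<longleftrightarrow> (\<forall>x. isCont f x) \<and> (\<forall>x. \<bar>f x\<bar> \<le> C / (1 + x\<^sup>2))"

lemma one_plus_sq_pos: "0 < 1 + (x::real)\<^sup>2" by (simp add: add_pos_nonneg)

lemma decaysD:
  assumes "decays C f"
  shows "isCont f x" "\<bar>f x\<bar> \<le> C / (1 + x\<^sup>2)" "f \<in> borel_measurable borel" "integrable lborel f"
    "square_integrable f" "(f \<longlongrightarrow> 0) at_top" "(f \<longlongrightarrow> 0) at_bot" "0 \<le> C" "\<bar>f x\<bar> \<le> C"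
    "norm (cls f) \<le> C * norm (cls (\<lambda>x. 1 / (1 + x\<^sup>2)))"
proof -
  have c: "isCont f x" and b: "\<bar>f x\<bar> \<le> C / (1 + x\<^sup>2)" for x using assms by (auto simp: decays_def)
  show "isCont f x" "\<bar>f x\<bar> \<le> C / (1 + x\<^sup>2)" by (rule c, rule b)
  show m [measurable]: "f \<in> borel_measurable borel"
    by (intro borel_measurable_continuous_onI continuous_at_imp_continuous_on ballI c)
  show C: "0 \<le> C" using b[of 0] by simp
  have "C / (1 + x\<^sup>2) \<le> C / 1" using C by (intro divide_left_mono) (auto simp: one_plus_sq_pos)
  then show bC: "\<bar>f x\<bar> \<le> C" using b[of x] by simp
  have bd: "AE x in lborel. \<bar>f x\<bar> \<le> C * \<bar>1 / (1 + x\<^sup>2)\<bar>" using b one_plus_sq_pos by (auto simp: abs_of_pos)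
  show "integrable lborel f"
  proof (rule Bochner_Integration.integrable_bound)
    show "integrable lborel (\<lambda>x. C * (1 / (1 + x\<^sup>2)))" by (intro integrable_mult_right integrable_inverse_square)
    show "AE x in lborel. norm (f x) \<le> norm (C * (1 / (1 + x\<^sup>2)))" using bd C by (simp add: abs_mult)
  qed measurable
  show sq: "square_integrable f"
    by (rule square_integrable_bound[OF square_integrable_cmult[OF square_integrable_inverse_square, of C] m])
       (use bd C in \<open>simp add: abs_mult\<close>)
  show "norm (cls f) \<le> C * norm (cls (\<lambda>x. 1 / (1 + x\<^sup>2)))"
    by (rule norm_cls_le[OF sq square_integrable_inverse_square C bd])
  have lt: "((\<lambda>x::real. 1 / (1 + x\<^sup>2)) \<longlongrightarrow> 0) at_top"
    by (intro tendsto_divide_0[OF tendsto_const] filterlim_at_top_imp_at_infinity filterlim_tendsto_add_at_top[OF tendsto_const] filterlim_pow_at_top filterlim_ident) auto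
  have lb: "((\<lambda>x::real. 1 / (1 + x\<^sup>2)) \<longlongrightarrow> 0) at_bot"
    unfolding filterlim_at_bot_mirror using lt by simp
  have ev: "norm (f x) \<le> norm (1 / (1 + x\<^sup>2)) * C" for x
    using b[of x] one_plus_sq_pos[of x] by (simp add: abs_of_pos)
  show "(f \<longlongrightarrow> 0) at_top" by (rule tendsto_0_le[OF lt, where K=C]) (intro always_eventually allI ev)
  show "(f \<longlongrightarrow> 0) at_bot" by (rule tendsto_0_le[OF lb, where K=C]) (intro always_eventually allI ev)
qed

lemma decaysI: "(\<And>x. isCont f x) \<Longrightarrow> (\<And>x. \<bar>f x\<bar> \<le> C / (1 + x\<^sup>2)) \<Longrightarrow> decays C f"
  by (simp add: decays_def)

lemma decays_mult_bounded:
  assumes "decays C f" "\<And>x. isCont g x" "\<And>x. \<bar>g x\<bar> \<le> B"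
  shows "decays (C * B) (\<lambda>x. f x * g x)"
proof (rule decaysI)
  fix x
  show "isCont (\<lambda>x. f x * g x) x" using assms decaysD(1) by (intro isCont_mult) auto
  have "\<bar>f x * g x\<bar> \<le> C / (1 + x\<^sup>2) * B"
    unfolding abs_mult using assms decaysD(2,8)[OF assms(1)] one_plus_sq_pos[of x] by (intro mult_mono) auto
  then show "\<bar>f x * g x\<bar> \<le> C * B / (1 + x\<^sup>2)" by simp
qed

lemma decays_add: "decays C f \<Longrightarrow> decays D g \<Longrightarrow> decays (C + D) (\<lambda>x. f x + g x)"
  unfolding decays_def by (auto simp: add_divide_distrib intro!: continuous_intros order_trans[OF abs_triangle_ineq] add_mono)

lemma decays_cmult: "decays C f \<Longrightarrow> decays (\<bar>a\<bar> * C) (\<lambda>x. a * f x)"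
  unfolding decays_def by (auto simp: abs_mult mult_left_mono intro!: continuous_intros simp flip: times_divide_eq_right)

lemma continuous_AE_eq:
  fixes f g :: "real \<Rightarrow> real"
  assumes "\<And>x. isCont f x" "\<And>x. isCont g x" "AE x in lborel. f x = g x"
  shows "f x = g x"
proof (rule ccontr)
  assume ne: "f x \<noteq> g x"
  have "isCont (\<lambda>y. f y - g y) x" using assms by (intro continuous_intros) auto
  moreover have "f x - g x \<noteq> 0" using ne by simp
  ultimately obtain d where d: "d > 0" "\<And>y. \<bar>x - y\<bar> < d \<Longrightarrow> f y - g y \<noteq> 0"
    using continuous_at_avoid[of x "\<lambda>y. f y - g y" 0] by (auto simp: dist_real_def)
  have "AE y in lborel. y \<notin> {x..x + d / 2}"
    using assms(3) by eventually_elim (use d in force)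
  then have "emeasure lborel {x..x + d / 2} = 0"
    by (subst (asm) AE_iff_measurable[of "{x..x + d / 2}"]) auto
  then show False using d(1) by simp
qed

definition omi2 :: "real \<Rightarrow> real" where "omi2 k = 1 / (1 + k\<^sup>2)"

text \<open>The equation \<open>Y'' = Y - f\<close> transforms into
  \<open>(1 + k\<^sup>2) * hart Y k = hart f k\<close>. Classical decaying solutions are thereby
  identified with the image of \<open>f\<close> under two factors \<open>1 / om\<close>, one written
  out and one contained in \<open>emb\<close>.\<close>

lemma bvp_emb:
  assumes Y: "decays C Y" and Y': "decays C' Y'" and f: "decays D f"
    and D1: "\<And>x. DERIV Y x :> Y' x" and D2: "\<And>x. DERIV Y' x :> Y x - f x"
  shows "emb (mul (\<lambda>k. 1 / om k) (Hartley (cls f))) x = Y x"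
proof -
  have d3: "decays (C + \<bar>-1\<bar> * D) (\<lambda>x. Y x + (-1) * f x)" by (intro decays_add decays_cmult Y f)
  then have d3: "decays (C + D) (\<lambda>x. Y x - f x)" by simp
  have h1: "hart Y' k = - k * hart Y (- k)" for k
    by (rule hart_derivative) (use decaysD[OF Y] decaysD[OF Y'] D1 in auto)
  have h2: "hart (\<lambda>x. Y x - f x) k = - k * hart Y' (- k)" for k
    by (rule hart_derivative) (use decaysD[OF Y'] decaysD[OF d3] D2 in auto)
  have "hart (\<lambda>x. Y x - f x) k = hart Y k - hart f k" for k
    by (rule hart_diff) (use decaysD[OF Y] decaysD[OF f] in auto)
  then have hf: "hart f k = (1 + k\<^sup>2) * hart Y k" for k
  proof -
    assume hd: "\<And>k. hart (\<lambda>x. Y x - f x) k = hart Y k - hart f k"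
    have "hart (\<lambda>x. Y x - f x) k = - (k * (k * hart Y k))" using h2[of k] h1[of "-k"] by simp
    moreover have "(1 + k\<^sup>2) * hart Y k = hart Y k + k * (k * hart Y k)" by (simp add: power2_eq_square algebra_simps)
    ultimately show ?thesis using hd[of k] by linarith
  qed
  note HY = Hartley_cls[OF decaysD(5,4)[OF Y]] and Hf = Hartley_cls[OF decaysD(5,4)[OF f]]
  let ?z = "mul (\<lambda>k. 1 / om k) (Hartley (cls f))"
  have "cls (emb ?z) = Hartley (mul (\<lambda>k. 1 / om k * (1 / om k)) (cls (hart f)))"
    unfolding cls_emb mul_mul[OF bounded_by_inverse_om bounded_by_inverse_om] Hf(2) ..
  also have "mul (\<lambda>k. 1 / om k * (1 / om k)) (cls (hart f)) = cls (\<lambda>k. 1 / om k * (1 / om k) * hart f k)"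
    by (rule mul_cls[OF bounded_by_mult[OF bounded_by_inverse_om bounded_by_inverse_om] Hf(1)])
  also have "(\<lambda>k. 1 / om k * (1 / om k) * hart f k) = hart Y"
  proof
    fix k
    have "hart f k = (om k * om k) * hart Y k" using om_sq[of k] by (simp add: hf power2_eq_square)
    then show "1 / om k * (1 / om k) * hart f k = hart Y k" by simp
  qed
  also have "cls (hart Y) = Hartley (cls Y)" using HY by simp
  finally have "cls (emb ?z) = cls Y" by simp
  then have "AE x in lborel. emb ?z x = Y x" using cls_eq_iff[OF sqi_emb decaysD(5)[OF Y]] by simp
  then show ?thesis by (rule continuous_AE_eq[OF isCont_emb decaysD(1)[OF Y]])
qed

section \<open>The soliton and the explicit solutions of the linearized equation\<close>

definition ch :: "real \<Rightarrow> real" where "ch x = cosh (x / 2)"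
definition sh :: "real \<Rightarrow> real" where "sh x = sinh (x / 2)"

lemma DERIV_ch: "DERIV ch x :> sh x / 2" and DERIV_sh: "DERIV sh x :> ch x / 2"
  unfolding ch_def[abs_def] sh_def[abs_def] by (auto intro!: derivative_eq_intros)

lemma ch_sq: "(ch x)\<^sup>2 = 1 + (sh x)\<^sup>2" unfolding ch_def sh_def using cosh_square_eq[of "x / 2"] by simp
lemma ch_pos: "ch x > 0" by (simp add: ch_def cosh_real_pos)
lemma ch_ge_1: "ch x \<ge> 1" by (simp add: ch_def cosh_real_ge_1)
lemma abs_sh_le: "\<bar>sh x\<bar> \<le> ch x"
proof -
  have "(sh x)\<^sup>2 \<le> (ch x)\<^sup>2" by (simp add: ch_sq)
  then show ?thesis using abs_le_square_iff[of "sh x" "ch x"] ch_pos[of x] by simp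
qed
lemma ch_minus [simp]: "ch (- x) = ch x" and sh_minus [simp]: "sh (- x) = - sh x" by (simp_all add: ch_def sh_def)

lemma ch_sq_ge: "exp x \<le> 4 * (ch x)\<^sup>2"
proof -
  have "exp (x / 2) \<le> 2 * ch x" by (simp add: ch_def cosh_field_def)
  then have "exp (x / 2) * exp (x / 2) \<le> (2 * ch x) * (2 * ch x)" by (intro mult_mono) (auto intro: less_imp_le[OF ch_pos])
  then show ?thesis by (simp add: power2_eq_square flip: exp_add)
qed

lemma ch_sq_le: "x \<ge> 0 \<Longrightarrow> (ch x)\<^sup>2 \<le> exp x"
proof -
  assume "x \<ge> 0"
  then have "ch x \<le> exp (x / 2)" by (simp add: ch_def cosh_field_def)
  then have "ch x * ch x \<le> exp (x / 2) * exp (x / 2)" by (intro mult_mono) (auto intro: less_imp_le[OF ch_pos])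
  then show ?thesis by (simp add: power2_eq_square flip: exp_add)
qed

lemma inverse_ch_sq: "1 / (ch x)\<^sup>2 \<le> 4 * exp (- x)"
  using ch_sq_ge[of x] ch_pos[of x] by (simp add: exp_minus field_simps)

text \<open>From \<open>(1 + x / 3) ^ 3 \<le> exp x\<close>; the factor 27 clears the
  denominators.\<close>

lemma exp_decay:
  fixes x :: real
  assumes "x \<ge> 0"
  shows "exp (- x) * (1 + x) \<le> 27 / (1 + x\<^sup>2)"
proof -
  have "1 + x / 3 \<le> exp (x / 3)" by (rule exp_ge_add_one_self)
  then have "(1 + x / 3) ^ 3 \<le> exp (x / 3) ^ 3" using assms by (intro power_mono) auto
  also have "exp (x / 3) ^ 3 = exp x" by (simp flip: exp_of_nat_mult)
  finally have e: "(1 + x / 3) ^ 3 \<le> exp x" .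
  have "(1 + x) * (1 + x\<^sup>2) \<le> 27 * (1 + x / 3) ^ 3"
  proof -
    have "(1 + x) * (1 + x\<^sup>2) = 1 + x + x\<^sup>2 + x ^ 3" by (simp add: power3_eq_cube power2_eq_square algebra_simps)
    moreover have "27 * (1 + x / 3) ^ 3 = 27 + 27 * x + 9 * x\<^sup>2 + x ^ 3"
      by (simp add: power3_eq_cube power2_eq_square field_simps)
    ultimately show ?thesis using assms zero_le_power2[of x] by linarith
  qed
  also have "\<dots> \<le> 27 * exp x" using e by simp
  finally show ?thesis using one_plus_sq_pos[of x] by (simp add: exp_minus field_simps)
qed

lemma exp_decay': "x \<ge> 0 \<Longrightarrow> exp (- x) \<le> 27 / (1 + x\<^sup>2)" for x :: real
  by (rule order_trans[OF _ exp_decay]) simp_all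

lemma inverse_ch_sq_decay: "1 / (ch x)\<^sup>2 \<le> 108 / (1 + x\<^sup>2)"
proof (cases "x \<ge> 0")
  case True then show ?thesis using inverse_ch_sq[of x] exp_decay'[of x] by simp
next
  case False then show ?thesis using inverse_ch_sq[of "-x"] exp_decay'[of "-x"] by simp
qed

text \<open>\<open>soliton\<close> is the even homoclinic solution of \<open>u'' = u - u\<^sup>2\<close>; \<open>hom1\<close> is a multiple of
  its derivative, and \<open>hom2\<close> is the second solution of \<open>v'' = (1 - 2 u) v\<close>, obtained from
  \<open>hom1\<close> by reduction of order, with Wronskian \<open>1/2\<close>.\<close>

definition soliton :: "real \<Rightarrow> real" where "soliton x = 3 / 2 / (ch x)\<^sup>2"
definition hom1 :: "real \<Rightarrow> real" where "hom1 x = sh x / (ch x) ^ 3"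
definition hom1' :: "real \<Rightarrow> real" where "hom1' x = (3 - 2 * (ch x)\<^sup>2) / (2 * (ch x) ^ 4)"
definition hom2 :: "real \<Rightarrow> real" where
  "hom2 x = 15 * x * sh x / (16 * (ch x) ^ 3) + (ch x)\<^sup>2 / 4 + 5 / 8 - 15 / (8 * (ch x)\<^sup>2)"
definition hom2' :: "real \<Rightarrow> real" where
  "hom2' x = 45 * sh x / (16 * (ch x) ^ 3) + 15 * x * (3 - 2 * (ch x)\<^sup>2) / (32 * (ch x) ^ 4) + ch x * sh x / 4"

lemma soliton_even [simp]: "soliton (- x) = soliton x" by (simp add: soliton_def)

lemma ch_neq_0 [simp]: "ch x \<noteq> 0" using ch_pos[of x] by simp

lemma hom_derivs:
  "DERIV soliton x :> - (3 / 2) * hom1 x"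
  "DERIV hom1 x :> hom1' x"
  "DERIV hom1' x :> (1 - 2 * soliton x) * hom1 x"
  "DERIV hom2 x :> hom2' x"
  "DERIV hom2' x :> (1 - 2 * soliton x) * hom2 x"
  "hom1 x * hom2' x - hom1' x * hom2 x = 1 / 2"
proof -
  note D = DERIV_ch DERIV_sh
  show "DERIV soliton x :> - (3 / 2) * hom1 x"
    unfolding soliton_def[abs_def] hom1_def
    apply (rule derivative_eq_intros refl D | simp)+
    apply (simp add: divide_simps)
    by algebra
  have s2: "sh x ^ 2 = ch x ^ 2 - 1" using ch_sq[of x] by simp
  show "DERIV hom1 x :> hom1' x"
    unfolding hom1_def[abs_def] hom1'_def
    apply (rule derivative_eq_intros refl D | simp)+
    apply (simp add: divide_simps)
    using s2 by algebra
  show "DERIV hom1' x :> (1 - 2 * soliton x) * hom1 x"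
    unfolding hom1'_def[abs_def] hom1_def soliton_def
    apply (rule derivative_eq_intros refl D | simp)+
    apply (simp add: divide_simps)
    by algebra
  show "DERIV hom2 x :> hom2' x"
    unfolding hom2_def[abs_def] hom2'_def
    apply (rule derivative_eq_intros refl D | simp)+
    apply (simp add: divide_simps)
    using s2 by algebra
  show "DERIV hom2' x :> (1 - 2 * soliton x) * hom2 x"
    unfolding hom2'_def[abs_def] hom2_def soliton_def
    apply (rule derivative_eq_intros refl D | simp)+
    apply (simp add: divide_simps)
    using s2 by algebra
  show "hom1 x * hom2' x - hom1' x * hom2 x = 1 / 2"
    unfolding hom1_def hom1'_def hom2_def hom2'_def
    apply (simp add: divide_simps)
    using s2 by algebra
qed

lemma soliton_nonneg: "0 \<le> soliton x" by (simp add: soliton_def)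

lemma soliton_le: "soliton x \<le> 6 * exp (- x)"
  using inverse_ch_sq[of x] by (simp add: soliton_def)

lemma isCont_soliton: "isCont soliton x" and isCont_hom1: "isCont hom1 x" and isCont_hom2: "isCont hom2 x"
  using DERIV_isCont hom_derivs by blast+

lemma decays_soliton: "decays 162 soliton"
proof (rule decaysI[OF isCont_soliton])
  fix x
  have "soliton x \<le> 3 / 2 * (108 / (1 + x\<^sup>2))"
    using mult_left_mono[OF inverse_ch_sq_decay[of x], of "3 / 2"] by (simp add: soliton_def)
  then show "\<bar>soliton x\<bar> \<le> 162 / (1 + x\<^sup>2)" by (simp add: soliton_nonneg)
qed

lemma soliton_bound: "\<bar>soliton x\<bar> \<le> 162" by (rule decaysD(9)[OF decays_soliton])

lemma hom1_le: "\<bar>hom1 x\<bar> \<le> 1 / (ch x)\<^sup>2"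
proof -
  have "\<bar>hom1 x\<bar> = \<bar>sh x\<bar> / (ch x) ^ 3" using ch_pos[of x] by (simp add: hom1_def)
  also have "\<dots> \<le> ch x / (ch x) ^ 3" using abs_sh_le ch_pos[of x] by (intro divide_right_mono) auto
  also have "\<dots> = 1 / (ch x)\<^sup>2" by (simp add: power3_eq_cube power2_eq_square)
  finally show ?thesis .
qed

lemma hom1'_le: "\<bar>hom1' x\<bar> \<le> 1 / (ch x)\<^sup>2"
proof -
  have "1 \<le> (ch x)\<^sup>2" using ch_ge_1[of x] by simp
  then have "\<bar>3 - 2 * (ch x)\<^sup>2\<bar> \<le> 2 * (ch x)\<^sup>2" by (simp add: abs_le_iff)
  then have "\<bar>3 - 2 * (ch x)\<^sup>2\<bar> / (2 * (ch x) ^ 4) \<le> 2 * (ch x)\<^sup>2 / (2 * (ch x) ^ 4)"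
    by (intro divide_right_mono) auto
  also have "\<dots> = 1 / (ch x)\<^sup>2" by (simp add: power4_eq_xxxx power2_eq_square)
  finally show ?thesis by (simp add: hom1'_def)
qed

lemma decays_hom1: "decays 108 hom1"
  by (rule decaysI[OF isCont_hom1]) (rule order_trans[OF hom1_le inverse_ch_sq_decay])

lemma decays_soliton_prod: "decays (162 * 162) (\<lambda>x. soliton x * soliton x)"
  by (rule decays_mult_bounded[OF decays_soliton isCont_soliton soliton_bound])

text \<open>The profile equation u - u'' = u^2 in encoded form: the soliton is recovered from its
  own square.\<close>

lemma emb_soliton: "emb (mul (\<lambda>k. 1 / om k) (Hartley (cls (\<lambda>x. soliton x * soliton x)))) x = soliton x"
proof (rule bvp_emb[OF decays_soliton decays_cmult[OF decays_hom1, of "- (3 / 2)"] decays_soliton_prod])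
  show "DERIV soliton x :> - (3 / 2) * hom1 x" for x by (rule hom_derivs)
  show "DERIV (\<lambda>x. - (3 / 2) * hom1 x) x :> soliton x - soliton x * soliton x" for x
  proof (rule DERIV_cong[OF DERIV_cmult[OF hom_derivs(2)]])
    show "- (3 / 2) * hom1' x = soliton x - soliton x * soliton x"
      unfolding hom1'_def soliton_def apply (simp add: divide_simps) by algebra
  qed
qed

text \<open>Two further orders of smoothness, now for the square of the soliton. They are what lets
  the residual of the limit profile reach the full order \<epsilon> powr \<sigma>.\<close>

lemma emb_soliton_sq:
  "\<exists>q. \<forall>x. emb (mul (\<lambda>k. 1 / om k) q) x = soliton x * soliton x"
proof -
  \<comment> \<open>This is v - v'' for v = u^2, computed from u'' = u - u^2 and its first integral
    u'^2 = u^2 - 2 u^3 / 3.\<close>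
  let ?f = "\<lambda>x. soliton x * soliton x * (10 / 3 * soliton x - 3)"
  have c: "isCont (\<lambda>x. 10 / 3 * soliton x - 3) x" for x by (intro continuous_intros isCont_soliton)
  have b: "\<bar>10 / 3 * soliton x - 3\<bar> \<le> 600" for x using soliton_bound[of x] by (simp add: abs_le_iff)
  have bs: "\<bar>2 * soliton x\<bar> \<le> 324" for x using soliton_bound[of x] by (simp add: abs_mult)
  have cs: "isCont (\<lambda>x. 2 * soliton x) x" for x by (intro continuous_intros isCont_soliton)
  have "emb (mul (\<lambda>k. 1 / om k) (Hartley (cls ?f))) x = soliton x * soliton x" for x
  proof (rule bvp_emb[OF decays_soliton_prod
        decays_mult_bounded[OF decays_cmult[OF decays_hom1, of "- (3 / 2)"] cs bs] decays_mult_bounded[OF decays_soliton_prod c b]])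
    show "DERIV (\<lambda>x. soliton x * soliton x) x :> - (3 / 2) * hom1 x * (2 * soliton x)" for x
      by (rule DERIV_cong[OF DERIV_mult[OF hom_derivs(1) hom_derivs(1)]]) simp
    show "DERIV (\<lambda>x. - (3 / 2) * hom1 x * (2 * soliton x)) x :> soliton x * soliton x - ?f x" for x
    proof (rule DERIV_cong[OF DERIV_mult[OF DERIV_cmult[OF hom_derivs(2)] DERIV_cmult[OF hom_derivs(1)]]])
      have s2: "sh x ^ 2 = ch x ^ 2 - 1" using ch_sq[of x] by simp
      show "- (3 / 2) * hom1' x * (2 * soliton x) + 2 * (- (3 / 2) * hom1 x) * (- (3 / 2) * hom1 x) = soliton x * soliton x - ?f x"
        unfolding hom1'_def hom1_def soliton_def apply (simp add: divide_simps) using s2 by algebra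
    qed
  qed
  then show ?thesis by blast
qed

lemma hom2_le: "x \<ge> 0 \<Longrightarrow> \<bar>hom2 x\<bar> \<le> 4 * exp x" and hom2'_le: "x \<ge> 0 \<Longrightarrow> \<bar>hom2' x\<bar> \<le> 4 * exp x"
proof -
  assume x: "x \<ge> 0"
  have c1: "1 \<le> (ch x)\<^sup>2" "(ch x)\<^sup>2 \<le> exp x" using ch_ge_1[of x] ch_sq_le[OF x] by simp_all
  have i1: "1 / (ch x)\<^sup>2 \<le> 1" "0 \<le> 1 / (ch x)\<^sup>2" using c1 by simp_all
  have xe: "x \<le> exp x" "1 \<le> exp x" using exp_ge_add_one_self[of x] x by linarith+
  have h1: "\<bar>hom1 x\<bar> \<le> 1" "\<bar>hom1' x\<bar> \<le> 1" using hom1_le[of x] hom1'_le[of x] i1 by linarith+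
  have "hom2 x = 15 / 16 * (x * hom1 x) + (ch x)\<^sup>2 / 4 + 5 / 8 - 15 / 8 * (1 / (ch x)\<^sup>2)"
    by (simp add: hom2_def hom1_def)
  moreover have "\<bar>x * hom1 x\<bar> \<le> x" using x h1 by (simp add: abs_mult mult_left_le)
  ultimately show "\<bar>hom2 x\<bar> \<le> 4 * exp x" using c1 i1 xe by (simp only: abs_le_iff) linarith
  have cs: "\<bar>ch x * sh x\<bar> \<le> (ch x)\<^sup>2"
    using abs_sh_le[of x] ch_pos[of x] by (simp add: abs_mult power2_eq_square)
  have "hom2' x = 45 / 16 * hom1 x + 15 / 16 * (x * hom1' x) + ch x * sh x / 4"
    by (simp add: hom2'_def hom1_def hom1'_def)
  moreover have "\<bar>x * hom1' x\<bar> \<le> x" using x h1 by (simp add: abs_mult mult_left_le)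
  ultimately show "\<bar>hom2' x\<bar> \<le> 4 * exp x" using c1 xe h1 cs by (simp only: abs_le_iff) linarith
qed

section \<open>Variation of constants for the linearized equation\<close>

lemma ex_antiderivative:
  fixes f :: "real \<Rightarrow> real"
  assumes c: "\<And>x. isCont f x"
  shows "\<exists>F. F 0 = 0 \<and> (\<forall>x. DERIV F x :> f x)"
proof -
  define F where "F u = (LBINT y=ereal 0..ereal u. f y)" for u :: real
  have "DERIV F x :> f x" for x
  proof -
    have "(at x within {min 0 (x - 1)..max 0 (x + 1)}) = at x" by (intro at_within_interior) auto
    moreover have "(F has_vector_derivative f x) (at x within {min 0 (x - 1)..max 0 (x + 1)})"
      unfolding F_def by (rule interval_integral_FTC2) (auto intro!: continuous_at_imp_continuous_on c)
    ultimately show ?thesis by (simp add: has_real_derivative_iff_has_vector_derivative)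
  qed
  moreover have "F 0 = 0" by (simp add: F_def)
  ultimately show ?thesis by blast
qed

lemma antiderivative_parity:
  fixes f :: "real \<Rightarrow> real"
  assumes F: "F 0 = 0" "\<And>x. DERIV F x :> f x" and f: "\<And>x. f (- x) = s * f x" and s: "s = 1 \<or> s = -1"
  shows "F (- x) = - s * F x"
proof -
  have "DERIV (\<lambda>x. F (- x) + s * F x) x :> 0" for x
  proof -
    have "DERIV (\<lambda>x. F (- x)) x :> f (- x) * (-1)"
      by (rule DERIV_chain2[OF F(2)]) (auto intro!: derivative_eq_intros)
    from DERIV_add[OF this DERIV_cmult[OF F(2), of s x]] show ?thesis by (simp add: f)
  qed
  then have "F (- x) + s * F x = F (- 0) + s * F 0" by (intro DERIV_isconst_all) auto
  then show ?thesis using F(1) by simp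
qed

text \<open>Monotone comparison with \<open>K / 2 * exp (- 2 * x)\<close> from both sides gives a
  Cauchy estimate. \<open>C - F x\<close> then plays the role of the improper integral of
  \<open>f\<close> from \<open>x\<close> to infinity.\<close>

lemma antiderivative_limit:
  fixes f :: "real \<Rightarrow> real"
  assumes D: "\<And>x. DERIV F x :> f x" and b: "\<And>x. x \<ge> 0 \<Longrightarrow> \<bar>f x\<bar> \<le> K * exp (- 2 * x)"
  shows "\<exists>C. \<forall>x\<ge>0. \<bar>C - F x\<bar> \<le> K * exp (- 2 * x)"
proof -
  have K: "K \<ge> 0" using b[of 0] by simp
  have E: "DERIV (\<lambda>x. K / 2 * exp (- 2 * x)) x :> - (K * exp (- 2 * x))" for x
    by (auto intro!: derivative_eq_intros)
  have diff: "\<bar>F y - F x\<bar> \<le> K * exp (- 2 * x)" if "0 \<le> x" "x \<le> y" for x y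
  proof -
    have "F x - K / 2 * exp (- 2 * x) \<le> F y - K / 2 * exp (- 2 * y)"
    proof (rule DERIV_nonneg_imp_nondecreasing[OF that(2)])
      fix t assume "x \<le> t"
      then show "\<exists>d. DERIV (\<lambda>x. F x - K / 2 * exp (- 2 * x)) t :> d \<and> 0 \<le> d"
        using DERIV_diff[OF D E, of t] b[of t] that by (intro exI[of _ "f t - - (K * exp (- 2 * t))"]) (auto simp: abs_le_iff)
    qed
    moreover have "F y + K / 2 * exp (- 2 * y) \<le> F x + K / 2 * exp (- 2 * x)"
    proof (rule DERIV_nonpos_imp_nonincreasing[OF that(2)])
      fix t assume "x \<le> t"
      then show "\<exists>d. DERIV (\<lambda>x. F x + K / 2 * exp (- 2 * x)) t :> d \<and> d \<le> 0"
        using DERIV_add[OF D E, of t] b[of t] that by (intro exI[of _ "f t + - (K * exp (- 2 * t))"]) (auto simp: abs_le_iff)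
    qed
    moreover have "0 \<le> K / 2 * exp (- 2 * y)" "0 \<le> K / 2 * exp (- 2 * x)" using K by simp_all
    ultimately show ?thesis unfolding abs_le_iff by linarith
  qed
  have e0: "(\<lambda>n. K * exp (- 2 * real n)) \<longlonglongrightarrow> 0"
  proof (rule tendsto_mult_right_zero, rule filterlim_compose[OF exp_at_bot])
    show "filterlim (\<lambda>n. - 2 * real n) at_bot sequentially"
      by (rule filterlim_tendsto_neg_mult_at_bot[OF tendsto_const _ filterlim_real_sequentially]) simp
  qed
  have "Cauchy (\<lambda>n. F (real n))"
  proof (rule CauchyI')
    fix e :: real assume "e > 0"
    from LIMSEQ_D[OF e0 this] obtain N where N: "\<And>n. n \<ge> N \<Longrightarrow> \<bar>K * exp (- 2 * real n)\<bar> < e" by auto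
    have "dist (F (real m)) (F (real n)) < e" if "m \<ge> N" "n > m" for m n
      using diff[of "real m" "real n"] N[OF that(1)] that by (simp add: dist_real_def abs_minus_commute)
    then show "\<exists>M. \<forall>m\<ge>M. \<forall>n>m. dist (F (real m)) (F (real n)) < e" by blast
  qed
  then obtain C where C: "(\<lambda>n. F (real n)) \<longlonglongrightarrow> C" using Cauchy_convergent convergent_def by blast
  have "\<bar>C - F x\<bar> \<le> K * exp (- 2 * x)" if "x \<ge> 0" for x
  proof (rule LIMSEQ_le_const2)
    show "(\<lambda>n. \<bar>F (real n) - F x\<bar>) \<longlonglongrightarrow> \<bar>C - F x\<bar>" by (intro tendsto_intros C)
    obtain N where "x \<le> real N" using real_arch_simple by blast
    then show "\<exists>N. \<forall>n\<ge>N. \<bar>F (real n) - F x\<bar> \<le> K * exp (- 2 * x)"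
      using diff[OF that] by (intro exI[of _ N]) auto
  qed
  then show ?thesis by blast
qed

text \<open>Variation of constants. The growing solution \<open>hom2\<close> is paired with a tail
  integral of order exp(-2x), the decaying solution \<open>hom1\<close> with an integral from 0 that
  grows at most linearly, so both products decay for x \<ge> 0. Parity then transfers the bounds to
  x < 0. The constant is 4 * 96 * 27.\<close>

lemma linearized_bvp:
  assumes Rc: "\<And>x. isCont R x" and Re: "\<And>x. R (- x) = R x" and Rb: "\<And>x. \<bar>R x\<bar> \<le> \<rho>"
  shows "\<exists>Z Z'. (\<forall>x. DERIV Z x :> Z' x) \<and> (\<forall>x. DERIV Z' x :> Z x - 2 * soliton x * (Z x + R x)) \<and>
      (\<forall>x. Z (- x) = Z x) \<and> decays (10368 * \<rho>) Z \<and> decays (10368 * \<rho>) Z'"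
proof -
  have \<rho>: "\<rho> \<ge> 0" using Rb[of 0] by simp
  \<comment> \<open>The factor 4 is the 2 of the equation divided by the Wronskian 1/2.\<close>
  define g1 where "g1 x = 4 * soliton x * R x * hom1 x" for x
  define g2 where "g2 x = 4 * soliton x * R x * hom2 x" for x
  have c1: "isCont g1 x" and c2: "isCont g2 x" for x
    unfolding g1_def g2_def by (intro continuous_intros isCont_soliton isCont_hom1 isCont_hom2 Rc)+
  obtain F1 where F1: "F1 0 = 0" "\<And>x. DERIV F1 x :> g1 x" using ex_antiderivative[OF c1] by blast
  obtain a where a: "a 0 = 0" "\<And>x. DERIV a x :> g2 x" using ex_antiderivative[OF c2] by blast
  have hom_par: "hom1 (- x) = - hom1 x" "hom2 (- x) = hom2 x" "hom1' (- x) = hom1' x" "hom2' (- x) = - hom2' x" for x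
    by (simp_all add: hom1_def hom2_def hom1'_def hom2'_def)
  have F1e: "F1 (- x) = F1 x" for x
    using antiderivative_parity[OF F1, of "-1" x] by (simp add: g1_def Re hom_par)
  have ao: "a (- x) = - a x" for x
    using antiderivative_parity[OF a, of 1 x] by (simp add: g2_def Re hom_par)
  have sR: "4 * soliton x * \<bar>R x\<bar> \<le> 24 * \<rho> * exp (- x)" for x
    using mult_mono[OF soliton_le[of x] Rb[of x]] by (simp add: mult_ac)
  have b1: "\<bar>g1 x\<bar> \<le> 96 * \<rho> * exp (- 2 * x)" if "x \<ge> 0" for x
  proof -
    have "\<bar>g1 x\<bar> = (4 * soliton x * \<bar>R x\<bar>) * \<bar>hom1 x\<bar>" by (simp add: g1_def abs_mult soliton_nonneg)
    also have "\<dots> \<le> (24 * \<rho> * exp (- x)) * (4 * exp (- x))"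
      by (rule mult_mono[OF sR order_trans[OF hom1_le inverse_ch_sq]]) (use \<rho> in auto)
    also have "\<dots> = 96 * \<rho> * exp (- 2 * x)" by (simp flip: exp_add)
    finally show ?thesis .
  qed
  have b2: "\<bar>g2 x\<bar> \<le> 96 * \<rho>" if "x \<ge> 0" for x
  proof -
    have "\<bar>g2 x\<bar> = (4 * soliton x * \<bar>R x\<bar>) * \<bar>hom2 x\<bar>" by (simp add: g2_def abs_mult soliton_nonneg)
    also have "\<dots> \<le> (24 * \<rho> * exp (- x)) * (4 * exp x)"
      by (rule mult_mono[OF sR hom2_le[OF that]]) (use \<rho> in auto)
    also have "\<dots> = 96 * \<rho>" by (simp add: exp_minus)
    finally show ?thesis .
  qed
  obtain C where C: "\<And>x. x \<ge> 0 \<Longrightarrow> \<bar>C - F1 x\<bar> \<le> 96 * \<rho> * exp (- 2 * x)"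
    using antiderivative_limit[OF F1(2) b1] by blast
  have ab: "\<bar>a x\<bar> \<le> 96 * \<rho> * x" if "x \<ge> 0" for x
  proof -
    have "a 0 - 96 * \<rho> * 0 \<ge> a x - 96 * \<rho> * x"
    proof (rule DERIV_nonpos_imp_nonincreasing[OF that])
      fix t :: real assume "0 \<le> t"
      have "DERIV (\<lambda>x. a x - 96 * \<rho> * x) t :> g2 t - 96 * \<rho>" by (auto intro!: derivative_eq_intros a)
      then show "\<exists>d. DERIV (\<lambda>x. a x - 96 * \<rho> * x) t :> d \<and> d \<le> 0"
        using b2[OF \<open>0 \<le> t\<close>] by (intro exI[of _ "g2 t - 96 * \<rho>"]) (auto simp: abs_le_iff)
    qed
    moreover have "a 0 + 96 * \<rho> * 0 \<le> a x + 96 * \<rho> * x"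
    proof (rule DERIV_nonneg_imp_nondecreasing[OF that])
      fix t :: real assume "0 \<le> t"
      have "DERIV (\<lambda>x. a x + 96 * \<rho> * x) t :> g2 t + 96 * \<rho>" by (auto intro!: derivative_eq_intros a)
      then show "\<exists>d. DERIV (\<lambda>x. a x + 96 * \<rho> * x) t :> d \<and> 0 \<le> d"
        using b2[OF \<open>0 \<le> t\<close>] by (intro exI[of _ "g2 t + 96 * \<rho>"]) (auto simp: abs_le_iff)
    qed
    ultimately show ?thesis using a(1) by (simp add: abs_le_iff)
  qed
  \<comment> \<open>Starting \<open>a\<close> at 0 makes it odd like \<open>hom1\<close>, while
    \<open>C - F1\<close> is even like \<open>hom2\<close>; hence \<open>Z\<close> is even. In the
    class of even functions the odd translation mode \<open>hom1\<close> cannot be added.\<close>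
  define Z where "Z x = hom1 x * a x + hom2 x * (C - F1 x)" for x
  define Z' where "Z' x = hom1' x * a x + hom2' x * (C - F1 x)" for x
  have DC: "DERIV (\<lambda>x. C - F1 x) x :> - g1 x" for x by (auto intro!: derivative_eq_intros F1)
  have D1: "DERIV Z x :> Z' x" for x
    unfolding Z_def[abs_def] Z'_def
    by (rule DERIV_cong[OF DERIV_add[OF DERIV_mult[OF hom_derivs(2) a(2)] DERIV_mult[OF hom_derivs(4) DC]]])
       (simp add: g1_def g2_def algebra_simps)
  have D2: "DERIV Z' x :> Z x - 2 * soliton x * (Z x + R x)" for x
  proof -
    have w: "hom1' x * hom2 x - hom2' x * hom1 x = - (1 / 2)" using hom_derivs(6)[of x] by (simp add: mult.commute)
    have "DERIV Z' x :> (1 - 2 * soliton x) * hom1 x * a x + g2 x * hom1' x + ((1 - 2 * soliton x) * hom2 x * (C - F1 x) + - g1 x * hom2' x)"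
      unfolding Z'_def[abs_def] by (rule DERIV_add[OF DERIV_mult[OF hom_derivs(3) a(2)] DERIV_mult[OF hom_derivs(5) DC]])
    also have "(1 - 2 * soliton x) * hom1 x * a x + g2 x * hom1' x + ((1 - 2 * soliton x) * hom2 x * (C - F1 x) + - g1 x * hom2' x)
        = (1 - 2 * soliton x) * Z x + 4 * soliton x * R x * (hom1' x * hom2 x - hom2' x * hom1 x)"
      by (simp add: Z_def g1_def g2_def algebra_simps)
    also have "\<dots> = Z x - 2 * soliton x * (Z x + R x)" unfolding w by (simp add: algebra_simps)
    finally show ?thesis .
  qed
  have Ze: "Z (- x) = Z x" and Z'o: "Z' (- x) = - Z' x" for x by (simp_all add: Z_def Z'_def ao F1e hom_par)
  have bound: "\<bar>h1 * a x + h2 * (C - F1 x)\<bar> \<le> 10368 * \<rho> / (1 + x\<^sup>2)"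
    if x: "x \<ge> 0" and h: "\<bar>h1\<bar> \<le> 4 * exp (- x)" "\<bar>h2\<bar> \<le> 4 * exp x" for h1 h2 x
  proof -
    have "\<bar>h1 * a x\<bar> \<le> 4 * exp (- x) * (96 * \<rho> * x)"
      unfolding abs_mult using h ab[OF x] by (intro mult_mono) auto
    moreover have "\<bar>h2 * (C - F1 x)\<bar> \<le> 4 * exp x * (96 * \<rho> * exp (- 2 * x))"
      unfolding abs_mult using h C[OF x] by (intro mult_mono) auto
    moreover have "4 * exp x * (96 * \<rho> * exp (- 2 * x)) = 384 * \<rho> * exp (- x)" by (simp flip: exp_add)
    moreover have "384 * \<rho> * (exp (- x) * (1 + x)) = 4 * exp (- x) * (96 * \<rho> * x) + 384 * \<rho> * exp (- x)"
      by (simp add: algebra_simps)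
    moreover have "\<bar>h1 * a x + h2 * (C - F1 x)\<bar> \<le> \<bar>h1 * a x\<bar> + \<bar>h2 * (C - F1 x)\<bar>" by (rule abs_triangle_ineq)
    ultimately have "\<bar>h1 * a x + h2 * (C - F1 x)\<bar> \<le> 384 * \<rho> * (exp (- x) * (1 + x))"
      by linarith
    also have "\<dots> \<le> 384 * \<rho> * (27 / (1 + x\<^sup>2))" using exp_decay[OF x] \<rho> by (intro mult_left_mono) auto
    finally show ?thesis by simp
  qed
  have Zb: "\<bar>Z x\<bar> \<le> 10368 * \<rho> / (1 + x\<^sup>2)" "\<bar>Z' x\<bar> \<le> 10368 * \<rho> / (1 + x\<^sup>2)" if "x \<ge> 0" for x
    unfolding Z_def Z'_def
    by (rule bound[OF that order_trans[OF hom1_le inverse_ch_sq] hom2_le[OF that]]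
             bound[OF that order_trans[OF hom1'_le inverse_ch_sq] hom2'_le[OF that]])+
  have Zb': "\<bar>Z x\<bar> \<le> 10368 * \<rho> / (1 + x\<^sup>2)" "\<bar>Z' x\<bar> \<le> 10368 * \<rho> / (1 + x\<^sup>2)" for x
    using Zb[of x] Zb[of "-x"] by (cases "x \<ge> 0"; simp add: Ze Z'o)+
  have "decays (10368 * \<rho>) Z" "decays (10368 * \<rho>) Z'"
    by (auto intro!: decaysI Zb' DERIV_isCont[OF D1] DERIV_isCont[OF D2])
  with D1 D2 Ze show ?thesis by blast
qed

text \<open>The linearization at the limit profile of the limiting fixed point map, written for
  encodings. The weights \<open>1 / om\<close> stand on both sides of the multiplication by
  \<open>2 * soliton\<close>, one of them inside \<open>emb\<close>, which makes the operator
  symmetric on L2.\<close>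

definition Kop :: "l2 \<Rightarrow> l2" where
  "Kop p = mul (\<lambda>k. 1 / om k) (Hartley (cls (\<lambda>x. 2 * soliton x * emb p x)))"

lemma sqi_soliton_mult: "square_integrable f \<Longrightarrow> square_integrable (\<lambda>x. 2 * soliton x * f x)"
  by (rule square_integrable_mult_bounded(1)[where C=324])
     (use soliton_bound decaysD(3)[OF decays_soliton] in \<open>auto simp: abs_mult\<close>)

lemma Kop_diff: "Kop (p - q) = Kop p - Kop q"
proof -
  have "(\<lambda>x. 2 * soliton x * emb (p - q) x) = (\<lambda>x. 2 * soliton x * emb p x - 2 * soliton x * emb q x)"
    by (simp add: emb_diff right_diff_distrib)
  then show ?thesis unfolding Kop_def
    by (simp add: cls_diff[symmetric] sqi_soliton_mult Hartley_diff mul_diff[OF bounded_by_inverse_om])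
qed

lemma Kop_symmetric: "inner (Kop p) q = inner p (Kop q)"
proof -
  have "inner (Kop p) q = (LINT x|lborel. 2 * soliton x * emb p x * emb q x)" for p q
  proof -
    have "inner (Kop p) q = inner (cls (\<lambda>x. 2 * soliton x * emb p x)) (cls (emb q))"
      unfolding Kop_def inner_mul[OF bounded_by_inverse_om] Hartley_symmetric cls_emb ..
    then show ?thesis by (simp add: inner_cls sqi_soliton_mult)
  qed
  from this[of p q] this[of q p] show ?thesis by (simp add: inner_commute mult_ac)
qed

lemma Kop_refl: "refl (Kop p) = Kop (refl p)"
proof -
  have "refl (cls (\<lambda>x. 2 * soliton x * emb p x)) = cls (\<lambda>x. 2 * soliton x * emb (refl p) x)"
    by (simp add: refl_cls sqi_soliton_mult emb_refl)
  then show ?thesis unfolding Kop_def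
    by (subst refl_mul[OF bounded_by_inverse_om]) (simp_all add: Hartley_refl[symmetric])
qed

text \<open>With \<open>p = q + z\<close> the equation becomes \<open>z = Kop (q + z)\<close>, which
  is the boundary value problem of \<open>linearized_bvp\<close> for \<open>R = emb q\<close>. Only
  the sup norm of \<open>emb q\<close> enters the bound on \<open>z\<close>, and \<open>Cinf\<close>
  controls it by the norm of \<open>q\<close>.\<close>

lemma Kop_solvable: "\<exists>C\<ge>0. \<forall>q. refl q = q \<longrightarrow> (\<exists>p. refl p = p \<and> p - Kop p = q \<and> norm p \<le> C * norm q)"
proof -
  define n1 where "n1 = norm (cls (\<lambda>x. 1 / (1 + x\<^sup>2)))"
  define C where "C = 1 + 162 * ((10368 * Cinf + Cinf) * 2) * n1"
  have "\<exists>p. refl p = p \<and> p - Kop p = q \<and> norm p \<le> C * norm q" if q: "refl q = q" for q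
  proof -
    define \<rho> where "\<rho> = Cinf * norm q"
    have \<rho>: "\<rho> \<ge> 0" by (simp add: \<rho>_def Cinf_nonneg)
    have Re: "emb q (- x) = emb q x" for x using emb_refl[of q x] q by simp
    obtain Z Z' where Z: "\<And>x. DERIV Z x :> Z' x" "\<And>x. DERIV Z' x :> Z x - 2 * soliton x * (Z x + emb q x)"
        "\<And>x. Z (- x) = Z x" "decays (10368 * \<rho>) Z" "decays (10368 * \<rho>) Z'"
      using linearized_bvp[OF isCont_emb Re emb_bound, folded \<rho>_def] by blast
    define f where "f x = soliton x * (2 * (Z x + emb q x))" for x
    have fb: "\<bar>2 * (Z x + emb q x)\<bar> \<le> (10368 * \<rho> + \<rho>) * 2" for x
      using decaysD(9)[OF Z(4), of x] emb_bound[of q x] by (simp add: \<rho>_def abs_le_iff)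
    have fd: "decays (162 * ((10368 * \<rho> + \<rho>) * 2)) f"
      unfolding f_def by (rule decays_mult_bounded[OF decays_soliton _ fb])
        (intro continuous_intros decaysD(1)[OF Z(4)] isCont_emb)
    define z where "z = mul (\<lambda>k. 1 / om k) (Hartley (cls f))"
    have ez: "emb z x = Z x" for x
      unfolding z_def by (rule bvp_emb[OF Z(4,5) fd Z(1)]) (use Z(2) in \<open>simp add: f_def mult_ac\<close>)
    have zr: "refl z = z" by (rule refl_eqI_emb) (simp add: ez Z(3))
    have Kz: "Kop (q + z) = z"
    proof -
      have "(\<lambda>x. 2 * soliton x * emb (q + z) x) = f"
        by (auto simp: f_def emb_add ez algebra_simps)
      then show ?thesis unfolding Kop_def z_def by (simp only:)
    qed
    have "norm z \<le> 1 * norm (cls f)"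
      unfolding z_def using norm_mul[OF bounded_by_inverse_om, of "Hartley (cls f)"] by simp
    also have "norm (cls f) \<le> 162 * ((10368 * \<rho> + \<rho>) * 2) * n1" unfolding n1_def by (rule decaysD(10)[OF fd])
    finally have "norm (q + z) \<le> norm q + 162 * ((10368 * \<rho> + \<rho>) * 2) * n1"
      using norm_triangle_ineq[of q z] by simp
    also have "\<dots> = C * norm q" by (simp add: C_def \<rho>_def algebra_simps)
    finally have "norm (q + z) \<le> C * norm q" .
    moreover have "refl (q + z) = q + z" by (simp add: refl_add q zr)
    ultimately show ?thesis using Kz by (intro exI[of _ "q + z"]) simp
  qed
  moreover have "C \<ge> 0" unfolding C_def n1_def using Cinf_nonneg by simp
  ultimately show ?thesis by blast
qed

definition CK :: real where
  "CK = (SOME C. C \<ge> 0 \<and> (\<forall>q. refl q = q \<longrightarrow> (\<exists>p. refl p = p \<and> p - Kop p = q \<and> norm p \<le> C * norm q)))"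

lemma CK_nonneg: "CK \<ge> 0"
  and Kop_solve: "refl q = q \<Longrightarrow> \<exists>p. refl p = p \<and> p - Kop p = q \<and> norm p \<le> CK * norm q"
  using someI_ex[OF Kop_solvable[unfolded Bex_def]] unfolding CK_def[symmetric] by auto

text \<open>By symmetry an element of the kernel is orthogonal to the range; the range contains
  every even element, in particular the given one.\<close>

lemma Kop_injective: "refl p = p \<Longrightarrow> p = Kop p \<Longrightarrow> p = 0"
proof -
  assume p: "refl p = p" "p = Kop p"
  obtain q where q: "q - Kop q = p" using Kop_solve[OF p(1)] by blast
  have "inner p p = inner p (q - Kop q)" using q by simp
  also have "\<dots> = inner p q - inner (Kop p) q" by (simp add: inner_diff_right Kop_symmetric)
  also have "\<dots> = 0" using p(2) by simp
  finally show ?thesis by simp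
qed

lemma Kop_bound:
  assumes p: "refl p = p"
  shows "norm p \<le> CK * norm (p - Kop p)"
proof -
  have "refl (p - Kop p) = p - Kop p" by (simp add: refl_diff Kop_refl p)
  from Kop_solve[OF this] obtain r where r: "refl r = r" "r - Kop r = p - Kop p" "norm r \<le> CK * norm (p - Kop p)" by blast
  have "r - p = Kop (r - p)" using r(2) by (simp add: Kop_diff algebra_simps)
  moreover have "refl (r - p) = r - p" by (simp add: refl_diff r(1) p)
  ultimately have "r - p = 0" by (rule Kop_injective[rotated])
  then show ?thesis using r(3) by simp
qed

section \<open>The fixed point equation\<close>

text \<open>The transform of the soliton is \<open>sol2\<close> divided by om^2 and
  \<open>sol4\<close> divided by om^4, as the numbers in the names indicate, while
  \<open>solp\<close> is its encoding, with a single factor \<open>om\<close> removed.\<close>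

definition sol2 :: l2 where "sol2 = Hartley (cls (\<lambda>x. soliton x * soliton x))"
definition solp :: l2 where "solp = mul (\<lambda>k. 1 / om k) sol2"
definition sol4 :: l2 where "sol4 = (SOME q. \<forall>x. emb (mul (\<lambda>k. 1 / om k) q) x = soliton x * soliton x)"

lemma emb_solp: "emb solp x = soliton x"
  unfolding solp_def sol2_def by (rule emb_soliton)

lemma emb_sol4: "emb (mul (\<lambda>k. 1 / om k) sol4) x = soliton x * soliton x"
  using someI_ex[OF emb_soliton_sq] unfolding sol4_def by blast

lemma sol2_sol4: "sol2 = mul (\<lambda>k. 1 / om k) (mul (\<lambda>k. 1 / om k) sol4)"
proof -
  have "cls (\<lambda>x. soliton x * soliton x) = cls (emb (mul (\<lambda>k. 1 / om k) sol4))"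
    by (simp add: emb_sol4[abs_def])
  then show ?thesis unfolding sol2_def by (simp add: cls_emb)
qed

lemma refl_solp: "refl solp = solp"
  by (rule refl_eqI_emb) (simp add: emb_solp)

lemma norm_triangle3:
  fixes x y z v :: "'a :: real_normed_vector"
  assumes "x = y + z + v" "norm y \<le> B" "norm z \<le> C"
  shows "norm x \<le> B + C + norm v"
  using norm_triangle_ineq[of "y + z" v] norm_triangle_ineq[of y z] assms(2,3) unfolding assms(1) by linarith

lemma Hartley_eq_iff: "Hartley x = Hartley y \<longleftrightarrow> x = y"
proof
  assume h: "Hartley x = Hartley y"
  have "Hartley (Hartley x) = Hartley (Hartley y)" by (simp only: h)
  then show "x = y" by (simp only: Hartley_Hartley)
qed simp

lemma summable_norm_mul:
  fixes f :: "nat \<Rightarrow> l2"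
  assumes "summable (\<lambda>n. norm (f n))" "bounded_by C a"
  shows "mul a (suminf f) = (\<Sum>n. mul a (f n))"
  by (rule bounded_linear.suminf[OF bounded_linear_mul[OF assms(2)] summable_norm_cancel[OF assms(1)]])

lemma norm_emb_mul_le:
  assumes "bounded_by C a" "bounded_by D (\<lambda>k. a k / om k)"
  shows "norm (cls (emb (mul a p))) \<le> D * norm p"
  using norm_mul[OF assms(2), of p] mul_mul[OF bounded_by_inverse_om assms(1), of p] by (simp add: cls_emb)

text \<open>Everything needed for one fixed \<epsilon>, with the potentials abstracted away.
  \<open>G n\<close> is the rescaled Taylor remainder of the force at distance m = n + 1 and
  \<open>G' n\<close> its derivative; \<open>bt n\<close> stands for \<beta> m^3,
  \<open>gm n\<close> for 6 \<gamma> m^4, and \<open>M\<close> bounds profiles in sup norm. In the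
  application \<open>C2\<close>, \<open>C3\<close>, \<open>C4\<close> are chosen before \<epsilon>.
  \<open>S2\<close> makes \<open>T\<close> well defined, \<open>S3\<close> serves arguments without
  extra smoothness, \<open>S4\<close> the smooth limit profile.\<close>

locale step =
  fixes \<epsilon> \<nu> M b \<sigma> C2 C3 C4 A :: real and a :: "real \<Rightarrow> real" and G G' :: "nat \<Rightarrow> real \<Rightarrow> real"
    and bt gm :: "nat \<Rightarrow> real"
  assumes eps: "0 < \<epsilon>" "\<epsilon> \<le> 1" and nu: "0 < \<nu>" and M: "0 < M" and epsM: "\<epsilon>\<^sup>2 * M \<le> 1"
    and b0: "b \<noteq> 0" and bsum: "bt sums b"
    and sigma: "0 < \<sigma>" "\<sigma> \<le> 2"
    and aA: "bounded_by A a" and a_ge: "\<And>k. \<nu> \<le> a k" and a_even: "\<And>k. a (- k) = a k"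
    and S2: "\<And>n k. om k * \<bar>sm (\<epsilon> * real (Suc n)) k\<bar> / a k \<le> C2"
    and S3: "\<And>n k. om k * \<bar>sm (\<epsilon> * real (Suc n)) k / a k - 1 / (\<nu> * (1 + k\<^sup>2))\<bar> \<le> C3 * \<epsilon> powr (\<sigma> / 2) * real (Suc n)"
    and S4: "\<And>n k. \<bar>sm (\<epsilon> * real (Suc n)) k / a k - 1 / (\<nu> * (1 + k\<^sup>2))\<bar> \<le> C4 * \<epsilon> powr \<sigma> * (real (Suc n))\<^sup>2"
    and G0: "\<And>n. G n 0 = 0" "\<And>n. G' n 0 = 0"
    and GD: "\<And>n s. \<bar>s\<bar> \<le> M \<Longrightarrow> (G n has_real_derivative G' n s) (at s within {-M..M})"
    and G1: "\<And>n s. \<bar>s\<bar> \<le> M \<Longrightarrow> \<bar>G' n s - 2 * bt n * s\<bar> \<le> gm n * \<epsilon>\<^sup>2 * M\<^sup>2"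
    and G2: "\<And>n s t. \<bar>s\<bar> \<le> M \<Longrightarrow> \<bar>t\<bar> \<le> M \<Longrightarrow> \<bar>G' n s - G' n t\<bar> \<le> (2 * \<bar>bt n\<bar> + gm n) * \<bar>s - t\<bar>"
    and gm_nonneg: "\<And>n. 0 \<le> gm n" and gm_sum: "summable gm" and bt_sum: "summable (\<lambda>n. \<bar>bt n\<bar> * (real (Suc n))\<^sup>2)"
begin

definition h :: "nat \<Rightarrow> real" where "h n = \<epsilon> * real (Suc n)"
definition d :: "nat \<Rightarrow> real" where "d n = 2 * \<bar>bt n\<bar> + gm n"
definition inM :: "l2 \<Rightarrow> bool" where "inM p \<longleftrightarrow> Cinf * norm p \<le> M"
definition u :: "nat \<Rightarrow> l2 \<Rightarrow> real \<Rightarrow> real" where "u n p = emb (mul (sm (h n)) p)"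
definition N :: "nat \<Rightarrow> l2 \<Rightarrow> real \<Rightarrow> real" where "N n p x = G n (u n p x)"
text \<open>The transform of the profile is \<open>p\<close> divided by \<open>om\<close>, so
  solving the equation for the encoding multiplies the symbol \<open>sm / a\<close> by
  \<open>om\<close>.\<close>

definition om_symb :: "nat \<Rightarrow> real \<Rightarrow> real" where "om_symb n k = om k * sm (h n) k / a k"
definition T :: "l2 \<Rightarrow> l2" where "T p = (\<Sum>n. mul (om_symb n) (Hartley (cls (N n p))))"

lemma h_pos: "0 < h n" using eps by (simp add: h_def)

lemma a_pos: "0 < a k" using a_ge[of k] nu by linarith

lemma a_measurable [measurable]: "a \<in> borel_measurable borel" using aA by (simp add: bounded_by_def)

lemma bt_le: "\<bar>bt n\<bar> * real (Suc n) \<le> \<bar>bt n\<bar> * (real (Suc n))\<^sup>2" "\<bar>bt n\<bar> \<le> \<bar>bt n\<bar> * (real (Suc n))\<^sup>2"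
proof -
  have 1: "1 \<le> real (Suc n)" by simp
  then have "real (Suc n) * 1 \<le> real (Suc n) * real (Suc n)" by (intro mult_left_mono) auto
  then have 2: "real (Suc n) \<le> (real (Suc n))\<^sup>2" by (simp add: power2_eq_square)
  then show "\<bar>bt n\<bar> * real (Suc n) \<le> \<bar>bt n\<bar> * (real (Suc n))\<^sup>2" by (intro mult_left_mono) auto
  have "\<bar>bt n\<bar> * 1 \<le> \<bar>bt n\<bar> * (real (Suc n))\<^sup>2" using 1 2 by (intro mult_left_mono) linarith+
  then show "\<bar>bt n\<bar> \<le> \<bar>bt n\<bar> * (real (Suc n))\<^sup>2" by simp
qed

lemma summable_bt: "summable (\<lambda>n. \<bar>bt n\<bar> * real (Suc n))" "summable (\<lambda>n. \<bar>bt n\<bar>)"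
  by (rule summable_comparison_test'[OF bt_sum]; use bt_le in \<open>simp add: abs_mult del: of_nat_Suc\<close>)+

lemma summable_d: "summable d"
  unfolding d_def using summable_bt(2) gm_sum by (intro summable_add summable_mult)

lemma d_nonneg: "0 \<le> d n" using gm_nonneg[of n] by (simp add: d_def)

lemma u_bound: "inM p \<Longrightarrow> \<bar>u n p x\<bar> \<le> M"
proof -
  assume "inM p"
  have "\<bar>u n p x\<bar> \<le> Cinf * norm (mul (sm (h n)) p)" unfolding u_def by (rule emb_bound)
  also have "\<dots> \<le> Cinf * norm p"
    using norm_mul[OF bounded_by_sm, of "h n" p] Cinf_nonneg by (intro mult_left_mono) auto
  finally show ?thesis using \<open>inM p\<close> by (simp add: inM_def)
qed

lemma u_avg: "avg (h n) (emb p) x = u n p x"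
  unfolding u_def by (rule avg_emb[OF h_pos])

lemma isCont_u: "isCont (u n p) x" unfolding u_def by (rule isCont_emb)
lemma sqi_u: "square_integrable (u n p)" unfolding u_def by simp
lemma norm_u: "norm (cls (u n p)) \<le> norm p"
  unfolding u_def using norm_emb[of "mul (sm (h n)) p"] norm_mul[OF bounded_by_sm, of "h n" p] by simp

lemma u_diff: "u n (p - q) x = u n p x - u n q x"
  by (simp add: u_def mul_diff[OF bounded_by_sm] emb_diff)

lemma G_affine:
  assumes s: "\<bar>s\<bar> \<le> M" "\<bar>t\<bar> \<le> M" and K: "\<And>z. z \<in> closed_segment s t \<Longrightarrow> \<bar>G' n z - c\<bar> \<le> K"
  shows "\<bar>G n s - G n t - c * (s - t)\<bar> \<le> K * \<bar>s - t\<bar>"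
proof -
  have sub: "closed_segment s t \<subseteq> {-M..M}"
    using s by (auto simp: closed_segment_eq_real_ivl abs_le_iff)
  have "norm ((\<lambda>z. G n z - c * z) s - (\<lambda>z. G n z - c * z) t) \<le> K * norm (s - t)"
  proof (rule field_differentiable_bound[where S="closed_segment s t"])
    fix z assume z: "z \<in> closed_segment s t"
    then have "\<bar>z\<bar> \<le> M" using sub by (auto simp: abs_le_iff)
    then have "(G n has_real_derivative G' n z) (at z within closed_segment s t)"
      using DERIV_subset[OF GD sub] by blast
    moreover have "((\<lambda>z. c * z) has_real_derivative c) (at z within closed_segment s t)"
      by (auto intro!: derivative_eq_intros)
    ultimately show "((\<lambda>z. G n z - c * z) has_real_derivative G' n z - c) (at z within closed_segment s t)"
      by (rule DERIV_diff)
    show "norm (G' n z - c) \<le> K" using K[OF z] by simp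
  qed auto
  then show ?thesis by (simp add: right_diff_distrib algebra_simps)
qed

lemma G'_le: "\<bar>s\<bar> \<le> M \<Longrightarrow> \<bar>G' n s\<bar> \<le> d n * \<bar>s\<bar>"
  using G2[of s 0 n] M by (simp add: G0 d_def)

lemma segment_bound:
  fixes s t z c :: real
  shows "z \<in> closed_segment s t \<Longrightarrow> \<bar>z - c\<bar> \<le> max \<bar>s - c\<bar> \<bar>t - c\<bar>"
  by (auto simp: closed_segment_eq_real_ivl split: if_splits)

lemma G_le: "\<bar>s\<bar> \<le> M \<Longrightarrow> \<bar>G n s\<bar> \<le> d n * \<bar>s\<bar> * \<bar>s\<bar>"
proof -
  assume s: "\<bar>s\<bar> \<le> M"
  have "\<bar>G n s - G n 0 - 0 * (s - 0)\<bar> \<le> (d n * \<bar>s\<bar>) * \<bar>s - 0\<bar>"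
  proof (rule G_affine[OF s])
    fix z assume "z \<in> closed_segment s 0"
    then have z: "\<bar>z\<bar> \<le> \<bar>s\<bar>" using segment_bound[of z s 0 0] by simp
    have "\<bar>G' n z\<bar> \<le> d n * \<bar>z\<bar>" by (rule G'_le) (use z s in simp)
    also have "\<dots> \<le> d n * \<bar>s\<bar>" using z d_nonneg by (intro mult_left_mono) auto
    finally show "\<bar>G' n z - 0\<bar> \<le> d n * \<bar>s\<bar>" by simp
  qed (use M in simp)
  then show ?thesis by (simp add: G0)
qed

lemma isCont_N: "inM p \<Longrightarrow> isCont (N n p) x"
proof -
  assume p: "inM p"
  have "continuous_on {-M..M} (G n)"
    by (rule DERIV_continuous_on[of _ _ "G' n"]) (use GD in \<open>auto simp: abs_le_iff\<close>)
  moreover have "continuous_on UNIV (u n p)" by (intro continuous_at_imp_continuous_on ballI isCont_u)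
  moreover have "u n p ` UNIV \<subseteq> {-M..M}" using u_bound[OF p] by (auto simp: abs_le_iff minus_le_iff)
  ultimately have "continuous_on UNIV (\<lambda>x. G n (u n p x))"
    by (rule continuous_on_compose2)
  then show ?thesis by (simp add: N_def[abs_def] continuous_on_eq_continuous_at)
qed

lemma N_measurable: "inM p \<Longrightarrow> N n p \<in> borel_measurable borel"
  by (intro borel_measurable_continuous_onI continuous_at_imp_continuous_on ballI isCont_N)

lemma N_facts:
  assumes p: "inM p"
  shows N_int: "integrable lborel (N n p)" and N_sqi: "square_integrable (N n p)"
    and N_bd: "\<bar>N n p x\<bar> \<le> d n * M * M" and N_norm: "norm (cls (N n p)) \<le> d n * M * norm p"
proof -
  note [measurable] = N_measurable[OF p]
  have le: "\<bar>N n p x\<bar> \<le> d n * \<bar>u n p x\<bar> * \<bar>u n p x\<bar>" for x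
    unfolding N_def by (rule G_le[OF u_bound[OF p]])
  have leM: "\<bar>N n p x\<bar> \<le> d n * M * \<bar>u n p x\<bar>" for x
    by (rule order_trans[OF le]) (intro mult_right_mono mult_left_mono u_bound[OF p] d_nonneg abs_ge_zero)
  show bd: "\<bar>N n p x\<bar> \<le> d n * M * M" for x
    by (rule order_trans[OF leM]) (use M d_nonneg[of n] u_bound[OF p] in \<open>intro mult_left_mono, auto\<close>)
  show int: "integrable lborel (N n p)"
  proof (rule Bochner_Integration.integrable_bound)
    show "integrable lborel (\<lambda>x. d n * (u n p x)\<^sup>2)" using square_integrable_sq[OF sqi_u] by simp
    show "AE x in lborel. norm (N n p x) \<le> norm (d n * (u n p x)\<^sup>2)"
      using le d_nonneg by (intro AE_I2) (simp add: abs_mult power2_eq_square mult.assoc)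
  qed measurable
  show sq: "square_integrable (N n p)" by (rule integrable_bounded_imp_sqi[OF int bd])
  have "norm (cls (N n p)) \<le> d n * M * norm (cls (u n p))"
    by (rule norm_cls_le[OF sq sqi_u]) (use leM M d_nonneg in auto)
  also have "\<dots> \<le> d n * M * norm p" using norm_u[of n p] M d_nonneg by (intro mult_left_mono) auto
  finally show "norm (cls (N n p)) \<le> d n * M * norm p" .
qed

lemma bounded_by_om_symb: "bounded_by C2 (om_symb n)"
proof (rule bounded_byI)
  show "om_symb n \<in> borel_measurable borel" unfolding om_symb_def by measurable
  show "\<bar>om_symb n k\<bar> \<le> C2" for k
    using S2[of k n] om_pos[of k] a_pos[of k] by (simp add: om_symb_def h_def abs_mult)
qed

lemma C2_nonneg: "0 \<le> C2" by (rule bounded_by_nonneg[OF bounded_by_om_symb])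

lemma norm_om_symb: "norm (mul (om_symb n) (Hartley F)) \<le> C2 * norm F"
  using norm_mul[OF bounded_by_om_symb, of n "Hartley F"] by simp

lemma T_term_norm: "inM p \<Longrightarrow> norm (mul (om_symb n) (Hartley (cls (N n p)))) \<le> d n * (C2 * M * norm p)"
  using order_trans[OF norm_om_symb mult_left_mono[OF N_norm C2_nonneg]] by (simp add: mult_ac)

lemma T_summable: "inM p \<Longrightarrow> summable (\<lambda>n. norm (mul (om_symb n) (Hartley (cls (N n p)))))"
  by (rule summable_comparison_test'[OF summable_mult2[OF summable_d, of "C2 * M * norm p"]]) (simp add: T_term_norm)

lemma T_sums: "inM p \<Longrightarrow> (\<lambda>n. mul (om_symb n) (Hartley (cls (N n p)))) sums T p"
  unfolding T_def by (rule summable_sums[OF summable_norm_cancel[OF T_summable]])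

lemma refl_T:
  assumes p: "inM p" and r: "refl p = p"
  shows "refl (T p) = T p"
proof -
  have ue: "u n p (- x) = u n p x" for n x
    unfolding u_def emb_refl[symmetric] refl_mul[OF bounded_by_sm sm_even] r ..
  have "refl (cls (N n p)) = cls (N n p)" for n
    unfolding refl_cls[OF N_sqi[OF p]] N_def ue ..
  moreover have "om_symb n (- k) = om_symb n k" for n k by (simp add: om_symb_def a_even)
  ultimately have t: "refl (mul (om_symb n) (Hartley (cls (N n p)))) = mul (om_symb n) (Hartley (cls (N n p)))" for n
    by (simp add: refl_mul[OF bounded_by_om_symb] flip: Hartley_refl)
  show ?thesis unfolding T_def
    using bounded_linear.suminf[OF bounded_linear_refl summable_norm_cancel[OF T_summable[OF p]]] t by simp
qed

lemma bounded_by_a_om: "bounded_by A (\<lambda>k. a k / om k)"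
proof -
  have "bounded_by (A * 1) (\<lambda>k. a k * (1 / om k))" by (rule bounded_by_mult[OF aA bounded_by_inverse_om])
  then show ?thesis by simp
qed

lemma mul_a_om_injective: "mul (\<lambda>k. a k / om k) p = mul (\<lambda>k. a k / om k) q \<Longrightarrow> p = q"
proof (rule l2_eqI)
  assume eq: "mul (\<lambda>k. a k / om k) p = mul (\<lambda>k. a k / om k) q"
  show "AE x in lborel. fn p x = fn q x"
    using fn_mul[OF bounded_by_a_om, of p] fn_mul[OF bounded_by_a_om, of q]
  proof eventually_elim
    fix k assume 1: "fn (mul (\<lambda>k. a k / om k) p) k = a k / om k * fn p k"
      and 2: "fn (mul (\<lambda>k. a k / om k) q) k = a k / om k * fn q k"
    have "a k / om k * fn p k = a k / om k * fn q k" by (rule trans[OF 1[unfolded eq, symmetric] 2])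
    then show "fn p k = fn q k" using a_pos[of k] by simp
  qed
qed

text \<open>The averages are summable both pointwise and in L2, by \<open>summable_d\<close>, with
  the same sum. On the transform side the two sides of the equation are \<open>T p\<close> and
  \<open>p\<close>, each multiplied by \<open>a / om\<close>; this symbol is positive and may be
  cancelled.\<close>

lemma equation_iff:
  assumes p: "inM p"
  shows "(AE x in lborel. (\<lambda>n. avg (h n) (N n p) x) sums hart (\<lambda>k. a k * (fn p k / om k)) x) \<longleftrightarrow> T p = p"
proof -
  define v where "v n = avg (h n) (N n p)" for n
  have vb: "\<bar>v n x\<bar> \<le> d n * (M * M)" for n x
    unfolding v_def using avg_bounded[OF N_measurable[OF p] N_bd[OF p] h_pos] by (simp add: mult.assoc)
  have Hv: "square_integrable (v n)" "Hartley (cls (v n)) = mul (sm (h n)) (Hartley (cls (N n p)))" for n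
    unfolding v_def by (rule Hartley_avg[OF N_int[OF p] N_bd[OF p] h_pos])+
  have vs: "summable (\<lambda>n. v n x)" for x
    by (rule summable_comparison_test'[OF summable_mult2[OF summable_d, of "M * M"]]) (use vb in simp)
  define s where "s x = (\<Sum>n. v n x)" for x
  have [measurable]: "v n \<in> borel_measurable borel" for n by (rule square_integrableD[OF Hv(1)])
  have [measurable]: "s \<in> borel_measurable borel" unfolding s_def by measurable
  have "norm (cls (v n)) = norm (mul (sm (h n)) (Hartley (cls (N n p))))" for n
    using norm_Hartley[of "cls (v n)"] Hv(2) by simp
  then have nv: "norm (cls (v n)) \<le> d n * (M * norm p)" for n
    using norm_mul[OF bounded_by_sm, of "h n" "Hartley (cls (N n p))"] N_norm[OF p, of n] by (simp add: mult.assoc)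
  have sv: "summable (\<lambda>n. norm (cls (v n)))"
    by (rule summable_comparison_test'[OF summable_mult2[OF summable_d, of "M * norm p"]]) (use nv in simp)
  have lim: "(\<lambda>m. \<Sum>n<m. cls (v n)) \<longlonglongrightarrow> (\<Sum>n. cls (v n))"
    by (rule summable_LIMSEQ[OF summable_norm_cancel[OF sv]])
  have ae: "AE x in lborel. \<forall>m. fn (\<Sum>n<m. cls (v n)) x = (\<Sum>n<m. v n x)"
    unfolding AE_all_countable
  proof
    fix m
    have c: "square_integrable (\<lambda>x. \<Sum>n<m. v n x)" "cls (\<lambda>x. \<Sum>n<m. v n x) = (\<Sum>n<m. cls (v n))"
      using cls_sum[of "{..<m}" v] Hv(1) by auto
    show "AE x in lborel. fn (\<Sum>n<m. cls (v n)) x = (\<Sum>n<m. v n x)"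
      using fn_cls[OF c(1)] unfolding c(2) .
  qed
  have "AE x in lborel. (\<lambda>m. fn (\<Sum>n<m. cls (v n)) x) \<longlonglongrightarrow> s x"
    using ae
  proof eventually_elim
    fix x assume *: "\<forall>m. fn (\<Sum>n<m. cls (v n)) x = (\<Sum>n<m. v n x)"
    show "(\<lambda>m. fn (\<Sum>n<m. cls (v n)) x) \<longlonglongrightarrow> s x"
      unfolding *[rule_format] s_def by (rule summable_LIMSEQ[OF vs])
  qed
  from fn_lim_AE[OF lim _ this]
  have s: "square_integrable s" "(\<Sum>n. cls (v n)) = cls s" by auto
  have "Hartley (cls s) = (\<Sum>n. Hartley (cls (v n)))"
    unfolding s(2)[symmetric] by (rule bounded_linear.suminf[OF bounded_linear_Hartley summable_norm_cancel[OF sv]])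
  also have "\<dots> = (\<Sum>n. mul (\<lambda>k. a k / om k) (mul (om_symb n) (Hartley (cls (N n p)))))"
  proof (rule suminf_cong)
    fix n
    have "(\<lambda>k. a k / om k * om_symb n k) = sm (h n)"
      using a_pos[THEN less_imp_neq] by (auto simp: om_symb_def fun_eq_iff)
    then show "Hartley (cls (v n)) = mul (\<lambda>k. a k / om k) (mul (om_symb n) (Hartley (cls (N n p))))"
      unfolding mul_mul[OF bounded_by_a_om bounded_by_om_symb] Hv(2) by simp
  qed
  also have "\<dots> = mul (\<lambda>k. a k / om k) (T p)"
    unfolding T_def by (rule summable_norm_mul[OF T_summable[OF p] bounded_by_a_om, symmetric])
  finally have Hs: "Hartley (cls s) = mul (\<lambda>k. a k / om k) (T p)" .
  have e: "hart (\<lambda>k. a k * (fn p k / om k)) x = emb (mul a p) x" for x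
    by (rule emb_mul[OF aA, symmetric])
  have He: "Hartley (cls (emb (mul a p))) = mul (\<lambda>k. a k / om k) p"
    unfolding Hartley_emb mul_mul[OF bounded_by_inverse_om aA] by simp
  have "(AE x in lborel. (\<lambda>n. v n x) sums emb (mul a p) x) \<longleftrightarrow> (AE x in lborel. s x = emb (mul a p) x)"
    unfolding s_def sums_iff using vs by simp
  also have "\<dots> \<longleftrightarrow> cls s = cls (emb (mul a p))" by (rule cls_eq_iff[OF s(1) sqi_emb, symmetric])
  also have "\<dots> \<longleftrightarrow> Hartley (cls s) = Hartley (cls (emb (mul a p)))"
    by (simp only: Hartley_eq_iff)
  also have "\<dots> \<longleftrightarrow> T p = p"
    unfolding Hs He using mul_a_om_injective[of "T p" p] by auto
  finally show ?thesis unfolding e v_def .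
qed

section \<open>Estimates for the contraction argument\<close>

text \<open>The encoding of \<open>w\<close>, which is the profile W0 of the theorem. The factor
  \<open>\<nu> / b\<close> turns the solution of u'' = u - u^2 into that of \<nu> (W - W'') = b
  W^2.\<close>

definition P0 :: l2 where "P0 = (\<nu> / b) *\<^sub>R solp"
definition w :: "real \<Rightarrow> real" where "w x = \<nu> / b * soliton x"
definition sigB :: real where "sigB = (\<Sum>n. \<bar>bt n\<bar> * (real (Suc n))\<^sup>2)"
definition sigG :: real where "sigG = (\<Sum>n. gm n)"

lemma emb_P0: "emb P0 x = w x" by (simp add: P0_def w_def emb_scaleR emb_solp)

lemma P0_om: "P0 = mul (\<lambda>k. 1 / om k) ((\<nu> / b) *\<^sub>R sol2)"
  by (simp add: P0_def solp_def mul_scaleR[OF bounded_by_inverse_om])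

lemma bounded_by_sm1: "bounded_by 2 (\<lambda>k. sm c k - 1)"
  by (rule bounded_byI) (use abs_snc_le in \<open>auto simp: sm_def intro!: order_trans[OF abs_triangle_ineq4]\<close>)

lemma bounded_by_sm1_om: "bounded_by (h n) (\<lambda>k. (sm (h n) k - 1) / om k)"
proof (rule bounded_byI)
  fix k
  have "\<bar>sm (h n) k - 1\<bar> \<le> 2 * \<bar>h n * k / 2\<bar>" unfolding sm_def by (rule snc_minus_1_le)
  also have "\<dots> = h n * \<bar>k\<bar>" using h_pos[of n] by (simp add: abs_mult)
  also have "\<dots> \<le> h n * om k" using h_pos[of n] abs_le_om by (intro mult_left_mono) auto
  finally show "\<bar>(sm (h n) k - 1) / om k\<bar> \<le> h n" using om_pos[of k] by (simp add: field_simps)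
qed measurable

text \<open>Each weight \<open>1 / om\<close> buys one power of \<open>h n\<close> in the averaging
  error. A general encoding has one weight to spare, the smooth \<open>P0\<close> has two.\<close>

lemma bounded_by_sm1_om2: "bounded_by ((h n)\<^sup>2) (\<lambda>k. (sm (h n) k - 1) / om k * (1 / om k))"
proof (rule bounded_byI)
  fix k
  have "\<bar>sm (h n) k - 1\<bar> \<le> (h n * k / 2)\<^sup>2" unfolding sm_def by (rule snc_minus_1_le_sq)
  also have "\<dots> = (h n)\<^sup>2 * (k\<^sup>2 / 4)" by (simp add: power_mult_distrib power_divide)
  also have "\<dots> \<le> (h n)\<^sup>2 * (om k)\<^sup>2" by (intro mult_left_mono) (auto simp: om_sq)
  finally have "\<bar>sm (h n) k - 1\<bar> \<le> (h n)\<^sup>2 * (om k)\<^sup>2" .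
  then show "\<bar>(sm (h n) k - 1) / om k * (1 / om k)\<bar> \<le> (h n)\<^sup>2"
    using om_pos[of k] by (simp add: abs_mult power2_eq_square field_simps)
qed measurable

lemma u_minus_emb: "u n p x - emb p x = emb (mul (\<lambda>k. sm (h n) k - 1) p) x"
proof -
  have "mul (\<lambda>k. sm (h n) k - 1) p = mul (sm (h n)) p - p"
  proof (rule l2_eqI)
    show "AE k in lborel. fn (mul (\<lambda>k. sm (h n) k - 1) p) k = fn (mul (sm (h n)) p - p) k"
      using fn_mul[OF bounded_by_sm1, of "h n" p] fn_mul[OF bounded_by_sm, of "h n" p] fn_diff[of "mul (sm (h n)) p" p]
      by eventually_elim (simp add: algebra_simps)
  qed
  then show ?thesis by (simp add: u_def emb_diff)
qed

lemma sqi_u_minus_emb: "square_integrable (\<lambda>x. u n p x - emb p x)"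
  by (intro square_integrable_diff sqi_u sqi_emb)

lemma norm_u_minus_emb: "norm (cls (\<lambda>x. u n p x - emb p x)) \<le> h n * norm p"
  unfolding u_minus_emb by (rule norm_emb_mul_le[OF bounded_by_sm1 bounded_by_sm1_om])

lemma norm_u_minus_P0: "norm (cls (\<lambda>x. u n P0 x - w x)) \<le> (h n)\<^sup>2 * norm ((\<nu> / b) *\<^sub>R sol2)"
proof -
  have "cls (\<lambda>x. u n P0 x - w x) = Hartley (mul (\<lambda>k. (sm (h n) k - 1) / om k * (1 / om k)) ((\<nu> / b) *\<^sub>R sol2))"
    unfolding emb_P0[symmetric] u_minus_emb cls_emb mul_mul[OF bounded_by_inverse_om bounded_by_sm1]
    unfolding P0_om
    using mul_mul[OF bounded_by_sm1_om bounded_by_inverse_om, of n "(\<nu> / b) *\<^sub>R sol2"] by simp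
  then show ?thesis using norm_mul[OF bounded_by_sm1_om2, of n "(\<nu> / b) *\<^sub>R sol2"] by (simp only: norm_Hartley)
qed

lemma sup_u_minus_P0: "\<bar>u n P0 x - w x\<bar> \<le> Cinf * (h n * norm ((\<nu> / b) *\<^sub>R sol2))"
proof -
  have "u n P0 x - w x = emb (mul (\<lambda>k. (sm (h n) k - 1) / om k) ((\<nu> / b) *\<^sub>R sol2)) x"
    unfolding emb_P0[symmetric] u_minus_emb
    unfolding P0_om mul_mul[OF bounded_by_sm1 bounded_by_inverse_om] by simp
  then have "\<bar>u n P0 x - w x\<bar> \<le> Cinf * norm (mul (\<lambda>k. (sm (h n) k - 1) / om k) ((\<nu> / b) *\<^sub>R sol2))"
    using emb_bound by simp
  also have "\<dots> \<le> Cinf * (h n * norm ((\<nu> / b) *\<^sub>R sol2))"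
    by (intro mult_left_mono norm_mul[OF bounded_by_sm1_om] Cinf_nonneg)
  finally show ?thesis .
qed

text \<open>The formal limit of \<open>om_symb n\<close> as \<epsilon> tends to 0. It no longer
  depends on \<open>n\<close>, so in the limit the series collapses to the single coefficient
  \<open>b\<close>.\<close>

definition lim_symb :: "real \<Rightarrow> real" where "lim_symb k = 1 / \<nu> * (1 / om k)"

lemma bounded_by_lim: "bounded_by (1 / \<nu> * 1) lim_symb"
  unfolding lim_symb_def[abs_def]
  by (rule bounded_by_mult[OF _ bounded_by_inverse_om]) (rule bounded_byI, use nu in auto)

lemma om_lim: "om k * (1 / (\<nu> * (1 + k\<^sup>2))) = lim_symb k"
  using nu om_pos[of k] by (simp add: lim_symb_def flip: om_sq) (simp add: power2_eq_square)

lemma symb_diff: "om_symb n k - lim_symb k = om k * (sm (h n) k / a k - 1 / (\<nu> * (1 + k\<^sup>2)))"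
  unfolding om_lim[symmetric] om_symb_def by (simp add: right_diff_distrib)

lemma bounded_by_symb_diff: "bounded_by (C3 * \<epsilon> powr (\<sigma> / 2) * real (Suc n)) (\<lambda>k. om_symb n k - lim_symb k)"
proof (rule bounded_byI)
  show "(\<lambda>k. om_symb n k - lim_symb k) \<in> borel_measurable borel" unfolding om_symb_def lim_symb_def by measurable
  show "\<bar>om_symb n k - lim_symb k\<bar> \<le> C3 * \<epsilon> powr (\<sigma> / 2) * real (Suc n)" for k
    unfolding symb_diff abs_mult using S3[of k n] om_pos[of k] by (simp add: h_def)
qed

lemma bounded_by_symb_diff_om: "bounded_by (C4 * \<epsilon> powr \<sigma> * (real (Suc n))\<^sup>2) (\<lambda>k. (om_symb n k - lim_symb k) * (1 / om k))"
proof (rule bounded_byI)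
  show "(\<lambda>k. (om_symb n k - lim_symb k) * (1 / om k)) \<in> borel_measurable borel" unfolding om_symb_def lim_symb_def by measurable
  show "\<bar>(om_symb n k - lim_symb k) * (1 / om k)\<bar> \<le> C4 * \<epsilon> powr \<sigma> * (real (Suc n))\<^sup>2" for k
    unfolding symb_diff using S4[of n k] om_pos[of k] by (simp add: h_def)
qed

lemma mul_symb_diff: "mul (om_symb n) F - mul lim_symb F = mul (\<lambda>k. om_symb n k - lim_symb k) F"
proof (rule l2_eqI)
  show "AE k in lborel. fn (mul (om_symb n) F - mul lim_symb F) k = fn (mul (\<lambda>k. om_symb n k - lim_symb k) F) k"
    using fn_mul[OF bounded_by_om_symb, of n F] fn_mul[OF bounded_by_lim, of F] fn_mul[OF bounded_by_symb_diff, of n F]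
      fn_diff[of "mul (om_symb n) F" "mul lim_symb F"]
    by eventually_elim (simp add: algebra_simps)
qed

lemma sqi_w_mult: "square_integrable f \<Longrightarrow> square_integrable (\<lambda>x. w x * f x)"
proof -
  assume f: "square_integrable f"
  have "(\<lambda>x. w x * f x) = (\<lambda>x. \<nu> / (2 * b) * (2 * soliton x * f x))" by (auto simp: w_def)
  then show ?thesis using square_integrable_cmult[OF sqi_soliton_mult[OF f], of "\<nu> / (2 * b)"] by (simp only:)
qed

lemma sqi_w: "square_integrable w"
  unfolding w_def by (intro square_integrable_cmult decaysD(5)[OF decays_soliton])

lemma sqi_ww: "square_integrable (\<lambda>x. w x * w x)" by (rule sqi_w_mult[OF sqi_w])

lemma bounded_sums_l2:
  assumes "\<And>n. norm (f n) \<le> g n" "summable g"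
  shows "norm (\<Sum>n. f n :: l2) \<le> (\<Sum>n. g n)"
proof -
  have s: "summable (\<lambda>n. norm (f n))" by (rule summable_comparison_test'[OF assms(2)]) (use assms(1) in simp)
  show ?thesis by (rule order_trans[OF summable_norm[OF s] suminf_le[OF assms(1) s assms(2)]])
qed

lemma sums_bt_scaleR: "(\<lambda>n. bt n *\<^sub>R F) sums (b *\<^sub>R (F :: l2))"
  using bounded_linear.sums[OF bounded_linear_scaleR_left bsum] .

text \<open>The \<open>1 / \<nu>\<close> of \<open>lim_symb\<close> and the coefficient
  \<open>b\<close> cancel the factor \<open>\<nu> / b\<close> of \<open>w\<close>, which leaves an
  operator free of parameters.\<close>

lemma Kop_eq: "Kop D = b *\<^sub>R mul lim_symb (Hartley (cls (\<lambda>x. 2 * (w x * emb D x))))"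
proof -
  have sq: "square_integrable (\<lambda>x. 2 * soliton x * emb D x)" by (rule sqi_soliton_mult) simp
  have "(\<lambda>x. 2 * (w x * emb D x)) = (\<lambda>x. \<nu> / b * (2 * soliton x * emb D x))"
    by (auto simp: w_def)
  then have "cls (\<lambda>x. 2 * (w x * emb D x)) = (\<nu> / b) *\<^sub>R cls (\<lambda>x. 2 * soliton x * emb D x)"
    using cls_scaleR[OF sq] by simp
  moreover have "mul lim_symb F = (1 / \<nu>) *\<^sub>R mul (\<lambda>k. 1 / om k) F" for F
    using cls_scaleR[OF sqi_mul[OF bounded_by_inverse_om sqi_fn[of F]], of "1 / \<nu>"]
    by (simp add: mul_def lim_symb_def)
  ultimately show ?thesis
    using nu b0 by (simp add: Kop_def Hartley_scaleR mul_scaleR[OF bounded_by_inverse_om])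
qed

lemma P0_eq: "P0 = b *\<^sub>R mul lim_symb (Hartley (cls (\<lambda>x. w x * w x)))"
proof -
  have "(\<lambda>x. w x * w x) = (\<lambda>x. (\<nu> / b)\<^sup>2 * (soliton x * soliton x))"
    by (auto simp: w_def power2_eq_square)
  then have "cls (\<lambda>x. w x * w x) = (\<nu> / b)\<^sup>2 *\<^sub>R cls (\<lambda>x. soliton x * soliton x)"
    using cls_scaleR[OF decaysD(5)[OF decays_soliton_prod]] by simp
  moreover have "mul lim_symb F = (1 / \<nu>) *\<^sub>R mul (\<lambda>k. 1 / om k) F" for F
    using cls_scaleR[OF sqi_mul[OF bounded_by_inverse_om sqi_fn[of F]], of "1 / \<nu>"]
    by (simp add: mul_def lim_symb_def)
  ultimately show ?thesis
    using nu b0 by (simp add: P0_def solp_def sol2_def Hartley_scaleR mul_scaleR[OF bounded_by_inverse_om] power2_eq_square)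
qed

lemma w_bound: "inM P0 \<Longrightarrow> \<bar>w x\<bar> \<le> M"
  using emb_bound[of P0 x] by (simp add: emb_P0 inM_def)

text \<open>The linear part of the nonlinearity at \<open>P0\<close> is compared with its long wave limit.\<close>

lemma T_lipschitz:
  assumes P0: "inM P0" and p: "inM p" "norm (p - P0) \<le> \<rho>" and q: "inM q" "norm (q - P0) \<le> \<rho>"
  shows "norm (T p - T q - Kop (p - q)) \<le>
     (\<epsilon> powr (\<sigma> / 2) + \<rho>) * ((C2 * M\<^sup>2 * sigG + C2 * (2 * Cinf) * sigB)
       + (C2 * (2 * (Cinf * norm ((\<nu> / b) *\<^sub>R sol2) + M)) + C3 * (2 * M)) * sigB) * norm (p - q)"
proof -
  define D where "D = p - q"
  define e where "e = \<epsilon> powr (\<sigma> / 2)"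
  define Q where "Q = norm ((\<nu> / b) *\<^sub>R sol2)"
  have Q: "0 \<le> Q" by (simp add: Q_def)
  have rho: "0 \<le> \<rho>" using p(2) norm_ge_zero order_trans by blast
  have e: "\<epsilon> \<le> e" "\<epsilon>\<^sup>2 \<le> e" "0 \<le> e"
  proof -
    show e1: "\<epsilon> \<le> e" unfolding e_def using powr_mono'[of "\<sigma> / 2" 1 \<epsilon>] eps sigma by simp
    have "\<epsilon> * \<epsilon> \<le> \<epsilon> * 1" using eps by (intro mult_left_mono) auto
    then show "\<epsilon>\<^sup>2 \<le> e" using e1 by (simp add: power2_eq_square)
    show "0 \<le> e" by (simp add: e_def)
  qed
  have uD: "u n D x = u n p x - u n q x" for n x by (simp add: D_def u_diff)
  have sqL: "square_integrable (\<lambda>x. 2 * (w x * emb D x))" by (intro square_integrable_cmult sqi_w_mult sqi_emb)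
  have nL: "norm (cls (\<lambda>x. 2 * (w x * emb D x))) \<le> 2 * M * norm D"
  proof -
    have "norm (cls (\<lambda>x. 2 * (w x * emb D x))) \<le> 2 * M * norm (cls (emb D))"
      by (rule norm_cls_le[OF sqL sqi_emb])
         (use M w_bound[OF P0] in \<open>auto simp: abs_mult intro!: AE_I2 mult_right_mono\<close>)
    also have "\<dots> \<le> 2 * M * norm D" using norm_emb[of D] M by (intro mult_left_mono) auto
    finally show ?thesis .
  qed
  \<comment> \<open>\<open>Kop D\<close> is spread over the series with weights \<open>bt n\<close>,
    whose sum is \<open>b\<close>, so that the comparison can be made term by term.\<close>
  define t where "t n = mul (om_symb n) (Hartley (cls (N n p))) - mul (om_symb n) (Hartley (cls (N n q)))
      - bt n *\<^sub>R mul lim_symb (Hartley (cls (\<lambda>x. 2 * (w x * emb D x))))" for n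
  have sums: "t sums (T p - T q - Kop D)"
    unfolding t_def Kop_eq
    by (rule sums_diff[OF sums_diff[OF T_sums[OF p(1)] T_sums[OF q(1)]] sums_bt_scaleR])
  have tn: "norm (t n) \<le> ((C2 * M\<^sup>2 * gm n + C2 * (2 * Cinf) * \<bar>bt n\<bar>)
       + (C2 * (2 * (Cinf * Q + M)) + C3 * (2 * M)) * (\<bar>bt n\<bar> * real (Suc n))) * ((e + \<rho>) * norm D)" for n
  proof -
    \<comment> \<open>\<open>L\<close> is the limiting linear term, \<open>f1\<close> the error of
      replacing \<open>G n\<close> by a linear function with slope
      \<open>2 * bt n * u n P0 x\<close>, and \<open>f2\<close> the error of dropping the averages
      from that linear term.\<close>
    define L where "L x = bt n * (2 * (w x * emb D x))" for x
    define f1 where "f1 x = (N n p x - N n q x) - 2 * bt n * u n P0 x * u n D x" for x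
    define f2 where "f2 x = 2 * bt n * (u n P0 x * u n D x - w x * emb D x)" for x
    have sqLn: "square_integrable L" unfolding L_def by (rule square_integrable_cmult[OF sqL])
    have mu [measurable]: "u n p \<in> borel_measurable borel" "u n q \<in> borel_measurable borel" "u n P0 \<in> borel_measurable borel" "u n D \<in> borel_measurable borel"
      by (rule square_integrableD[OF sqi_u])+
    have sqUU: "square_integrable (\<lambda>x. u n P0 x * u n D x)"
      by (rule square_integrable_mult_bounded(1)[OF sqi_u _ u_bound[OF P0]]) measurable
    have sq1: "square_integrable f1" unfolding f1_def
      using square_integrable_diff[OF square_integrable_diff[OF N_sqi[OF p(1)] N_sqi[OF q(1)]] square_integrable_cmult[OF sqUU, of "2 * bt n"]]
      by (simp only: mult.assoc)
    have sq2: "square_integrable f2" unfolding f2_def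
      by (intro square_integrable_cmult square_integrable_diff sqUU sqi_w_mult sqi_emb)
    have dec: "cls (N n p) - cls (N n q) = cls f1 + cls f2 + cls L"
    proof -
      have "(\<lambda>x. N n p x - N n q x) = (\<lambda>x. f1 x + f2 x + L x)"
        by (auto simp: f1_def f2_def L_def algebra_simps)
      then show ?thesis
        by (simp add: cls_diff cls_add N_sqi p q sq1 sq2 sqLn)
    qed
    have clsL: "cls L = bt n *\<^sub>R cls (\<lambda>x. 2 * (w x * emb D x))" unfolding L_def by (rule cls_scaleR[OF sqL, symmetric])
    have "mul (om_symb n) (Hartley (cls (N n p))) - mul (om_symb n) (Hartley (cls (N n q)))
        = mul (om_symb n) (Hartley (cls f1)) + mul (om_symb n) (Hartley (cls f2)) + mul (om_symb n) (Hartley (cls L))"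
      by (simp add: mul_diff[OF bounded_by_om_symb, symmetric] Hartley_diff[symmetric] dec
          mul_add[OF bounded_by_om_symb, symmetric] Hartley_add[symmetric])
    then have "t n = mul (om_symb n) (Hartley (cls f1)) + mul (om_symb n) (Hartley (cls f2))
        + (mul (om_symb n) (Hartley (cls L)) - mul lim_symb (Hartley (cls L)))"
      unfolding t_def by (simp add: clsL Hartley_scaleR mul_scaleR[OF bounded_by_lim])
    then have "norm (t n) \<le> C2 * norm (cls f1) + C2 * norm (cls f2) + norm (mul (\<lambda>k. om_symb n k - lim_symb k) (Hartley (cls L)))"
      unfolding mul_symb_diff by (rule norm_triangle3[OF _ norm_om_symb norm_om_symb])
    \<comment> \<open>\<open>D\<close> is an arbitrary difference without extra smoothness, so the
      multiplier bound of order \<epsilon> powr (\<sigma> / 2) is used.\<close>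
    also have "norm (mul (\<lambda>k. om_symb n k - lim_symb k) (Hartley (cls L))) \<le> C3 * e * real (Suc n) * (\<bar>bt n\<bar> * (2 * M * norm D))"
    proof -
      have "norm (mul (\<lambda>k. om_symb n k - lim_symb k) (Hartley (cls L))) \<le> C3 * e * real (Suc n) * norm (cls L)"
        using norm_mul[OF bounded_by_symb_diff, of n "Hartley (cls L)"] by (simp add: e_def del: of_nat_Suc)
      also have "\<dots> \<le> C3 * e * real (Suc n) * (\<bar>bt n\<bar> * (2 * M * norm D))"
        unfolding clsL norm_scaleR e_def
        by (intro mult_left_mono nL bounded_by_nonneg[OF bounded_by_symb_diff]) auto
      finally show ?thesis .
    qed
    also have "C2 * norm (cls f1) \<le> C2 * ((gm n * \<epsilon>\<^sup>2 * M\<^sup>2 + 2 * \<bar>bt n\<bar> * (Cinf * \<rho>)) * norm D)"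
    proof (rule mult_left_mono[OF _ C2_nonneg])
      have "norm (cls f1) \<le> (gm n * \<epsilon>\<^sup>2 * M\<^sup>2 + 2 * \<bar>bt n\<bar> * (Cinf * \<rho>)) * norm (cls (u n D))"
      proof (rule norm_cls_le[OF sq1 sqi_u])
        show "0 \<le> gm n * \<epsilon>\<^sup>2 * M\<^sup>2 + 2 * \<bar>bt n\<bar> * (Cinf * \<rho>)"
          using gm_nonneg rho Cinf_nonneg by simp
        show "AE x in lborel. \<bar>f1 x\<bar> \<le> (gm n * \<epsilon>\<^sup>2 * M\<^sup>2 + 2 * \<bar>bt n\<bar> * (Cinf * \<rho>)) * \<bar>u n D x\<bar>"
        proof (rule AE_I2)
          fix x
          have near: "\<bar>u n z x - u n P0 x\<bar> \<le> Cinf * \<rho>" if "norm (z - P0) \<le> \<rho>" for z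
          proof -
            have "\<bar>u n (z - P0) x\<bar> \<le> Cinf * norm (mul (sm (h n)) (z - P0))" unfolding u_def by (rule emb_bound)
            also have "\<dots> \<le> Cinf * \<rho>"
              using norm_mul[OF bounded_by_sm, of "h n" "z - P0"] that by (intro mult_left_mono Cinf_nonneg) auto
            finally show ?thesis by (simp add: u_diff)
          qed
          have "\<bar>G n (u n p x) - G n (u n q x) - (2 * bt n * u n P0 x) * (u n p x - u n q x)\<bar>
              \<le> (gm n * \<epsilon>\<^sup>2 * M\<^sup>2 + 2 * \<bar>bt n\<bar> * (Cinf * \<rho>)) * \<bar>u n p x - u n q x\<bar>"
          proof (rule G_affine[OF u_bound[OF p(1)] u_bound[OF q(1)]])
            fix z assume z: "z \<in> closed_segment (u n p x) (u n q x)"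
            have "\<bar>z\<bar> \<le> M" using segment_bound[OF z, of 0] u_bound[OF p(1), of n x] u_bound[OF q(1), of n x] by simp
            from G1[OF this, of n] have 1: "\<bar>G' n z - 2 * bt n * z\<bar> \<le> gm n * \<epsilon>\<^sup>2 * M\<^sup>2" .
            have "\<bar>z - u n P0 x\<bar> \<le> Cinf * \<rho>" using segment_bound[OF z, of "u n P0 x"] near[OF p(2)] near[OF q(2)] by simp
            then have "\<bar>2 * bt n * (z - u n P0 x)\<bar> \<le> 2 * \<bar>bt n\<bar> * (Cinf * \<rho>)"
              unfolding abs_mult by (intro mult_mono) auto
            then have "\<bar>2 * bt n * z - 2 * bt n * u n P0 x\<bar> \<le> 2 * \<bar>bt n\<bar> * (Cinf * \<rho>)"
              by (simp add: right_diff_distrib)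
            with 1 show "\<bar>G' n z - 2 * bt n * u n P0 x\<bar> \<le> gm n * \<epsilon>\<^sup>2 * M\<^sup>2 + 2 * \<bar>bt n\<bar> * (Cinf * \<rho>)" by linarith
          qed
          then show "\<bar>f1 x\<bar> \<le> (gm n * \<epsilon>\<^sup>2 * M\<^sup>2 + 2 * \<bar>bt n\<bar> * (Cinf * \<rho>)) * \<bar>u n D x\<bar>"
            by (simp add: f1_def N_def uD)
        qed
      qed
      also have "\<dots> \<le> (gm n * \<epsilon>\<^sup>2 * M\<^sup>2 + 2 * \<bar>bt n\<bar> * (Cinf * \<rho>)) * norm D"
        using gm_nonneg rho Cinf_nonneg by (intro mult_left_mono norm_u) simp
      finally show "norm (cls f1) \<le> (gm n * \<epsilon>\<^sup>2 * M\<^sup>2 + 2 * \<bar>bt n\<bar> * (Cinf * \<rho>)) * norm D" .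
    qed
    also have "C2 * norm (cls f2) \<le> C2 * (2 * \<bar>bt n\<bar> * ((Cinf * Q + M) * h n * norm D))"
    proof (rule mult_left_mono[OF _ C2_nonneg])
      \<comment> \<open>In the first product the averaging error of the smooth \<open>P0\<close> is
        taken in sup norm, in the second that of \<open>D\<close> in L2; each is of first order in
        \<open>h n\<close>.\<close>
      define g1 where "g1 x = (u n P0 x - w x) * u n D x" for x
      define g2 where "g2 x = w x * (u n D x - emb D x)" for x
      have s1: "square_integrable g1" "norm (cls g1) \<le> Cinf * (h n * Q) * norm (cls (u n D))"
      proof -
        have m: "(\<lambda>x. u n P0 x - w x) \<in> borel_measurable borel"
          by (rule square_integrableD[OF square_integrable_diff[OF sqi_u sqi_w]])
        show "square_integrable g1" "norm (cls g1) \<le> Cinf * (h n * Q) * norm (cls (u n D))"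
          unfolding g1_def by (rule square_integrable_mult_bounded[OF sqi_u m sup_u_minus_P0[folded Q_def]])+
      qed
      have s2: "square_integrable g2" "norm (cls g2) \<le> M * norm (cls (\<lambda>x. u n D x - emb D x))"
        unfolding g2_def using square_integrable_mult_bounded[OF sqi_u_minus_emb square_integrableD[OF sqi_w] w_bound[OF P0]]
        by auto
      have "cls f2 = (2 * bt n) *\<^sub>R (cls g1 + cls g2)"
      proof -
        have "f2 = (\<lambda>x. (2 * bt n) * (g1 x + g2 x))" by (auto simp: f2_def g1_def g2_def algebra_simps)
        then show ?thesis using s1 s2 by (simp add: cls_add cls_scaleR)
      qed
      then have "norm (cls f2) \<le> 2 * \<bar>bt n\<bar> * (norm (cls g1) + norm (cls g2))"
        by (simp add: abs_mult mult_left_mono norm_triangle_ineq)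
      also have "\<dots> \<le> 2 * \<bar>bt n\<bar> * (Cinf * (h n * Q) * norm D + M * (h n * norm D))"
      proof (intro mult_left_mono add_mono)
        show "norm (cls g1) \<le> Cinf * (h n * Q) * norm D"
          by (rule order_trans[OF s1(2)]) (use Cinf_nonneg h_pos[of n] Q in \<open>intro mult_left_mono norm_u, auto\<close>)
        show "norm (cls g2) \<le> M * (h n * norm D)"
          by (rule order_trans[OF s2(2)]) (use M in \<open>intro mult_left_mono norm_u_minus_emb, auto\<close>)
      qed auto
      finally show "norm (cls f2) \<le> 2 * \<bar>bt n\<bar> * ((Cinf * Q + M) * h n * norm D)" by (simp add: algebra_simps)
    qed
    finally have main: "norm (t n) \<le> C2 * ((gm n * \<epsilon>\<^sup>2 * M\<^sup>2 + 2 * \<bar>bt n\<bar> * (Cinf * \<rho>)) * norm D)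
        + C2 * (2 * \<bar>bt n\<bar> * ((Cinf * Q + M) * h n * norm D)) + C3 * e * real (Suc n) * (\<bar>bt n\<bar> * (2 * M * norm D))"
      by simp
    have C3: "0 \<le> C3 * e" using bounded_by_nonneg[OF bounded_by_symb_diff, of 0] by (simp add: e_def)
    have er: "\<epsilon> \<le> e + \<rho>" "\<epsilon>\<^sup>2 \<le> e + \<rho>" "\<rho> \<le> e + \<rho>" "e \<le> e + \<rho>" using e rho by auto
    have C3': "C3 * e \<le> C3 * (e + \<rho>)"
    proof -
      have "e > 0" using eps by (simp add: e_def)
      then have "0 \<le> C3" using C3 by (simp add: zero_le_mult_iff)
      then show ?thesis using er(4) by (intro mult_left_mono)
    qed
    have a1: "C2 * ((gm n * \<epsilon>\<^sup>2 * M\<^sup>2) * norm D) \<le> C2 * ((gm n * (e + \<rho>) * M\<^sup>2) * norm D)"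
      using C2_nonneg gm_nonneg er by (intro mult_left_mono mult_right_mono) auto
    have a2: "C2 * ((2 * \<bar>bt n\<bar> * (Cinf * \<rho>)) * norm D) \<le> C2 * ((2 * \<bar>bt n\<bar> * (Cinf * (e + \<rho>))) * norm D)"
      using C2_nonneg Cinf_nonneg er by (intro mult_left_mono mult_right_mono) auto
    have a3: "C2 * (2 * \<bar>bt n\<bar> * ((Cinf * Q + M) * h n * norm D)) \<le> C2 * (2 * \<bar>bt n\<bar> * ((Cinf * Q + M) * ((e + \<rho>) * real (Suc n)) * norm D))"
      unfolding h_def using C2_nonneg Cinf_nonneg Q M er by (intro mult_left_mono mult_right_mono) auto
    have a4: "C3 * e * real (Suc n) * (\<bar>bt n\<bar> * (2 * M * norm D)) \<le> C3 * (e + \<rho>) * real (Suc n) * (\<bar>bt n\<bar> * (2 * M * norm D))"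
      using C3' M by (intro mult_right_mono) auto
    have "norm (t n) \<le> C2 * ((gm n * (e + \<rho>) * M\<^sup>2) * norm D) + C2 * ((2 * \<bar>bt n\<bar> * (Cinf * (e + \<rho>))) * norm D)
       + C2 * (2 * \<bar>bt n\<bar> * ((Cinf * Q + M) * ((e + \<rho>) * real (Suc n)) * norm D)) + C3 * (e + \<rho>) * real (Suc n) * (\<bar>bt n\<bar> * (2 * M * norm D))"
    proof -
      have "C2 * ((gm n * \<epsilon>\<^sup>2 * M\<^sup>2 + 2 * \<bar>bt n\<bar> * (Cinf * \<rho>)) * norm D)
          = C2 * ((gm n * \<epsilon>\<^sup>2 * M\<^sup>2) * norm D) + C2 * ((2 * \<bar>bt n\<bar> * (Cinf * \<rho>)) * norm D)"
        by (simp only: distrib_right distrib_left)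
      then show ?thesis using main a1 a2 a3 a4 by linarith
    qed
    also have "\<dots> = ((C2 * M\<^sup>2 * gm n + C2 * (2 * Cinf) * \<bar>bt n\<bar>)
       + (C2 * (2 * (Cinf * Q + M)) + C3 * (2 * M)) * (\<bar>bt n\<bar> * real (Suc n))) * ((e + \<rho>) * norm D)"
      by (simp add: algebra_simps del: of_nat_Suc)
    finally show ?thesis .
  qed
  have C3: "0 \<le> C3"
    using bounded_by_nonneg[OF bounded_by_symb_diff, of 0] eps by (simp add: zero_le_mult_iff)
  let ?g = "\<lambda>n. ((C2 * M\<^sup>2 * gm n + C2 * (2 * Cinf) * (\<bar>bt n\<bar> * (real (Suc n))\<^sup>2))
       + (C2 * (2 * (Cinf * Q + M)) + C3 * (2 * M)) * (\<bar>bt n\<bar> * (real (Suc n))\<^sup>2)) * ((e + \<rho>) * norm D)"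
  have tg: "norm (t n) \<le> ?g n" for n
    by (rule order_trans[OF tn], intro mult_right_mono add_mono mult_left_mono bt_le order_refl)
       (use C2_nonneg C3 Cinf_nonneg Q M e rho in auto)
  have gs: "?g sums (((C2 * M\<^sup>2 * sigG + C2 * (2 * Cinf) * sigB)
       + (C2 * (2 * (Cinf * Q + M)) + C3 * (2 * M)) * sigB) * ((e + \<rho>) * norm D))"
    unfolding sigG_def sigB_def
    by (intro sums_mult2 sums_add sums_mult summable_sums gm_sum bt_sum)
  have "norm (T p - T q - Kop D) \<le> suminf ?g"
    using bounded_sums_l2[OF tg sums_summable[OF gs]] sums_unique[OF sums] by simp
  also have "suminf ?g = ((C2 * M\<^sup>2 * sigG + C2 * (2 * Cinf) * sigB)
       + (C2 * (2 * (Cinf * Q + M)) + C3 * (2 * M)) * sigB) * ((e + \<rho>) * norm D)"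
    using sums_unique[OF gs] by simp
  finally show ?thesis by (simp add: D_def e_def Q_def mult_ac)
qed

text \<open>\<open>P0\<close> solves the limiting equation \<open>P0_eq\<close>, so only consistency
  errors remain. Because the soliton is smooth, the multiplier error is of order \<epsilon> powr
  \<sigma> and the averaging error of second order in \<open>h n\<close>; the Taylor remainder is of
  order \<epsilon>^2, which is no larger since \<sigma> \<le> 2.\<close>

lemma T_residual:
  assumes P0: "inM P0"
  shows "norm (T P0 - P0) \<le> \<epsilon> powr \<sigma> * (C2 * M\<^sup>2 * norm P0 * sigG
     + (C2 * (2 * M * norm ((\<nu> / b) *\<^sub>R sol2)) + C4 * ((\<nu> / b)\<^sup>2 * norm sol4)) * sigB)"
proof -
  define e where "e = \<epsilon> powr \<sigma>"
  define Q where "Q = norm ((\<nu> / b) *\<^sub>R sol2)"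
  have Q: "0 \<le> Q" by (simp add: Q_def)
  have e: "\<epsilon>\<^sup>2 \<le> e" "0 < e"
  proof -
    have "\<epsilon> powr 2 \<le> e" unfolding e_def using eps sigma by (intro powr_mono') auto
    then show "\<epsilon>\<^sup>2 \<le> e" using eps by (simp add: powr_numeral)
    show "0 < e" using eps by (simp add: e_def)
  qed
  have C4: "0 \<le> C4"
    using bounded_by_nonneg[OF bounded_by_symb_diff_om, of 0] eps by (simp add: zero_le_mult_iff)
  define t where "t n = mul (om_symb n) (Hartley (cls (N n P0))) - bt n *\<^sub>R mul lim_symb (Hartley (cls (\<lambda>x. w x * w x)))" for n
  have sums: "t sums (T P0 - P0)"
    unfolding t_def using sums_diff[OF T_sums[OF P0] sums_bt_scaleR[of "mul lim_symb (Hartley (cls (\<lambda>x. w x * w x)))"]]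
    unfolding P0_eq[symmetric] .
  have Hww: "Hartley (cls (\<lambda>x. w x * w x)) = (\<nu> / b)\<^sup>2 *\<^sub>R mul (\<lambda>k. 1 / om k) (mul (\<lambda>k. 1 / om k) sol4)"
  proof -
    have "(\<lambda>x. w x * w x) = (\<lambda>x. (\<nu> / b)\<^sup>2 * (soliton x * soliton x))" by (auto simp: w_def power2_eq_square)
    then have "cls (\<lambda>x. w x * w x) = (\<nu> / b)\<^sup>2 *\<^sub>R cls (\<lambda>x. soliton x * soliton x)"
      using cls_scaleR[OF decaysD(5)[OF decays_soliton_prod]] by simp
    then show ?thesis by (simp add: Hartley_scaleR sol2_sol4[symmetric] sol2_def)
  qed
  have tn: "norm (t n) \<le> (C2 * M\<^sup>2 * norm P0 * gm n
     + (C2 * (2 * M * Q) + C4 * ((\<nu> / b)\<^sup>2 * norm sol4)) * (\<bar>bt n\<bar> * (real (Suc n))\<^sup>2)) * e" for n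
  proof -
    define L where "L x = bt n * (w x * w x)" for x
    define f1 where "f1 x = N n P0 x - bt n * (u n P0 x * u n P0 x)" for x
    \<comment> \<open>The difference of squares is factored, so that the averaging error is measured
      in L2, where it is quadratic in \<open>h n\<close>, and the sum is merely bounded by
      \<open>2 * M\<close>.\<close>
    define f2 where "f2 x = bt n * ((u n P0 x - w x) * (u n P0 x + w x))" for x
    have mu [measurable]: "u n P0 \<in> borel_measurable borel" "w \<in> borel_measurable borel"
      by (rule square_integrableD[OF sqi_u] square_integrableD[OF sqi_w])+
    have sqL: "square_integrable L" unfolding L_def by (rule square_integrable_cmult[OF sqi_ww])
    have sqUU: "square_integrable (\<lambda>x. u n P0 x * u n P0 x)"
      by (rule square_integrable_mult_bounded(1)[OF sqi_u _ u_bound[OF P0]]) measurable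
    have sq1: "square_integrable f1" unfolding f1_def
      by (intro square_integrable_diff N_sqi P0 square_integrable_cmult sqUU)
    have ub: "\<bar>u n P0 x + w x\<bar> \<le> 2 * M" for x using u_bound[OF P0, of n x] w_bound[OF P0, of x] by linarith
    have sq2': "square_integrable (\<lambda>x. (u n P0 x + w x) * (u n P0 x - w x))"
      "norm (cls (\<lambda>x. (u n P0 x + w x) * (u n P0 x - w x))) \<le> 2 * M * norm (cls (\<lambda>x. u n P0 x - w x))"
      by (rule square_integrable_mult_bounded[OF square_integrable_diff[OF sqi_u sqi_w] _ ub]; measurable)+
    have sq2: "square_integrable f2" unfolding f2_def using square_integrable_cmult[OF sq2'(1), of "bt n"] by (simp add: mult_ac)
    have "cls (N n P0) = cls f1 + cls f2 + cls L"
    proof -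
      have "N n P0 = (\<lambda>x. f1 x + f2 x + L x)" by (auto simp: f1_def f2_def L_def algebra_simps)
      then show ?thesis by (simp add: cls_add sq1 sq2 sqL)
    qed
    moreover have clsL: "cls L = bt n *\<^sub>R cls (\<lambda>x. w x * w x)" unfolding L_def by (rule cls_scaleR[OF sqi_ww, symmetric])
    ultimately have "t n = mul (om_symb n) (Hartley (cls f1)) + mul (om_symb n) (Hartley (cls f2))
        + (mul (om_symb n) (Hartley (cls L)) - mul lim_symb (Hartley (cls L)))"
      unfolding t_def by (simp add: Hartley_scaleR mul_scaleR[OF bounded_by_lim] Hartley_add mul_add[OF bounded_by_om_symb])
    then have "norm (t n) \<le> C2 * norm (cls f1) + C2 * norm (cls f2) + norm (mul (\<lambda>k. om_symb n k - lim_symb k) (Hartley (cls L)))"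
      unfolding mul_symb_diff by (rule norm_triangle3[OF _ norm_om_symb norm_om_symb])
    also have "norm (mul (\<lambda>k. om_symb n k - lim_symb k) (Hartley (cls L))) \<le> C4 * e * (real (Suc n))\<^sup>2 * (\<bar>bt n\<bar> * ((\<nu> / b)\<^sup>2 * norm sol4))"
    proof -
      \<comment> \<open>By \<open>sol4\<close> the function \<open>w * w\<close> has two weights
        \<open>1 / om\<close> to spare. One of them goes into the multiplier and upgrades its bound
        to order \<epsilon> powr \<sigma>, with weight m^2.\<close>
      have "mul (\<lambda>k. om_symb n k - lim_symb k) (Hartley (cls L))
          = (bt n * (\<nu> / b)\<^sup>2) *\<^sub>R mul (\<lambda>k. (om_symb n k - lim_symb k) * (1 / om k)) (mul (\<lambda>k. 1 / om k) sol4)"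
        unfolding clsL Hartley_scaleR Hww
        by (simp add: mul_scaleR[OF bounded_by_symb_diff] mul_mul[OF bounded_by_symb_diff bounded_by_inverse_om])
      then have "norm (mul (\<lambda>k. om_symb n k - lim_symb k) (Hartley (cls L)))
          = \<bar>bt n\<bar> * (\<nu> / b)\<^sup>2 * norm (mul (\<lambda>k. (om_symb n k - lim_symb k) * (1 / om k)) (mul (\<lambda>k. 1 / om k) sol4))"
        by (simp add: abs_mult)
      also have "\<dots> \<le> \<bar>bt n\<bar> * (\<nu> / b)\<^sup>2 * (C4 * e * (real (Suc n))\<^sup>2 * norm sol4)"
      proof (rule mult_left_mono)
        have "norm (mul (\<lambda>k. 1 / om k) sol4) \<le> norm sol4" using norm_mul[OF bounded_by_inverse_om, of sol4] by simp
        then have "C4 * e * (real (Suc n))\<^sup>2 * norm (mul (\<lambda>k. 1 / om k) sol4) \<le> C4 * e * (real (Suc n))\<^sup>2 * norm sol4"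
          using C4 e by (intro mult_left_mono) auto
        then show "norm (mul (\<lambda>k. (om_symb n k - lim_symb k) * (1 / om k)) (mul (\<lambda>k. 1 / om k) sol4))
            \<le> C4 * e * (real (Suc n))\<^sup>2 * norm sol4"
          using norm_mul[OF bounded_by_symb_diff_om, of n "mul (\<lambda>k. 1 / om k) sol4"] unfolding e_def by linarith
      qed simp
      also have "\<dots> = C4 * e * (real (Suc n))\<^sup>2 * (\<bar>bt n\<bar> * ((\<nu> / b)\<^sup>2 * norm sol4))"
        by (simp only: mult_ac)
      finally show ?thesis .
    qed
    also have "C2 * norm (cls f1) \<le> C2 * (gm n * \<epsilon>\<^sup>2 * M\<^sup>2 * norm P0)"
    proof (rule mult_left_mono[OF _ C2_nonneg])
      have "norm (cls f1) \<le> (gm n * \<epsilon>\<^sup>2 * M\<^sup>2) * norm (cls (u n P0))"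
      proof (rule norm_cls_le[OF sq1 sqi_u _ AE_I2])
        show "0 \<le> gm n * \<epsilon>\<^sup>2 * M\<^sup>2" using gm_nonneg by simp
        fix x
        let ?s = "u n P0 x"
        have "norm ((\<lambda>z. G n z - bt n * (z * z)) ?s - (\<lambda>z. G n z - bt n * (z * z)) 0) \<le> (gm n * \<epsilon>\<^sup>2 * M\<^sup>2) * norm (?s - 0)"
        proof (rule field_differentiable_bound[where S="{-M..M}"])
          fix z :: real assume z: "z \<in> {-M..M}"
          then have zM: "\<bar>z\<bar> \<le> M" by (auto simp: abs_le_iff)
          show "((\<lambda>z. G n z - bt n * (z * z)) has_real_derivative G' n z - 2 * bt n * z) (at z within {-M..M})"
            using GD[OF zM] by (auto intro!: derivative_eq_intros)
          show "norm (G' n z - 2 * bt n * z) \<le> gm n * \<epsilon>\<^sup>2 * M\<^sup>2" using G1[OF zM] by simp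
        qed (use u_bound[OF P0, of n x] M in \<open>auto simp: abs_le_iff\<close>)
        then show "\<bar>f1 x\<bar> \<le> gm n * \<epsilon>\<^sup>2 * M\<^sup>2 * \<bar>?s\<bar>" by (simp add: f1_def N_def G0)
      qed
      also have "\<dots> \<le> gm n * \<epsilon>\<^sup>2 * M\<^sup>2 * norm P0" using gm_nonneg by (intro mult_left_mono norm_u) simp
      finally show "norm (cls f1) \<le> gm n * \<epsilon>\<^sup>2 * M\<^sup>2 * norm P0" .
    qed
    also have "C2 * norm (cls f2) \<le> C2 * (\<bar>bt n\<bar> * (2 * M * ((h n)\<^sup>2 * Q)))"
    proof (rule mult_left_mono[OF _ C2_nonneg])
      have "f2 = (\<lambda>x. bt n * ((u n P0 x + w x) * (u n P0 x - w x)))" by (auto simp: f2_def mult_ac)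
      then have "norm (cls f2) = \<bar>bt n\<bar> * norm (cls (\<lambda>x. (u n P0 x + w x) * (u n P0 x - w x)))"
        using cls_scaleR[OF sq2'(1), of "bt n"] by (metis norm_scaleR)
      also have "\<dots> \<le> \<bar>bt n\<bar> * (2 * M * ((h n)\<^sup>2 * Q))"
        by (intro mult_left_mono order_trans[OF sq2'(2)] norm_u_minus_P0[folded Q_def]) (use M in auto)
      finally show "norm (cls f2) \<le> \<bar>bt n\<bar> * (2 * M * ((h n)\<^sup>2 * Q))" .
    qed
    finally have main: "norm (t n) \<le> C2 * (gm n * \<epsilon>\<^sup>2 * M\<^sup>2 * norm P0) + C2 * (\<bar>bt n\<bar> * (2 * M * ((h n)\<^sup>2 * Q)))
        + C4 * e * (real (Suc n))\<^sup>2 * (\<bar>bt n\<bar> * ((\<nu> / b)\<^sup>2 * norm sol4))"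
      by simp
    have a1: "C2 * (gm n * \<epsilon>\<^sup>2 * M\<^sup>2 * norm P0) \<le> C2 * (gm n * e * M\<^sup>2 * norm P0)"
      using C2_nonneg gm_nonneg e by (intro mult_left_mono mult_right_mono) auto
    have a2: "C2 * (\<bar>bt n\<bar> * (2 * M * ((h n)\<^sup>2 * Q))) \<le> C2 * (\<bar>bt n\<bar> * (2 * M * ((e * (real (Suc n))\<^sup>2) * Q)))"
      unfolding h_def power_mult_distrib using C2_nonneg M Q e by (intro mult_left_mono mult_right_mono) auto
    have "norm (t n) \<le> C2 * (gm n * e * M\<^sup>2 * norm P0) + C2 * (\<bar>bt n\<bar> * (2 * M * ((e * (real (Suc n))\<^sup>2) * Q)))
        + C4 * e * (real (Suc n))\<^sup>2 * (\<bar>bt n\<bar> * ((\<nu> / b)\<^sup>2 * norm sol4))"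
      using main a1 a2 by linarith
    also have "\<dots> = (C2 * M\<^sup>2 * norm P0 * gm n
     + (C2 * (2 * M * Q) + C4 * ((\<nu> / b)\<^sup>2 * norm sol4)) * (\<bar>bt n\<bar> * (real (Suc n))\<^sup>2)) * e"
      by (simp add: algebra_simps del: of_nat_Suc)
    finally show ?thesis .
  qed
  let ?g = "\<lambda>n. (C2 * M\<^sup>2 * norm P0 * gm n
     + (C2 * (2 * M * Q) + C4 * ((\<nu> / b)\<^sup>2 * norm sol4)) * (\<bar>bt n\<bar> * (real (Suc n))\<^sup>2)) * e"
  have gs: "?g sums ((C2 * M\<^sup>2 * norm P0 * sigG
     + (C2 * (2 * M * Q) + C4 * ((\<nu> / b)\<^sup>2 * norm sol4)) * sigB) * e)"
    unfolding sigG_def sigB_def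
    by (intro sums_mult2 sums_add sums_mult summable_sums gm_sum bt_sum)
  have "norm (T P0 - P0) \<le> suminf ?g"
    using bounded_sums_l2[OF tn sums_summable[OF gs]] sums_unique[OF sums] by simp
  also have "suminf ?g = (C2 * M\<^sup>2 * norm P0 * sigG
     + (C2 * (2 * M * Q) + C4 * ((\<nu> / b)\<^sup>2 * norm sol4)) * sigB) * e"
    using sums_unique[OF gs] by simp
  finally show ?thesis by (simp add: e_def Q_def mult.commute)
qed

end

section \<open>Second differences and the regularity of fixed points\<close>

lemma sqi_shift:
  assumes f: "square_integrable f"
  shows "square_integrable (\<lambda>x. f (x + t))"
proof (rule square_integrableI)
  note [measurable] = square_integrableD[OF f]
  show "(\<lambda>x. f (x + t)) \<in> borel_measurable borel" by measurable
  show "integrable lborel (\<lambda>x. (f (x + t))\<^sup>2)"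
    using lborel_integrable_real_affine[OF square_integrable_sq[OF f], of 1 t] by (simp add: add.commute)
qed

lemma integral_shift: "(LINT x|lborel. f (x + t)) = (LINT x|lborel. f (x::real) :: real)"
  using lborel_integral_real_affine[of 1 f t] by (simp add: add.commute)

text \<open>The symmetric second difference has the real and even multiplier
  \<open>2 * cos (t * k) - 2\<close>, so the Hartley transform handles it without
  reflections.\<close>

definition diff2 :: "real \<Rightarrow> (real \<Rightarrow> real) \<Rightarrow> real \<Rightarrow> real" where
  "diff2 t f x = f (x + t) + f (x - t) - 2 * f x"

lemma sqi_diff2: "square_integrable f \<Longrightarrow> square_integrable (diff2 t f)"
  unfolding diff2_def using sqi_shift[of f t] sqi_shift[of f "-t"]
  by (intro square_integrable_diff square_integrable_add square_integrable_cmult) auto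

lemma cas_sym_sum: "cas (a + b) + cas (a - b) = 2 * cos b * cas a"
  by (simp add: cas_def cos_add cos_diff sin_add sin_diff algebra_simps)

lemma hart_diff2_arg:
  assumes g: "integrable lborel g"
  shows "diff2 t (hart g) x = hart (\<lambda>k. (2 * cos (t * k) - 2) * g k) x"
proof -
  have i: "integrable lborel (\<lambda>k. g k * cas (k * y))" for y by (rule integrable_cas[OF g]) simp
  have "(LINT k|lborel. g k * cas (k * (x + t))) + (LINT k|lborel. g k * cas (k * (x - t))) - 2 * (LINT k|lborel. g k * cas (k * x))
      = (LINT k|lborel. g k * cas (k * (x + t)) + g k * cas (k * (x - t)) - 2 * (g k * cas (k * x)))"
    using i by simp
  also have "\<dots> = (LINT k|lborel. (2 * cos (t * k) - 2) * g k * cas (k * x))"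
  proof (rule Bochner_Integration.integral_cong[OF HOL.refl])
    fix k
    have "cas (k * (x + t)) + cas (k * (x - t)) = 2 * cos (t * k) * cas (k * x)"
      using cas_sym_sum[of "k * x" "t * k"] by (simp add: algebra_simps)
    then have "g k * (cas (k * (x + t)) + cas (k * (x - t))) = g k * (2 * cos (t * k) * cas (k * x))" by simp
    then show "g k * cas (k * (x + t)) + g k * cas (k * (x - t)) - 2 * (g k * cas (k * x)) = (2 * cos (t * k) - 2) * g k * cas (k * x)"
      by (simp add: algebra_simps)
  qed
  finally show ?thesis by (simp add: diff2_def hart_def flip: add_divide_distrib diff_divide_distrib)
qed

lemma bounded_by_cos2: "bounded_by 4 (\<lambda>k. 2 * cos (t * k) - 2)"
proof (rule bounded_byI)
  show "\<bar>2 * cos (t * k) - 2\<bar> \<le> 4" for k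
    unfolding abs_le_iff using cos_le_one[of "t * k"] cos_ge_minus_one[of "t * k"] by linarith
qed measurable

lemma cos2_eq: "2 * cos (t * k) - 2 = - (t * k)\<^sup>2 * (snc (t * k / 2))\<^sup>2"
proof -
  have "2 * cos (t * k) - 2 = - 4 * (sin (t * k / 2))\<^sup>2" using cos_double_sin[of "t * k / 2"] by simp
  also have "(sin (t * k / 2))\<^sup>2 = (t * k / 2 * snc (t * k / 2))\<^sup>2" by (simp only: snc_mult)
  finally show ?thesis by (simp add: power_mult_distrib power_divide)
qed

lemma Hartley_diff2:
  assumes f: "integrable lborel f" "square_integrable f"
  shows "Hartley (cls (diff2 t f)) = mul (\<lambda>k. 2 * cos (t * k) - 2) (Hartley (cls f))"
proof -
  have i: "integrable lborel (\<lambda>x. f (x + s))" for s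
    using lborel_integrable_real_affine[OF f(1), of 1 s] by (simp add: add.commute)
  have i2: "integrable lborel (diff2 t f)"
    unfolding diff2_def using i[of t] i[of "-t"] f(1) by simp
  have hs: "hart (\<lambda>x. f (x + s)) k = (LINT x|lborel. f x * cas ((x - s) * k)) / sqrt (2 * pi)" for s k
    using integral_shift[of "\<lambda>x. f x * cas ((x - s) * k)" s] by (simp add: hart_def)
  have "hart (diff2 t f) k = (2 * cos (t * k) - 2) * hart f k" for k
  proof -
    have ic: "integrable lborel (\<lambda>x. f x * cas ((x - s) * k))" for s by (rule integrable_cas[OF f(1)]) simp
    have "hart (diff2 t f) k = hart (\<lambda>x. f (x + t) + f (x + - t)) k - hart (\<lambda>x. 2 * f x) k"
      unfolding diff2_def using hart_diff[of "\<lambda>x. f (x + t) + f (x + - t)" "\<lambda>x. 2 * f x" k] i[of t] i[of "-t"] f(1) by simp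
    also have "\<dots> = hart (\<lambda>x. f (x + t)) k + hart (\<lambda>x. f (x + - t)) k - 2 * hart f k"
      by (simp only: hart_add[OF i i] hart_cmult)
    also have "hart (\<lambda>x. f (x + t)) k + hart (\<lambda>x. f (x + - t)) k
        = (LINT x|lborel. f x * cas ((x - t) * k) + f x * cas ((x - - t) * k)) / sqrt (2 * pi)"
      unfolding hs using ic[of t] ic[of "-t"] by (simp add: add_divide_distrib)
    also have "(\<lambda>x. f x * cas ((x - t) * k) + f x * cas ((x - - t) * k)) = (\<lambda>x. 2 * cos (t * k) * (f x * cas (x * k)))"
    proof
      fix x
      have "cas ((x - t) * k) + cas ((x - - t) * k) = 2 * cos (t * k) * cas (x * k)"
        using cas_sym_sum[of "x * k" "t * k"] by (simp add: algebra_simps)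
      then have "f x * (cas ((x - t) * k) + cas ((x - - t) * k)) = f x * (2 * cos (t * k) * cas (x * k))" by simp
      then show "f x * cas ((x - t) * k) + f x * cas ((x - - t) * k) = 2 * cos (t * k) * (f x * cas (x * k))"
        by (simp add: algebra_simps)
    qed
    finally show ?thesis by (simp add: hart_def left_diff_distrib diff_divide_distrib)
  qed
  then have e: "hart (diff2 t f) = (\<lambda>k. (2 * cos (t * k) - 2) * hart f k)" by (rule ext)
  show ?thesis
    unfolding Hartley_cls(2)[OF sqi_diff2[OF f(2)] i2] Hartley_cls(2)[OF f(2,1)]
      mul_cls[OF bounded_by_cos2 Hartley_cls(1)[OF f(2,1)]] e ..
qed

text \<open>Divided by t^2, the multiplier of the second difference tends to -k^2 pointwise as t
  tends to 0 along 1, 1/2, 1/3 and so on. Fatou's lemma carries the uniform norm bound to the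
  limit.\<close>

lemma diff2_regularity:
  assumes f: "integrable lborel f" "square_integrable f"
    and c: "\<And>t. 0 < t \<Longrightarrow> t \<le> 1 \<Longrightarrow> norm (cls (diff2 t f)) \<le> c * t\<^sup>2"
  shows "square_integrable (\<lambda>k. k\<^sup>2 * fn (Hartley (cls f)) k) \<and> norm (cls (\<lambda>k. k\<^sup>2 * fn (Hartley (cls f)) k)) \<le> c"
proof (rule fatou_l2)
  let ?F = "fn (Hartley (cls f))"
  define t where "t n = 1 / real (Suc n)" for n
  have t: "0 < t n" "t n \<le> 1" for n by (auto simp: t_def)
  define g where "g n k = k\<^sup>2 * (snc (t n * k / 2))\<^sup>2 * ?F k" for n k
  have g_eq: "g n = (\<lambda>k. - (1 / (t n)\<^sup>2) * ((2 * cos (t n * k) - 2) * ?F k))" for n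
    using t[of n] by (auto simp: g_def cos2_eq power_mult_distrib fun_eq_iff)
  have sq: "square_integrable (\<lambda>k. (2 * cos (t n * k) - 2) * ?F k)" for n
    by (rule sqi_mul[OF bounded_by_cos2 sqi_fn])
  show "square_integrable (g n)" for n unfolding g_eq by (rule square_integrable_cmult[OF sq])
  show "norm (cls (g n)) \<le> c" for n
  proof -
    have "norm (cls (g n)) = 1 / (t n)\<^sup>2 * norm (mul (\<lambda>k. 2 * cos (t n * k) - 2) (Hartley (cls f)))"
      unfolding g_eq cls_scaleR[OF sq, symmetric] by (simp add: mul_def)
    also have "\<dots> = 1 / (t n)\<^sup>2 * norm (cls (diff2 (t n) f))"
      unfolding Hartley_diff2[OF f, symmetric] by simp
    also have "\<dots> \<le> 1 / (t n)\<^sup>2 * (c * (t n)\<^sup>2)" using c[OF t] by (intro mult_left_mono) auto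
    also have "\<dots> = c" using t[of n] by simp
    finally show ?thesis .
  qed
  show "AE k in lborel. (\<lambda>n. g n k) \<longlonglongrightarrow> k\<^sup>2 * ?F k"
  proof (rule AE_I2)
    fix k
    have "t \<longlonglongrightarrow> 0" unfolding t_def by (rule LIMSEQ_Suc[OF lim_1_over_n])
    then have "(\<lambda>n. t n * k / 2) \<longlonglongrightarrow> 0 * k / 2" by (intro tendsto_intros) auto
    then have "(\<lambda>n. snc (t n * k / 2)) \<longlonglongrightarrow> snc (0 * k / 2)" by (rule isCont_tendsto_compose[OF isCont_snc])
    then have "(\<lambda>n. k\<^sup>2 * (snc (t n * k / 2))\<^sup>2 * ?F k) \<longlonglongrightarrow> k\<^sup>2 * (snc (0 * k / 2))\<^sup>2 * ?F k"
      by (intro tendsto_intros)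
    then show "(\<lambda>n. g n k) \<longlonglongrightarrow> k\<^sup>2 * ?F k" by (simp add: g_def snc_def)
  qed
qed measurable


lemma cas_lipschitz: "\<bar>cas x - cas y\<bar> \<le> 2 * \<bar>x - y\<bar>"
proof -
  have "norm (cas x - cas y) \<le> 2 * norm (x - y)"
  proof (rule field_differentiable_bound[where S=UNIV])
    show "(cas has_real_derivative cas (- z)) (at z within UNIV)" for z
      using cas_affine_DERIV[of 1 z] by simp
  qed (use cas_le in auto)
  then show ?thesis by simp
qed

lemma abs_sm_mult_le: "\<bar>sm c k * y\<bar> \<le> \<bar>y\<bar>"
  using mult_right_mono[OF abs_snc_le[of "c * k / 2"], of "\<bar>y\<bar>"] by (simp add: abs_mult sm_def)

context step begin

text \<open>Averaging gains one derivative at the price 1/h. As \<open>h n \<ge> \<epsilon>\<close>,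
  the gain is uniform in \<open>n\<close>; that the price is unbounded as \<epsilon> tends to 0 does
  no harm, since it enters only the membership in H3 and not the size of the correction.\<close>

lemma k_sm_le: "\<bar>k * sm (h n) k\<bar> \<le> 2 / h n"
proof -
  have "\<bar>(h n * k / 2) * snc (h n * k / 2)\<bar> \<le> 1" by (rule abs_mult_snc_le)
  then have "h n / 2 * \<bar>k * sm (h n) k\<bar> \<le> 1" using h_pos[of n] by (simp add: sm_def abs_mult)
  then show ?thesis using h_pos[of n] by (simp add: field_simps)
qed

lemma h_ge: "2 / h n \<le> 2 / \<epsilon>"
  using eps h_pos[of n] by (intro divide_left_mono) (auto simp: h_def)

lemma u_lipschitz: "\<bar>u n p (x + t) - u n p x\<bar> \<le> 2 / \<epsilon> * \<bar>t\<bar> * (Cinf * norm p)"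
proof -
  define g where "g k = sm (h n) k * (fn p k / om k)" for k
  have g: "integrable lborel g"
  proof (rule Bochner_Integration.integrable_bound[OF integrable_emb])
    show "g \<in> borel_measurable lborel" unfolding g_def by measurable
    show "AE k in lborel. norm (g k) \<le> norm (fn p k / om k)"
      unfolding g_def real_norm_def by (intro AE_I2 abs_sm_mult_le)
  qed
  have ug: "u n p y = hart g y" for y unfolding u_def g_def by (rule emb_mul[OF bounded_by_sm])
  have ic: "integrable lborel (\<lambda>k. g k * cas (k * y))" for y by (rule integrable_cas[OF g]) simp
  have "\<bar>(LINT k|lborel. g k * cas (k * (x + t))) - (LINT k|lborel. g k * cas (k * x))\<bar>
      = \<bar>LINT k|lborel. g k * cas (k * (x + t)) - g k * cas (k * x)\<bar>"
    using ic by simp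
  also have "\<dots> \<le> (LINT k|lborel. \<bar>g k * cas (k * (x + t)) - g k * cas (k * x)\<bar>)" by (rule integral_abs_bound)
  also have "\<dots> \<le> (LINT k|lborel. 2 * (2 / \<epsilon>) * \<bar>t\<bar> * \<bar>fn p k / om k\<bar>)"
  proof (rule integral_mono)
    fix k
    have "\<bar>g k * cas (k * (x + t)) - g k * cas (k * x)\<bar> = \<bar>g k\<bar> * \<bar>cas (k * (x + t)) - cas (k * x)\<bar>"
      by (simp add: abs_mult flip: right_diff_distrib)
    also have "\<dots> \<le> \<bar>g k\<bar> * (2 * \<bar>k * (x + t) - k * x\<bar>)" by (intro mult_left_mono cas_lipschitz) simp
    also have "\<dots> = 2 * \<bar>k * sm (h n) k\<bar> * \<bar>t\<bar> * \<bar>fn p k / om k\<bar>" by (simp add: g_def abs_mult algebra_simps flip: abs_mult)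
    also have "\<dots> \<le> 2 * (2 / \<epsilon>) * \<bar>t\<bar> * \<bar>fn p k / om k\<bar>"
      using order_trans[OF k_sm_le h_ge] by (intro mult_right_mono mult_left_mono) auto
    finally show "\<bar>g k * cas (k * (x + t)) - g k * cas (k * x)\<bar> \<le> 2 * (2 / \<epsilon>) * \<bar>t\<bar> * \<bar>fn p k / om k\<bar>" .
  next
    show "integrable lborel (\<lambda>k. \<bar>g k * cas (k * (x + t)) - g k * cas (k * x)\<bar>)" using ic by simp
    show "integrable lborel (\<lambda>k. 2 * (2 / \<epsilon>) * \<bar>t\<bar> * \<bar>fn p k / om k\<bar>)"
      by (intro integrable_mult_right integrable_abs integrable_emb)
  qed
  also have "\<dots> = 2 * (2 / \<epsilon>) * \<bar>t\<bar> * (LINT k|lborel. \<bar>fn p k / om k\<bar>)" by (rule integral_mult_right_zero)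
  also have "\<dots> = 2 * (2 / \<epsilon> * \<bar>t\<bar> * (LINT k|lborel. \<bar>fn p k / om k\<bar>))" by (simp only: mult.assoc)
  also have "\<dots> \<le> 2 * (2 / \<epsilon> * \<bar>t\<bar> * (Cinf * norm p))"
    using integral_abs_emb[of p] eps by (intro mult_left_mono) auto
  finally have *: "\<bar>(LINT k|lborel. g k * cas (k * (x + t))) - (LINT k|lborel. g k * cas (k * x))\<bar> \<le> 2 * (2 / \<epsilon> * \<bar>t\<bar> * (Cinf * norm p))" .
  have X: "0 \<le> 2 / \<epsilon> * \<bar>t\<bar> * (Cinf * norm p)" using eps Cinf_nonneg by simp
  have "\<bar>u n p (x + t) - u n p x\<bar> = \<bar>(LINT k|lborel. g k * cas (k * (x + t))) - (LINT k|lborel. g k * cas (k * x))\<bar> / sqrt (2 * pi)"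
    by (simp add: ug hart_def abs_divide flip: diff_divide_distrib)
  also have "\<dots> \<le> 2 * (2 / \<epsilon> * \<bar>t\<bar> * (Cinf * norm p)) / sqrt (2 * pi)" using * by (intro divide_right_mono) auto
  also have "\<dots> \<le> 2 * (2 / \<epsilon> * \<bar>t\<bar> * (Cinf * norm p)) / 2" using sqrt_2pi_ge X by (intro divide_left_mono) auto
  also have "\<dots> = 2 / \<epsilon> * \<bar>t\<bar> * (Cinf * norm p)" by (rule nonzero_mult_div_cancel_left) simp
  finally show ?thesis .
qed

text \<open>Of the factor k^2 in the multiplier of the second difference, one power is absorbed by
  \<open>sm\<close> and the other by the weight \<open>1 / om\<close> of the encoding.\<close>

lemma norm_diff2_u: "norm (cls (diff2 t (u n p))) \<le> t\<^sup>2 * (2 / \<epsilon>) * norm p"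
proof -
  have b0: "bounded_by 4 (\<lambda>k. (2 * cos (t * k) - 2) * sm (h n) k)"
    using bounded_by_mult[OF bounded_by_cos2 bounded_by_sm] by simp
  have ig: "integrable lborel (\<lambda>k. sm (h n) k * (fn p k / om k))"
  proof (rule Bochner_Integration.integrable_bound[OF integrable_emb])
    show "AE k in lborel. norm (sm (h n) k * (fn p k / om k)) \<le> norm (fn p k / om k)"
      unfolding real_norm_def by (intro AE_I2 abs_sm_mult_le)
  qed measurable
  have e1: "diff2 t (u n p) = emb (mul (\<lambda>k. (2 * cos (t * k) - 2) * sm (h n) k) p)"
    unfolding u_def emb_mul[OF bounded_by_sm, abs_def] emb_mul[OF b0, abs_def]
    by (rule ext) (simp only: hart_diff2_arg[OF ig] mult.assoc)
  have e2: "bounded_by (t\<^sup>2 * (2 / \<epsilon>)) (\<lambda>k. (2 * cos (t * k) - 2) * sm (h n) k / om k)"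
  proof (rule bounded_byI)
    fix k
    have 1: "\<bar>2 * cos (t * k) - 2\<bar> \<le> t\<^sup>2 * (\<bar>k\<bar> * \<bar>k\<bar>)"
    proof -
      have "(snc (t * k / 2))\<^sup>2 \<le> 1" using abs_snc_le by (simp add: abs_square_le_1)
      then have "(t * k)\<^sup>2 * (snc (t * k / 2))\<^sup>2 \<le> (t * k)\<^sup>2 * 1" by (intro mult_left_mono) auto
      moreover have "\<bar>2 * cos (t * k) - 2\<bar> = (t * k)\<^sup>2 * (snc (t * k / 2))\<^sup>2" unfolding cos2_eq by (simp add: abs_mult)
      moreover have "(t * k)\<^sup>2 * 1 = t\<^sup>2 * (\<bar>k\<bar> * \<bar>k\<bar>)" by (simp add: power_mult_distrib power2_eq_square)
      ultimately show ?thesis by linarith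
    qed
    have "\<bar>(2 * cos (t * k) - 2) * sm (h n) k / om k\<bar> = \<bar>2 * cos (t * k) - 2\<bar> * \<bar>sm (h n) k\<bar> / om k"
      using om_pos[of k] by (simp add: abs_mult)
    also have "\<dots> \<le> t\<^sup>2 * (\<bar>k\<bar> * \<bar>k\<bar>) * \<bar>sm (h n) k\<bar> / om k"
      using 1 om_pos[of k] by (intro divide_right_mono mult_right_mono) (auto intro: less_imp_le)
    also have "\<dots> = t\<^sup>2 * \<bar>k * sm (h n) k\<bar> * (\<bar>k\<bar> / om k)" by (simp add: abs_mult)
    also have "\<dots> \<le> t\<^sup>2 * (2 / \<epsilon>) * 1"
      using order_trans[OF k_sm_le h_ge, of k n] abs_le_om[of k] om_pos[of k] eps by (intro mult_mono) auto
    finally show "\<bar>(2 * cos (t * k) - 2) * sm (h n) k / om k\<bar> \<le> t\<^sup>2 * (2 / \<epsilon>)" by simp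
  qed measurable
  show ?thesis unfolding e1 by (rule norm_emb_mul_le[OF b0 e2])
qed

text \<open>By translation invariance the squared norm of the first difference is minus the inner
  product of the second difference with the function itself. Cauchy-Schwarz then gives order t from
  the order t^2 of \<open>norm_diff2_u\<close>.\<close>

lemma norm_shift_u: "norm (cls (\<lambda>x. u n p (x + t) - u n p x)) \<le> \<bar>t\<bar> * sqrt (2 / \<epsilon>) * norm p"
proof -
  let ?u = "u n p"
  have s: "square_integrable (\<lambda>x. ?u (x + t))" for t by (rule sqi_shift[OF sqi_u])
  have i1: "integrable lborel (\<lambda>x. ?u (x + t) * ?u x)" for t by (rule square_integrable_prod[OF s sqi_u])
  have i2: "integrable lborel (\<lambda>x. ?u x * ?u x)" "integrable lborel (\<lambda>x. ?u (x + t) * ?u (x + t))"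
    by (rule square_integrable_prod[OF sqi_u sqi_u] square_integrable_prod[OF s s])+
  have e1: "(LINT x|lborel. ?u (x + t) * ?u (x + t)) = (LINT x|lborel. ?u x * ?u x)"
    by (rule integral_shift[of "\<lambda>x. ?u x * ?u x"])
  have e2: "(LINT x|lborel. ?u (x + - t) * ?u x) = (LINT x|lborel. ?u (x + t) * ?u x)"
    using integral_shift[of "\<lambda>x. ?u (x + - t) * ?u x" t] by (simp add: mult.commute)
  have "(norm (cls (\<lambda>x. ?u (x + t) - ?u x)))\<^sup>2 = (LINT x|lborel. ?u (x + t) * ?u (x + t) - 2 * (?u (x + t) * ?u x) + ?u x * ?u x)"
    unfolding norm_cls[OF square_integrable_diff[OF s sqi_u]] by (simp add: power2_eq_square algebra_simps)
  also have "\<dots> = 2 * (LINT x|lborel. ?u x * ?u x) - 2 * (LINT x|lborel. ?u (x + t) * ?u x)"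
    using i1[of t] i2 by (simp add: e1)
  finally have a: "(norm (cls (\<lambda>x. ?u (x + t) - ?u x)))\<^sup>2 = 2 * (LINT x|lborel. ?u x * ?u x) - 2 * (LINT x|lborel. ?u (x + t) * ?u x)" .
  have "inner (cls (diff2 t ?u)) (cls ?u) = (LINT x|lborel. ?u (x + t) * ?u x + ?u (x + - t) * ?u x - 2 * (?u x * ?u x))"
    unfolding inner_cls[OF sqi_diff2[OF sqi_u] sqi_u] diff2_def by (simp add: algebra_simps)
  also have "\<dots> = 2 * (LINT x|lborel. ?u (x + t) * ?u x) - 2 * (LINT x|lborel. ?u x * ?u x)"
  proof -
    have "(LINT x|lborel. ?u (x + t) * ?u x + ?u (x + - t) * ?u x - 2 * (?u x * ?u x))
        = (LINT x|lborel. ?u (x + t) * ?u x) + (LINT x|lborel. ?u (x + - t) * ?u x) - 2 * (LINT x|lborel. ?u x * ?u x)"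
      using i1[of t] i1[of "-t"] i2 by simp
    then show ?thesis unfolding e2 by simp
  qed
  finally have "(norm (cls (\<lambda>x. ?u (x + t) - ?u x)))\<^sup>2 = - inner (cls (diff2 t ?u)) (cls ?u)" using a by simp
  also have "\<dots> \<le> norm (cls (diff2 t ?u)) * norm (cls ?u)"
    using Cauchy_Schwarz_ineq2[of "cls (diff2 t ?u)" "cls ?u"] by (simp add: abs_le_iff)
  also have "\<dots> \<le> (t\<^sup>2 * (2 / \<epsilon>) * norm p) * norm p"
    using eps by (intro mult_mono norm_diff2_u norm_u) auto
  also have "\<dots> = (\<bar>t\<bar> * sqrt (2 / \<epsilon>) * norm p)\<^sup>2"
  proof -
    have "(sqrt (2 / \<epsilon>))\<^sup>2 = 2 / \<epsilon>" using eps by simp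
    then show ?thesis unfolding power_mult_distrib by (simp add: power2_eq_square)
  qed
  finally show ?thesis by (rule power2_le_imp_le) (use eps in simp)
qed

definition Creg :: "l2 \<Rightarrow> real" where
  "Creg p = M * ((2 / \<epsilon>) * norm p) + 2 * ((2 / \<epsilon>) * (Cinf * norm p) * (sqrt (2 / \<epsilon>) * norm p))"

text \<open>A chain rule for second differences when \<open>G' n\<close> is merely Lipschitz:
  \<open>G' n\<close> times the second difference of \<open>u\<close>, plus remainders bounded by
  squares of first differences. Of such a square one factor is taken in sup norm by
  \<open>u_lipschitz\<close>, the other in L2 by \<open>norm_shift_u\<close>, so it is of order t^2
  as well.\<close>

lemma norm_diff2_N:
  assumes p: "inM p"
  shows "norm (cls (diff2 t (N n p))) \<le> d n * Creg p * t\<^sup>2"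
proof -
  let ?u = "u n p"
  define Lu where "Lu = 2 / \<epsilon> * \<bar>t\<bar> * (Cinf * norm p)"
  have Lu: "0 \<le> Lu" using eps Cinf_nonneg by (simp add: Lu_def)
  define D where "D s x = ?u (x + s) - ?u x" for s x
  have sqD: "square_integrable (D s)" for s unfolding D_def by (intro square_integrable_diff sqi_shift sqi_u)
  have Db: "\<bar>D s x\<bar> \<le> Lu" if "\<bar>s\<bar> = \<bar>t\<bar>" for s x
    unfolding D_def Lu_def that[symmetric] by (rule u_lipschitz)
  have sqDD: "square_integrable (\<lambda>x. D s x * D s x)" "norm (cls (\<lambda>x. D s x * D s x)) \<le> Lu * (\<bar>t\<bar> * sqrt (2 / \<epsilon>) * norm p)" if "\<bar>s\<bar> = \<bar>t\<bar>" for s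
  proof -
    note m = square_integrable_mult_bounded[OF sqD square_integrableD[OF sqD] Db[OF that]]
    show "square_integrable (\<lambda>x. D s x * D s x)" by (rule m)
    have "norm (cls (D s)) \<le> \<bar>t\<bar> * sqrt (2 / \<epsilon>) * norm p" unfolding D_def that[symmetric] by (rule norm_shift_u)
    then show "norm (cls (\<lambda>x. D s x * D s x)) \<le> Lu * (\<bar>t\<bar> * sqrt (2 / \<epsilon>) * norm p)"
      using order_trans[OF m(2) mult_left_mono[OF _ Lu]] by blast
  qed
  have sqA: "square_integrable (\<lambda>x. \<bar>diff2 t ?u x\<bar>)"
    by (rule square_integrable_bound[OF sqi_diff2[OF sqi_u, of t n p]]) (use square_integrableD[OF sqi_diff2[OF sqi_u, of t n p]] in auto)
  define Bf where "Bf x = M * \<bar>diff2 t ?u x\<bar> + (D t x * D t x + D (-t) x * D (-t) x)" for x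
  have sqB: "square_integrable Bf"
    unfolding Bf_def by (intro square_integrable_add square_integrable_cmult sqA sqDD) auto
  have "norm (cls (diff2 t (N n p))) \<le> d n * norm (cls Bf)"
  proof (rule norm_cls_le[OF sqi_diff2[OF N_sqi[OF p]] sqB d_nonneg AE_I2])
    fix x
    have aff: "\<bar>G n y - G n (?u x) - G' n (?u x) * (y - ?u x)\<bar> \<le> d n * ((y - ?u x) * (y - ?u x))" if y: "\<bar>y\<bar> \<le> M" for y
    proof -
      have "\<bar>G n y - G n (?u x) - G' n (?u x) * (y - ?u x)\<bar> \<le> (d n * \<bar>y - ?u x\<bar>) * \<bar>y - ?u x\<bar>"
      proof (rule G_affine[OF y u_bound[OF p]])
        fix z assume z: "z \<in> closed_segment y (?u x)"
        have "\<bar>z\<bar> \<le> M" using segment_bound[OF z, of 0] y u_bound[OF p, of n x] by simp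
        from G2[OF this u_bound[OF p], of n n x] have "\<bar>G' n z - G' n (?u x)\<bar> \<le> d n * \<bar>z - ?u x\<bar>" by (simp add: d_def)
        also have "\<dots> \<le> d n * \<bar>y - ?u x\<bar>" using segment_bound[OF z, of "?u x"] d_nonneg by (intro mult_left_mono) auto
        finally show "\<bar>G' n z - G' n (?u x)\<bar> \<le> d n * \<bar>y - ?u x\<bar>" .
      qed
      then show ?thesis by (simp add: mult.assoc flip: abs_mult)
    qed
    have 1: "\<bar>G n (?u (x + t)) - G n (?u x) - G' n (?u x) * D t x\<bar> \<le> d n * (D t x * D t x)"
      unfolding D_def by (rule aff[OF u_bound[OF p]])
    have 2: "\<bar>G n (?u (x - t)) - G n (?u x) - G' n (?u x) * D (-t) x\<bar> \<le> d n * (D (-t) x * D (-t) x)"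
      unfolding D_def using aff[OF u_bound[OF p, of n "x - t"]] by simp
    have "\<bar>G' n (?u x)\<bar> \<le> d n * M"
      by (rule order_trans[OF G'_le[OF u_bound[OF p]]]) (intro mult_left_mono u_bound[OF p] d_nonneg)
    then have 3: "\<bar>G' n (?u x) * diff2 t ?u x\<bar> \<le> d n * M * \<bar>diff2 t ?u x\<bar>"
      unfolding abs_mult by (intro mult_right_mono) auto
    have "diff2 t (N n p) x = (G n (?u (x + t)) - G n (?u x) - G' n (?u x) * D t x)
        + (G n (?u (x - t)) - G n (?u x) - G' n (?u x) * D (-t) x) + G' n (?u x) * diff2 t ?u x"
      by (simp add: diff2_def N_def D_def algebra_simps)
    then have "\<bar>diff2 t (N n p) x\<bar> \<le> d n * (D t x * D t x) + d n * (D (-t) x * D (-t) x) + d n * M * \<bar>diff2 t ?u x\<bar>"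
      using 1 2 3 by linarith
    also have "\<dots> = d n * Bf x" by (simp add: Bf_def algebra_simps)
    also have "\<dots> \<le> d n * \<bar>Bf x\<bar>" using d_nonneg by (intro mult_left_mono) auto
    finally show "\<bar>diff2 t (N n p) x\<bar> \<le> d n * \<bar>Bf x\<bar>" .
  qed
  also have "norm (cls Bf) \<le> Creg p * t\<^sup>2"
  proof -
    have "cls Bf = M *\<^sub>R cls (\<lambda>x. \<bar>diff2 t ?u x\<bar>) + (cls (\<lambda>x. D t x * D t x) + cls (\<lambda>x. D (-t) x * D (-t) x))"
      unfolding Bf_def using sqDD[of t] sqDD[of "-t"] sqA by (simp add: cls_add cls_scaleR)
    then have "norm (cls Bf) \<le> M * norm (cls (\<lambda>x. \<bar>diff2 t ?u x\<bar>)) + (norm (cls (\<lambda>x. D t x * D t x)) + norm (cls (\<lambda>x. D (-t) x * D (-t) x)))"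
      using M norm_triangle_ineq[of "M *\<^sub>R cls (\<lambda>x. \<bar>diff2 t ?u x\<bar>)" "cls (\<lambda>x. D t x * D t x) + cls (\<lambda>x. D (-t) x * D (-t) x)"]
        norm_triangle_ineq[of "cls (\<lambda>x. D t x * D t x)" "cls (\<lambda>x. D (-t) x * D (-t) x)"] by simp
    also have "\<dots> \<le> M * (t\<^sup>2 * (2 / \<epsilon>) * norm p) + (Lu * (\<bar>t\<bar> * sqrt (2 / \<epsilon>) * norm p) + Lu * (\<bar>t\<bar> * sqrt (2 / \<epsilon>) * norm p))"
    proof (intro add_mono mult_left_mono sqDD(2))
      have "norm (cls (\<lambda>x. \<bar>diff2 t ?u x\<bar>)) \<le> 1 * norm (cls (diff2 t ?u))"
        by (rule norm_cls_le[OF sqA sqi_diff2[OF sqi_u]]) auto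
      then show "norm (cls (\<lambda>x. \<bar>diff2 t ?u x\<bar>)) \<le> t\<^sup>2 * (2 / \<epsilon>) * norm p" using norm_diff2_u[of t n p] by simp
    qed (use M in auto)
    also have "\<dots> = Creg p * (\<bar>t\<bar> * \<bar>t\<bar>)" by (simp add: Creg_def Lu_def power2_eq_square algebra_simps)
    finally show ?thesis by (simp add: power2_eq_square)
  qed
  finally show ?thesis using d_nonneg[of n] by (simp add: mult_left_mono mult.assoc)
qed

text \<open>The multipliers in \<open>T\<close> are bounded and commute with the weight k^2, which
  can therefore be applied to the nonlinear terms. The weight is first cut off at |k| = R to stay
  bounded; the estimate does not depend on R, and Fatou's lemma removes the cut-off.\<close>

lemma fixed_point_regularity:
  assumes p: "inM p" and T: "T p = p"
  shows "square_integrable (\<lambda>k. k\<^sup>2 * fn p k)"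
proof -
  let ?F = "\<lambda>n. Hartley (cls (N n p))"
  have reg: "square_integrable (\<lambda>k. k\<^sup>2 * fn (?F n) k)" "norm (cls (\<lambda>k. k\<^sup>2 * fn (?F n) k)) \<le> d n * Creg p" for n
    using diff2_regularity[OF N_int[OF p] N_sqi[OF p] norm_diff2_N[OF p], of n] by auto
  define J where "J R k = (if \<bar>k\<bar> \<le> real R then k\<^sup>2 else 0)" for R k
  have J: "bounded_by ((real R)\<^sup>2) (J R)" for R
  proof (rule bounded_byI)
    show "J R \<in> borel_measurable borel" unfolding J_def by measurable
    show "\<bar>J R k\<bar> \<le> (real R)\<^sup>2" for k
      using abs_le_square_iff[of k "real R"] by (auto simp: J_def)
  qed
  define C where "C = (\<Sum>n. d n * (C2 * Creg p))"
  have "norm (mul (J R) p) \<le> C" for R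
  proof -
    have t: "norm (mul (J R) (mul (om_symb n) (?F n))) \<le> d n * (C2 * Creg p)" for n
    proof -
      have "norm (mul (J R) (mul (om_symb n) (?F n))) = norm (mul (\<lambda>k. J R k * om_symb n k) (?F n))"
        by (simp add: mul_mul[OF J bounded_by_om_symb])
      also have "\<dots> \<le> C2 * norm (cls (\<lambda>k. k\<^sup>2 * fn (?F n) k))"
      proof (rule norm_mul_le[OF bounded_by_mult[OF J bounded_by_om_symb] reg(1) C2_nonneg AE_I2])
        fix k
        have "\<bar>J R k * om_symb n k * fn (?F n) k\<bar> = \<bar>om_symb n k\<bar> * \<bar>J R k * fn (?F n) k\<bar>" by (simp add: abs_mult)
        also have "\<dots> \<le> C2 * \<bar>k\<^sup>2 * fn (?F n) k\<bar>"
          using bounded_by_om_symb[of n] by (intro mult_mono C2_nonneg) (auto simp: bounded_by_def J_def)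
        finally show "\<bar>J R k * om_symb n k * fn (?F n) k\<bar> \<le> C2 * \<bar>k\<^sup>2 * fn (?F n) k\<bar>" .
      qed
      also have "\<dots> \<le> C2 * (d n * Creg p)" by (intro mult_left_mono reg C2_nonneg)
      finally show ?thesis by (simp add: mult_ac)
    qed
    have "mul (J R) p = (\<Sum>n. mul (J R) (mul (om_symb n) (?F n)))"
      using summable_norm_mul[OF T_summable[OF p] J] T unfolding T_def by simp
    then show ?thesis unfolding C_def
      using bounded_sums_l2[OF t summable_mult2[OF summable_d]] by simp
  qed
  then have "square_integrable (\<lambda>k. k\<^sup>2 * fn p k) \<and> norm (cls (\<lambda>k. k\<^sup>2 * fn p k)) \<le> C"
  proof (intro fatou_l2[where f="\<lambda>R k. J R k * fn p k"])
    show "square_integrable (\<lambda>k. J R k * fn p k)" for R by (rule sqi_mul[OF J sqi_fn])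
    show "AE k in lborel. (\<lambda>R. J R k * fn p k) \<longlonglongrightarrow> k\<^sup>2 * fn p k"
    proof (rule AE_I2)
      fix k
      obtain R0 where "\<bar>k\<bar> \<le> real R0" using real_arch_simple by blast
      then have "eventually (\<lambda>R. J R k * fn p k = k\<^sup>2 * fn p k) sequentially"
        by (intro eventually_sequentiallyI[of R0]) (auto simp: J_def)
      then show "(\<lambda>R. J R k * fn p k) \<longlonglongrightarrow> k\<^sup>2 * fn p k" by (rule tendsto_eventually)
    qed
  qed (auto simp: mul_def)
  then show ?thesis by simp
qed

text \<open>At \<open>P0 + D\<close> the equation reads \<open>D - Kop D = F D\<close>, where
  \<open>F\<close> has the small Lipschitz constant \<theta>. Inverting the left side on even
  elements gives \<open>\<Psi>\<close>, a contraction with factor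
  \<open>CK * \<theta> \<le> 1 / 2\<close>; the bound \<open>\<rho> / 2\<close> on
  \<open>\<Psi> 0\<close> leaves just enough room for the ball to be mapped into itself.\<close>

lemma fixed_point:
  assumes ball: "Cinf * (norm P0 + \<rho>) \<le> M" and \<rho>: "0 \<le> \<rho>" and \<theta>: "CK * \<theta> \<le> 1 / 2" "0 \<le> \<theta>"
    and lip: "\<And>p q. inM p \<Longrightarrow> inM q \<Longrightarrow> norm (p - P0) \<le> \<rho> \<Longrightarrow> norm (q - P0) \<le> \<rho> \<Longrightarrow>
        norm (T p - T q - Kop (p - q)) \<le> \<theta> * norm (p - q)"
    and res: "CK * norm (T P0 - P0) \<le> \<rho> / 2"
  shows "\<exists>D. refl D = D \<and> norm D \<le> \<rho> \<and> T (P0 + D) = P0 + D \<and>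
     (\<forall>D'. refl D' = D' \<and> norm D' \<le> \<rho> \<and> T (P0 + D') = P0 + D' \<longrightarrow> D' = D)"
proof -
  define S where "S = {D. refl D = D \<and> norm D \<le> \<rho>}"
  have rP0: "refl P0 = P0" by (simp add: P0_def refl_scaleR refl_solp)
  have inS: "inM (P0 + D)" if "D \<in> S" for D
  proof -
    have "norm (P0 + D) \<le> norm P0 + \<rho>" using norm_triangle_ineq[of P0 D] that by (simp add: S_def)
    then have "Cinf * norm (P0 + D) \<le> Cinf * (norm P0 + \<rho>)" using Cinf_nonneg by (intro mult_left_mono)
    then show ?thesis using ball by (simp add: inM_def)
  qed
  define F where "F D = T (P0 + D) - P0 - Kop D" for D
  have Fr: "refl (F D) = F D" if "D \<in> S" for D
    using that inS[OF that] rP0 by (simp add: F_def refl_diff refl_T refl_add Kop_refl S_def)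
  define \<Psi> where "\<Psi> D = (SOME y. refl y = y \<and> y - Kop y = F D)" for D
  have \<Psi>: "refl (\<Psi> D) = \<Psi> D" "\<Psi> D - Kop (\<Psi> D) = F D" if "D \<in> S" for D
  proof -
    have "\<exists>y. refl y = y \<and> y - Kop y = F D" using Kop_solve[OF Fr[OF that]] by blast
    from someI_ex[OF this] show "refl (\<Psi> D) = \<Psi> D" "\<Psi> D - Kop (\<Psi> D) = F D" by (auto simp: \<Psi>_def)
  qed
  have lipF: "norm (F D - F D') \<le> \<theta> * norm (D - D')" if "D \<in> S" "D' \<in> S" for D D'
  proof -
    have "F D - F D' = T (P0 + D) - T (P0 + D') - Kop ((P0 + D) - (P0 + D'))"
      by (simp add: F_def Kop_diff)
    then show ?thesis using lip[OF inS[OF that(1)] inS[OF that(2)]] that by (simp add: S_def)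
  qed
  have contr: "norm (\<Psi> D - \<Psi> D') \<le> 1 / 2 * norm (D - D')" if "D \<in> S" "D' \<in> S" for D D'
  proof -
    have "(\<Psi> D - \<Psi> D') - Kop (\<Psi> D - \<Psi> D') = F D - F D'" 
      unfolding \<Psi>(2)[OF that(1), symmetric] \<Psi>(2)[OF that(2), symmetric] Kop_diff by simp
    moreover have "refl (\<Psi> D - \<Psi> D') = \<Psi> D - \<Psi> D'" using \<Psi>(1)[OF that(1)] \<Psi>(1)[OF that(2)] by (simp add: refl_diff)
    ultimately have "norm (\<Psi> D - \<Psi> D') \<le> CK * norm (F D - F D')" using Kop_bound by metis
    also have "\<dots> \<le> CK * (\<theta> * norm (D - D'))" using lipF[OF that] CK_nonneg by (intro mult_left_mono) auto
    also have "\<dots> = (CK * \<theta>) * norm (D - D')" by simp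
    also have "\<dots> \<le> 1 / 2 * norm (D - D')" using \<theta> by (intro mult_right_mono) auto
    finally show ?thesis .
  qed
  have z: "0 \<in> S" using \<rho> refl_diff[of 0 0] by (simp add: S_def)
  have K0: "Kop 0 = 0" using Kop_diff[of 0 0] by simp
  have \<Psi>0: "norm (\<Psi> 0) \<le> \<rho> / 2"
    using Kop_bound[OF \<Psi>(1)[OF z]] \<Psi>(2)[OF z] res by (simp add: F_def K0)
  have maps: "\<Psi> ` S \<subseteq> S"
  proof safe
    fix D assume D: "D \<in> S"
    have "norm (\<Psi> D) \<le> norm (\<Psi> D - \<Psi> 0) + norm (\<Psi> 0)" using norm_triangle_ineq[of "\<Psi> D - \<Psi> 0" "\<Psi> 0"] by simp
    also have "\<dots> \<le> 1 / 2 * norm (D - 0) + \<rho> / 2" by (intro add_mono contr D z \<Psi>0)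
    also have "\<dots> \<le> \<rho>" using D by (simp add: S_def)
    finally show "\<Psi> D \<in> S" using \<Psi>(1)[OF D] by (simp add: S_def)
  qed
  have cl: "closed S"
  proof -
    have "closed {D. refl D = D}"
      by (intro closed_Collect_eq linear_continuous_on[OF bounded_linear_refl] continuous_on_id)
    moreover have "closed {D :: l2. norm D \<le> \<rho>}" by (intro closed_Collect_le continuous_intros)
    ultimately have "closed ({D. refl D = D} \<inter> {D. norm D \<le> \<rho>})" by (rule closed_Int)
    then show ?thesis by (simp add: S_def Collect_conj_eq)
  qed
  have "\<exists>!D\<in>S. \<Psi> D = D"
    by (rule Banach_fix[where c="1/2"]) (use z maps contr cl in \<open>auto simp: dist_norm complete_eq_closed\<close>)
  moreover have "\<Psi> D = D \<longleftrightarrow> T (P0 + D) = P0 + D" if "D \<in> S" for D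
  proof
    assume "\<Psi> D = D"
    then have "D - Kop D = T (P0 + D) - P0 - Kop D" using \<Psi>(2)[OF that] by (simp add: F_def)
    then show "T (P0 + D) = P0 + D" by (simp add: algebra_simps)
  next
    assume "T (P0 + D) = P0 + D"
    then have "F D = D - Kop D" by (simp add: F_def)
    moreover have "(\<Psi> D - D) - Kop (\<Psi> D - D) = (\<Psi> D - Kop (\<Psi> D)) - (D - Kop D)" by (simp add: Kop_diff)
    ultimately have "(\<Psi> D - D) - Kop (\<Psi> D - D) = 0" using \<Psi>(2)[OF that] by simp
    moreover have "refl (\<Psi> D - D) = \<Psi> D - D" using \<Psi>(1)[OF that] that by (simp add: refl_diff S_def)
    ultimately have "norm (\<Psi> D - D) \<le> CK * norm (0::l2)" using Kop_bound by metis
    then show "\<Psi> D = D" by simp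
  qed
  ultimately show ?thesis unfolding S_def by blast
qed

end

section \<open>The travelling wave equation as a fixed point problem\<close>

lemma lam_even: "lam \<alpha> (- k) = lam \<alpha> k"
proof -
  have "snc (real (Suc n) * - k / 2) = snc (real (Suc n) * k / 2)" for n
    using snc_even[of "real (Suc n) * k / 2"] by simp
  then show ?thesis by (simp only: lam_alt)
qed

lemma lam_measurable [measurable]: "lam \<alpha> \<in> borel_measurable borel"
  unfolding lam_alt[abs_def] by measurable

text \<open>The series in \<alpha> need not converge absolutely, so sum and integral are not
  exchanged by Fubini. The bound on the partial sums that is uniform in \<open>N\<close> and
  \<open>k\<close> permits dominated convergence.\<close>

lemma lam_hart_sums:
  assumes a: "summable (\<lambda>n. \<alpha> (Suc n) * real (Suc n) ^ 2)" and g: "integrable lborel g"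
  shows "(\<lambda>n. \<alpha> (Suc n) * (real (Suc n))\<^sup>2 * hart (\<lambda>k. (sm (\<epsilon> * real (Suc n)) k)\<^sup>2 * g k) x) sums hart (\<lambda>k. lam \<alpha> (\<epsilon> * k) * g k) x"
    and integrable_lam_mult: "integrable lborel (\<lambda>k. lam \<alpha> (\<epsilon> * k) * g k)"
proof -
  have [measurable]: "g \<in> borel_measurable borel" using borel_measurable_integrable[OF g] by simp
  define f where "f n k = \<alpha> (Suc n) * (real (Suc n))\<^sup>2 * (sm (\<epsilon> * real (Suc n)) k)\<^sup>2" for n k
  have [measurable]: "f n \<in> borel_measurable borel" for n unfolding f_def by measurable
  have f_eq: "f n k = \<alpha> (Suc n) * (real (Suc n))\<^sup>2 * (snc (real (Suc n) * (\<epsilon> * k) / 2))\<^sup>2" for n k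
    by (simp add: f_def sm_def mult_ac del: of_nat_Suc)
  have fs: "(\<lambda>n. f n k) sums lam \<alpha> (\<epsilon> * k)" for k
    unfolding f_eq by (rule lam_sums[OF a])
  obtain C where C: "\<And>N k. \<bar>\<Sum>n<N. f n k\<bar> \<le> C"
    using lam_partial_bound[OF a] unfolding f_eq by blast
  have lamb: "\<bar>lam \<alpha> (\<epsilon> * k)\<bar> \<le> C" for k
    by (rule LIMSEQ_le_const2[OF tendsto_rabs[OF fs[of k, unfolded sums_def]]]) (use C in auto)
  have gC: "integrable lborel (\<lambda>k. C * \<bar>g k\<bar>)" using g by simp
  show il: "integrable lborel (\<lambda>k. lam \<alpha> (\<epsilon> * k) * g k)"
    by (rule Bochner_Integration.integrable_bound[OF gC])
       (use lamb order_trans[OF lamb abs_ge_self] in \<open>auto simp: abs_mult intro!: mult_right_mono\<close>)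
  have if': "integrable lborel (\<lambda>k. f n k * g k * cas (k * x))" for n
  proof (rule integrable_cas)
    show "integrable lborel (\<lambda>k. f n k * g k)"
    proof (rule Bochner_Integration.integrable_bound)
      show "integrable lborel (\<lambda>k. \<alpha> (Suc n) * (real (Suc n))\<^sup>2 * g k)" using g by simp
      have "(sm (\<epsilon> * real (Suc n)) k)\<^sup>2 \<le> 1" for k using abs_snc_le by (simp add: sm_def abs_square_le_1)
      then have "\<bar>f n k\<bar> \<le> \<bar>\<alpha> (Suc n) * (real (Suc n))\<^sup>2\<bar>" for k
        unfolding f_def by (simp add: abs_mult mult_left_le)
      then show "AE k in lborel. norm (f n k * g k) \<le> norm (\<alpha> (Suc n) * (real (Suc n))\<^sup>2 * g k)"
        by (intro AE_I2) (simp only: real_norm_def abs_mult[of _ "g k" for k], intro mult_right_mono, auto)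
    qed measurable
  qed simp
  have "(\<lambda>N. LINT k|lborel. (\<Sum>n<N. f n k) * g k * cas (k * x)) \<longlonglongrightarrow> (LINT k|lborel. lam \<alpha> (\<epsilon> * k) * g k * cas (k * x))"
  proof (rule integral_dominated_convergence[where w="\<lambda>k. 2 * (C * \<bar>g k\<bar>)"])
    show "AE k in lborel. (\<lambda>N. (\<Sum>n<N. f n k) * g k * cas (k * x)) \<longlonglongrightarrow> lam \<alpha> (\<epsilon> * k) * g k * cas (k * x)"
      using fs unfolding sums_def by (intro AE_I2 tendsto_mult tendsto_const) auto
    show "AE k in lborel. norm ((\<Sum>n<N. f n k) * g k * cas (k * x)) \<le> 2 * (C * \<bar>g k\<bar>)" for N
    proof (rule AE_I2)
      fix k
      have "\<bar>(\<Sum>n<N. f n k) * g k * cas (k * x)\<bar> \<le> 2 * \<bar>(\<Sum>n<N. f n k) * g k\<bar>" by (rule abs_mult_cas_le)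
      also have "\<dots> \<le> 2 * (C * \<bar>g k\<bar>)" using C[of k N] by (simp add: abs_mult mult_right_mono)
      finally show "norm ((\<Sum>n<N. f n k) * g k * cas (k * x)) \<le> 2 * (C * \<bar>g k\<bar>)" by simp
    qed
  qed (use gC in auto)
  moreover have "(LINT k|lborel. (\<Sum>n<N. f n k) * g k * cas (k * x)) = (\<Sum>n<N. LINT k|lborel. f n k * g k * cas (k * x))" for N
    using if' by (simp add: sum_distrib_right)
  ultimately have "(\<lambda>n. LINT k|lborel. f n k * g k * cas (k * x)) sums (LINT k|lborel. lam \<alpha> (\<epsilon> * k) * g k * cas (k * x))"
    by (simp add: sums_def)
  then have "(\<lambda>n. (LINT k|lborel. f n k * g k * cas (k * x)) / sqrt (2 * pi)) sums hart (\<lambda>k. lam \<alpha> (\<epsilon> * k) * g k) x"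
    unfolding hart_def by (rule sums_divide)
  moreover have "(LINT k|lborel. f n k * g k * cas (k * x)) / sqrt (2 * pi)
      = \<alpha> (Suc n) * (real (Suc n))\<^sup>2 * hart (\<lambda>k. (sm (\<epsilon> * real (Suc n)) k)\<^sup>2 * g k) x" for n
    unfolding hart_cmult[symmetric] by (simp add: hart_def f_def mult.assoc)
  ultimately show "(\<lambda>n. \<alpha> (Suc n) * (real (Suc n))\<^sup>2 * hart (\<lambda>k. (sm (\<epsilon> * real (Suc n)) k)\<^sup>2 * g k) x) sums hart (\<lambda>k. lam \<alpha> (\<epsilon> * k) * g k) x"
    by simp
qed

lemma avg_lincomb:
  assumes "\<And>x. isCont f x" "\<And>x. isCont g x"
  shows "avg h (\<lambda>y. c * f y + e * g y) x = c * avg h f x + e * avg h g x"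
proof -
  have i: "integrable lborel (\<lambda>y. indicator {x - h / 2..x + h / 2} y * k y)" if "\<And>x. isCont k x" for k :: "real \<Rightarrow> real"
    using borel_integrable_compact[of "{x - h / 2..x + h / 2}" k] that
    by (simp add: continuous_at_imp_continuous_on)
  have "(\<lambda>y. indicator {x - h / 2..x + h / 2} y * (c * f y + e * g y))
      = (\<lambda>y. c * (indicator {x - h / 2..x + h / 2} y * f y) + e * (indicator {x - h / 2..x + h / 2} y * g y))"
    by (auto simp: algebra_simps)
  then show ?thesis unfolding avg_eq using i[OF assms(1)] i[OF assms(2)] by (simp add: add_divide_distrib)
qed

text \<open>Adds the link to the potentials. The powers in \<open>G_eq\<close> are such that, after
  the outer factor m of the equation, each nonlinear part is \<epsilon>^4 times an average of
  \<open>N n\<close>. This matches the linear side, where \<epsilon>^2 (c^2 - \<lambda>(\<epsilon>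
  k)) is \<epsilon>^4 times \<open>a k\<close>.\<close>

locale wave = step +
  fixes r \<delta> c :: real and \<Phi> :: "nat \<Rightarrow> real \<Rightarrow> real" and \<alpha> :: "nat \<Rightarrow> real"
  assumes alpha_sum: "summable (\<lambda>n. \<alpha> (Suc n) * real (Suc n) ^ 2)"
    and a_eq: "\<And>k. a k = (c\<^sup>2 - lam \<alpha> (\<epsilon> * k)) / \<epsilon>\<^sup>2"
    and eps_delta: "\<epsilon>\<^sup>2 * M \<le> \<delta>"
    and G_eq: "\<And>n s. \<bar>s\<bar> \<le> M \<Longrightarrow> dPot 1 r \<delta> \<Phi> (Suc n) (r * real (Suc n) + real (Suc n) * \<epsilon>\<^sup>2 * s) - varsigma_coeff r \<delta> \<Phi> (Suc n)
        = \<epsilon> ^ 4 / real (Suc n) * G n s + \<alpha> (Suc n) * real (Suc n) * \<epsilon>\<^sup>2 * s"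
begin

text \<open>The linear parts of the forces add up to the multiplier
  \<open>lam \<alpha> (\<epsilon> * k)\<close>. Moved to the other side they complete the symbol
  \<open>a\<close>, and dividing by \<epsilon>^4 leaves the equation of
  \<open>equation_iff\<close>.\<close>

lemma tw_solution_iff:
  assumes p: "inM p"
  shows "tw_solution r \<delta> \<Phi> \<epsilon> c (emb p) \<longleftrightarrow> T p = p"
proof -
  define g where "g k = fn p k / om k" for k
  have g: "integrable lborel g" unfolding g_def by (rule integrable_emb)
  have emb_g: "emb p x = hart g x" for x by (simp add: emb_def g_def[abs_def])
  have av: "avg (\<epsilon> * real (Suc n)) (emb p) y = u n p y" for n y
    using u_avg[of n p y] by (simp add: h_def)
  \<comment> \<open>The domain condition holds for every \<open>p\<close> with \<open>inM p\<close>,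
    since averages are bounded by \<open>M\<close> and
    \<open>\<epsilon>\<^sup>2 * M \<le> \<delta>\<close>.\<close>
  have rng: "r * real m + real m * \<epsilon>\<^sup>2 * avg (\<epsilon> * real m) (emb p) x \<in> range_set r \<delta> m" if m: "m \<ge> 1" for m x
  proof -
    obtain n where n: "m = Suc n" using m by (cases m) auto
    have "\<epsilon>\<^sup>2 * \<bar>u n p x\<bar> \<le> \<epsilon>\<^sup>2 * M" by (intro mult_left_mono u_bound[OF p]) simp
    then have "real m * (\<epsilon>\<^sup>2 * \<bar>u n p x\<bar>) \<le> real m * \<delta>" using eps_delta by (intro mult_left_mono) auto
    then show ?thesis unfolding n av by (simp add: range_set_def dist_real_def abs_mult mult.assoc del: of_nat_Suc)
  qed
  have term_eq: "real (Suc n) * avg (\<epsilon> * real (Suc n)) (\<lambda>y. dPot 1 r \<delta> \<Phi> (Suc n) (r * real (Suc n) + real (Suc n) * \<epsilon>\<^sup>2 * avg (\<epsilon> * real (Suc n)) (emb p) y)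
          - varsigma_coeff r \<delta> \<Phi> (Suc n)) x
      = \<epsilon> ^ 4 * avg (h n) (N n p) x + \<epsilon>\<^sup>2 * (\<alpha> (Suc n) * (real (Suc n))\<^sup>2 * hart (\<lambda>k. (sm (\<epsilon> * real (Suc n)) k)\<^sup>2 * g k) x)" for n x
  proof -
    have "avg (\<epsilon> * real (Suc n)) (\<lambda>y. dPot 1 r \<delta> \<Phi> (Suc n) (r * real (Suc n) + real (Suc n) * \<epsilon>\<^sup>2 * avg (\<epsilon> * real (Suc n)) (emb p) y)
          - varsigma_coeff r \<delta> \<Phi> (Suc n)) x = avg (h n) (\<lambda>y. \<epsilon> ^ 4 / real (Suc n) * N n p y + \<alpha> (Suc n) * real (Suc n) * \<epsilon>\<^sup>2 * u n p y) x"
      unfolding av G_eq[OF u_bound[OF p]] N_def h_def ..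
    also have "\<dots> = \<epsilon> ^ 4 / real (Suc n) * avg (h n) (N n p) x + \<alpha> (Suc n) * real (Suc n) * \<epsilon>\<^sup>2 * avg (h n) (u n p) x"
      by (rule avg_lincomb[OF isCont_N[OF p] isCont_u])
    also have "avg (h n) (u n p) x = hart (\<lambda>k. (sm (\<epsilon> * real (Suc n)) k)\<^sup>2 * g k) x"
    proof -
      have "avg (h n) (u n p) x = emb (mul (\<lambda>k. sm (h n) k * sm (h n) k) p) x"
        unfolding u_def avg_emb[OF h_pos] mul_mul[OF bounded_by_sm bounded_by_sm] ..
      also have "\<dots> = hart (\<lambda>k. sm (h n) k * sm (h n) k * (fn p k / om k)) x"
        by (rule emb_mul[OF bounded_by_mult[OF bounded_by_sm bounded_by_sm]])
      finally show ?thesis by (simp add: g_def h_def power2_eq_square)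
    qed
    finally show ?thesis by (simp add: power2_eq_square algebra_simps del: of_nat_Suc)
  qed
  have lin: "(\<lambda>n. \<epsilon>\<^sup>2 * (\<alpha> (Suc n) * (real (Suc n))\<^sup>2 * hart (\<lambda>k. (sm (\<epsilon> * real (Suc n)) k)\<^sup>2 * g k) x)) sums (\<epsilon>\<^sup>2 * hart (\<lambda>k. lam \<alpha> (\<epsilon> * k) * g k) x)" for x
    by (rule sums_mult[OF lam_hart_sums(1)[OF alpha_sum g]])
  have ha: "\<epsilon> ^ 4 * hart (\<lambda>k. a k * g k) x = \<epsilon>\<^sup>2 * c\<^sup>2 * emb p x - \<epsilon>\<^sup>2 * hart (\<lambda>k. lam \<alpha> (\<epsilon> * k) * g k) x" for x
  proof -
    have "(\<lambda>k. \<epsilon> ^ 4 * (a k * g k)) = (\<lambda>k. (\<epsilon>\<^sup>2 * c\<^sup>2) * g k - \<epsilon>\<^sup>2 * (lam \<alpha> (\<epsilon> * k) * g k))"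
    proof
      fix k
      have "\<epsilon> ^ 4 * a k = \<epsilon>\<^sup>2 * (c\<^sup>2 - lam \<alpha> (\<epsilon> * k))" using eps by (simp add: a_eq power4_eq_xxxx power2_eq_square)
      then have "\<epsilon> ^ 4 * a k * g k = \<epsilon>\<^sup>2 * (c\<^sup>2 - lam \<alpha> (\<epsilon> * k)) * g k" by simp
      then show "\<epsilon> ^ 4 * (a k * g k) = (\<epsilon>\<^sup>2 * c\<^sup>2) * g k - \<epsilon>\<^sup>2 * (lam \<alpha> (\<epsilon> * k) * g k)" by (simp add: algebra_simps)
    qed
    then have "hart (\<lambda>k. \<epsilon> ^ 4 * (a k * g k)) x = hart (\<lambda>k. (\<epsilon>\<^sup>2 * c\<^sup>2) * g k - \<epsilon>\<^sup>2 * (lam \<alpha> (\<epsilon> * k) * g k)) x" by simp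
    also have "\<dots> = hart (\<lambda>k. (\<epsilon>\<^sup>2 * c\<^sup>2) * g k) x - hart (\<lambda>k. \<epsilon>\<^sup>2 * (lam \<alpha> (\<epsilon> * k) * g k)) x"
      by (rule hart_diff) (intro integrable_mult_right g integrable_lam_mult[OF alpha_sum g])+
    finally show ?thesis by (simp only: hart_cmult emb_g)
  qed
  have iff: "(\<lambda>n. real (Suc n) * avg (\<epsilon> * real (Suc n)) (\<lambda>y. dPot 1 r \<delta> \<Phi> (Suc n) (r * real (Suc n) + real (Suc n) * \<epsilon>\<^sup>2 * avg (\<epsilon> * real (Suc n)) (emb p) y)
          - varsigma_coeff r \<delta> \<Phi> (Suc n)) x) sums (\<epsilon>\<^sup>2 * c\<^sup>2 * emb p x)
      \<longleftrightarrow> (\<lambda>n. avg (h n) (N n p) x) sums hart (\<lambda>k. a k * g k) x" (is "?L sums _ \<longleftrightarrow> ?R sums _") for x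
  proof
    assume "?L sums (\<epsilon>\<^sup>2 * c\<^sup>2 * emb p x)"
    from sums_diff[OF this lin[of x]] have "(\<lambda>n. \<epsilon> ^ 4 * avg (h n) (N n p) x) sums (\<epsilon> ^ 4 * hart (\<lambda>k. a k * g k) x)"
      unfolding ha term_eq by simp
    then show "?R sums hart (\<lambda>k. a k * g k) x" using sums_mult_iff[of "\<epsilon> ^ 4"] eps by simp
  next
    assume "?R sums hart (\<lambda>k. a k * g k) x"
    from sums_add[OF sums_mult[OF this, of "\<epsilon> ^ 4"] lin[of x]]
    show "?L sums (\<epsilon>\<^sup>2 * c\<^sup>2 * emb p x)" unfolding ha term_eq by simp
  qed
  have "tw_solution r \<delta> \<Phi> \<epsilon> c (emb p) \<longleftrightarrow> (AE x in lborel. (\<lambda>n. avg (h n) (N n p) x) sums hart (\<lambda>k. a k * g k) x)"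
    unfolding tw_solution_def Let_def iff using rng by blast
  then show ?thesis using equation_iff[OF p] unfolding g_def by simp
qed

end

lemma tw_solution_cong_AE:
  assumes "f \<in> borel_measurable borel" "g \<in> borel_measurable borel" "AE x in lborel. f x = g x"
    and tw: "tw_solution r \<delta> \<Phi> \<epsilon> c f"
  shows "tw_solution r \<delta> \<Phi> \<epsilon> c g"
proof -
  have av: "avg h f = avg h g" for h by (rule ext) (rule avg_cong_AE[OF assms(1-3)])
  from tw show ?thesis unfolding tw_solution_def av
  proof (elim conjE, intro conjI)
    assume "AE x in lborel. (\<lambda>n. let m = Suc n in real m * avg (\<epsilon> * real m)
        (\<lambda>y. dPot 1 r \<delta> \<Phi> m (r * real m + real m * \<epsilon>\<^sup>2 * avg (\<epsilon> * real m) g y) - varsigma_coeff r \<delta> \<Phi> m) x) sums (\<epsilon>\<^sup>2 * c\<^sup>2 * f x)"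
    then show "AE x in lborel. (\<lambda>n. let m = Suc n in real m * avg (\<epsilon> * real m)
        (\<lambda>y. dPot 1 r \<delta> \<Phi> m (r * real m + real m * \<epsilon>\<^sup>2 * avg (\<epsilon> * real m) g y) - varsigma_coeff r \<delta> \<Phi> m) x) sums (\<epsilon>\<^sup>2 * c\<^sup>2 * g x)"
      using assms(3) by eventually_elim simp
  qed
qed

section \<open>The symbol\<close>

text \<open>Split at |\<epsilon> k| = ks. For low frequencies \<open>A1\<close> bounds
  \<open>a\<close> below by a multiple of 1 + k^2 and \<open>A2\<close> controls its distance from
  \<nu> (1 + k^2). For high frequencies \<open>B\<close> makes \<open>a\<close> at least of order
  \<epsilon> powr (-2), and \<open>1 / a\<close> and its limit are small separately, without
  cancellation.\<close>

lemma symbol_estimates: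
  fixes l :: "real \<Rightarrow> real"
  assumes nu: "0 < \<nu>" and mu: "0 < \<mu>" and ks: "0 < ks" and sigma: "0 < \<sigma>" "\<sigma> \<le> 2" and d0: "0 < d0"
    and A1: "\<And>k. \<bar>k\<bar> \<le> ks \<Longrightarrow> l k - l 0 \<le> - \<mu> * k\<^sup>2"
    and A2: "\<And>k. \<bar>k\<bar> \<le> ks \<Longrightarrow> \<bar>l k - l 0 + \<nu> * k\<^sup>2\<bar> \<le> \<mu> * \<bar>k\<bar> powr (2 + \<sigma>)"
    and B: "\<And>k. ks \<le> \<bar>k\<bar> \<Longrightarrow> l k \<le> l 0 - d0"
  shows "\<exists>C2 C3 C4. 0 \<le> C2 \<and> 0 \<le> C3 \<and> 0 \<le> C4 \<and> (\<forall>\<epsilon> m k. 0 < \<epsilon> \<and> \<epsilon> \<le> 1 \<and> 1 \<le> m \<longrightarrow>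
     (let a = \<nu> + (l 0 - l (\<epsilon> * k)) / \<epsilon>\<^sup>2 in \<nu> \<le> a \<and> om k * \<bar>sm (\<epsilon> * m) k\<bar> / a \<le> C2 \<and>
       om k * \<bar>sm (\<epsilon> * m) k / a - 1 / (\<nu> * (1 + k\<^sup>2))\<bar> \<le> C3 * \<epsilon> powr (\<sigma> / 2) * m \<and>
       \<bar>sm (\<epsilon> * m) k / a - 1 / (\<nu> * (1 + k\<^sup>2))\<bar> \<le> C4 * \<epsilon> powr \<sigma> * m\<^sup>2))"
proof -
  define c1 where "c1 = min \<nu> \<mu>"
  have c1: "0 < c1" "c1 \<le> \<nu>" "c1 \<le> \<mu>" using nu mu by (auto simp: c1_def)
  \<comment> \<open>In \<open>X3\<close> and \<open>X4\<close> the first summand comes from low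
    frequencies and the bracket from high ones; the \<open>1 / \<nu>\<close> added in the final
    constants accounts for \<open>s - 1\<close>.\<close>
  define X3 where "X3 = \<mu> / (c1 * \<nu>) * ks powr (\<sigma> / 2) + (3 / d0 + 1 / (\<nu> * ks))"
  define X4 where "X4 = \<mu> / (c1 * \<nu>) + (1 / d0 + 1 / (\<nu> * ks\<^sup>2))"
  have X: "0 \<le> X3" "0 \<le> X4" using c1 nu mu ks d0 by (simp_all add: X3_def X4_def)
  have main: "\<nu> \<le> a \<and> om k * \<bar>s\<bar> / a \<le> 1 / c1 + 3 / d0 \<and>
       om k * \<bar>s / a - 1 / (\<nu> * (1 + k\<^sup>2))\<bar> \<le> (X3 + 1 / \<nu>) * \<epsilon> powr (\<sigma> / 2) * m \<and>
       \<bar>s / a - 1 / (\<nu> * (1 + k\<^sup>2))\<bar> \<le> (X4 + 1 / \<nu>) * \<epsilon> powr \<sigma> * m\<^sup>2"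
    if e: "0 < \<epsilon>" "\<epsilon> \<le> 1" and m: "1 \<le> m" and a: "a = \<nu> + (l 0 - l (\<epsilon> * k)) / \<epsilon>\<^sup>2" and s: "s = sm (\<epsilon> * m) k" for \<epsilon> m k a s
  proof -
    define w where "w = om k"
    have w: "1 \<le> w" "0 < w" "\<bar>k\<bar> \<le> w" and ww: "w * w = 1 + k\<^sup>2"
      using om_ge_1[of k] om_pos[of k] abs_le_om[of k] om_sq[of k] by (auto simp: w_def power2_eq_square)
    have e2: "0 < \<epsilon>\<^sup>2" using e by simp
    have ep1: "\<epsilon> \<le> \<epsilon> powr (\<sigma> / 2)" using powr_mono'[of "\<sigma> / 2" 1 \<epsilon>] e sigma by simp
    have ep2: "\<epsilon>\<^sup>2 \<le> \<epsilon> powr \<sigma>" using powr_mono'[of \<sigma> 2 \<epsilon>] e sigma by (simp add: powr_numeral)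
    have epp: "0 < \<epsilon> powr (\<sigma> / 2)" "0 < \<epsilon> powr \<sigma>" using e by simp_all
    have s1: "\<bar>s\<bar> \<le> 1" using abs_snc_le by (simp add: s sm_def)
    have sk: "\<bar>k\<bar> * \<bar>s\<bar> \<le> 2 / \<epsilon>"
    proof -
      have "\<bar>(\<epsilon> * m * k / 2) * s\<bar> \<le> 1" unfolding s sm_def by (rule abs_mult_snc_le)
      then have "(\<epsilon> * m / 2) * (\<bar>k\<bar> * \<bar>s\<bar>) \<le> 1" using e m by (simp add: abs_mult)
      moreover have "(\<epsilon> * 1 / 2) * (\<bar>k\<bar> * \<bar>s\<bar>) \<le> (\<epsilon> * m / 2) * (\<bar>k\<bar> * \<bar>s\<bar>)"
        using e m by (intro mult_right_mono divide_right_mono mult_left_mono) auto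
      ultimately have "(\<epsilon> / 2) * (\<bar>k\<bar> * \<bar>s\<bar>) \<le> 1" by simp
      then show ?thesis using e by (simp add: field_simps)
    qed
    have ws: "w * \<bar>s\<bar> \<le> 3 / \<epsilon>"
    proof -
      have "w \<le> 1 + \<bar>k\<bar>"
      proof (rule power2_le_imp_le)
        show "w\<^sup>2 \<le> (1 + \<bar>k\<bar>)\<^sup>2" using ww by (simp add: power2_eq_square algebra_simps)
      qed simp
      then have "w * \<bar>s\<bar> \<le> (1 + \<bar>k\<bar>) * \<bar>s\<bar>" by (intro mult_right_mono) auto
      also have "\<dots> \<le> 1 + 2 / \<epsilon>" using s1 sk by (simp add: distrib_right)
      also have "\<dots> \<le> 3 / \<epsilon>" using e by (simp add: field_simps)
      finally show ?thesis .
    qed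
    have sm1: "\<bar>s - 1\<bar> \<le> \<epsilon> * m * w" "\<bar>s - 1\<bar> \<le> \<epsilon>\<^sup>2 * m\<^sup>2 * (w * w)"
    proof -
      have "\<bar>s - 1\<bar> \<le> 2 * \<bar>\<epsilon> * m * k / 2\<bar>" unfolding s sm_def by (rule snc_minus_1_le)
      also have "\<dots> = \<epsilon> * m * \<bar>k\<bar>" using e m by (simp add: abs_mult)
      also have "\<dots> \<le> \<epsilon> * m * w" using e m w by (intro mult_left_mono) auto
      finally show "\<bar>s - 1\<bar> \<le> \<epsilon> * m * w" .
      have "\<bar>s - 1\<bar> \<le> (\<epsilon> * m * k / 2)\<^sup>2" unfolding s sm_def by (rule snc_minus_1_le_sq)
      also have "\<dots> = \<epsilon>\<^sup>2 * m\<^sup>2 * (k\<^sup>2 / 4)" by (simp add: power_mult_distrib power_divide)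
      also have "\<dots> \<le> \<epsilon>\<^sup>2 * m\<^sup>2 * (w * w)" unfolding ww by (intro mult_left_mono) auto
      finally show "\<bar>s - 1\<bar> \<le> \<epsilon>\<^sup>2 * m\<^sup>2 * (w * w)" .
    qed
    define L where "L = 1 / (\<nu> * (1 + k\<^sup>2))"
    have L: "L = 1 / (\<nu> * (w * w))" by (simp add: L_def ww)
    have Lpos: "0 < L" unfolding L using nu w by (intro divide_pos_pos mult_pos_pos) auto
    have s1L: "w * (\<bar>s - 1\<bar> * L) \<le> 1 / \<nu> * \<epsilon> powr (\<sigma> / 2) * m" "\<bar>s - 1\<bar> * L \<le> 1 / \<nu> * \<epsilon> powr \<sigma> * m\<^sup>2"
    proof -
      have "w * (\<bar>s - 1\<bar> * L) \<le> w * ((\<epsilon> * m * w) * L)" using sm1(1) w Lpos by (intro mult_left_mono mult_right_mono) auto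
      also have "\<dots> = 1 / \<nu> * \<epsilon> * m" using w nu by (simp add: L)
      also have "\<dots> \<le> 1 / \<nu> * \<epsilon> powr (\<sigma> / 2) * m" using ep1 nu m by (intro mult_left_mono mult_right_mono) auto
      finally show "w * (\<bar>s - 1\<bar> * L) \<le> 1 / \<nu> * \<epsilon> powr (\<sigma> / 2) * m" .
      have "\<bar>s - 1\<bar> * L \<le> (\<epsilon>\<^sup>2 * m\<^sup>2 * (w * w)) * L" using sm1(2) Lpos by (intro mult_right_mono) auto
      also have "\<dots> = 1 / \<nu> * \<epsilon>\<^sup>2 * m\<^sup>2" using w nu by (simp add: L)
      also have "\<dots> \<le> 1 / \<nu> * \<epsilon> powr \<sigma> * m\<^sup>2" using ep2 nu by (intro mult_left_mono mult_right_mono) auto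
      finally show "\<bar>s - 1\<bar> * L \<le> 1 / \<nu> * \<epsilon> powr \<sigma> * m\<^sup>2" .
    qed
    have key: "\<nu> \<le> a \<and> w * \<bar>s\<bar> / a \<le> 1 / c1 + 3 / d0 \<and> w * (\<bar>s\<bar> * \<bar>1 / a - L\<bar>) \<le> X3 * \<epsilon> powr (\<sigma> / 2) \<and> \<bar>1 / a - L\<bar> \<le> X4 * \<epsilon> powr \<sigma>"
    proof (cases "\<bar>\<epsilon> * k\<bar> \<le> ks")
      case True
      have "\<mu> * k\<^sup>2 = \<mu> * (\<epsilon> * k)\<^sup>2 / \<epsilon>\<^sup>2" using e by (simp add: power_mult_distrib)
      also have "\<dots> \<le> (l 0 - l (\<epsilon> * k)) / \<epsilon>\<^sup>2" using A1[OF True] by (intro divide_right_mono) auto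
      finally have am: "\<nu> + \<mu> * k\<^sup>2 \<le> a" by (simp add: a)
      have "c1 * (w * w) \<le> \<nu> + \<mu> * k\<^sup>2"
        unfolding ww using c1 by (simp add: distrib_left add_mono mult_right_mono)
      then have aw: "c1 * (w * w) \<le> a" using am by simp
      have cw: "0 < c1 * (w * w)" using c1 w by simp
      have ap: "0 < a" using aw cw by linarith
      have nua: "\<nu> \<le> a" using am mult_nonneg_nonneg[OF less_imp_le[OF mu] zero_le_power2[of k]] by linarith
      have kp: "\<bar>a - \<nu> * (w * w)\<bar> \<le> \<mu> * (\<epsilon> powr \<sigma> * \<bar>k\<bar> powr (2 + \<sigma>))"
      proof -
        have "a - \<nu> * (w * w) = - (l (\<epsilon> * k) - l 0 + \<nu> * (\<epsilon> * k)\<^sup>2) / \<epsilon>\<^sup>2"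
          unfolding ww a using e by (simp add: field_simps)
        then have "\<bar>a - \<nu> * (w * w)\<bar> = \<bar>l (\<epsilon> * k) - l 0 + \<nu> * (\<epsilon> * k)\<^sup>2\<bar> / \<epsilon>\<^sup>2" using e by (simp add: abs_divide)
        also have "\<dots> \<le> \<mu> * \<bar>\<epsilon> * k\<bar> powr (2 + \<sigma>) / \<epsilon>\<^sup>2" by (intro divide_right_mono A2[OF True]) simp
        also have "\<bar>\<epsilon> * k\<bar> powr (2 + \<sigma>) = (\<epsilon>\<^sup>2 * \<epsilon> powr \<sigma>) * \<bar>k\<bar> powr (2 + \<sigma>)"
          using e by (simp add: abs_mult powr_mult powr_add powr_numeral)
        finally show ?thesis using e by simp
      qed
      have dif: "\<bar>1 / a - L\<bar> \<le> \<mu> * (\<epsilon> powr \<sigma> * \<bar>k\<bar> powr (2 + \<sigma>)) / (c1 * (w * w) * (\<nu> * (w * w)))"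
      proof -
        have "1 / a - L = - (a - \<nu> * (w * w)) / (a * (\<nu> * (w * w)))"
          using ap nu w by (simp add: L field_simps)
        then have "\<bar>1 / a - L\<bar> = \<bar>a - \<nu> * (w * w)\<bar> / (a * (\<nu> * (w * w)))"
          using ap nu w by (simp add: abs_divide abs_mult)
        also have "\<dots> \<le> \<mu> * (\<epsilon> powr \<sigma> * \<bar>k\<bar> powr (2 + \<sigma>)) / (c1 * (w * w) * (\<nu> * (w * w)))"
          using kp aw cw nu w by (intro frac_le mult_right_mono) auto
        finally show ?thesis .
      qed
      have k4: "\<bar>k\<bar> powr (2 + \<sigma>) \<le> (w * w) * (w * w)"
      proof -
        have "\<bar>k\<bar> powr (2 + \<sigma>) \<le> w powr (2 + \<sigma>)" using w sigma by (intro powr_mono2) auto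
        also have "\<dots> \<le> w powr 4" using w sigma by (intro powr_mono) auto
        also have "\<dots> = (w * w) * (w * w)" using w by (simp add: powr_numeral power4_eq_xxxx)
        finally show ?thesis .
      qed
      have "w * \<bar>s\<bar> / a \<le> w * 1 / (c1 * (w * w))" using s1 w aw cw by (intro frac_le mult_left_mono) auto
      also have "\<dots> \<le> 1 / c1"
      proof -
        have "w * 1 / (c1 * (w * w)) = 1 / (c1 * w)" using w by simp
        also have "\<dots> \<le> 1 / (c1 * 1)" using w c1 by (intro divide_left_mono mult_left_mono) auto
        finally show ?thesis by simp
      qed
      finally have S2: "w * \<bar>s\<bar> / a \<le> 1 / c1 + 3 / d0" using d0 by (simp add: add_increasing2)
      have S4: "\<bar>1 / a - L\<bar> \<le> X4 * \<epsilon> powr \<sigma>"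
      proof -
        have "\<mu> * (\<epsilon> powr \<sigma> * \<bar>k\<bar> powr (2 + \<sigma>)) / (c1 * (w * w) * (\<nu> * (w * w)))
            \<le> \<mu> * (\<epsilon> powr \<sigma> * ((w * w) * (w * w))) / (c1 * (w * w) * (\<nu> * (w * w)))"
          using k4 mu epp cw nu w by (intro divide_right_mono mult_left_mono) auto
        also have "\<dots> = \<mu> / (c1 * \<nu>) * \<epsilon> powr \<sigma>" using w c1 nu by (simp add: field_simps)
        also have "\<dots> \<le> X4 * \<epsilon> powr \<sigma>" unfolding X4_def using d0 nu ks epp by (intro mult_right_mono) auto
        finally show ?thesis using dif by linarith
      qed
      \<comment> \<open>For \<sigma> > 1 the power of |k| exceeds the available w^3. One half of
        (\<epsilon> |k|) powr \<sigma> is bounded through |\<epsilon> k| \<le> ks, the other by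
        \<epsilon> powr (\<sigma> / 2) times w, as \<sigma> / 2 \<le> 1. This is where half of the
        order is given up.\<close>
      have ek: "\<epsilon> powr \<sigma> * \<bar>k\<bar> powr (2 + \<sigma>) \<le> ks powr (\<sigma> / 2) * \<epsilon> powr (\<sigma> / 2) * (w * w * w)"
      proof (cases "k = 0")
        case False
        have "\<epsilon> powr \<sigma> * \<bar>k\<bar> powr (2 + \<sigma>) = k\<^sup>2 * ((\<epsilon> * \<bar>k\<bar>) powr (\<sigma> / 2) * (\<epsilon> * \<bar>k\<bar>) powr (\<sigma> / 2))"
        proof -
          have "(\<epsilon> * \<bar>k\<bar>) powr (\<sigma> / 2) * (\<epsilon> * \<bar>k\<bar>) powr (\<sigma> / 2) = (\<epsilon> * \<bar>k\<bar>) powr \<sigma>"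
            by (simp flip: powr_add)
          also have "\<dots> = \<epsilon> powr \<sigma> * \<bar>k\<bar> powr \<sigma>" using e by (simp add: powr_mult)
          finally have 1: "(\<epsilon> * \<bar>k\<bar>) powr (\<sigma> / 2) * (\<epsilon> * \<bar>k\<bar>) powr (\<sigma> / 2) = \<epsilon> powr \<sigma> * \<bar>k\<bar> powr \<sigma>" .
          have "\<bar>k\<bar> powr (2 + \<sigma>) = k\<^sup>2 * \<bar>k\<bar> powr \<sigma>" using False by (simp add: powr_add powr_numeral)
          then show ?thesis unfolding 1 by simp
        qed
        also have "\<dots> \<le> (w * w) * (ks powr (\<sigma> / 2) * (\<epsilon> powr (\<sigma> / 2) * w))"
        proof (intro mult_mono)
          show "k\<^sup>2 \<le> w * w" by (simp add: ww)
          show "(\<epsilon> * \<bar>k\<bar>) powr (\<sigma> / 2) \<le> ks powr (\<sigma> / 2)" using True e sigma by (intro powr_mono2) (auto simp: abs_mult)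
          have "(\<epsilon> * \<bar>k\<bar>) powr (\<sigma> / 2) = \<epsilon> powr (\<sigma> / 2) * \<bar>k\<bar> powr (\<sigma> / 2)" using e by (simp add: powr_mult)
          moreover have "\<bar>k\<bar> powr (\<sigma> / 2) \<le> w powr (\<sigma> / 2)" using w sigma by (intro powr_mono2) auto
          moreover have "w powr (\<sigma> / 2) \<le> w powr 1" using w sigma by (intro powr_mono) auto
          ultimately show "(\<epsilon> * \<bar>k\<bar>) powr (\<sigma> / 2) \<le> \<epsilon> powr (\<sigma> / 2) * w" using w epp by (simp add: mult_left_mono)
        qed (use w in auto)
        finally show ?thesis by (simp add: mult_ac)
      qed (use w in simp)
      have S3: "w * (\<bar>s\<bar> * \<bar>1 / a - L\<bar>) \<le> X3 * \<epsilon> powr (\<sigma> / 2)"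
      proof -
        have "\<bar>s\<bar> * \<bar>1 / a - L\<bar> \<le> 1 * \<bar>1 / a - L\<bar>" using s1 by (intro mult_right_mono) auto
        then have "w * (\<bar>s\<bar> * \<bar>1 / a - L\<bar>) \<le> w * \<bar>1 / a - L\<bar>" using w by (intro mult_left_mono) auto
        also have "\<dots> \<le> w * (\<mu> * (ks powr (\<sigma> / 2) * \<epsilon> powr (\<sigma> / 2) * (w * w * w)) / (c1 * (w * w) * (\<nu> * (w * w))))"
          using w mu ek cw nu by (intro mult_left_mono order_trans[OF dif] divide_right_mono) auto
        also have "\<dots> = \<mu> / (c1 * \<nu>) * ks powr (\<sigma> / 2) * \<epsilon> powr (\<sigma> / 2)" using w c1 nu by (simp add: field_simps)
        also have "\<dots> \<le> X3 * \<epsilon> powr (\<sigma> / 2)" unfolding X3_def using d0 nu ks epp by (intro mult_right_mono) auto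
        finally show ?thesis .
      qed
      show ?thesis using nua S2 S3 S4 by blast
    next
      case False
      have "l (\<epsilon> * k) \<le> l 0 - d0" by (rule B) (use False in simp)
      then have "d0 / \<epsilon>\<^sup>2 \<le> (l 0 - l (\<epsilon> * k)) / \<epsilon>\<^sup>2" by (intro divide_right_mono) auto
      then have ad: "\<nu> + d0 / \<epsilon>\<^sup>2 \<le> a" by (simp add: a)
      have dp: "0 < d0 / \<epsilon>\<^sup>2" using d0 e by simp
      have nua: "\<nu> \<le> a" and ap: "0 < a" and ad': "d0 / \<epsilon>\<^sup>2 \<le> a" using ad dp nu by linarith+
      have ia: "1 / a \<le> \<epsilon>\<^sup>2 / d0"
      proof -
        have "1 / a \<le> 1 / (d0 / \<epsilon>\<^sup>2)" using ad' dp ap by (intro divide_left_mono mult_pos_pos) auto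
        then show ?thesis by simp
      qed
      have kk: "ks / \<epsilon> \<le> \<bar>k\<bar>" using False e by (simp add: abs_mult field_simps)
      have kse: "0 < ks / \<epsilon>" using ks e by simp
      have wk: "ks / \<epsilon> \<le> w" using kk w by linarith
      have Lw: "w * L \<le> \<epsilon> / (\<nu> * ks)"
      proof -
        have "w * L = 1 / (\<nu> * w)" using w by (simp add: L)
        also have "\<dots> \<le> 1 / (\<nu> * (ks / \<epsilon>))" using wk kse nu w by (intro divide_left_mono mult_left_mono mult_pos_pos) auto
        finally show ?thesis by simp
      qed
      have LL: "L \<le> \<epsilon>\<^sup>2 / (\<nu> * ks\<^sup>2)"
      proof -
        have "L \<le> 1 / (\<nu> * ((ks / \<epsilon>) * (ks / \<epsilon>)))"
          unfolding L using wk kse nu w by (intro divide_left_mono mult_left_mono mult_mono mult_pos_pos) auto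
        also have "\<dots> = \<epsilon>\<^sup>2 / (\<nu> * ks\<^sup>2)" by (simp add: power2_eq_square)
        finally show ?thesis .
      qed
      have wsa: "w * \<bar>s\<bar> / a \<le> 3 / d0 * \<epsilon>"
      proof -
        have "w * \<bar>s\<bar> * (1 / a) \<le> 3 / \<epsilon> * (\<epsilon>\<^sup>2 / d0)" using ws ia e ap by (intro mult_mono) auto
        then show ?thesis using e by (simp add: power2_eq_square)
      qed
      have "3 / d0 * \<epsilon> \<le> 3 / d0 * 1" using e d0 by (intro mult_left_mono) auto
      then have S2: "w * \<bar>s\<bar> / a \<le> 1 / c1 + 3 / d0" using wsa c1 by (simp add: add_increasing)
      have S4: "\<bar>1 / a - L\<bar> \<le> X4 * \<epsilon> powr \<sigma>"
      proof -
        have "\<bar>1 / a - L\<bar> \<le> 1 / a + L" using ap Lpos by (simp add: abs_le_iff add_increasing)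
        also have "\<dots> \<le> (1 / d0 + 1 / (\<nu> * ks\<^sup>2)) * \<epsilon>\<^sup>2" using ia LL by (simp add: distrib_right)
        also have "\<dots> \<le> X4 * \<epsilon> powr \<sigma>" unfolding X4_def using ep2 d0 nu ks c1 mu by (intro mult_mono) auto
        finally show ?thesis .
      qed
      have S3: "w * (\<bar>s\<bar> * \<bar>1 / a - L\<bar>) \<le> X3 * \<epsilon> powr (\<sigma> / 2)"
      proof -
        have "\<bar>s\<bar> * \<bar>1 / a - L\<bar> \<le> \<bar>s\<bar> * (1 / a + L)"
          using ap Lpos by (intro mult_left_mono) (auto simp: abs_le_iff add_increasing)
        also have "\<dots> \<le> \<bar>s\<bar> / a + 1 * L" unfolding distrib_left using s1 Lpos by (intro add_mono mult_right_mono) auto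
        finally have "w * (\<bar>s\<bar> * \<bar>1 / a - L\<bar>) \<le> w * (\<bar>s\<bar> / a + 1 * L)" using w by (intro mult_left_mono) auto
        also have "\<dots> = w * \<bar>s\<bar> / a + w * L" by (simp add: distrib_left)
        also have "\<dots> \<le> (3 / d0 + 1 / (\<nu> * ks)) * \<epsilon>" using wsa Lw by (simp add: distrib_right)
        also have "\<dots> \<le> X3 * \<epsilon> powr (\<sigma> / 2)" unfolding X3_def using ep1 d0 nu ks c1 mu e by (intro mult_mono) auto
        finally show ?thesis .
      qed
      show ?thesis using nua S2 S3 S4 by blast
    qed
    then have ap: "0 < a" using nu by linarith
    \<comment> \<open>Separates the error of the symbol from the error of the average. The first
      part keeps the factor |s|, which at high frequencies compensates the weight
      \<open>w\<close>.\<close>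
    have spl: "\<bar>s / a - L\<bar> \<le> \<bar>s\<bar> * \<bar>1 / a - L\<bar> + \<bar>s - 1\<bar> * L"
    proof -
      have "s / a - L = s * (1 / a - L) + (s - 1) * L" by (simp add: algebra_simps)
      then show ?thesis using abs_triangle_ineq[of "s * (1 / a - L)" "(s - 1) * L"] Lpos by (simp add: abs_mult)
    qed
    have m2: "1 \<le> m\<^sup>2" using m by simp
    have "w * \<bar>s / a - L\<bar> \<le> w * (\<bar>s\<bar> * \<bar>1 / a - L\<bar>) + w * (\<bar>s - 1\<bar> * L)"
      using mult_left_mono[OF spl, of w] w by (simp add: distrib_left)
    also have "\<dots> \<le> X3 * \<epsilon> powr (\<sigma> / 2) * 1 + 1 / \<nu> * \<epsilon> powr (\<sigma> / 2) * m" using key s1L by simp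
    also have "\<dots> \<le> X3 * \<epsilon> powr (\<sigma> / 2) * m + 1 / \<nu> * \<epsilon> powr (\<sigma> / 2) * m"
      using mult_left_mono[OF m, of "X3 * \<epsilon> powr (\<sigma> / 2)"] X epp by simp
    finally have F3: "w * \<bar>s / a - L\<bar> \<le> (X3 + 1 / \<nu>) * \<epsilon> powr (\<sigma> / 2) * m" by (simp add: distrib_right)
    have "\<bar>s\<bar> * \<bar>1 / a - L\<bar> \<le> 1 * (X4 * \<epsilon> powr \<sigma>)" using key s1 by (intro mult_mono) auto
    then have "\<bar>s / a - L\<bar> \<le> X4 * \<epsilon> powr \<sigma> * 1 + 1 / \<nu> * \<epsilon> powr \<sigma> * m\<^sup>2" using spl s1L by simp
    also have "\<dots> \<le> X4 * \<epsilon> powr \<sigma> * m\<^sup>2 + 1 / \<nu> * \<epsilon> powr \<sigma> * m\<^sup>2"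
      using mult_left_mono[OF m2, of "X4 * \<epsilon> powr \<sigma>"] X epp by simp
    finally have F4: "\<bar>s / a - L\<bar> \<le> (X4 + 1 / \<nu>) * \<epsilon> powr \<sigma> * m\<^sup>2" by (simp add: distrib_right)
    show ?thesis using key F3 F4 unfolding w_def L_def by blast
  qed
  have "0 \<le> 1 / c1 + 3 / d0" "0 \<le> X3 + 1 / \<nu>" "0 \<le> X4 + 1 / \<nu>" using X c1 d0 nu by simp_all
  then show ?thesis unfolding Let_def using main[OF _ _ _ HOL.refl HOL.refl] by blast
qed

section \<open>Taylor estimates for the potentials\<close>

text \<open>The infimum is attained, because every difference quotient is a lower bound for the set
  of admissible constants.\<close>

lemma lipschitz_constant_on:
  assumes "\<exists>L. L-lipschitz_on S f"
  shows "(lipschitz_constant S f)-lipschitz_on S f" "0 \<le> lipschitz_constant S f"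
proof -
  have ne: "{L. L-lipschitz_on S f} \<noteq> {}" using assms by blast
  show nonneg: "0 \<le> lipschitz_constant S f"
    unfolding lipschitz_constant_def by (rule cInf_greatest[OF ne]) (auto dest: lipschitz_on_nonneg)
  show "(lipschitz_constant S f)-lipschitz_on S f"
  proof (rule lipschitz_onI)
    fix x y assume xy: "x \<in> S" "y \<in> S"
    show "dist (f x) (f y) \<le> lipschitz_constant S f * dist x y"
    proof (cases "x = y")
      case False
      have "dist (f x) (f y) / dist x y \<le> lipschitz_constant S f"
        unfolding lipschitz_constant_def
      proof (rule cInf_greatest[OF ne])
        fix L assume "L \<in> {L. L-lipschitz_on S f}"
        then show "dist (f x) (f y) / dist x y \<le> L"
          using lipschitz_onD[of L S f x y] xy False by (simp add: pos_divide_le_eq)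
      qed
      then show ?thesis using False by (simp add: pos_divide_le_eq)
    qed simp
  qed (rule nonneg)
qed

lemma deriv_within_has_derivative:
  assumes f: "C31_on S f" and i: "i < 3" and y: "y \<in> S"
  shows "(deriv_within i S f has_real_derivative deriv_within (Suc i) S f y) (at y within S)"
proof -
  have "deriv_within i S f differentiable (at y within S)"
    using f i y by (auto simp: C31_on_def differentiable_on_def)
  then show ?thesis
    by (simp add: deriv_within_def vector_derivative_works has_real_derivative_iff_has_vector_derivative)
qed

text \<open>The scaling makes the derivative of \<open>G'\<close> equal to m^3 times the third
  derivative of the potential, with no explicit power of \<epsilon>. Its value at 0 is
  \<open>2 * bt\<close>, and it varies from there by at most
  \<open>gm * (\<epsilon>\<^sup>2 * M)\<close>, since \<open>gm\<close> is m^4 times the Lipschitz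
  constant. The last two bounds are mean value estimates based on this.\<close>

lemma potential_bounds:
  fixes \<Phi> :: "nat \<Rightarrow> real \<Rightarrow> real"
  assumes m: "m \<ge> 1" and reg: "C31_on (range_set r \<delta> m) (\<Phi> m)"
    and e: "0 < \<epsilon>" and M: "0 < M" and eM: "\<epsilon>\<^sup>2 * M \<le> \<delta>" "\<epsilon>\<^sup>2 * M \<le> 1"
    and bt: "bt = beta_coeff r \<delta> \<Phi> m * real m ^ 3" and gm: "gm = 6 * gamma_coeff r \<delta> \<Phi> m * real m ^ 4"
    and G: "G = (\<lambda>s. real m / \<epsilon> ^ 4 * (dPot 1 r \<delta> \<Phi> m (r * real m + real m * \<epsilon>\<^sup>2 * s) - varsigma_coeff r \<delta> \<Phi> m
        - alpha_coeff r \<delta> \<Phi> m * (real m * \<epsilon>\<^sup>2 * s)))"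
    and G': "G' = (\<lambda>s. (real m)\<^sup>2 / \<epsilon>\<^sup>2 * (dPot 2 r \<delta> \<Phi> m (r * real m + real m * \<epsilon>\<^sup>2 * s) - alpha_coeff r \<delta> \<Phi> m))"
  shows "0 \<le> gm"
    and "\<bar>s\<bar> \<le> M \<Longrightarrow> (G has_real_derivative G' s) (at s within {-M..M})"
    and "\<bar>s\<bar> \<le> M \<Longrightarrow> \<bar>G' s - 2 * bt * s\<bar> \<le> gm * \<epsilon>\<^sup>2 * M\<^sup>2"
    and "\<bar>s\<bar> \<le> M \<Longrightarrow> \<bar>t\<bar> \<le> M \<Longrightarrow> \<bar>G' s - G' t\<bar> \<le> (2 * \<bar>bt\<bar> + gm) * \<bar>s - t\<bar>"
proof -
  define S where "S = range_set r \<delta> m"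
  define F where "F i = deriv_within i S (\<Phi> m)" for i
  define y where "y s = r * real m + real m * \<epsilon>\<^sup>2 * s" for s
  have dP: "dPot i r \<delta> \<Phi> m = F i" for i by (simp add: dPot_def F_def S_def)
  have mp: "0 < real m" using m by simp
  have yS: "y s \<in> S" if "\<bar>s\<bar> \<le> M" for s
  proof -
    have "\<epsilon>\<^sup>2 * \<bar>s\<bar> \<le> \<epsilon>\<^sup>2 * M" using that by (intro mult_left_mono) auto
    then have "real m * (\<epsilon>\<^sup>2 * \<bar>s\<bar>) \<le> real m * \<delta>" using eM(1) by (intro mult_left_mono) auto
    then show ?thesis by (simp add: y_def S_def range_set_def dist_real_def abs_mult mult.assoc)
  qed
  have Fd: "(F i has_real_derivative F (Suc i) x) (at x within S)" if "i < 3" "x \<in> S" for i x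
    unfolding F_def by (rule deriv_within_has_derivative[OF reg[folded S_def] that])
  have yd: "(y has_real_derivative real m * \<epsilon>\<^sup>2) (at s within X)" for s X
    unfolding y_def[abs_def] by (auto intro!: derivative_eq_intros)
  have Fy: "((\<lambda>s. F i (y s)) has_real_derivative F (Suc i) (y s) * (real m * \<epsilon>\<^sup>2)) (at s within {-M..M})"
    if "i < 3" "\<bar>s\<bar> \<le> M" for i s
  proof -
    have sub: "y ` {-M..M} \<subseteq> S" using yS by (auto simp: abs_le_iff)
    have "(F i has_real_derivative F (Suc i) (y s)) (at (y s) within y ` {-M..M})"
      by (rule DERIV_subset[OF Fd[OF that(1) yS[OF that(2)]] sub])
    from DERIV_image_chain[OF this yd] show ?thesis by (simp add: o_def)
  qed
  have num: "Suc 1 = 2" "Suc 2 = 3" by simp_all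
  define L where "L = lipschitz_constant S (F 3)"
  have "\<exists>L. L-lipschitz_on S (F 3)" using reg by (simp add: C31_on_def F_def S_def)
  then have L: "L-lipschitz_on S (F 3)" "0 \<le> L" using lipschitz_constant_on unfolding L_def by auto
  have gmL: "gm = L * real m ^ 4" by (simp add: gm gamma_coeff_def dP L_def S_def)
  show gm0: "0 \<le> gm" using L by (simp add: gmL)
  have al: "alpha_coeff r \<delta> \<Phi> m = F 2 (y 0)" by (simp add: alpha_coeff_def dP y_def)
  have be: "2 * bt = real m ^ 3 * F 3 (y 0)" by (simp add: bt beta_coeff_def dP y_def)
  have Geq: "G = (\<lambda>s. real m / \<epsilon> ^ 4 * (F 1 (y s) - varsigma_coeff r \<delta> \<Phi> m - F 2 (y 0) * (real m * \<epsilon>\<^sup>2 * s)))"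
    unfolding G dP al by (simp add: y_def)
  have Geq': "G' = (\<lambda>s. (real m)\<^sup>2 / \<epsilon>\<^sup>2 * (F 2 (y s) - F 2 (y 0)))"
    unfolding G' dP al by (simp add: y_def)
  show "(G has_real_derivative G' s) (at s within {-M..M})" if s: "\<bar>s\<bar> \<le> M"
  proof -
    have "(G has_real_derivative real m / \<epsilon> ^ 4 * (F 2 (y s) * (real m * \<epsilon>\<^sup>2) - 0 - F 2 (y 0) * (real m * \<epsilon>\<^sup>2 * 1))) (at s within {-M..M})"
      unfolding Geq using Fy[of 1 s, unfolded num] s
      by (intro DERIV_cmult DERIV_diff DERIV_const DERIV_ident) auto
    moreover have "real m / \<epsilon> ^ 4 * (F 2 (y s) * (real m * \<epsilon>\<^sup>2) - 0 - F 2 (y 0) * (real m * \<epsilon>\<^sup>2 * 1)) = G' s"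
      unfolding Geq' using e by (simp add: field_simps power2_eq_square power4_eq_xxxx)
    ultimately show ?thesis by simp
  qed
  have G'd: "(G' has_real_derivative real m ^ 3 * F 3 (y s)) (at s within {-M..M})" if s: "\<bar>s\<bar> \<le> M" for s
  proof -
    have "(G' has_real_derivative (real m)\<^sup>2 / \<epsilon>\<^sup>2 * (F 3 (y s) * (real m * \<epsilon>\<^sup>2) - 0)) (at s within {-M..M})"
      unfolding Geq' using Fy[of 2 s, unfolded num] s by (intro DERIV_cmult DERIV_diff DERIV_const) auto
    moreover have "(real m)\<^sup>2 / \<epsilon>\<^sup>2 * (F 3 (y s) * (real m * \<epsilon>\<^sup>2) - 0) = real m ^ 3 * F 3 (y s)"
      using e by (simp add: power2_eq_square power3_eq_cube)
    ultimately show ?thesis by simp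
  qed
  have F3: "\<bar>F 3 (y s) - F 3 (y 0)\<bar> \<le> L * (real m * (\<epsilon>\<^sup>2 * M))" if s: "\<bar>s\<bar> \<le> M" for s
  proof -
    have "\<bar>F 3 (y s) - F 3 (y 0)\<bar> \<le> L * \<bar>y s - y 0\<bar>"
      using lipschitz_onD[OF L(1) yS[OF s] yS[of 0]] M by (simp add: dist_real_def)
    also have "\<bar>y s - y 0\<bar> = real m * (\<epsilon>\<^sup>2 * \<bar>s\<bar>)" by (simp add: y_def abs_mult)
    also have "L * (real m * (\<epsilon>\<^sup>2 * \<bar>s\<bar>)) \<le> L * (real m * (\<epsilon>\<^sup>2 * M))"
      using L s by (intro mult_left_mono) auto
    finally show ?thesis .
  qed
  have F3m: "\<bar>real m ^ 3 * F 3 (y s) - 2 * bt\<bar> \<le> gm * (\<epsilon>\<^sup>2 * M)" if s: "\<bar>s\<bar> \<le> M" for s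
  proof -
    have "\<bar>real m ^ 3 * F 3 (y s) - 2 * bt\<bar> = real m ^ 3 * \<bar>F 3 (y s) - F 3 (y 0)\<bar>"
      unfolding be by (simp add: abs_mult flip: right_diff_distrib)
    also have "\<dots> \<le> real m ^ 3 * (L * (real m * (\<epsilon>\<^sup>2 * M)))" by (intro mult_left_mono F3 s) simp
    finally show ?thesis by (simp add: gmL power4_eq_xxxx power3_eq_cube mult_ac)
  qed
  have cv: "convex {-M..M}" by simp
  show "\<bar>G' s - 2 * bt * s\<bar> \<le> gm * \<epsilon>\<^sup>2 * M\<^sup>2" if s: "\<bar>s\<bar> \<le> M"
  proof -
    have "norm ((G' s - 2 * bt * s) - (G' 0 - 2 * bt * 0)) \<le> (gm * (\<epsilon>\<^sup>2 * M)) * norm (s - 0)"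
    proof (rule field_differentiable_bound[OF cv])
      fix z assume "z \<in> {-M..M}"
      then have z: "\<bar>z\<bar> \<le> M" by auto
      have "((\<lambda>s. G' s - 2 * bt * s) has_real_derivative real m ^ 3 * F 3 (y z) - 2 * bt * 1) (at z within {-M..M})"
        by (intro DERIV_diff G'd z DERIV_cmult DERIV_ident)
      then show "((\<lambda>s. G' s - 2 * bt * s) has_field_derivative real m ^ 3 * F 3 (y z) - 2 * bt) (at z within {-M..M})" by simp
      show "norm (real m ^ 3 * F 3 (y z) - 2 * bt) \<le> gm * (\<epsilon>\<^sup>2 * M)" using F3m[OF z] by simp
    qed (use s M in auto)
    moreover have "G' 0 = 0" by (simp add: Geq')
    moreover have "gm * (\<epsilon>\<^sup>2 * M) * \<bar>s\<bar> \<le> gm * (\<epsilon>\<^sup>2 * M) * M" using gm0 M s by (intro mult_left_mono) auto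
    ultimately show ?thesis by (simp add: power2_eq_square mult_ac)
  qed
  show "\<bar>G' s - G' t\<bar> \<le> (2 * \<bar>bt\<bar> + gm) * \<bar>s - t\<bar>" if s: "\<bar>s\<bar> \<le> M" and t: "\<bar>t\<bar> \<le> M"
  proof -
    have "norm (G' s - G' t) \<le> (2 * \<bar>bt\<bar> + gm) * norm (s - t)"
    proof (rule field_differentiable_bound[OF cv])
      fix z assume "z \<in> {-M..M}"
      then have z: "\<bar>z\<bar> \<le> M" by auto
      show "(G' has_field_derivative real m ^ 3 * F 3 (y z)) (at z within {-M..M})" by (rule G'd[OF z])
      have "gm * (\<epsilon>\<^sup>2 * M) \<le> gm * 1" by (intro mult_left_mono eM gm0)
      then show "norm (real m ^ 3 * F 3 (y z)) \<le> 2 * \<bar>bt\<bar> + gm" using F3m[OF z] by (simp add: abs_le_iff) linarith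
    qed (use s t in auto)
    then show ?thesis by simp
  qed
qed

section \<open>Existence and local uniqueness\<close>

context wave
begin

lemma inM_ball: "Cinf * (norm P0 + \<rho>) \<le> M \<Longrightarrow> norm D \<le> \<rho> \<Longrightarrow> inM (P0 + D)"
  unfolding inM_def
  using order_trans[OF mult_left_mono[OF order_trans[OF norm_triangle_ineq[of P0 D] add_left_mono] Cinf_nonneg]] by blast

lemma sqi_P0: "square_integrable (\<lambda>k. k\<^sup>2 * fn P0 k)"
proof -
  define q where "q = (\<nu> / b) *\<^sub>R mul (\<lambda>k. 1 / om k) sol4"
  have P0: "P0 = mul (\<lambda>k. 1 / om k) (mul (\<lambda>k. 1 / om k) q)"
    unfolding P0_om sol2_sol4 q_def by (simp only: mul_scaleR[OF bounded_by_inverse_om])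
  have ae: "AE k in lborel. \<bar>k\<^sup>2 * fn P0 k\<bar> \<le> \<bar>fn q k\<bar>"
    using fn_mul[OF bounded_by_inverse_om, of "mul (\<lambda>k. 1 / om k) q"] fn_mul[OF bounded_by_inverse_om, of q]
  proof eventually_elim
    case (elim k)
    have "k\<^sup>2 * fn P0 k = k\<^sup>2 / (1 + k\<^sup>2) * fn q k"
      unfolding P0 elim by (simp add: om_sq flip: power2_eq_square)
    moreover have "\<bar>k\<^sup>2 / (1 + k\<^sup>2)\<bar> \<le> 1" by (simp add: abs_of_nonneg divide_le_eq_1 add_pos_nonneg)
    ultimately show ?case by (simp only: abs_mult mult_left_le_one_le abs_ge_zero)
  qed
  show ?thesis by (rule square_integrable_bound[OF sqi_fn _ ae]) measurable
qed

lemma H_space_emb: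
  assumes "square_integrable (\<lambda>k. k\<^sup>2 * fn q k)"
  shows "emb q \<in> H_space 3"
proof (rule H_space_3I[OF sqi_emb])
  have ae: "AE k in lborel. \<bar>k ^ 3 * fn (Hartley (cls (emb q))) k\<bar> \<le> \<bar>k\<^sup>2 * fn q k\<bar>"
    unfolding Hartley_emb using fn_mul[OF bounded_by_inverse_om, of q]
  proof eventually_elim
    case (elim k)
    have "k ^ 3 * fn (mul (\<lambda>k. 1 / om k) q) k = (k / om k) * (k\<^sup>2 * fn q k)"
      unfolding elim by (simp add: power3_eq_cube power2_eq_square)
    moreover have "\<bar>k / om k\<bar> \<le> 1" using abs_le_om[of k] om_pos[of k] by simp
    ultimately show ?case by (simp only: abs_mult[of "k / om k"] mult_left_le_one_le abs_ge_zero)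
  qed
  show "square_integrable (\<lambda>k. k ^ 3 * fn (Hartley (cls (emb q))) k)"
    by (rule square_integrable_bound[OF assms _ ae]) measurable
qed

text \<open>For existence the correction \<open>D\<close> is rescaled by \<epsilon> powr \<sigma>.
  For uniqueness a competitor is encoded through \<open>om\<close> times its transform; the scaled
  encoding solves the same fixed point problem in the same ball.\<close>

lemma travelling_wave:
  assumes ball: "Cinf * (norm P0 + \<epsilon> powr \<sigma> * \<kappa>) \<le> M" and \<kappa>: "0 \<le> \<kappa>" and \<theta>: "CK * \<theta> \<le> 1 / 2" "0 \<le> \<theta>"
    and lip: "\<And>p q. inM p \<Longrightarrow> inM q \<Longrightarrow> norm (p - P0) \<le> \<epsilon> powr \<sigma> * \<kappa> \<Longrightarrow> norm (q - P0) \<le> \<epsilon> powr \<sigma> * \<kappa> \<Longrightarrow>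
        norm (T p - T q - Kop (p - q)) \<le> \<theta> * norm (p - q)"
    and res: "CK * norm (T P0 - P0) \<le> \<epsilon> powr \<sigma> * \<kappa> / 2"
  shows "\<exists>V. V \<in> E_space 3 \<and> H_norm 1 V \<le> \<kappa> \<and> tw_solution r \<delta> \<Phi> \<epsilon> c (\<lambda>x. w x + \<epsilon> powr \<sigma> * V x) \<and>
     (\<forall>V'. V' \<in> E_space 3 \<and> H_norm 1 V' \<le> \<kappa> \<and> tw_solution r \<delta> \<Phi> \<epsilon> c (\<lambda>x. w x + \<epsilon> powr \<sigma> * V' x) \<longrightarrow>
        (AE x in lborel. V' x = V x))"
proof -
  define e where "e = \<epsilon> powr \<sigma>"
  have e: "0 < e" using eps by (simp add: e_def)
  note as = ball lip res
  note as = as[folded e_def]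
  have \<rho>: "0 \<le> e * \<kappa>" using e \<kappa> by simp
  obtain D where D: "refl D = D" "norm D \<le> e * \<kappa>" "T (P0 + D) = P0 + D"
    and uniq: "\<And>D'. refl D' = D' \<Longrightarrow> norm D' \<le> e * \<kappa> \<Longrightarrow> T (P0 + D') = P0 + D' \<Longrightarrow> D' = D"
    using fixed_point[OF as(1) \<rho> \<theta> as(2,3)] by blast
  define q where "q = (1 / e) *\<^sub>R D"
  have Dq: "D = e *\<^sub>R q" using e by (simp add: q_def)
  have inMD: "inM (P0 + D')" if "norm D' \<le> e * \<kappa>" for D' by (rule inM_ball[OF as(1) that])
  have emb_eq: "(\<lambda>x. w x + e * emb p x) = emb (P0 + e *\<^sub>R p)" for p
    by (rule ext) (simp add: emb_add emb_scaleR emb_P0)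
  have sq: "square_integrable (\<lambda>k. k\<^sup>2 * fn q k)"
  proof (rule square_integrable_cong_AE)
    show "square_integrable (\<lambda>k. 1 / e * (k\<^sup>2 * fn (P0 + D) k - k\<^sup>2 * fn P0 k))"
      by (rule square_integrable_cmult, rule square_integrable_diff[OF fixed_point_regularity[OF inMD[OF D(2)] D(3)] sqi_P0])
    show "AE k in lborel. k\<^sup>2 * fn q k = 1 / e * (k\<^sup>2 * fn (P0 + D) k - k\<^sup>2 * fn P0 k)"
      unfolding q_def using fn_scaleR[of "1 / e" D] fn_add[of P0 D] by eventually_elim (simp add: algebra_simps)
  qed measurable
  have H3: "emb q \<in> H_space 3" by (rule H_space_emb[OF sq])
  have rq: "refl q = q" using D(1) by (simp add: q_def refl_scaleR)
  have "H_norm 1 (emb q) = norm q"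
    using H_norm_1(3)[OF H_space_mono_1[OF H3]] by (simp only: om_Hartley_emb)
  also have "norm q \<le> \<kappa>" using D(2) e by (simp add: q_def field_simps)
  finally have Hq: "H_norm 1 (emb q) \<le> \<kappa>" .
  show ?thesis unfolding e_def[symmetric]
  proof (intro exI[of _ "emb q"] conjI allI impI)
    show "emb q \<in> E_space 3" using H3 emb_refl[of q] rq by (simp add: E_space_def)
    show "H_norm 1 (emb q) \<le> \<kappa>" by (rule Hq)
    show "tw_solution r \<delta> \<Phi> \<epsilon> c (\<lambda>x. w x + e * emb q x)"
      unfolding emb_eq Dq[symmetric] using tw_solution_iff[OF inMD[OF D(2)]] D(3) by blast
  next
    fix V' assume V': "V' \<in> E_space 3 \<and> H_norm 1 V' \<le> \<kappa> \<and> tw_solution r \<delta> \<Phi> \<epsilon> c (\<lambda>x. w x + e * V' x)"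
    have H1: "V' \<in> H_space 1" and ev: "AE x in lborel. V' (- x) = V' x"
      using V' H_space_mono_1 by (auto simp: E_space_def)
    note H = H_norm_1[OF H1]
    define p where "p = cls (\<lambda>k. om k * fn (Hartley (cls V')) k)"
    have np: "norm p \<le> \<kappa>" using V' H(3) by (simp add: p_def)
    have ae: "AE x in lborel. emb p x = V' x" unfolding p_def by (rule emb_repr[OF H(1,2)])
    \<comment> \<open>Evenness of the competitor is known almost everywhere; continuity of
      \<open>emb p\<close> upgrades it to every point, as \<open>refl_eqI_emb\<close>
      requires.\<close>
    have "emb p (- x) = emb p x" for x
    proof (rule continuous_AE_eq[of "\<lambda>x. emb p (- x)" "emb p"])
      show "isCont (\<lambda>x. emb p (- x)) x" for x
        by (rule isCont_o2[OF isCont_minus[OF continuous_ident] isCont_emb])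
      show "AE x in lborel. emb p (- x) = emb p x"
        using ae AE_reflect[OF ae] ev by eventually_elim simp
    qed (rule isCont_emb)
    then have rp: "refl p = p" by (rule refl_eqI_emb)
    have nD: "norm (e *\<^sub>R p) \<le> e * \<kappa>" using np e by simp
    have "tw_solution r \<delta> \<Phi> \<epsilon> c (\<lambda>x. w x + e * emb p x)"
    proof (rule tw_solution_cong_AE)
      show "tw_solution r \<delta> \<Phi> \<epsilon> c (\<lambda>x. w x + e * V' x)" using V' by blast
      have w': "w = emb P0" by (rule ext) (rule emb_P0[symmetric])
      note [measurable] = square_integrableD[OF H(1)]
      show "(\<lambda>x. w x + e * V' x) \<in> borel_measurable borel" unfolding w' by measurable
      show "(\<lambda>x. w x + e * emb p x) \<in> borel_measurable borel" unfolding w' by measurable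
      show "AE x in lborel. w x + e * V' x = w x + e * emb p x" using ae by eventually_elim simp
    qed
    then have "T (P0 + e *\<^sub>R p) = P0 + e *\<^sub>R p" unfolding emb_eq using tw_solution_iff[OF inMD[OF nD]] by blast
    then have "e *\<^sub>R p = D" by (intro uniq nD) (simp_all add: refl_scaleR rp)
    then have "p = q" using e by (simp add: Dq)
    then show "AE x in lborel. V' x = emb q x" using ae by (auto elim: eventually_mono)
  qed
qed

end

text \<open>Besides unpacking the definition this yields \<open>0 \<le> lam \<alpha> 0\<close>: for
  large \<open>k\<close> the value \<open>lam \<alpha> k\<close> is at least \<open>- d0\<close>,
  because it tends to 0, and at most \<open>lam \<alpha> 0 - d0\<close>, by the gap away from the
  origin.\<close>

lemma type_I_bounds:
  assumes a: "summable (\<lambda>n. \<alpha> (Suc n) * real (Suc n) ^ 2)" and t: "type_I (lam \<alpha>) \<sigma>"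
    and nu: "\<nu> = - deriv (deriv (lam \<alpha>)) 0 / 2"
  obtains \<mu> ks d0 Lb where "0 < \<mu>" "0 < ks" "0 < d0"
    "\<And>k. \<bar>k\<bar> \<le> ks \<Longrightarrow> lam \<alpha> k - lam \<alpha> 0 \<le> - \<mu> * k\<^sup>2"
    "\<And>k. \<bar>k\<bar> \<le> ks \<Longrightarrow> \<bar>lam \<alpha> k - lam \<alpha> 0 + \<nu> * k\<^sup>2\<bar> \<le> \<mu> * \<bar>k\<bar> powr (2 + \<sigma>)"
    "\<And>k. ks \<le> \<bar>k\<bar> \<Longrightarrow> lam \<alpha> k \<le> lam \<alpha> 0 - d0"
    "\<And>k. Lb \<le> lam \<alpha> k" "0 \<le> lam \<alpha> 0"
proof -
  let ?l = "lam \<alpha>"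
  obtain \<mu> ks where m: "0 < \<mu>" "0 < ks"
    and A: "\<And>k. \<bar>k\<bar> \<le> ks \<Longrightarrow> ?l k - ?l 0 \<le> - \<mu> * k\<^sup>2 \<and>
           \<bar>?l k - ?l 0 - deriv (deriv ?l) 0 * k\<^sup>2 / 2\<bar> \<le> \<mu> * \<bar>k\<bar> powr (2 + \<sigma>)"
    and B: "bdd_above (?l ` {k. \<bar>k\<bar> \<ge> ks})" "(SUP k\<in>{k. \<bar>k\<bar> \<ge> ks}. ?l k) < ?l 0"
    using t unfolding type_I_def by blast
  obtain Lb where Lb: "\<And>k. Lb \<le> ?l k" using t by (auto simp: type_I_def bdd_below_def)
  define d0 where "d0 = ?l 0 - (SUP k\<in>{k. \<bar>k\<bar> \<ge> ks}. ?l k)"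
  have d0: "0 < d0" using B(2) by (simp add: d0_def)
  have B': "?l k \<le> ?l 0 - d0" if "ks \<le> \<bar>k\<bar>" for k
    unfolding d0_def using cSUP_upper[OF _ B(1), of k] that by simp
  have A2: "\<bar>?l k - ?l 0 + \<nu> * k\<^sup>2\<bar> \<le> \<mu> * \<bar>k\<bar> powr (2 + \<sigma>)" if "\<bar>k\<bar> \<le> ks" for k
    using A[OF that] by (simp add: nu)
  obtain K where K: "\<And>k. K \<le> k \<Longrightarrow> \<bar>?l k\<bar> \<le> d0" using lam_limit[OF a d0] by blast
  have "0 \<le> ?l 0" using K[of "max K ks"] B'[of "max K ks"] m by (simp add: abs_le_iff)
  then show thesis using A by (intro that[OF m d0 _ A2 B' Lb]) auto
qed

theorem theorem6:
  fixes r \<delta> \<sigma> b l2 :: real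
    and \<Phi> :: "nat \<Rightarrow> real \<Rightarrow> real"
    and \<alpha> \<beta> \<gamma> :: "nat \<Rightarrow> real"
    and l :: "real \<Rightarrow> real"
  assumes delta_pos: "\<delta> > 0"
    and regularity: "\<And>m. m \<ge> 1 \<Longrightarrow> C31_on (range_set r \<delta> m) (\<Phi> m)"
    and alpha: "\<alpha> = alpha_coeff r \<delta> \<Phi>"
    and beta: "\<beta> = beta_coeff r \<delta> \<Phi>"
    and gamma: "\<gamma> = gamma_coeff r \<delta> \<Phi>"
    and summable_alpha: "summable (\<lambda>n. \<alpha> (Suc n) * real (Suc n) ^ 2)"
    and summable_beta: "summable (\<lambda>n. \<bar>\<beta> (Suc n)\<bar> * real (Suc n) ^ 5)"
    and summable_gamma: "summable (\<lambda>n. \<gamma> (Suc n) * real (Suc n) ^ 4)"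
    and b: "b = (\<Sum>n. \<beta> (Suc n) * real (Suc n) ^ 3)"
    and b_nonzero: "b \<noteq> 0"
    and l: "l = lam \<alpha>"
    and type_I: "type_I l \<sigma>"
    and l2: "l2 = deriv (deriv l) 0"
  shows "\<exists>\<epsilon>\<^sub>I>0. \<exists>\<kappa>\<^sub>I>0. \<forall>\<epsilon>. 0 < \<epsilon> \<and> \<epsilon> < \<epsilon>\<^sub>I \<longrightarrow>
    (\<exists>c. c\<^sup>2 = l 0 - l2 * \<epsilon>\<^sup>2 / 2 \<and>
      (\<exists>V. V \<in> E_space 3 \<and> H_norm 1 V \<le> \<kappa>\<^sub>I \<and>
           tw_solution r \<delta> \<Phi> \<epsilon> c (\<lambda>x. W0 l2 b x + \<epsilon> powr \<sigma> * V x) \<and>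
           (\<forall>V'. V' \<in> E_space 3 \<and> H_norm 1 V' \<le> \<kappa>\<^sub>I \<and>
                 tw_solution r \<delta> \<Phi> \<epsilon> c (\<lambda>x. W0 l2 b x + \<epsilon> powr \<sigma> * V' x) \<longrightarrow>
                 (AE x in lborel. V' x = V x))))"
proof -
  define \<nu> where "\<nu> = - l2 / 2"
  have nu: "0 < \<nu>" and sigma: "0 < \<sigma>" "\<sigma> \<le> 2" using type_I by (auto simp: \<nu>_def l2 type_I_def)
  obtain \<mu> ks d0 Lb where tI: "0 < \<mu>" "0 < ks" "0 < d0"
    "\<And>k. \<bar>k\<bar> \<le> ks \<Longrightarrow> l k - l 0 \<le> - \<mu> * k\<^sup>2"
    "\<And>k. \<bar>k\<bar> \<le> ks \<Longrightarrow> \<bar>l k - l 0 + \<nu> * k\<^sup>2\<bar> \<le> \<mu> * \<bar>k\<bar> powr (2 + \<sigma>)"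
    "\<And>k. ks \<le> \<bar>k\<bar> \<Longrightarrow> l k \<le> l 0 - d0"
    and Lb: "\<And>k. Lb \<le> l k" and l0: "0 \<le> l 0"
    using type_I_bounds[OF summable_alpha type_I[unfolded l], of \<nu>] unfolding l \<nu>_def l2 by blast
  obtain C2 C3 C4 where C: "0 \<le> C2" "0 \<le> C3" "0 \<le> C4" and
    sym: "\<And>\<epsilon> m k. 0 < \<epsilon> \<Longrightarrow> \<epsilon> \<le> 1 \<Longrightarrow> 1 \<le> m \<Longrightarrow>
     (let a = \<nu> + (l 0 - l (\<epsilon> * k)) / \<epsilon>\<^sup>2 in \<nu> \<le> a \<and> om k * \<bar>sm (\<epsilon> * m) k\<bar> / a \<le> C2 \<and>
       om k * \<bar>sm (\<epsilon> * m) k / a - 1 / (\<nu> * (1 + k\<^sup>2))\<bar> \<le> C3 * \<epsilon> powr (\<sigma> / 2) * m \<and>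
       \<bar>sm (\<epsilon> * m) k / a - 1 / (\<nu> * (1 + k\<^sup>2))\<bar> \<le> C4 * \<epsilon> powr \<sigma> * m\<^sup>2)"
    using symbol_estimates[OF nu tI(1,2) sigma tI(3-6)] by blast
  define bt where "bt n = \<beta> (Suc n) * real (Suc n) ^ 3" for n
  define gm where "gm n = 6 * \<gamma> (Suc n) * real (Suc n) ^ 4" for n
  have bt2: "\<bar>bt n\<bar> * (real (Suc n))\<^sup>2 = \<bar>\<beta> (Suc n)\<bar> * real (Suc n) ^ 5" for n
    by (simp add: bt_def abs_mult power_abs del: of_nat_Suc flip: power_add)
  have bt_sum: "summable (\<lambda>n. \<bar>bt n\<bar> * (real (Suc n))\<^sup>2)" unfolding bt2 by (rule summable_beta)
  have "norm (bt n) \<le> \<bar>bt n\<bar> * (real (Suc n))\<^sup>2" for n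
    using mult_left_mono[of 1 "(real (Suc n))\<^sup>2" "\<bar>bt n\<bar>"] by simp
  then have "summable bt" by (intro summable_comparison_test'[OF bt_sum]) auto
  then have bsum: "bt sums b" unfolding b bt_def by (rule summable_sums)
  have gm_sum: "summable gm" unfolding gm_def mult.assoc by (rule summable_mult[OF summable_gamma])
  define Q where "Q = norm ((\<nu> / b) *\<^sub>R sol2)"
  define P where "P = norm ((\<nu> / b) *\<^sub>R solp)"
  \<comment> \<open>Bounds in sup norm all profiles whose encoding is within distance 1 of
    \<open>P0\<close>; \<epsilon> will be so small that the ball of radius
    \<open>\<epsilon> powr \<sigma> * \<kappa>\<close> is contained in that range. The last summand
    keeps \<open>M\<close> positive.\<close>
  define M where "M = Cinf * (P + 1) + 1"
  have P: "0 \<le> P" by (simp add: P_def)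
  have M: "0 < M" using mult_nonneg_nonneg[OF Cinf_nonneg, of "P + 1"] P by (simp add: M_def)
  define SB where "SB = (\<Sum>n. \<bar>bt n\<bar> * (real (Suc n))\<^sup>2)"
  define SG where "SG = (\<Sum>n. gm n)"
  \<comment> \<open>\<open>L\<close> and \<open>R\<close> copy the constants of
    \<open>T_lipschitz\<close> and \<open>T_residual\<close>. They have to be fixed before
    \<epsilon>, hence before the locale is interpreted.\<close>
  define L where "L = (C2 * M\<^sup>2 * SG + C2 * (2 * Cinf) * SB) + (C2 * (2 * (Cinf * Q + M)) + C3 * (2 * M)) * SB"
  define R where "R = C2 * M\<^sup>2 * P * SG + (C2 * (2 * M * Q) + C4 * ((\<nu> / b)\<^sup>2 * norm sol4)) * SB"
  \<comment> \<open>Chosen so that the residual, after inversion of the linearization, fills at most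
    half of the ball.\<close>
  define \<kappa> where "\<kappa> = 2 * CK * \<bar>R\<bar> + 1"
  have \<kappa>: "1 \<le> \<kappa>" using CK_nonneg by (simp add: \<kappa>_def)
  \<comment> \<open>The contraction factor is at most \<epsilon> powr (\<sigma> / 2) times
    \<open>X\<close>, and \<open>X\<close> also dominates \<open>\<kappa>\<close>. Making this
    product at most 1/2 secures the contraction and a radius below 1 at once.\<close>
  define X where "X = (1 + \<kappa>) * (CK * \<bar>L\<bar> + 1)"
  have X1: "1 + \<kappa> \<le> X" unfolding X_def using \<kappa> CK_nonneg by simp
  define \<eta> where "\<eta> = 1 / (2 * X)"
  have \<eta>: "0 < \<eta>" using X1 \<kappa> by (simp add: \<eta>_def)
  \<comment> \<open>Three constraints: \<epsilon> below 1, \<epsilon> M below both 1 and \<delta>,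
    and \<epsilon> powr (\<sigma> / 2) below \<eta>.\<close>
  define eI where "eI = min (min 1 (min 1 \<delta> / M)) (\<eta> powr (2 / \<sigma>))"
  have eI: "0 < eI" using delta_pos M \<eta> by (simp add: eI_def)
  show ?thesis
  proof (rule exI[of _ eI], rule conjI[OF eI], rule exI[of _ \<kappa>], rule conjI, use \<kappa> in linarith, intro allI impI)
    fix \<epsilon> assume "0 < \<epsilon> \<and> \<epsilon> < eI"
    then have e: "0 < \<epsilon>" "\<epsilon> \<le> 1" and e2: "\<epsilon> < min 1 \<delta> / M" and e3: "\<epsilon> < \<eta> powr (2 / \<sigma>)" by (auto simp: eI_def)
    have "\<epsilon> * M < min 1 \<delta>" using e2 M by (simp add: pos_less_divide_eq)
    moreover have "\<epsilon>\<^sup>2 * M \<le> \<epsilon> * M" using e M by (intro mult_right_mono) (auto simp: power2_eq_square)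
    ultimately have eM: "\<epsilon>\<^sup>2 * M \<le> 1" "\<epsilon>\<^sup>2 * M \<le> \<delta>" by auto
    define q where "q = \<epsilon> powr (\<sigma> / 2)"
    have q0: "0 < q" using e by (simp add: q_def)
    have "q < (\<eta> powr (2 / \<sigma>)) powr (\<sigma> / 2)" unfolding q_def using e e3 sigma by (intro powr_less_mono2) auto
    also have "\<dots> = \<eta>" using \<eta> sigma by (simp add: powr_powr)
    finally have "q * X \<le> \<eta> * X" using X1 \<kappa> by (intro mult_right_mono) auto
    also have "\<eta> * X = 1 / 2" using X1 \<kappa> by (simp add: \<eta>_def)
    finally have qX: "q * X \<le> 1 / 2" .
    have eq: "\<epsilon> powr \<sigma> \<le> q" unfolding q_def using powr_mono'[of "\<sigma> / 2" \<sigma> \<epsilon>] e sigma by simp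
    have ep: "0 < \<epsilon> powr \<sigma>" using e by simp
    have ek: "\<epsilon> powr \<sigma> * \<kappa> \<le> q * \<kappa>" using eq \<kappa> by (intro mult_right_mono) auto
    have "q * \<kappa> \<le> q * X" using X1 q0 by (intro mult_left_mono) auto
    then have \<rho>1: "\<epsilon> powr \<sigma> * \<kappa> \<le> 1" using ek qX by linarith
    \<comment> \<open>The equation depends on the speed only through its square; the root is real
      because \<open>l 0\<close> is nonnegative and \<open>l2\<close> is negative.\<close>
    define c where "c = sqrt (l 0 - l2 * \<epsilon>\<^sup>2 / 2)"
    have "0 \<le> \<nu> * \<epsilon>\<^sup>2" using nu by simp
    then have c2: "c\<^sup>2 = l 0 - l2 * \<epsilon>\<^sup>2 / 2" unfolding c_def using l0 by (simp add: \<nu>_def)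
    define a where "a k = (c\<^sup>2 - lam \<alpha> (\<epsilon> * k)) / \<epsilon>\<^sup>2" for k
    have a: "a k = \<nu> + (l 0 - l (\<epsilon> * k)) / \<epsilon>\<^sup>2" for k
      using e by (simp add: a_def c2 \<nu>_def l field_simps)
    have sy: "\<nu> \<le> a k" "om k * \<bar>sm (\<epsilon> * real (Suc n)) k\<bar> / a k \<le> C2"
       "om k * \<bar>sm (\<epsilon> * real (Suc n)) k / a k - 1 / (\<nu> * (1 + k\<^sup>2))\<bar> \<le> C3 * \<epsilon> powr (\<sigma> / 2) * real (Suc n)"
       "\<bar>sm (\<epsilon> * real (Suc n)) k / a k - 1 / (\<nu> * (1 + k\<^sup>2))\<bar> \<le> C4 * \<epsilon> powr \<sigma> * (real (Suc n))\<^sup>2" for n k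
      using sym[OF e, of "real (Suc n)" k] unfolding Let_def a[symmetric] by auto
    define A where "A = \<nu> + (l 0 - Lb) / \<epsilon>\<^sup>2"
    have aA: "bounded_by A a"
    proof (rule bounded_byI)
      show "a \<in> borel_measurable borel" unfolding a_def[abs_def] by measurable
      fix k
      have "(l 0 - l (\<epsilon> * k)) / \<epsilon>\<^sup>2 \<le> (l 0 - Lb) / \<epsilon>\<^sup>2" using Lb[of "\<epsilon> * k"] by (intro divide_right_mono) auto
      then show "\<bar>a k\<bar> \<le> A" using sy(1)[of k] nu unfolding A_def a by linarith
    qed
    define G where "G n = (\<lambda>s. real (Suc n) / \<epsilon> ^ 4 * (dPot 1 r \<delta> \<Phi> (Suc n) (r * real (Suc n) + real (Suc n) * \<epsilon>\<^sup>2 * s) - varsigma_coeff r \<delta> \<Phi> (Suc n)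
        - alpha_coeff r \<delta> \<Phi> (Suc n) * (real (Suc n) * \<epsilon>\<^sup>2 * s)))" for n
    define G' where "G' n = (\<lambda>s. (real (Suc n))\<^sup>2 / \<epsilon>\<^sup>2 * (dPot 2 r \<delta> \<Phi> (Suc n) (r * real (Suc n) + real (Suc n) * \<epsilon>\<^sup>2 * s) - alpha_coeff r \<delta> \<Phi> (Suc n)))" for n
    have "1 \<le> Suc n" for n by simp
    note pot = potential_bounds[OF this regularity[OF this] e(1) M eM(2,1) bt_def[unfolded beta] gm_def[unfolded gamma] G_def G'_def]
    interpret wave \<epsilon> \<nu> M b \<sigma> C2 C3 C4 A a G G' bt gm r \<delta> c \<Phi> \<alpha>
    proof
      show "G n 0 = 0" "G' n 0 = 0" for n
        by (simp_all add: G_def G'_def varsigma_coeff_def alpha_coeff_def del: of_nat_Suc)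
      show "a (- k) = a k" for k using lam_even[of \<alpha> "\<epsilon> * k"] by (simp add: a_def)
      show "dPot 1 r \<delta> \<Phi> (Suc n) (r * real (Suc n) + real (Suc n) * \<epsilon>\<^sup>2 * s) - varsigma_coeff r \<delta> \<Phi> (Suc n)
        = \<epsilon> ^ 4 / real (Suc n) * G n s + \<alpha> (Suc n) * real (Suc n) * \<epsilon>\<^sup>2 * s" for n s
      proof -
        have "\<epsilon> ^ 4 / real (Suc n) * (real (Suc n) / \<epsilon> ^ 4 * z) = z" for z using e by (simp del: of_nat_Suc)
        then show ?thesis unfolding G_def alpha by (simp add: mult.assoc del: of_nat_Suc)
      qed
    qed (use e nu M eM b_nonzero bsum sigma aA sy pot gm_sum bt_sum summable_alpha a_def in \<open>auto simp del: of_nat_Suc\<close>)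
    have nP: "norm P0 = P" by (simp add: P0_def P_def)
    have W: "W0 l2 b x = w x" for x unfolding w_def by (simp add: W0_def soliton_def ch_def \<nu>_def power_divide)
    have ball: "Cinf * (norm P0 + \<epsilon> powr \<sigma> * \<kappa>) \<le> M"
    proof -
      have "Cinf * (P + \<epsilon> powr \<sigma> * \<kappa>) \<le> Cinf * (P + 1)" using \<rho>1 by (intro mult_left_mono Cinf_nonneg) auto
      then show ?thesis by (simp add: nP M_def)
    qed
    have inP0: "inM P0"
      using inM_ball[OF ball, of 0] ep \<kappa> by simp
    have sums: "sigB = SB" "sigG = SG" by (simp_all add: sigB_def SB_def sigG_def SG_def)
    \<comment> \<open>The Lipschitz constant of \<open>T\<close> minus its linearization on the
      ball: the first summand is the error of the long wave limit, the second the radius of the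
      ball.\<close>
    define \<theta> where "\<theta> = (q + \<epsilon> powr \<sigma> * \<kappa>) * \<bar>L\<bar>"
    have th0: "0 \<le> \<theta>" using q0 ep \<kappa> by (simp add: \<theta>_def)
    have "CK * \<theta> \<le> CK * ((q + q * \<kappa>) * \<bar>L\<bar>)"
      unfolding \<theta>_def using ek by (intro mult_left_mono mult_right_mono CK_nonneg) auto
    also have "\<dots> \<le> q * X" unfolding X_def using q0 \<kappa> by (simp add: algebra_simps)
    finally have th: "CK * \<theta> \<le> 1 / 2" using qX by linarith
    have lip: "norm (T p - T p' - Kop (p - p')) \<le> \<theta> * norm (p - p')"
      if "inM p" "inM p'" "norm (p - P0) \<le> \<epsilon> powr \<sigma> * \<kappa>" "norm (p' - P0) \<le> \<epsilon> powr \<sigma> * \<kappa>" for p p'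
    proof -
      have "norm (T p - T p' - Kop (p - p')) \<le> (q + \<epsilon> powr \<sigma> * \<kappa>) * L * norm (p - p')"
        using T_lipschitz[OF inP0 that(1,3,2,4)] unfolding sums q_def L_def Q_def .
      also have "\<dots> \<le> \<theta> * norm (p - p')"
        unfolding \<theta>_def using q0 ep \<kappa> by (intro mult_right_mono mult_left_mono) auto
      finally show ?thesis .
    qed
    have "norm (T P0 - P0) \<le> \<epsilon> powr \<sigma> * R"
      using T_residual[OF inP0] unfolding sums nP R_def Q_def .
    also have "\<dots> \<le> \<epsilon> powr \<sigma> * \<bar>R\<bar>" using ep by (intro mult_left_mono) auto
    finally have "CK * norm (T P0 - P0) \<le> CK * (\<epsilon> powr \<sigma> * \<bar>R\<bar>)" by (intro mult_left_mono CK_nonneg)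
    also have "\<dots> \<le> \<epsilon> powr \<sigma> * \<kappa> / 2" using ep by (simp add: \<kappa>_def algebra_simps)
    finally have res: "CK * norm (T P0 - P0) \<le> \<epsilon> powr \<sigma> * \<kappa> / 2" .
    have "0 \<le> \<kappa>" using \<kappa> by linarith
    from travelling_wave[OF ball this th th0 lip res] c2
    show "\<exists>c. c\<^sup>2 = l 0 - l2 * \<epsilon>\<^sup>2 / 2 \<and>
      (\<exists>V. V \<in> E_space 3 \<and> H_norm 1 V \<le> \<kappa> \<and>
           tw_solution r \<delta> \<Phi> \<epsilon> c (\<lambda>x. W0 l2 b x + \<epsilon> powr \<sigma> * V x) \<and>
           (\<forall>V'. V' \<in> E_space 3 \<and> H_norm 1 V' \<le> \<kappa> \<and>
                 tw_solution r \<delta> \<Phi> \<epsilon> c (\<lambda>x. W0 l2 b x + \<epsilon> powr \<sigma> * V' x) \<longrightarrow>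
                 (AE x in lborel. V' x = V x)))"
      unfolding W by blast
  qed
qed

end
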